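(* Let $n\ge 2$. For $k=1,\dots,n$ define the Laurent series $$\ell_k(u)=\operatorname{tr}_{1,\dots,k}\,A_k\,L_1^{-}(u_1)\cdots L_k^{-}(u_k)\,L_k^{+}(u_k+\tfrac12 hn)^{-1}\cdots L_1^{+}(u_1+\tfrac12 hn)^{-1},\qquad u_i=u+(i-1)h,$$ where the trace is taken over all $k$ copies of $\mathrm{End}\,\mathbb{C}^n$ in $(\mathrm{End}\,\mathbb{C}^n)^{\otimes k}\otimes \mathrm{DY}_h(\mathfrak{gl}_n)_{cr}$. Then for every $k=1,\dots,n$ all coefficients of $\ell_k(u)$ belong to the center of the completed Yangian double at the critical level $\mathrm{DY}_h(\mathfrak{gl}_n)_{cr}$.
   Context: Let $P$ be the permutation operator on $\mathbb{C}^n\otimes\mathbb{C}^n$, $\bar R(u)=I+\frac{h}{u}P$, and $R(u)=f(u)\bar R(u)$, where $f(u)=1+\sum_{k\ge1}f_ku^{-k}$ is the power series in $u^{-1}$ uniquely determined by $f(u-nh)=\frac{u^2-h^2}{u^2}f(u)$. The Yangian double $\mathrm{DY}_h(\mathfrak{gl}_n)$ is the ($h$-adically completed) associative algebra over $\mathbb{C}[[h]]$ generated by $l_{ij}^{(k)}$ ($1\le i,j\le n$, $k\in\mathbb{Z}$) and $c$. Put $l_{ij}^{+}(u)=\delta_{ij}-h\sum_{k\ge0}l_{ij}^{(k)}u^{-k-1}$, $l_{ij}^{-}(u)=\delta_{ij}+h\sum_{k<0}l_{ij}^{(k)}u^{-k-1}$, $L^{\pm}(u)=(l^{\pm}_{ij}(u))_{i,j}$.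 The defining relations are $[L^{\pm}(u),c]=0$ and $$R(u-v)L_1^{\pm}(u)L_2^{\pm}(v)=L_2^{\pm}(v)L_1^{\pm}(u)R(u-v),$$ $$R(u-v-\tfrac12hc)L_1^{+}(u)L_2^{-}(v)=L_2^{-}(v)L_1^{+}(u)R(u-v+\tfrac12hc),$$ where $R$ is viewed as a power series in $u^{-1}$ (in the $h$-adic topology). A subscript $a$ on $L_a^\pm$ indicates the tensor copy of $\mathrm{End}\,\mathbb{C}^n$ in which the matrix is placed. $\overline{\mathrm{DY}}_h(\mathfrak{gl}_n)_{cr}$ is the quotient of $\mathrm{DY}_h(\mathfrak{gl}_n)$ by the ideal generated by $c+n$ (critical level $c=-n$). Its completion is $\mathrm{DY}_h(\mathfrak{gl}_n)_{cr}=\varprojlim_{p>0}\overline{\mathrm{DY}}_h(\mathfrak{gl}_n)_{cr}/J_p$, where $J_p$ is the left ideal generated by all $l_{ij}^{(r)}$ with $r\ge p$. $A_k=\frac1{k!}\sum_{\sigma\in\mathfrak{S}_k}\mathrm{sgn}(\sigma)\,\sigma$ is the antisymmetrizer, acting on $(\mathbb{C}^n)^{\otimes k}$ by permuting tensor factors.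
   Formalization: The defining relations are imposed on the generators l_ij^(k) after cancelling common powers of h (undivided they give h-torsion and the claim fails); J_p is taken h-adically closed, and the product on the completion is the extension by continuity for the neighbourhoods J_p + h^N. *)

theory Defs
  imports
    "HOL-Analysis.Analysis"
    "HOL-Computational_Algebra.Formal_Power_Series"
    "HOL-Library.Poly_Mapping"
begin

unbundle fps_syntax

text \<open>
  Throughout, the index set of the matrices is a finite type \<open>'n\<close>, and the rank is
  \<open>n = CARD('n)\<close>. The ring \<open>\<complex>[[h]]\<close> is the type \<open>complex fps\<close>, with \<open>h = fps_X\<close>.
\<close>


section \<open>The free algebra on the generators\<close>

datatype 'n gen = Ell 'n 'n int | Cen

datatype 'a free_monoid = Word "'a list"

instantiation free_monoid :: (type) monoid_add
begin

definition zero_free_monoid :: "'a free_monoid" where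
  "zero_free_monoid = Word []"

fun plus_free_monoid :: "'a free_monoid \<Rightarrow> 'a free_monoid \<Rightarrow> 'a free_monoid" where
  "plus_free_monoid (Word xs) (Word ys) = Word (xs @ ys)"

instance
proof
  fix a b c :: "'a free_monoid"
  show "a + b + c = a + (b + c)" by (cases a; cases b; cases c) simp
  show "0 + a = a" by (cases a) (simp add: zero_free_monoid_def)
  show "a + 0 = a" by (cases a) (simp add: zero_free_monoid_def)
qed

end

text \<open>
  The monoid algebra of the free monoid over \<open>\<complex>\<close> is the free associative algebra
  \<open>\<complex>\<langle>l_ij^(k), c\<rangle>\<close>; power series in \<open>h\<close> over it form the \<open>h\<close>-adic completion of the
  free associative \<open>\<complex>[[h]]\<close>-algebra. The metric which the library puts on \<open>fps\<close> is the
  \<open>h\<close>-adic one, so that \<open>closed\<close> and \<open>infsum\<close> below refer to the \<open>h\<close>-adic topology.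
\<close>

type_synonym 'n free = "('n gen free_monoid \<Rightarrow>\<^sub>0 complex) fps"

definition gen :: "'n gen \<Rightarrow> 'n free" where
  "gen g = fps_const (Poly_Mapping.single (Word [g]) 1)"

definition scal :: "complex fps \<Rightarrow> 'n free" where
  "scal a = Abs_fps (\<lambda>m. Poly_Mapping.single 0 (a $ m))"

abbreviation hh :: "'n free" where
  "hh \<equiv> fps_X"

text \<open>
  Coefficient of \<open>u^e\<close> in \<open>l_ij^+(u)\<close> (flag \<open>True\<close>) and in \<open>l_ij^-(u)\<close> (flag \<open>False\<close>).
  The generator \<open>l_ij^(k)\<close> goes with \<open>u^(-k-1)\<close>.
\<close>

definition lcoeff :: "bool \<Rightarrow> 'n \<Rightarrow> 'n \<Rightarrow> int \<Rightarrow> 'n free" where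
  "lcoeff pos i j e =
     (if e = 0 \<and> i = j then 1 else 0) +
     (if pos then (if e < 0 then - (hh * gen (Ell i j (- e - 1))) else 0)
             else (if e \<ge> 0 then hh * gen (Ell i j (- e - 1)) else 0))"


section \<open>The \<open>R\<close>-matrix\<close>

text \<open>The expansion \<open>(u - a)^(-1) = \<Sum>j\<ge>1. a^(j-1) u^(-j)\<close>, as a power series in \<open>u^(-1)\<close>.\<close>

definition inv_minus :: "'a::semiring_1 \<Rightarrow> 'a fps" where
  "inv_minus a = Abs_fps (\<lambda>j. if j = 0 then 0 else a ^ (j - 1))"

text \<open>The series \<open>f(u)\<close>; the outer variable is \<open>u^(-1)\<close>.\<close>

definition fser :: "nat \<Rightarrow> complex fps fps" where
  "fser n = (THE f. f $ 0 = 1 \<and>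
      f oo inv_minus (of_nat n * fps_X) = (1 - fps_const (fps_X ^ 2) * fps_X ^ 2) * f)"

text \<open>
  Entry of \<open>R(u) = f(u) (I + h u^(-1) P)\<close> in row \<open>(i,j)\<close> and column \<open>(k,l)\<close>, with respect
  to the basis \<open>e_i \<otimes> e_j\<close>.
\<close>

definition Rentry :: "'n::finite \<Rightarrow> 'n \<Rightarrow> 'n \<Rightarrow> 'n \<Rightarrow> complex fps fps" where
  "Rentry i j k l = fser CARD('n) *
     ((if i = k \<and> j = l then 1 else 0)
      + fps_const fps_X * fps_X * (if i = l \<and> j = k then 1 else 0))"

text \<open>
  Entries of \<open>R(u - v - a)\<close>, expanded as a power series in \<open>u^(-1)\<close>: the outer variable is
  \<open>u^(-1)\<close>, the inner one is \<open>v\<close>.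
\<close>

definition Rshift :: "'n::finite free \<Rightarrow> 'n \<Rightarrow> 'n \<Rightarrow> 'n \<Rightarrow> 'n \<Rightarrow> 'n free fps fps" where
  "Rshift a i j k l =
     Abs_fps (\<lambda>p. fps_const (scal (Rentry i j k l $ p))) oo inv_minus (fps_X + fps_const a)"


section \<open>The Yangian double\<close>

text \<open>
  Coefficients of \<open>u^a v^b\<close> in the matrix entries of \<open>R(u-v-\<kappa>) L_1(u) L_2(v)\<close> and of
  \<open>L_2(v) L_1(u) R(u-v-\<kappa>)\<close>; the flags \<open>s\<close>, \<open>t\<close> select \<open>L^+\<close> or \<open>L^-\<close> in the first and in
  the second tensor copy. In the case of two minus signs these are infinite,
  \<open>h\<close>-adically convergent sums.
\<close>

definition rll_left ::
  "bool \<Rightarrow> bool \<Rightarrow> 'n::finite free \<Rightarrow> 'n \<Rightarrow> 'n \<Rightarrow> 'n \<Rightarrow> 'n \<Rightarrow> int \<Rightarrow> int \<Rightarrow> 'n free" where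
  "rll_left s t \<kappa> i j k l a b =
     (\<Sum>\<^sub>\<infinity>(p, q)\<in>UNIV. \<Sum>i'\<in>UNIV. \<Sum>j'\<in>UNIV.
        Rshift \<kappa> i j i' j' $ p $ q * lcoeff s i' k (a + int p) * lcoeff t j' l (b - int q))"

definition rll_right ::
  "bool \<Rightarrow> bool \<Rightarrow> 'n::finite free \<Rightarrow> 'n \<Rightarrow> 'n \<Rightarrow> 'n \<Rightarrow> 'n \<Rightarrow> int \<Rightarrow> int \<Rightarrow> 'n free" where
  "rll_right s t \<kappa> i j k l a b =
     (\<Sum>\<^sub>\<infinity>(p, q)\<in>UNIV. \<Sum>k'\<in>UNIV. \<Sum>l'\<in>UNIV.
        lcoeff t j l' (b - int q) * lcoeff s i k' (a + int p) * Rshift \<kappa> k' l' k l $ p $ q)"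

definition half_hc :: "'n free" where
  "half_hc = scal (fps_const (1 / 2)) * hh * gen Cen"

definition relators :: "'n::finite free set" where
  "relators =
     {lcoeff s i j e * gen Cen - gen Cen * lcoeff s i j e | s i j e. True} \<union>
     {rll_left s s 0 i j k l a b - rll_right s s 0 i j k l a b | s i j k l a b. True} \<union>
     {rll_left True False half_hc i j k l a b - rll_right True False (- half_hc) i j k l a b
       | i j k l a b. True}"

text \<open>
  As the generators enter \<open>L^\<plusminus>(u)\<close> multiplied by \<open>h\<close>, the coefficients of the defining
  relations carry common factors \<open>h\<close> (resp. \<open>h^2\<close>). As usual, the relations are understood as
  relations on the generators \<open>l_ij^(k)\<close>, that is, after cancelling these factors; otherwise
  the algebra would have \<open>h\<close>-torsion.
\<close>

definition cancelled_relators :: "'n::finite free set" where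
  "cancelled_relators = {x. \<exists>m. hh ^ m * x \<in> relators}"

definition two_sided_ideal :: "'a::{ring, monoid_mult} set \<Rightarrow> bool" where
  "two_sided_ideal I \<longleftrightarrow> 0 \<in> I \<and> (\<forall>x\<in>I. \<forall>y\<in>I. x + y \<in> I) \<and> (\<forall>x\<in>I. \<forall>a. a * x \<in> I \<and> x * a \<in> I)"

definition left_ideal :: "'a::{ring, monoid_mult} set \<Rightarrow> bool" where
  "left_ideal I \<longleftrightarrow> 0 \<in> I \<and> (\<forall>x\<in>I. \<forall>y\<in>I. x + y \<in> I) \<and> (\<forall>x\<in>I. \<forall>a. a * x \<in> I)"

definition dy_ideal :: "'n::finite free set" where
  "dy_ideal = \<Inter>{I. two_sided_ideal I \<and> closed I \<and> cancelled_relators \<subseteq> I}"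

lemma two_sided_ideal_Inter:
  "(\<And>I. I \<in> \<I> \<Longrightarrow> two_sided_ideal I) \<Longrightarrow> two_sided_ideal (\<Inter>\<I>)"
  unfolding two_sided_ideal_def by blast

lemma two_sided_ideal_uminus:
  assumes "two_sided_ideal I" "x \<in> I" shows "- x \<in> I"
proof -
  have "(- 1) * x \<in> I" using assms unfolding two_sided_ideal_def by blast
  thus ?thesis by simp
qed

lemma two_sided_ideal_equivp:
  assumes "two_sided_ideal I" shows "equivp (\<lambda>x y. x - y \<in> I)"
proof (rule equivpI)
  show "reflp (\<lambda>x y. x - y \<in> I)"
    using assms by (auto simp: reflp_def two_sided_ideal_def)
  show "symp (\<lambda>x y. x - y \<in> I)"
    using two_sided_ideal_uminus[OF assms] by (metis minus_diff_eq sympI)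
  show "transp (\<lambda>x y. x - y \<in> I)"
  proof (rule transpI)
    fix x y z assume "x - y \<in> I" "y - z \<in> I"
    hence "(x - y) + (y - z) \<in> I" using assms unfolding two_sided_ideal_def by blast
    thus "x - z \<in> I" by simp
  qed
qed

lemma two_sided_ideal_cong:
  assumes I: "two_sided_ideal I" and "x - x' \<in> I" "y - y' \<in> I"
  shows "(x + y) - (x' + y') \<in> I" "(x - y) - (x' - y') \<in> I" "- x - (- x') \<in> I"
    "x * y - x' * y' \<in> I"
proof -
  have "(x - x') + (y - y') \<in> I" using assms unfolding two_sided_ideal_def by blast
  thus "(x + y) - (x' + y') \<in> I" by (simp add: algebra_simps)
  have "(x - x') + - (y - y') \<in> I"
    using assms two_sided_ideal_uminus[OF I] unfolding two_sided_ideal_def by blast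
  thus "(x - y) - (x' - y') \<in> I" by (simp add: algebra_simps)
  have "- (x - x') \<in> I" using assms two_sided_ideal_uminus[OF I] by blast
  thus "- x - (- x') \<in> I" by (simp add: algebra_simps)
  have "(x - x') * y + x' * (y - y') \<in> I" using assms unfolding two_sided_ideal_def by blast
  thus "x * y - x' * y' \<in> I" by (simp add: algebra_simps)
qed

lemma two_sided_ideal_dy_ideal: "two_sided_ideal dy_ideal"
  unfolding dy_ideal_def by (rule two_sided_ideal_Inter) blast

text \<open>The \<open>h\<close>-adically completed Yangian double.\<close>

quotient_type (overloaded) 'n dy = "'n::finite free" / "\<lambda>x y. x - y \<in> dy_ideal"
  by (rule two_sided_ideal_equivp[OF two_sided_ideal_dy_ideal])

text \<open>
  The class \<open>ring_1\<close> of the library would include \<open>0 \<noteq> 1\<close>.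
\<close>

instantiation dy :: (finite) "{ring, monoid_mult}"
begin

lift_definition zero_dy :: "'a dy" is 0 .
lift_definition one_dy :: "'a dy" is 1 .
lift_definition plus_dy :: "'a dy \<Rightarrow> 'a dy \<Rightarrow> 'a dy" is "(+)"
  by (rule two_sided_ideal_cong(1)[OF two_sided_ideal_dy_ideal])
lift_definition minus_dy :: "'a dy \<Rightarrow> 'a dy \<Rightarrow> 'a dy" is "(-)"
  by (rule two_sided_ideal_cong(2)[OF two_sided_ideal_dy_ideal])
lift_definition uminus_dy :: "'a dy \<Rightarrow> 'a dy" is "uminus"
  by (rule two_sided_ideal_cong(3)[OF two_sided_ideal_dy_ideal])
lift_definition times_dy :: "'a dy \<Rightarrow> 'a dy \<Rightarrow> 'a dy" is "(*)"
  by (rule two_sided_ideal_cong(4)[OF two_sided_ideal_dy_ideal])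

instance
proof -
  have z: "(0 :: 'a free) \<in> dy_ideal"
    using two_sided_ideal_dy_ideal unfolding two_sided_ideal_def by blast
  show "OFCLASS('a dy, ring_class)"
    by (intro_classes; transfer) (simp_all add: algebra_simps z)
  show "OFCLASS('a dy, monoid_mult_class)"
    by (intro_classes; transfer) (simp_all add: algebra_simps z)
qed

end


section \<open>The critical level\<close>

definition crit_ideal :: "'n::finite dy set" where
  "crit_ideal = \<Inter>{I. two_sided_ideal I \<and> abs_dy (gen Cen + of_nat CARD('n)) \<in> I}"

lemma two_sided_ideal_crit_ideal: "two_sided_ideal crit_ideal"
  unfolding crit_ideal_def by (rule two_sided_ideal_Inter) blast

quotient_type (overloaded) 'n dycr = "'n::finite dy" / "\<lambda>x y. x - y \<in> crit_ideal"
  by (rule two_sided_ideal_equivp[OF two_sided_ideal_crit_ideal])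

instantiation dycr :: (finite) "{ring, monoid_mult}"
begin

lift_definition zero_dycr :: "'a dycr" is 0 .
lift_definition one_dycr :: "'a dycr" is 1 .
lift_definition plus_dycr :: "'a dycr \<Rightarrow> 'a dycr \<Rightarrow> 'a dycr" is "(+)"
  by (rule two_sided_ideal_cong(1)[OF two_sided_ideal_crit_ideal])
lift_definition minus_dycr :: "'a dycr \<Rightarrow> 'a dycr \<Rightarrow> 'a dycr" is "(-)"
  by (rule two_sided_ideal_cong(2)[OF two_sided_ideal_crit_ideal])
lift_definition uminus_dycr :: "'a dycr \<Rightarrow> 'a dycr" is "uminus"
  by (rule two_sided_ideal_cong(3)[OF two_sided_ideal_crit_ideal])
lift_definition times_dycr :: "'a dycr \<Rightarrow> 'a dycr \<Rightarrow> 'a dycr" is "(*)"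
  by (rule two_sided_ideal_cong(4)[OF two_sided_ideal_crit_ideal])

instance
proof -
  have z: "(0 :: 'a dy) \<in> crit_ideal"
    using two_sided_ideal_crit_ideal unfolding two_sided_ideal_def by blast
  show "OFCLASS('a dycr, ring_class)"
    by (intro_classes; transfer) (simp_all add: algebra_simps z)
  show "OFCLASS('a dycr, monoid_mult_class)"
    by (intro_classes; transfer) (simp_all add: algebra_simps z)
qed

end

text \<open>The canonical homomorphism from the completed free algebra.\<close>

definition to_cr :: "'n::finite free \<Rightarrow> 'n dycr" where
  "to_cr x = abs_dycr (abs_dy x)"


section \<open>The completion at the critical level\<close>

definition h_closed :: "'n::finite dycr set \<Rightarrow> bool" where
  "h_closed I \<longleftrightarrow> (\<forall>x. (\<forall>N. \<exists>y\<in>I. \<exists>z. x - y = to_cr hh ^ N * z) \<longrightarrow> x \<in> I)"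

text \<open>
  As everything here is \<open>h\<close>-adically complete, the left ideal generated by a set is
  understood in the topological sense, that is, it is \<open>h\<close>-adically closed.
\<close>

definition J :: "nat \<Rightarrow> 'n::finite dycr set" where
  "J p = \<Inter>{I. left_ideal I \<and> h_closed I \<and>
               (\<forall>i j r. r \<ge> int p \<longrightarrow> to_cr (gen (Ell i j r)) \<in> I)}"

text \<open>
  The inverse limit of the quotients by \<open>J p\<close>: its elements are the compatible families of
  cosets. (The additional index \<open>p = 0\<close> does not change the limit.)
\<close>

definition completion :: "(nat \<Rightarrow> 'n::finite dycr set) set" where
  "completion = {x. (\<forall>p. \<exists>a. x p = (+) a ` J p) \<and> (\<forall>p q. p \<le> q \<longrightarrow> x q \<subseteq> x p)}"

text \<open>
  Basic neighbourhoods of \<open>0\<close> in the \<open>h\<close>-adic topology modulo \<open>J p\<close>. The power of \<open>h\<close> is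
  needed for the multiplication to be continuous: right multiplication by a fixed element maps
  \<open>J q\<close> into \<open>J p + h^N DY\<close> for \<open>q\<close> large enough, but in general not into \<open>J p\<close>.
\<close>

definition nbhd :: "nat \<Rightarrow> nat \<Rightarrow> 'n::finite dycr set" where
  "nbhd p N = {y + to_cr hh ^ N * z | y z. y \<in> J p}"

text \<open>
  The element of the completion to which a sequence of elements of the quotient algebra
  converges, and the multiplication of the completion, which extends the one of the quotient
  algebra by continuity: the component of a product modulo \<open>J p\<close> is the limit of the products
  of representatives. As \<open>J p\<close> is \<open>h\<close>-adically closed, the sets on the right-hand sides are
  cosets of \<open>J p\<close> as soon as they are non-empty.
\<close>

definition completion_lim :: "(nat \<Rightarrow> 'n::finite dycr) \<Rightarrow> nat \<Rightarrow> 'n dycr set" where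
  "completion_lim s = (\<lambda>p. {z. \<forall>N. \<exists>Q. \<forall>q\<ge>Q. s q - z \<in> nbhd p N})"

definition completion_mult ::
  "(nat \<Rightarrow> 'n::finite dycr set) \<Rightarrow> (nat \<Rightarrow> 'n dycr set) \<Rightarrow> nat \<Rightarrow> 'n dycr set" where
  "completion_mult x y =
     (\<lambda>p. {z. \<forall>N. \<exists>Q. \<forall>q\<ge>Q. \<forall>a\<in>x q. \<forall>b\<in>y q. a * b - z \<in> nbhd p N})"

text \<open>
  The requirement that the product lies in the completion is automatic; it is included in order
  to make explicit that no equation between non-convergent products is meant.
\<close>

definition completion_center :: "(nat \<Rightarrow> 'n::finite dycr set) set" where
  "completion_center = {x \<in> completion. \<forall>y\<in>completion.
     completion_mult x y \<in> completion \<and> completion_mult x y = completion_mult y x}"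


section \<open>The series \<open>\<ell>_k(u)\<close>\<close>

text \<open>
  The matrices \<open>L^\<plusminus>\<close> and their products are formed over the completed free algebra; only their
  coefficients are then mapped to the quotient. This makes no difference since the
  canonical map is a continuous ring homomorphism and since \<open>L^+(u)\<close> is already invertible over
  the completed free algebra.
\<close>

text \<open>\<open>L^-(u + a h)\<close> as a power series in \<open>u\<close>; its coefficients are \<open>h\<close>-adically convergent.\<close>

definition Lminus :: "complex \<Rightarrow> ('n::finite free fps)^'n^'n" where
  "Lminus a = (\<chi> i j. Abs_fps (\<lambda>m. \<Sum>\<^sub>\<infinity>e\<in>{m..}.
      of_nat (e choose m) * scal (fps_const a * fps_X) ^ (e - m) * lcoeff False i j (int e)))"

text \<open>\<open>L^+(u + a h)\<close> as a power series in \<open>u^(-1)\<close>.\<close>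

definition Lplus :: "complex \<Rightarrow> ('n::finite free fps)^'n^'n" where
  "Lplus a = (\<chi> i j. Abs_fps (\<lambda>m. lcoeff True i j (- int m))
      oo inv_minus (- scal (fps_const a * fps_X)))"

text \<open>
  Elements of \<open>(End \<complex>^n)^(\<otimes>k) \<otimes> A\<close> are matrices whose rows and columns are indexed by the
  lists of length \<open>k\<close> over \<open>'n\<close>. The tensor copies are numbered from \<open>0\<close> to \<open>k - 1\<close>.
\<close>

type_synonym ('n, 'a) tensor = "'n list \<Rightarrow> 'n list \<Rightarrow> 'a"

definition tensor_one :: "('n, 'a::semiring_1) tensor" where
  "tensor_one r s = (if r = s then 1 else 0)"

definition tensor_mult ::
  "nat \<Rightarrow> ('n::finite, 'a::semiring_1) tensor \<Rightarrow> ('n, 'a) tensor \<Rightarrow> ('n, 'a) tensor" where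
  "tensor_mult k A B r s = (\<Sum>t | length t = k. A r t * B t s)"

definition tensor_prod ::
  "nat \<Rightarrow> ('n::finite, 'a::semiring_1) tensor list \<Rightarrow> ('n, 'a) tensor" where
  "tensor_prod k Ms = foldr (tensor_mult k) Ms tensor_one"

definition tensor_trace :: "nat \<Rightarrow> ('n::finite, 'a::semiring_1) tensor \<Rightarrow> 'a" where
  "tensor_trace k A = (\<Sum>r | length r = k. A r r)"

definition in_copy :: "nat \<Rightarrow> nat \<Rightarrow> 'a::semiring_1^'n^'n \<Rightarrow> ('n::finite, 'a) tensor" where
  "in_copy k a M r s = (if \<forall>b<k. b \<noteq> a \<longrightarrow> r ! b = s ! b then M $ (r ! a) $ (s ! a) else 0)"

definition antisymmetrizer :: "nat \<Rightarrow> ('n::finite, 'n free) tensor" where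
  "antisymmetrizer k r s = scal (fps_const (
     (\<Sum>\<sigma> | \<sigma> permutes {..<k}. of_int (sign \<sigma>) * (if \<forall>a<k. r ! \<sigma> a = s ! a then 1 else 0))
     / fact k))"

text \<open>\<open>L_1^-(u_1) \<dots> L_k^-(u_k)\<close>, in the variable \<open>u\<close>.\<close>

definition Lminus_prod :: "nat \<Rightarrow> ('n::finite, 'n free fps) tensor" where
  "Lminus_prod k = tensor_prod k (map (\<lambda>a. in_copy k a (Lminus (of_nat a))) [0..<k])"

text \<open>\<open>L_k^+(u_k + hn/2)^(-1) \<dots> L_1^+(u_1 + hn/2)^(-1)\<close>, in the variable \<open>u^(-1)\<close>.\<close>

definition Lplus_inv_prod :: "nat \<Rightarrow> ('n::finite, 'n free fps) tensor" where
  "Lplus_inv_prod k = tensor_prod k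
     (map (\<lambda>a. in_copy k a (matrix_inv (Lplus (of_nat a + of_nat CARD('n) / 2))))
       (rev [0..<k]))"

text \<open>
  The coefficient of \<open>u^m\<close> in \<open>\<ell>_k(u)\<close> is the sum, over all \<open>b \<ge> 0\<close> with \<open>m + b \<ge> 0\<close>, of the
  following elements, convergent in the completion.
\<close>

definition ell_term :: "nat \<Rightarrow> int \<Rightarrow> nat \<Rightarrow> 'n::finite free" where
  "ell_term k m b = (if m + int b \<ge> 0 then
     tensor_trace k (tensor_mult k (antisymmetrizer k)
       (tensor_mult k (\<lambda>r s. Lminus_prod k r s $ nat (m + int b))
                      (\<lambda>r s. Lplus_inv_prod k r s $ b)))
     else 0)"

definition ell_coeff :: "nat \<Rightarrow> int \<Rightarrow> nat \<Rightarrow> 'n::finite dycr set" where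
  "ell_coeff k m = completion_lim (\<lambda>B. \<Sum>b<B. to_cr (ell_term k m b))"

end

(*
 The commutation of l_k(u) with L^+(v) and L^-(v) is a fusion argument in k + 1 tensor copies:
 the generator, placed in the extra copy, is moved through the product by RLL relations, and
 the R-matrices collected on both sides cancel under the antisymmetrized trace because of the
 crossing identity beta = alpha + n eta. This is carried out over an abstract ring of scalars
 in the locale ell_core. The normalizing series f drops out at c = -n: its functional equation
 makes the ratio of the two occurrences of f in the mixed relation a rational function.

 Products such as L^-(u) L^+(u)^(-1) do not converge in the algebra but do on smooth vectors.
 The ring of scalars is therefore realized by operators on Laurent series with coefficients in a
 module wmod, which is the direct sum of the quotients of the free algebra by the left ideals
 h (J_j + h^j). The operator io turns a polynomial in u^(-1) into a Laurent series in u; it is put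
 between the products of L^- and of the inverses of L^+. On the generator of the j-th summand
 of wmod, vanishing of an element means membership in J_j + h^j, which gives centrality in
 the completion. The rings free and ecr are used to divide relations by powers of h: ecr is the
 quotient of the free algebra by h^2 Icr, where Icr is the h-adic closure of the kernel
 of the projection to the critical quotient.
*)
theory Submission
 imports Defs "HOL-Library.Function_Algebras" "HOL-Combinatorics.Permutations"
begin

text \<open>Tracing out one copy multiplies a common term by \<eta> (\<beta> - \<alpha> - n \<eta>);
  the level -n and the shift hn/2 are used to make this vanish. All denominators are cleared, so the
  fusion argument ends in a commutator multiplied by a product F of scalars, and removing F is
  delicate. For L^+(v), F has constant term 1 in v^(-1). For L^-(v), F is a power of u - v plus a
  multiple of h, with no inverse at hand; it is removed because u - v is injective and h acts
  nilpotently on each vector of \<open>wmod\<close>. This is a second reason to work with vectors.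
  The ideals J_j + h^j are dictated by continuity: right multiplication respects the J_p only modulo
  powers of h. The critical quotient may have h-torsion, so h must be cancelled upstairs. Of the two
  factors h kept in \<open>ecr\<close>, one is spent on the relations between adjacent shifts, which
  come out multiplied by h; the other is the h in front of a generator in L^+ and L^-, divided out
  at the very end.\<close>

abbreviation swp :: "'a \<Rightarrow> 'a \<Rightarrow> 'a \<Rightarrow> 'a" where "swp \<equiv> Transposition.transpose"

section \<open>Additive endomorphisms as a ring\<close>

class nontrivial_group = ab_group_add +
 assumes ex_nonzero: "\<exists>x. x \<noteq> 0"

text \<open>Only additivity is required: the scalars are non-commutative and multiply vectors from
  the left, so the operators in question are not linear over them on that side.\<close>

typedef (overloaded) 'v endo = "{f :: 'v::ab_group_add \<Rightarrow> 'v. \<forall>x y. f (x + y) = f x + f y}"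
 morphisms app Endo
 by (rule exI[of _ "\<lambda>x. x"]) simp

setup_lifting type_definition_endo

instantiation endo :: (ab_group_add) "{ring, monoid_mult}"
begin

lift_definition zero_endo :: "'a endo" is "\<lambda>x. 0" by simp
lift_definition one_endo :: "'a endo" is "\<lambda>x. x" by simp
lift_definition plus_endo :: "'a endo \<Rightarrow> 'a endo \<Rightarrow> 'a endo" is "\<lambda>f g x. f x + g x"
 by (simp add: algebra_simps)
lift_definition minus_endo :: "'a endo \<Rightarrow> 'a endo \<Rightarrow> 'a endo" is "\<lambda>f g x. f x - g x"
 by (simp add: algebra_simps)
lift_definition uminus_endo :: "'a endo \<Rightarrow> 'a endo" is "\<lambda>f x. - f x"
 by (simp add: algebra_simps)
lift_definition times_endo :: "'a endo \<Rightarrow> 'a endo \<Rightarrow> 'a endo" is "\<lambda>f g x. f (g x)"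
 by simp

instance
proof
 fix a b c :: "'a endo"
 show "a + b + c = a + (b + c)" "(a + b) * c = a * c + b * c" by (transfer; simp add: add.assoc)+
 show "a + b = b + a" by transfer (simp add: add.commute)
 show "a * (b + c) = a * b + a * c" by transfer simp
qed (transfer; simp add: fun_eq_iff)+

end

instance endo :: (nontrivial_group) ring_1
proof
 show "(0 :: 'a endo) \<noteq> 1"
 using ex_nonzero[where 'a='a] by transfer (auto simp: fun_eq_iff)
qed

lemma app_simps [simp]:
 "app (f + g) x = app f x + app g x" "app (f - g) x = app f x - app g x"
 "app (- f) x = - app f x" "app (f * g) x = app f (app g x)" "app 0 x = 0" "app 1 x = x"
 by (transfer; simp)+

lemma endo_eqI: "(\<And>x. app f x = app g x) \<Longrightarrow> f = g"
 by (metis app_inject ext)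

lemma app_add: "app f (x + y) = app f x + app f y"
 by transfer simp

lemma app_Endo: "(\<And>x y. f (x + y) = f x + f y) \<Longrightarrow> app (Endo f) = f"
 by (rule Endo_inverse) simp

lemma app_zero [simp]: "app f 0 = 0"
 using app_add[of f 0 0] by simp

lemma app_sum_arg: "app f (\<Sum>i\<in>A. g i) = (\<Sum>i\<in>A. app f (g i))"
 by (induction A rule: infinite_finite_induct) (simp_all add: app_add)

lemma app_sum: "app (\<Sum>i\<in>A. f i) x = (\<Sum>i\<in>A. app (f i) x)"
 by (induction A rule: infinite_finite_induct) simp_all

lemma sum_fun_apply: "(\<Sum>i\<in>A. f i) x = (\<Sum>i\<in>A. f i x)"
 by (induction A rule: infinite_finite_induct) simp_all

lemma commute_prod_list:
 fixes q :: "'a::monoid_mult"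
 assumes "\<And>z. z \<in> set zs \<Longrightarrow> q * z = z * q"
 shows "q * prod_list zs = prod_list zs * q"
 using assms
proof (induction zs)
 case (Cons z zs)
 have "q * (z * prod_list zs) = z * (q * prod_list zs)"
 using Cons.prems[of z] by (simp flip: mult.assoc)
 also have "\<dots> = z * (prod_list zs * q)" using Cons by simp
 finally show ?case by (simp add: mult.assoc)
qed simp

text \<open>
 Operators on vectors indexed by assignments of a basis index to every tensor copy.
\<close>

type_synonym ('n, 't) ivec = "(nat \<Rightarrow> 'n) \<Rightarrow> 't"

definition scO :: "'t::ring_1 \<Rightarrow> ('n, 't) ivec endo" where
 "scO c = Endo (\<lambda>\<phi> r. c * \<phi> r)"

text \<open>The copies are numbered by all natural numbers, so that an operator is the same object
  whatever the number of copies in a product is.\<close>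

definition matO :: "nat \<Rightarrow> ('n \<Rightarrow> 'n \<Rightarrow> 't::ring_1) \<Rightarrow> ('n::finite, 't) ivec endo" where
 "matO a m = Endo (\<lambda>\<phi> r. \<Sum>t\<in>UNIV. m (r a) t * \<phi> (r(a := t)))"

definition prO :: "(nat \<Rightarrow> nat) \<Rightarrow> ('n, 't::ring_1) ivec endo" where
 "prO \<sigma> = Endo (\<lambda>\<phi> r. \<phi> (r \<circ> \<sigma>))"

text \<open>The matrix unit in row t and column t' of copy a. That an operator acts trivially on
  copy a is expressed below by commuting with all of these.\<close>

definition epsO :: "nat \<Rightarrow> 'n \<Rightarrow> 'n \<Rightarrow> ('n, 't::ring_1) ivec endo" where
 "epsO a t t' = Endo (\<lambda>\<phi> r. if r a = t then \<phi> (r(a := t')) else 0)"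

lemma app_scO [simp]: "app (scO c) \<phi> r = c * \<phi> r"
 unfolding scO_def by (subst app_Endo) (auto simp: fun_eq_iff algebra_simps)

lemma app_matO: "app (matO a m) \<phi> r = (\<Sum>t\<in>UNIV. m (r a) t * \<phi> (r(a := t)))"
 unfolding matO_def by (subst app_Endo) (auto simp: fun_eq_iff algebra_simps sum.distrib)

lemma app_prO [simp]: "app (prO \<sigma>) \<phi> r = \<phi> (r \<circ> \<sigma>)"
 unfolding prO_def by (subst app_Endo) (auto simp: fun_eq_iff algebra_simps)

lemma app_epsO: "app (epsO a t t') \<phi> r = (if r a = t then \<phi> (r(a := t')) else 0)"
 unfolding epsO_def by (subst app_Endo) (auto simp: fun_eq_iff algebra_simps)

lemma vec_endo_eqI: "(\<And>\<phi> r. app f \<phi> r = app g \<phi> r) \<Longrightarrow> f = g"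
 by (rule endo_eqI) (auto simp: fun_eq_iff)

lemma prO_mult: "prO \<sigma> * prO \<tau> = prO (\<sigma> \<circ> \<tau>)"
 by (rule vec_endo_eqI) (simp add: o_assoc)

lemma prO_id: "prO id = 1"
 by (rule vec_endo_eqI) simp

lemma scO_mult: "scO c * scO d = scO (c * d)"
 by (rule vec_endo_eqI) (simp add: mult.assoc)

lemma scO_add: "scO c + scO d = scO (c + d)"
 by (rule vec_endo_eqI) (simp add: algebra_simps)

lemma scO_diff: "scO c - scO d = scO (c - d)"
 by (rule vec_endo_eqI) (simp add: algebra_simps)

lemma scO_1 [simp]: "scO 1 = 1"
 by (rule vec_endo_eqI) simp

lemma scO_uminus: "scO (- c) = - scO c"
 by (rule vec_endo_eqI) simp

lemma scO_prO: "scO c * prO \<sigma> = prO \<sigma> * scO c"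
 by (rule vec_endo_eqI) simp

lemma scO_epsO: "scO c * epsO a t t' = epsO a t t' * scO c"
 by (rule vec_endo_eqI) (simp add: app_epsO)

lemma scO_matO:
 assumes "\<And>i j. c * m i j = m i j * c"
 shows "scO c * matO a m = matO a m * scO c"
 by (rule vec_endo_eqI) (simp add: app_matO sum_distrib_left flip: mult.assoc, simp add: assms)

lemma comp_transpose_upd: "(r(b := t)) \<circ> swp a b = (r \<circ> swp a b)(a := t)"
 by (auto simp: fun_eq_iff Transposition.transpose_def)

lemma prO_matO_fixed:
 assumes "\<sigma> permutes A" "c \<notin> A"
 shows "prO \<sigma> * matO c m = matO c m * prO \<sigma>"
proof (rule vec_endo_eqI)
 fix \<phi> :: "('a, 'b) ivec" and r :: "nat \<Rightarrow> 'a"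
 have c: "\<sigma> c = c" using assms by (simp add: permutes_not_in)
 have "(r \<circ> \<sigma>)(c := t) = (r(c := t)) \<circ> \<sigma>" for t :: 'a
 proof (rule ext)
 fix z
 show "((r \<circ> \<sigma>)(c := t)) z = (r(c := t) \<circ> \<sigma>) z"
 using c inj_eq[OF permutes_inj[OF assms(1)], of z c] by auto
 qed
 then show "app (prO \<sigma> * matO c m) \<phi> r = app (matO c m * prO \<sigma>) \<phi> r"
 by (simp add: app_matO c)
qed

lemma prO_epsO_fixed:
 assumes "\<sigma> permutes A" "c \<notin> A"
 shows "prO \<sigma> * epsO c t t' = epsO c t t' * prO \<sigma>"
proof (rule vec_endo_eqI)
 fix \<phi> :: "('a, 'b) ivec" and r :: "nat \<Rightarrow> 'a"
 have c: "\<sigma> c = c" using assms by (simp add: permutes_not_in)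
 have "(r \<circ> \<sigma>)(c := t) = (r(c := t)) \<circ> \<sigma>" for t :: 'a
 proof (rule ext)
 fix z
 show "((r \<circ> \<sigma>)(c := t)) z = (r(c := t) \<circ> \<sigma>) z"
 using c inj_eq[OF permutes_inj[OF assms(1)], of z c] by auto
 qed
 then show "app (prO \<sigma> * epsO c t t') \<phi> r = app (epsO c t t' * prO \<sigma>) \<phi> r"
 by (simp add: app_epsO c)
qed

lemma prO_transpose_epsO:
 "prO (swp a b) * epsO a t t' = epsO b t t' * prO (swp a b)"
 by (rule vec_endo_eqI) (simp add: app_epsO comp_transpose_upd)

lemma matO_epsO:
 assumes "a \<noteq> b"
 shows "matO a m * epsO b t t' = epsO b t t' * matO a m"
 by (rule vec_endo_eqI) (simp add: app_matO app_epsO assms assms[symmetric] fun_upd_twist[OF assms])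

lemma matO_mult: "matO a m * matO a m' = matO a (\<lambda>i j. \<Sum>t\<in>UNIV. m i t * m' t j)"
proof (rule vec_endo_eqI)
 fix \<phi> r
 have "app (matO a m * matO a m') \<phi> r
 = (\<Sum>t\<in>UNIV. \<Sum>j\<in>UNIV. m (r a) t * m' t j * \<phi> (r(a := j)))"
 by (simp add: app_matO sum_distrib_left mult.assoc)
 also have "\<dots> = (\<Sum>j\<in>UNIV. \<Sum>t\<in>UNIV. m (r a) t * m' t j * \<phi> (r(a := j)))"
 by (rule sum.swap)
 finally show "app (matO a m * matO a m') \<phi> r
 = app (matO a (\<lambda>i j. \<Sum>t\<in>UNIV. m i t * m' t j)) \<phi> r"
 by (simp add: app_matO sum_distrib_right)
qed

text \<open>The partial trace of a flip over one of its two copies is the identity on the other one.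
  The trace over copy a is written with matrix units that send the index d to t and back. Together
  with \<open>eps_sum\<close>, where the trace of the identity gives n, this is all that the
  crossing argument needs.\<close>

lemma eps_swap_sum:
 assumes "a \<noteq> b"
 shows "(\<Sum>t\<in>UNIV. epsO a d t * prO (swp b a) * epsO a t d)
 = (epsO a d d :: ('n::finite, 't::ring_1) ivec endo)"
proof (rule vec_endo_eqI)
 fix \<phi> :: "('n, 't) ivec" and r :: "nat \<Rightarrow> 'n"
 have 1: "app (epsO a d t * prO (swp b a) * epsO a t d) \<phi> r =
 (if t = r b then (if r a = d then \<phi> (r(a := d)) else 0) else 0)" for t
 proof -
 have "(r(a := t) \<circ> swp b a) a = r b" "(r(a := t) \<circ> swp b a) (a := d) = r(b := t, a := d)"
 using assms by (auto simp: fun_eq_iff Transposition.transpose_def)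
 moreover have "t = r b \<Longrightarrow> r(b := t, a := d) = r(a := d)" by auto
 ultimately show ?thesis using assms by (auto simp: app_epsO)
 qed
 show "app (\<Sum>t\<in>UNIV. epsO a d t * prO (swp b a) * epsO a t d) \<phi> r = app (epsO a d d) \<phi> r"
 by (simp only: app_sum sum_fun_apply 1) (simp add: app_epsO)
qed

lemma eps_sum:
 "(\<Sum>t\<in>UNIV. epsO a d t * epsO a t d)
 = scO (of_nat CARD('n)) * (epsO a d d :: ('n::finite, 't::ring_1) ivec endo)"
 by (rule vec_endo_eqI) (simp add: app_sum sum_fun_apply app_epsO)

lemma transpose_involutory: "prO (swp a b) * prO (swp a b) = 1"
 by (simp add: prO_mult prO_id)

lemma commute_left:
 fixes a :: "'a::semigroup_mult"
 assumes "a * b = b * a"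
 shows "a * (b * z) = b * (a * z)"
 using assms by (metis mult.assoc)

text \<open>Adjacent transpositions suffice: a transposition of distant places is conjugate to a
  shorter one by an adjacent transposition, and every permutation is a product of
  transpositions.\<close>

lemma permutes_absorb_sign:
 fixes B :: "('n, 't::ring_1) ivec endo"
 assumes adj: "\<And>a. Suc a < k \<Longrightarrow> B * prO (swp a (Suc a)) = - B"
 and \<sigma>: "\<sigma> permutes {..<k}"
 shows "B * prO \<sigma> = scO (of_int (sign \<sigma>)) * B"
proof -
 have tr: "B * prO (swp a (a + Suc m)) = - B" if "a + Suc m < k" for a m
 using that
 proof (induction m)
 case 0
 then show ?case using adj[of a] by simp
 next
 case (Suc m)
 let ?b = "a + Suc m"
 have eq: "swp a (Suc ?b) = swp ?b (Suc ?b) \<circ>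
 swp a ?b \<circ> swp ?b (Suc ?b)"
 by (auto simp: fun_eq_iff Transposition.transpose_def)
 have q: "B * prO (swp ?b (Suc ?b)) = - B"
 by (rule adj) (use Suc.prems in simp)
 have "B * prO (swp a (Suc ?b)) = B * prO (swp ?b (Suc ?b)) *
 prO (swp a ?b) * prO (swp ?b (Suc ?b))"
 by (simp only: eq mult.assoc prO_mult o_assoc)
 also have "\<dots> = - B" using Suc by (simp only: q minus_mult_left[symmetric]) simp
 finally show ?case by simp
 qed
 have tr': "B * prO (swp a b) = - B" if "a < k" "b < k" "a \<noteq> b" for a b
 proof (cases "a < b")
 case True
 then show ?thesis using tr[of a "b - a - 1"] that by simp
 next
 case False
 then show ?thesis using tr[of b "a - b - 1"] that by (simp add: transpose_commute)
 qed
 show ?thesis using \<sigma>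
 proof (induction rule: permutes_induct[consumes 1, case_names finite id swap])
 case finite
 show ?case by simp
 next
 case id
 show ?case by (simp add: prO_id[unfolded id_def] scO_1 id_def sign_id[unfolded id_def])
 next
 case (swap a b p)
 have "B * prO (swp a b \<circ> p) = - (B * prO p)"
 using swap tr'[of a b] by (simp add: prO_mult[symmetric] mult.assoc[symmetric])
 moreover have "sign (swp a b \<circ> p) = - sign p"
 using swap permutes_imp_permutation[OF finite_lessThan swap(4)]
 by (simp add: sign_compose permutation_swap_id sign_swap_id)
 ultimately show ?case
 using swap(5) by (simp only: of_int_minus scO_uminus minus_mult_left[symmetric])
 qed
qed

text \<open>The series \<open>l\<close> of generators sits in the extra copy k; \<open>x a\<close>
  and \<open>y a\<close> are the factor L^- and the inverse of the factor L^+ in copy a, and \<iota>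
  separates the two halves. Entrywise, \<open>lx\<close> says that moving \<open>l\<close> past
  \<open>x a\<close> produces \<alpha> + \<eta> P on the left and b - \<eta> P on the right; by
  \<open>ly\<close> the latter turns into \<beta> - \<eta> P when \<open>l\<close> moves past
  \<open>y a\<close>. The scalars c and \<alpha> \<beta> are cleared denominators.
  \<open>cross\<close> is the trace of the critical level, \<open>xx\<close> and \<open>yy\<close>
  are the relations between neighbouring copies.\<close>

locale ell_core =
 fixes k :: nat and l :: "'n::finite \<Rightarrow> 'n \<Rightarrow> 't::ring_1"
 and x y :: "nat \<Rightarrow> 'n \<Rightarrow> 'n \<Rightarrow> 't"
 and \<iota> \<eta> :: 't and \<alpha> \<beta> b c :: "nat \<Rightarrow> 't" and Sc :: "'t set"
 assumes torsion: "\<And>m z. of_nat m * (z::'t) = 0 \<Longrightarrow> m \<noteq> 0 \<Longrightarrow> z = 0"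
 and Sc: "\<eta> \<in> Sc" "\<And>a. \<alpha> a \<in> Sc" "\<And>a. \<beta> a \<in> Sc" "\<And>a. b a \<in> Sc" "\<And>a. c a \<in> Sc"
 and Sc_comm: "\<And>p q. p \<in> Sc \<Longrightarrow> q \<in> Sc \<Longrightarrow> p * q = q * p"
 and Sc_l: "\<And>p i j. p \<in> Sc \<Longrightarrow> p * l i j = l i j * p"
 and Sc_x: "\<And>p a i j. p \<in> Sc \<Longrightarrow> p * x a i j = x a i j * p"
 and Sc_y: "\<And>p a i j. p \<in> Sc \<Longrightarrow> p * y a i j = y a i j * p"
 and Sc_iota: "\<And>p. p \<in> Sc \<Longrightarrow> p * \<iota> = \<iota> * p"
 and l_iota: "\<And>i j. l i j * \<iota> = \<iota> * l i j"
 and shift: "\<And>a. \<alpha> (Suc a) = \<alpha> a + \<eta>" "\<And>a. \<beta> (Suc a) = \<beta> a + \<eta>"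
 and cross: "\<And>a. \<beta> a = \<alpha> a + of_nat CARD('n) * \<eta>"
 and lx: "\<And>a i j p q. a < k \<Longrightarrow> c a * l i j * x a p q =
 \<alpha> a * b a * x a p q * l i j + \<eta> * b a * x a i q * l p j
 - \<alpha> a * \<eta> * x a p j * l i q - \<eta> * \<eta> * x a i j * l p q"
 and ly: "\<And>a. a < k \<Longrightarrow>
 scO (\<alpha> a * \<beta> a) * matO k l * (scO (b a) - scO \<eta> * prO (swp k a)) * matO a (y a)
 = scO (c a) * matO a (y a) * (scO (\<beta> a) - scO \<eta> * prO (swp k a)) * matO k l"
 and xx: "\<And>a i j p q. Suc a < k \<Longrightarrow> x a i p * x (Suc a) j q - x a j p * x (Suc a) i q
 = x (Suc a) j q * x a i p - x (Suc a) j p * x a i q"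
 and yy: "\<And>a. Suc a < k \<Longrightarrow> (1 - prO (swp a (Suc a))) *
 (matO (Suc a) (y (Suc a)) * matO a (y a)) * (1 + prO (swp a (Suc a))) = 0"
begin

section \<open>Moving the generator through the product\<close>

abbreviation P :: "nat \<Rightarrow> ('n, 't) ivec endo" where
 "P a \<equiv> prO (swp k a)"

abbreviation Q :: "nat \<Rightarrow> ('n, 't) ivec endo" where
 "Q a \<equiv> prO (swp a (Suc a))"

abbreviation "L0 \<equiv> matO k l"
abbreviation "X a \<equiv> matO a (x a)"
abbreviation "Y a \<equiv> matO a (y a)"

definition "M a = scO (\<alpha> a) + scO \<eta> * P a"
definition "N a = scO (\<beta> a) - scO \<eta> * P a"
definition "B a = scO (b a) - scO \<eta> * P a"

definition "XX m = prod_list (map X [0..<m])"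
definition "YY m = prod_list (map Y (rev [0..<m]))"
definition "MM m = prod_list (map M [0..<m])"
definition "NN m = prod_list (map N (rev [0..<m]))"
definition "BB m = prod_list (map B (rev [0..<m]))"
definition "AB m = prod_list (map (\<lambda>a. \<alpha> a * \<beta> a) [0..<m])"
definition "CC m = prod_list (map c [0..<m])"

lemma prods_0 [simp]: "XX 0 = 1" "YY 0 = 1" "MM 0 = 1" "NN 0 = 1" "BB 0 = 1" "AB 0 = 1" "CC 0 = 1"
 by (simp_all add: XX_def YY_def MM_def NN_def BB_def AB_def CC_def)

lemma prods_Suc:
 "XX (Suc m) = XX m * X m" "YY (Suc m) = Y m * YY m" "MM (Suc m) = MM m * M m"
 "NN (Suc m) = N m * NN m" "BB (Suc m) = B m * BB m"
 "AB (Suc m) = AB m * (\<alpha> m * \<beta> m)" "CC (Suc m) = CC m * c m"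
 by (simp_all add: XX_def YY_def MM_def NN_def BB_def AB_def CC_def)

text \<open>\<open>Sc\<close> is not assumed to be closed under multiplication, but products over
  all copies are needed. This set contains \<open>Sc\<close> and is closed.\<close>

definition "cen = {p. (\<forall>i j. p * l i j = l i j * p) \<and> (\<forall>a i j. p * x a i j = x a i j * p)
 \<and> (\<forall>a i j. p * y a i j = y a i j * p) \<and> p * \<iota> = \<iota> * p \<and> (\<forall>q\<in>Sc. p * q = q * p)}"

lemma cen_Sc: "Sc \<subseteq> cen"
 unfolding cen_def using Sc_l Sc_x Sc_y Sc_iota Sc_comm by blast

lemma cen_mult: "p \<in> cen \<Longrightarrow> q \<in> cen \<Longrightarrow> p * q \<in> cen"
 unfolding cen_def by (simp add: mult.assoc) (simp add: mult.assoc[symmetric])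

lemma cen_1: "1 \<in> cen" unfolding cen_def by simp

lemma cen_prods: "AB m \<in> cen" "CC m \<in> cen"
 using cen_Sc Sc by (induction m) (auto simp: prods_Suc intro!: cen_mult cen_1)

lemma Sc_cen: "\<eta> \<in> cen" "\<alpha> a \<in> cen" "\<beta> a \<in> cen" "b a \<in> cen" "c a \<in> cen"
 using cen_Sc Sc by auto

lemma cen_comm:
 assumes "p \<in> cen"
 shows "scO p * L0 = L0 * scO p" "scO p * X a = X a * scO p" "scO p * Y a = Y a * scO p"
 "scO p * scO \<iota> = scO \<iota> * scO p" "scO p * prO \<sigma> = prO \<sigma> * scO p"
 "scO p * epsO a t t' = epsO a t t' * scO p" "q \<in> Sc \<Longrightarrow> scO p * scO q = scO q * scO p"
 "scO p * M a = M a * scO p" "scO p * N a = N a * scO p" "scO p * B a = B a * scO p"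
proof -
 show "scO p * L0 = L0 * scO p" "scO p * X a = X a * scO p" "scO p * Y a = Y a * scO p"
 using assms by (auto intro!: scO_matO simp: cen_def)
 show 0: "scO p * scO \<iota> = scO \<iota> * scO p" "\<And>q. q \<in> Sc \<Longrightarrow> scO p * scO q = scO q * scO p"
 using assms by (auto simp: scO_mult cen_def)
 show 1: "scO p * prO \<sigma> = prO \<sigma> * scO p" for \<sigma> by (rule scO_prO)
 show "scO p * epsO a t t' = epsO a t t' * scO p" by (rule scO_epsO)
 have "scO p * (scO \<eta> * P a) = scO \<eta> * P a * scO p"
 by (simp only: mult.assoc commute_left[OF 0(2)[OF Sc(1)]] 1)
 then show "scO p * M a = M a * scO p" "scO p * N a = N a * scO p" "scO p * B a = B a * scO p"
 unfolding M_def N_def B_def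
 by (simp_all add: distrib_left distrib_right left_diff_distrib right_diff_distrib 0 Sc)
qed

lemma P_comm_mat:
 assumes "a \<noteq> k" "a' \<noteq> k" "a \<noteq> a'"
 shows "P a * matO a' m = matO a' m * P a"
 by (rule prO_matO_fixed[OF permutes_swap_id[of k "{k, a}" a]]) (use assms in auto)

lemma MNB_comm_mat:
 assumes "a \<noteq> k" "a' \<noteq> k" "a \<noteq> a'" and m: "\<And>p i j. p \<in> Sc \<Longrightarrow> p * m i j = m i j * p"
 shows "M a * matO a' m = matO a' m * M a" "N a * matO a' m = matO a' m * N a"
 "B a * matO a' m = matO a' m * B a"
proof -
 have s: "p \<in> Sc \<Longrightarrow> scO p * matO a' m = matO a' m * scO p" for p
 by (rule scO_matO) (rule m)
 have pm: "scO \<eta> * P a * matO a' m = matO a' m * (scO \<eta> * P a)"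
 using commute_left[OF s[OF Sc(1)], of "P a"] P_comm_mat[OF assms(1-3), of m]
 by (simp only: mult.assoc)
 show "M a * matO a' m = matO a' m * M a" "N a * matO a' m = matO a' m * N a"
 "B a * matO a' m = matO a' m * B a"
 unfolding M_def N_def B_def
 by (simp_all only: distrib_left distrib_right left_diff_distrib right_diff_distrib s[OF Sc(2)]
 s[OF Sc(3)] s[OF Sc(4)] pm)
qed

text \<open>Expanding (\<alpha> + \<eta> P) X L0 (b - \<eta> P) gives four terms. A flip on the left
  exchanges the two row indices and a flip on the right the two column indices, which are the four
  terms of \<open>lx\<close>.\<close>

lemma L0X:
 assumes "a < k"
 shows "scO (c a) * L0 * X a = M a * X a * L0 * B a"
proof (rule vec_endo_eqI)
 fix \<phi> :: "('n, 't) ivec" and r :: "nat \<Rightarrow> 'n"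
 have ak: "a \<noteq> k" "k \<noteq> a" using assms by auto
 define i p where "i = r k" and "p = r a"
 define \<psi> where "\<psi> j q = \<phi> (r(k := j, a := q))" for j q
 have app_XL: "app (X a * L0) \<phi>' r' = (\<Sum>j\<in>UNIV. \<Sum>q\<in>UNIV. x a (r' a) q * l (r' k) j * \<phi>' (r'(k := j, a := q)))" for \<phi>' r'
 by (simp add: app_matO ak sum_distrib_left mult.assoc fun_upd_twist[OF ak(1)])
 (rule sum.swap)
 have tr: "(r(k := j, a := q)) \<circ> swp k a = r(k := q, a := j)"
 "(r \<circ> swp k a)(k := j, a := q) = r(k := j, a := q)"
 "((r \<circ> swp k a)(k := j, a := q)) \<circ> swp k a = r(k := q, a := j)"
 "(r \<circ> swp k a) k = p" "(r \<circ> swp k a) a = i" for j q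
 using ak by (auto simp: fun_eq_iff Transposition.transpose_def i_def p_def)
 have ra: "r a = p" "r k = i" by (simp_all add: i_def p_def)
 have 1: "app (X a * L0) \<phi> r = (\<Sum>j\<in>UNIV. \<Sum>q\<in>UNIV. x a p q * l i j * \<psi> j q)"
 unfolding app_XL \<psi>_def ra ..
 have 2: "app (P a * (X a * L0)) \<phi> r = (\<Sum>j\<in>UNIV. \<Sum>q\<in>UNIV. x a i q * l p j * \<psi> j q)"
 unfolding app_simps(4)[of "P a"] app_prO app_XL \<psi>_def tr ..
 have 3: "app (X a * L0 * P a) \<phi> r = (\<Sum>j\<in>UNIV. \<Sum>q\<in>UNIV. x a p j * l i q * \<psi> j q)"
 unfolding app_simps(4)[of _ "P a"] app_XL app_prO tr ra \<psi>_def
 by (rule sum.swap)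
 have 4: "app (P a * (X a * L0) * P a) \<phi> r = (\<Sum>j\<in>UNIV. \<Sum>q\<in>UNIV. x a i j * l p q * \<psi> j q)"
 unfolding app_simps(4)[of _ "P a"] app_simps(4)[of "P a" "X a * L0"] app_XL app_prO tr \<psi>_def
 by (rule sum.swap)
 let ?Z = "X a * L0"
 have cZ: "scO q * ?Z = ?Z * scO q" if "q \<in> cen" for q
 using commute_left[OF cen_comm(2)[OF that, of a], of L0] cen_comm(1)[OF that]
 by (simp only: mult.assoc)
 have "M a * X a * L0 * B a = scO (\<alpha> a * b a) * ?Z + scO (\<eta> * b a) * (P a * ?Z)
 - scO (\<alpha> a * \<eta>) * (?Z * P a) - scO (\<eta> * \<eta>) * (P a * ?Z * P a)"
 proof -
 have e: "M a * X a * L0 * B a = M a * ?Z * B a" by (simp add: mult.assoc)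
 have "?Z * B a = scO (b a) * ?Z - scO \<eta> * (?Z * P a)"
 unfolding B_def right_diff_distrib using cZ[OF Sc_cen(4)[of a]] cZ[OF Sc_cen(1)]
 by (simp add: mult.assoc[symmetric])
 moreover have "P a * (scO q * z) = scO q * (P a * z)" for q z
 by (rule commute_left[OF scO_prO, symmetric])
 ultimately show ?thesis unfolding e M_def
 by (simp add: distrib_right right_diff_distrib mult.assoc scO_mult[symmetric])
 qed
 then have "app (M a * X a * L0 * B a) \<phi> r = \<alpha> a * b a * app ?Z \<phi> r + \<eta> * b a * app (P a * ?Z) \<phi> r
 - \<alpha> a * \<eta> * app (?Z * P a) \<phi> r - \<eta> * \<eta> * app (P a * ?Z * P a) \<phi> r"
 by (simp only: app_simps(1-3) plus_fun_apply minus_apply app_simps(4)[of "scO _"] app_scO)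
 also have "\<dots> = (\<Sum>j\<in>UNIV. \<Sum>q\<in>UNIV. (\<alpha> a * b a * x a p q * l i j + \<eta> * b a * x a i q * l p j
 - \<alpha> a * \<eta> * x a p j * l i q - \<eta> * \<eta> * x a i j * l p q) * \<psi> j q)"
 unfolding 1 2 3 4 by (simp add: sum_distrib_left sum.distrib sum_subtractf
 left_diff_distrib distrib_right mult.assoc)
 also have "\<dots> = (\<Sum>j\<in>UNIV. \<Sum>q\<in>UNIV. c a * l i j * x a p q * \<psi> j q)"
 by (simp only: lx[OF assms])
 also have "\<dots> = app (scO (c a) * L0 * X a) \<phi> r"
 by (simp add: app_matO ak sum_distrib_left mult.assoc \<psi>_def i_def p_def)
 finally show "app (scO (c a) * L0 * X a) \<phi> r = app (M a * X a * L0 * B a) \<phi> r" by simp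
qed

lemma cen_comm_prods:
 assumes "p \<in> cen"
 shows "scO p * XX m = XX m * scO p" "scO p * YY m = YY m * scO p" "scO p * MM m = MM m * scO p"
 "scO p * NN m = NN m * scO p" "scO p * BB m = BB m * scO p"
 unfolding XX_def YY_def MM_def NN_def BB_def
 by (rule commute_prod_list; use cen_comm[OF assms] in force)+

lemma MNB_comm:
 assumes "a < k" "a' < k" "a \<noteq> a'"
 shows "M a * X a' = X a' * M a" "N a * X a' = X a' * N a" "B a * X a' = X a' * B a"
 "M a * Y a' = Y a' * M a" "N a * Y a' = Y a' * N a" "B a * Y a' = Y a' * B a"
 using assms Sc_x Sc_y by (auto intro!: MNB_comm_mat)

lemma prods_comm:
 assumes "m < k"
 shows "M m * XX m = XX m * M m" "X m * BB m = BB m * X m" "N m * YY m = YY m * N m"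
 "Y m * BB m = BB m * Y m"
 unfolding XX_def YY_def MM_def NN_def BB_def
 by (rule commute_prod_list; use MNB_comm assms in force)+

lemma L0_XX: "m \<le> k \<Longrightarrow> scO (CC m) * L0 * XX m = MM m * XX m * L0 * BB m"
proof (induction m)
 case (Suc m)
 note cm = cen_comm_prods[OF Sc_cen(5)[of m], THEN commute_left]
 have m: "m < k" using Suc.prems by simp
 have "scO (CC (Suc m)) * L0 * XX (Suc m) = scO (c m) * (scO (CC m) * L0 * XX m) * X m"
 using commute_left[OF cen_comm(7)[OF cen_prods(2)[of m] Sc(5)[of m]]]
 by (simp add: prods_Suc scO_mult[symmetric] mult.assoc)
 also have "\<dots> = scO (c m) * (MM m * XX m * L0 * BB m) * X m" using Suc by simp
 also have "\<dots> = MM m * XX m * (scO (c m) * L0 * X m) * BB m"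
 by (simp add: mult.assoc cm prods_comm(2)[OF m])
 also have "\<dots> = MM m * XX m * (M m * X m * L0 * B m) * BB m"
 by (simp only: L0X[OF m])
 also have "\<dots> = MM (Suc m) * XX (Suc m) * L0 * BB (Suc m)"
 by (simp add: prods_Suc mult.assoc commute_left[OF prods_comm(1)[OF m]])
 finally show ?case .
qed simp

lemma L0_YY: "m \<le> k \<Longrightarrow> scO (AB m) * L0 * BB m * YY m = scO (CC m) * YY m * NN m * L0"
proof (induction m)
 case (Suc m)
 have m: "m < k" using Suc.prems by simp
 have ab: "\<alpha> m * \<beta> m \<in> cen" using Sc_cen cen_mult by blast
 note cA = cen_comm_prods[OF cen_prods(1)[of m], THEN commute_left]
 note cA' = cen_comm[OF cen_prods(1)[of m], THEN commute_left]
 note cC = cen_comm_prods[OF cen_prods(2)[of m], THEN commute_left]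
 note cC' = cen_comm[OF cen_prods(2)[of m], THEN commute_left]
 have "scO (AB (Suc m)) * L0 * BB (Suc m) * YY (Suc m)
 = scO (AB m) * (scO (\<alpha> m * \<beta> m) * L0 * B m * Y m) * BB m * YY m"
 by (simp add: prods_Suc scO_mult[symmetric] mult.assoc commute_left[OF prods_comm(4)[OF m], symmetric])
 also have "\<dots> = scO (AB m) * (scO (c m) * Y m * N m * L0) * BB m * YY m"
 using ly[OF m] by (simp add: B_def N_def)
 also have "\<dots> = scO (c m) * Y m * N m * (scO (AB m) * L0 * BB m * YY m)"
 by (simp add: mult.assoc cA'(3,9) cA'(7)[OF Sc(5)])
 also have "\<dots> = scO (c m) * Y m * N m * (scO (CC m) * YY m * NN m * L0)"
 using Suc by simp
 also have "\<dots> = scO (CC (Suc m)) * YY (Suc m) * NN (Suc m) * L0"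
 by (simp add: prods_Suc mult.assoc scO_mult[symmetric] cC'(3,9)[symmetric] cC'(7)[OF Sc(5)]
 commute_left[OF prods_comm(3)[OF m]])
 finally show ?case .
qed simp

definition "Z = XX k * scO \<iota> * YY k"

lemma L0_iota: "scO \<iota> * L0 = L0 * scO \<iota>"
 by (rule scO_matO) (simp add: l_iota)

lemma BNM_iota: "scO \<iota> * B a = B a * scO \<iota>"
proof -
 have "scO \<iota> * (scO \<eta> * P a) = scO \<eta> * P a * scO \<iota>"
 by (simp only: mult.assoc commute_left[OF cen_comm(4)[OF Sc_cen(1), symmetric]] scO_prO[of \<iota>])
 then show ?thesis
 unfolding B_def using cen_comm(4)[OF Sc_cen(4)[of a], symmetric]
 by (simp add: left_diff_distrib right_diff_distrib)
qed

lemma BB_iota: "scO \<iota> * BB m = BB m * scO \<iota>"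
 unfolding BB_def by (rule commute_prod_list) (use BNM_iota in auto)

text \<open>The factors B left behind by the first half of the product are exactly those consumed by
  the second half, so only \<open>MM k\<close> on the left and \<open>NN k\<close> next to the
  generator survive.\<close>

lemma L0_Z: "scO (AB k * CC k) * L0 * Z = scO (CC k) * MM k * Z * NN k * L0"
proof -
 note cA = cen_comm_prods[OF cen_prods(1)[of k], THEN commute_left]
 note cA' = cen_comm[OF cen_prods(1)[of k], THEN commute_left]
 note cC = cen_comm_prods[OF cen_prods(2)[of k], THEN commute_left]
 note cC' = cen_comm[OF cen_prods(2)[of k], THEN commute_left]
 have "scO (AB k * CC k) * L0 * Z = scO (AB k) * (scO (CC k) * L0 * XX k) * scO \<iota> * YY k"
 by (simp add: Z_def scO_mult[symmetric] mult.assoc)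
 also have "\<dots> = scO (AB k) * (MM k * XX k * L0 * BB k) * scO \<iota> * YY k"
 by (simp add: L0_XX)
 also have "\<dots> = MM k * XX k * scO \<iota> * (scO (AB k) * L0 * BB k * YY k)"
 by (simp add: mult.assoc cA cA' commute_left[OF L0_iota] commute_left[OF BB_iota])
 also have "\<dots> = MM k * XX k * scO \<iota> * (scO (CC k) * YY k * NN k * L0)"
 by (simp add: L0_YY)
 also have "\<dots> = scO (CC k) * MM k * Z * NN k * L0"
 by (simp add: Z_def mult.assoc cC cC')
 finally show ?thesis .
qed

section \<open>The antisymmetrizer and the factors it absorbs\<close>

definition "A = (\<Sum>\<sigma> | \<sigma> permutes {..<k}. scO (of_int (sign \<sigma>)) * prO \<sigma> :: ('n, 't) ivec endo)"

lemma A_Q: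
 assumes "Suc a < k"
 shows "A * Q a = - A"
proof -
 let ?q = "swp a (Suc a)"
 have q: "?q permutes {..<k}" using assms by (intro permutes_swap_id) auto
 have "- A = (\<Sum>\<sigma> | \<sigma> permutes {..<k}. - (scO (of_int (sign \<sigma>)) * prO \<sigma>))"
 by (simp add: A_def sum_negf)
 also have "\<dots> = (\<Sum>\<sigma> | \<sigma> permutes {..<k}. - (scO (of_int (sign (\<sigma> \<circ> ?q))) * prO (\<sigma> \<circ> ?q)))"
 by (rule sum_permutations_compose_right[OF q])
 also have "\<dots> = (\<Sum>\<sigma> | \<sigma> permutes {..<k}. scO (of_int (sign \<sigma>)) * prO \<sigma> * Q a)"
 proof (rule sum.cong[OF refl])
 fix \<sigma> assume "\<sigma> \<in> {\<sigma>. \<sigma> permutes {..<k}}"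
 then have "permutation \<sigma>" using permutes_imp_permutation by blast
 then have "sign (\<sigma> \<circ> ?q) = - sign \<sigma>"
 by (simp add: sign_compose permutation_swap_id sign_swap_id)
 then show "- (scO (of_int (sign (\<sigma> \<circ> ?q))) * prO (\<sigma> \<circ> ?q)) = scO (of_int (sign \<sigma>)) * prO \<sigma> * Q a"
 by (simp only: of_int_minus scO_uminus minus_mult_left[symmetric] minus_minus mult.assoc prO_mult)
 qed
 finally show ?thesis by (simp add: A_def sum_distrib_right)
qed

text \<open>Every summand of \<open>A\<close> contributes U once its sign is absorbed. As
  \<open>A\<close> is k! times the antisymmetrizer, this is the projection property without a
  division; the factor k! is removed later by \<open>torsion\<close>.\<close>

lemma absorb_A:
 assumes "\<And>a. Suc a < k \<Longrightarrow> U * Q a = - U"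
 shows "U * A = scO (of_nat (fact k)) * U"
proof -
 have U: "U * (scO (of_int z) * V) = scO (of_int z) * (U * V)" if "z = 1 \<or> z = -1" for z V
 using that by (auto simp: scO_uminus)
 have "U * A = (\<Sum>\<sigma> | \<sigma> permutes {..<k}. U)"
 unfolding A_def sum_distrib_left
 proof (rule sum.cong[OF refl])
 fix \<sigma> assume s: "\<sigma> \<in> {\<sigma>. \<sigma> permutes {..<k}}"
 have "U * prO \<sigma> = scO (of_int (sign \<sigma>)) * U"
 using s by (intro permutes_absorb_sign[OF assms]) auto
 moreover have "sign \<sigma> = 1 \<or> sign \<sigma> = -1" by (rule sign_cases) auto
 ultimately show "U * (scO (of_int (sign \<sigma>)) * prO \<sigma>) = U"
 by (auto simp: U scO_uminus)
 qed
 also have "\<dots> = scO (of_nat (fact k)) * U"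
 proof -
 have "(\<Sum>\<sigma>\<in>S. U) = scO (of_nat (card S)) * U" if "finite S" for S :: "(nat \<Rightarrow> nat) set"
 using that by (induction S rule: finite_induct)
 (auto simp: scO_add[symmetric] distrib_right intro!: vec_endo_eqI)
 moreover have "card {\<sigma>. \<sigma> permutes {..<k}} = fact k" by (simp add: card_permutations)
 ultimately show ?thesis by (metis finite_permutations finite_lessThan)
 qed
 finally show ?thesis .
qed

lemma vec_torsion:
 assumes "scO (of_nat m) * U = scO (of_nat m) * (V :: ('n, 't) ivec endo)" "m \<noteq> 0"
 shows "U = V"
proof (rule vec_endo_eqI)
 fix \<phi> r
 have "of_nat m * app U \<phi> r = of_nat m * app V \<phi> r"
 using arg_cong[OF assms(1), of "\<lambda>f. app f \<phi> r"] by simp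
 then have "of_nat m * (app U \<phi> r - app V \<phi> r) = 0" by (simp add: right_diff_distrib)
 then show "app U \<phi> r = app V \<phi> r" using torsion[OF _ assms(2)] by force
qed

text \<open>Since A (1 - Q a) = 2 A, a factor 1 - Q a can be created next to \<open>A\<close>, moved
  through \<open>Lf\<close> to F, and annihilated there by the factor 1 + Q a that comes through
  \<open>Rt\<close> from the right.\<close>

lemma A_absorb:
 assumes a: "Suc a < k" and "U = Lf * F * Rt"
 and Lf: "Q a * Lf = Lf * Q a" and Rt: "Q a * Rt = Rt * Q a"
 and F: "(1 - Q a) * F * (1 + Q a) = 0"
 shows "A * U * Q a = - (A * U)"
proof -
 have 2: "A * (1 - Q a) = scO (of_nat 2) * A"
 using A_Q[OF a] by (auto intro!: vec_endo_eqI simp: right_diff_distrib mult_2)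
 have l: "(1 - Q a) * Lf = Lf * (1 - Q a)" using Lf by (simp add: left_diff_distrib right_diff_distrib)
 have r: "(1 + Q a) * Rt = Rt * (1 + Q a)" using Rt by (simp add: distrib_left distrib_right)
 have "scO (of_nat 2) * (A * U * (1 + Q a)) = A * (1 - Q a) * Lf * F * Rt * (1 + Q a)"
 unfolding 2 \<open>U = _\<close> by (simp add: mult.assoc)
 also have "\<dots> = A * Lf * ((1 - Q a) * F * (1 + Q a)) * Rt"
 by (simp only: mult.assoc r[symmetric] commute_left[OF l])
 also have "\<dots> = scO (of_nat 2) * 0" by (simp add: F)
 finally have "A * U * (1 + Q a) = 0" by (rule vec_torsion) simp
 then show ?thesis by (simp add: distrib_left eq_neg_iff_add_eq_0 add.commute)
qed

lemma upt_split: "Suc a < k \<Longrightarrow> [0..<k] = [0..<a] @ [a, Suc a] @ [Suc (Suc a)..<k]"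
 using upt_add_eq_append[of 0 a "k - a"] by (simp add: upt_conv_Cons)

lemma prod_list_A:
 assumes a: "Suc a < k" and F: "(1 - Q a) * (F a * F (Suc a)) * (1 + Q a) = 0"
 and c: "\<And>a'. a' < k \<Longrightarrow> a' \<noteq> a \<Longrightarrow> a' \<noteq> Suc a \<Longrightarrow> Q a * F a' = F a' * Q a"
 shows "A * prod_list (map F [0..<k]) * Q a = - (A * prod_list (map F [0..<k]))"
proof (rule A_absorb[OF a _ _ _ F])
 show "prod_list (map F [0..<k]) = prod_list (map F [0..<a]) * (F a * F (Suc a)) * prod_list (map F [Suc (Suc a)..<k])"
 by (subst upt_split[OF a]) (simp add: mult.assoc)
qed (rule commute_prod_list; use c a in force)+

lemma prod_list_rev_A:
 assumes a: "Suc a < k" and F: "(1 - Q a) * (F (Suc a) * F a) * (1 + Q a) = 0"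
 and c: "\<And>a'. a' < k \<Longrightarrow> a' \<noteq> a \<Longrightarrow> a' \<noteq> Suc a \<Longrightarrow> Q a * F a' = F a' * Q a"
 shows "A * prod_list (map F (rev [0..<k])) * Q a = - (A * prod_list (map F (rev [0..<k])))"
proof (rule A_absorb[OF a _ _ _ F])
 show "prod_list (map F (rev [0..<k]))
 = prod_list (map F (rev [Suc (Suc a)..<k])) * (F (Suc a) * F a) * prod_list (map F (rev [0..<a]))"
 by (subst upt_split[OF a]) (simp add: mult.assoc)
qed (rule commute_prod_list; use c a in force)+

lemma Q_mat: "a' \<noteq> a \<Longrightarrow> a' \<noteq> Suc a \<Longrightarrow> Q a * matO a' m = matO a' m * Q a"
 by (rule prO_matO_fixed[OF permutes_swap_id[of a "{a, Suc a}" "Suc a"]]) auto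

lemma A_XX_Q:
 assumes a: "Suc a < k"
 shows "A * XX k * Q a = - (A * XX k)"
 unfolding XX_def
proof (rule prod_list_A[OF a])
 have "(1 - Q a) * (X a * X (Suc a)) = X (Suc a) * X a * (1 - Q a)"
 proof (rule vec_endo_eqI)
 fix \<phi> :: "('n, 't) ivec" and r :: "nat \<Rightarrow> 'n"
 define i j where "i = r a" and "j = r (Suc a)"
 define \<psi> where "\<psi> p q = \<phi> (r(a := p, Suc a := q))" for p q
 have tr: "(r \<circ> swp a (Suc a)) (a := p, Suc a := q) = r (a := p, Suc a := q)"
 "(r \<circ> swp a (Suc a)) a = j" "(r \<circ> swp a (Suc a)) (Suc a) = i"
 "(r (a := p, Suc a := q)) \<circ> swp a (Suc a) = r (a := q, Suc a := p)" for p q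
 by (auto simp: fun_eq_iff Transposition.transpose_def i_def j_def)
 have xx1: "app (X a * X (Suc a)) \<phi>' r' = (\<Sum>p\<in>UNIV. \<Sum>q\<in>UNIV.
 x a (r' a) p * x (Suc a) (r' (Suc a)) q * \<phi>' (r'(a := p, Suc a := q)))" for \<phi>' r'
 by (simp add: app_matO sum_distrib_left mult.assoc)
 have xx2: "app (X (Suc a) * X a) \<phi>' r' = (\<Sum>p\<in>UNIV. \<Sum>q\<in>UNIV.
 x (Suc a) (r' (Suc a)) q * x a (r' a) p * \<phi>' (r'(a := p, Suc a := q)))" for \<phi>' r'
 by (simp add: app_matO sum_distrib_left mult.assoc fun_upd_twist[of "Suc a" a]) (rule sum.swap)
 have 1: "app (X a * X (Suc a)) \<phi> r = (\<Sum>p\<in>UNIV. \<Sum>q\<in>UNIV. x a i p * x (Suc a) j q * \<psi> p q)"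
 unfolding xx1 \<psi>_def i_def j_def ..
 have 2: "app (Q a * (X a * X (Suc a))) \<phi> r = (\<Sum>p\<in>UNIV. \<Sum>q\<in>UNIV. x a j p * x (Suc a) i q * \<psi> p q)"
 unfolding app_simps(4)[of "Q a"] app_prO xx1 tr \<psi>_def ..
 have 3: "app (X (Suc a) * X a) \<phi> r = (\<Sum>p\<in>UNIV. \<Sum>q\<in>UNIV. x (Suc a) j q * x a i p * \<psi> p q)"
 unfolding xx2 \<psi>_def i_def j_def ..
 have 4: "app (X (Suc a) * X a * Q a) \<phi> r = (\<Sum>p\<in>UNIV. \<Sum>q\<in>UNIV. x (Suc a) j p * x a i q * \<psi> p q)"
 unfolding app_simps(4)[of _ "Q a"] app_prO xx2 tr \<psi>_def i_def j_def by (rule sum.swap)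
 have "app ((1 - Q a) * (X a * X (Suc a))) \<phi> r = app (X a * X (Suc a)) \<phi> r - app (Q a * (X a * X (Suc a))) \<phi> r"
 by (simp add: left_diff_distrib)
 also have "\<dots> = (\<Sum>p\<in>UNIV. \<Sum>q\<in>UNIV. (x a i p * x (Suc a) j q - x a j p * x (Suc a) i q) * \<psi> p q)"
 unfolding 1 2 by (simp add: sum_subtractf left_diff_distrib)
 also have "\<dots> = app (X (Suc a) * X a) \<phi> r - app (X (Suc a) * X a * Q a) \<phi> r"
 unfolding 3 4 xx[OF a] by (simp add: sum_subtractf left_diff_distrib)
 also have "\<dots> = app (X (Suc a) * X a * (1 - Q a)) \<phi> r"
 by (simp add: right_diff_distrib)
 finally show "app ((1 - Q a) * (X a * X (Suc a))) \<phi> r = app (X (Suc a) * X a * (1 - Q a)) \<phi> r" .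
 qed
 moreover have "(1 - Q a) * (1 + Q a) = 0"
 by (simp add: distrib_left left_diff_distrib transpose_involutory)
 ultimately show "(1 - Q a) * (X a * X (Suc a)) * (1 + Q a) = 0"
 by (simp add: mult.assoc)
qed (simp add: Q_mat)

lemma A_YY_Q: "Suc a < k \<Longrightarrow> A * YY k * Q a = - (A * YY k)"
 unfolding YY_def by (rule prod_list_rev_A) (simp_all add: Q_mat yy)

lemma PP_Q:
 assumes "Suc a < k"
 shows "P a * Q a = Q a * P (Suc a)" "P (Suc a) * Q a = Q a * P a"
 "P a * P (Suc a) = Q a * P a" "P (Suc a) * P a = P a * Q a" "Q a * (P a * Q a) = P (Suc a)"
 "Q a * Q a = 1"
 using assms unfolding prO_mult transpose_involutory[symmetric, of a "Suc a"]
 by (auto intro!: arg_cong[of _ _ prO] simp: fun_eq_iff Transposition.transpose_def)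

text \<open>Between 1 - Q a and 1 + Q a, a Q a at the left end counts as -1 and at the right end as
  1. The braid relations bring each middle factor to \<open>P a\<close> with a Q a at an
  end.\<close>

lemma Q_sandwich:
 assumes "Suc a < k"
 shows "(1 - Q a) * P (Suc a) * (1 + Q a) = - ((1 - Q a) * P a * (1 + Q a))"
 "(1 - Q a) * (P a * P (Suc a)) * (1 + Q a) = - ((1 - Q a) * P a * (1 + Q a))"
 "(1 - Q a) * (P (Suc a) * P a) * (1 + Q a) = (1 - Q a) * P a * (1 + Q a)"
proof -
 have q: "Q a * (Q a * z) = z" for z using PP_Q(6)[OF assms] by (simp flip: mult.assoc)
 have p: "P (Suc a) = Q a * (P a * Q a)" using PP_Q[OF assms] by simp
 show "(1 - Q a) * P (Suc a) * (1 + Q a) = - ((1 - Q a) * P a * (1 + Q a))"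
 unfolding p by (simp add: algebra_simps q PP_Q(6)[OF assms])
 show "(1 - Q a) * (P a * P (Suc a)) * (1 + Q a) = - ((1 - Q a) * P a * (1 + Q a))"
 unfolding PP_Q(3)[OF assms] by (simp add: algebra_simps q PP_Q(6)[OF assms])
 show "(1 - Q a) * (P (Suc a) * P a) * (1 + Q a) = (1 - Q a) * P a * (1 + Q a)"
 unfolding PP_Q(4)[OF assms] by (simp add: algebra_simps q PP_Q(6)[OF assms])
qed

text \<open>Fusion: 1 - Q a is the R-matrix I + (h/u) P at u = -h, and neighbouring factors differ
  by the shift that fits this point in the Yang-Baxter equation. Here it is seen directly: all terms
  reduce to multiples of one element, and the total coefficient \<eta> \<alpha>(a+1) - \<alpha>(a)
  \<eta> - \<eta> \<eta> vanishes.\<close>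

lemma A_MM_Q:
 assumes a: "Suc a < k"
 shows "A * MM k * Q a = - (A * MM k)"
 unfolding MM_def
proof (rule prod_list_A[OF a])
 define D where "D = (1 - Q a) * P a * (1 + Q a)"
 have c: "z * (scO p * w) = scO p * (z * w)" if "z * scO p = scO p * z" for z w :: "('n, 't) ivec endo" and p
 using commute_left[OF that] .
 have cP: "P a * (scO p * w) = scO p * (P a * w)" for p w by (rule c) (rule scO_prO[symmetric])
 have sQ: "(1 - Q a) * (scO p * w) = scO p * ((1 - Q a) * w)" for p w
 using commute_left[OF scO_prO[of p "swp a (Suc a)"], of w]
 by (simp add: left_diff_distrib right_diff_distrib)
 have sQ1: "(1 - Q a) * scO p = scO p * (1 - Q a)" for p
 using sQ[of p 1] by simp
 have "M a * M (Suc a) = scO (\<alpha> a * \<alpha> (Suc a)) + scO (\<eta> * \<alpha> (Suc a)) * P a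
 + scO (\<alpha> a * \<eta>) * P (Suc a) + scO (\<eta> * \<eta>) * (P a * P (Suc a))"
 unfolding M_def by (simp add: distrib_left distrib_right mult.assoc scO_mult[symmetric] cP
 scO_prO[symmetric] algebra_simps)
 then have "(1 - Q a) * (M a * M (Suc a)) * (1 + Q a)
 = scO (\<alpha> a * \<alpha> (Suc a)) * ((1 - Q a) * 1 * (1 + Q a)) + scO (\<eta> * \<alpha> (Suc a)) * D
 + scO (\<alpha> a * \<eta>) * ((1 - Q a) * P (Suc a) * (1 + Q a))
 + scO (\<eta> * \<eta>) * ((1 - Q a) * (P a * P (Suc a)) * (1 + Q a))"
 unfolding D_def by (simp only: distrib_left[of "1 - Q a"] right_diff_distrib[of "1 - Q a"]
 distrib_right[of _ _ "1 + Q a"] left_diff_distrib[of _ _ "1 + Q a"] sQ sQ1 mult.assoc mult_1_left mult_1_right)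
 also have "\<dots> = scO (\<eta> * \<alpha> (Suc a) - \<alpha> a * \<eta> - \<eta> * \<eta>) * D"
 unfolding Q_sandwich[OF a] D_def[symmetric]
 by (simp add: distrib_left left_diff_distrib PP_Q(6)[OF a] scO_diff[symmetric])
 also have "\<eta> * \<alpha> (Suc a) - \<alpha> a * \<eta> - \<eta> * \<eta> = 0"
 using Sc_comm[OF Sc(1) Sc(2)[of a]] by (simp add: shift distrib_left)
 finally show "(1 - Q a) * (M a * M (Suc a)) * (1 + Q a) = 0"
 by (auto intro!: vec_endo_eqI)
next
 fix a' assume "a' < k" "a' \<noteq> a" "a' \<noteq> Suc a"
 then have "Q a * P a' = P a' * Q a"
 using a unfolding prO_mult
 by (intro arg_cong[of _ _ prO]) (auto simp: fun_eq_iff Transposition.transpose_def)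
 then have "Q a * (scO \<eta> * P a') = scO \<eta> * P a' * Q a"
 by (simp only: mult.assoc commute_left[OF scO_prO[symmetric]])
 then show "Q a * M a' = M a' * Q a"
 unfolding M_def by (simp only: distrib_left distrib_right scO_prO)
qed

lemma A_NN_Q:
 assumes a: "Suc a < k"
 shows "A * NN k * Q a = - (A * NN k)"
 unfolding NN_def
proof (rule prod_list_rev_A[OF a])
 define D where "D = (1 - Q a) * P a * (1 + Q a)"
 have cP: "P b * (scO p * w) = scO p * (P b * w)" for b p w
 using commute_left[OF scO_prO[symmetric]] .
 have sQ: "(1 - Q a) * (scO p * w) = scO p * ((1 - Q a) * w)" for p w
 using commute_left[OF scO_prO[of p "swp a (Suc a)"], of w]
 by (simp add: left_diff_distrib right_diff_distrib)
 have sQ1: "(1 - Q a) * scO p = scO p * (1 - Q a)" for p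
 using sQ[of p 1] by simp
 have "N (Suc a) * N a = scO (\<beta> (Suc a) * \<beta> a) - scO (\<beta> (Suc a) * \<eta>) * P a
 - scO (\<eta> * \<beta> a) * P (Suc a) + scO (\<eta> * \<eta>) * (P (Suc a) * P a)"
 unfolding N_def by (simp add: left_diff_distrib right_diff_distrib mult.assoc scO_mult[symmetric] cP
 scO_prO[symmetric] algebra_simps)
 then have "(1 - Q a) * (N (Suc a) * N a) * (1 + Q a)
 = scO (\<beta> (Suc a) * \<beta> a) * ((1 - Q a) * 1 * (1 + Q a)) - scO (\<beta> (Suc a) * \<eta>) * D
 - scO (\<eta> * \<beta> a) * ((1 - Q a) * P (Suc a) * (1 + Q a))
 + scO (\<eta> * \<eta>) * ((1 - Q a) * (P (Suc a) * P a) * (1 + Q a))"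
 unfolding D_def by (simp only: distrib_left[of "1 - Q a"] right_diff_distrib[of "1 - Q a"]
 distrib_right[of _ _ "1 + Q a"] left_diff_distrib[of _ _ "1 + Q a"] sQ sQ1 mult.assoc mult_1_left mult_1_right)
 also have "\<dots> = scO (\<eta> * \<beta> a - \<beta> (Suc a) * \<eta> + \<eta> * \<eta>) * D"
 unfolding Q_sandwich[OF a] D_def[symmetric]
 by (simp add: distrib_left distrib_right left_diff_distrib PP_Q(6)[OF a] scO_diff[symmetric] scO_add[symmetric])
 also have "\<eta> * \<beta> a - \<beta> (Suc a) * \<eta> + \<eta> * \<eta> = 0"
 using Sc_comm[OF Sc(1) Sc(3)[of a]] by (simp add: shift distrib_right)
 finally show "(1 - Q a) * (N (Suc a) * N a) * (1 + Q a) = 0"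
 by (auto intro!: vec_endo_eqI)
next
 fix a' assume "a' < k" "a' \<noteq> a" "a' \<noteq> Suc a"
 then have "Q a * P a' = P a' * Q a"
 using a unfolding prO_mult
 by (intro arg_cong[of _ _ prO]) (auto simp: fun_eq_iff Transposition.transpose_def)
 then have "Q a * (scO \<eta> * P a') = scO \<eta> * P a' * Q a"
 by (simp only: mult.assoc commute_left[OF scO_prO[symmetric]])
 then show "Q a * N a' = N a' * Q a"
 unfolding N_def by (simp only: left_diff_distrib right_diff_distrib scO_prO)
qed

section \<open>Partial traces over the copies 0 to k - 1\<close>

definition "d = (undefined :: 'n)"
text \<open>Freezing the assignments at an arbitrary index outside the first k copies leaves one
  assignment per basis vector of the k-fold tensor power, so that the trace is a finite sum.\<close>

definition "S = {r :: nat \<Rightarrow> 'n. \<forall>a\<ge>k. r a = d}"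
definition e :: "(nat \<Rightarrow> 'n) \<Rightarrow> 't \<Rightarrow> ('n, 't) ivec" where
 "e s v = (\<lambda>r. if r = s then v else 0)"
text \<open>The entry (i, j) in copy k of the trace of U over the other copies, applied to the
  scalar v. The argument v cannot be dropped at once because operators are only additive.\<close>

definition "PT i j U v = (\<Sum>s\<in>S. app U (e (s(k := j)) v) (s(k := i)))"

lemma PT_lin: "PT i j (U + V) v = PT i j U v + PT i j V v" "PT i j (U - V) v = PT i j U v - PT i j V v"
 "PT i j (scO p * U) v = p * PT i j U v" "PT i j 0 v = 0"
 by (simp_all add: PT_def sum.distrib sum_subtractf sum_distrib_left)

lemma PT_sum: "PT i j (\<Sum>z\<in>I. F z) v = (\<Sum>z\<in>I. PT i j (F z) v)"
 by (induction I rule: infinite_finite_induct) (simp_all add: PT_lin)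

lemma e_upd: "s a = t' \<Longrightarrow> e (s(a := t)) v = app (epsO a t t') (e s v)"
 by (auto simp: e_def app_epsO fun_eq_iff)

lemma eval_upd: "s a = t' \<Longrightarrow> \<psi> (s(a := t)) = app (epsO a t' t) \<psi> s"
 by (simp add: app_epsO)

lemma PT_eps:
 assumes "\<And>t t'. epsO k t t' * U = U * epsO k t t'"
 shows "app U (e (s(k := j)) v) (s(k := i)) = (if i = j then app U (e (s(k := d)) v) (s(k := d)) else 0)"
proof -
 have "e (s(k := j)) v = app (epsO k j d) (e (s(k := d)) v)"
 using e_upd[of "s(k := d)" k d j v] by simp
 then have "app U (e (s(k := j)) v) = app (epsO k j d) (app U (e (s(k := d)) v))"
 by (simp only: app_simps(4)[symmetric] assms)
 then show ?thesis by (simp add: app_epsO)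
qed

lemma PT_L0_left:
 assumes "\<And>t t'. epsO k t t' * U = U * epsO k t t'"
 shows "PT i j (L0 * U) v = l i j * PT d d U v"
proof -
 have "app (L0 * U) (e (s(k := j)) v) (s(k := i)) = l i j * app U (e (s(k := d)) v) (s(k := d))" for s
 proof -
 have "app (L0 * U) (e (s(k := j)) v) (s(k := i)) = (\<Sum>t\<in>UNIV. l i t * app U (e (s(k := j)) v) (s(k := t)))"
 by (simp add: app_matO)
 also have "\<dots> = (\<Sum>t\<in>UNIV. if t = j then l i t * app U (e (s(k := d)) v) (s(k := d)) else 0)"
 by (rule sum.cong[OF refl]) (subst PT_eps[OF assms], simp)
 finally show ?thesis by simp
 qed
 then show ?thesis by (simp add: PT_def sum_distrib_left)
qed

lemma PT_L0_right: "PT i j (U * L0) v = (\<Sum>t\<in>UNIV. PT i t U (l t j * v))"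
proof -
 have "app L0 (e (s(k := j)) v) = (\<Sum>t\<in>UNIV. e (s(k := t)) (l t j * v))" for s
 proof
 fix r :: "nat \<Rightarrow> 'n"
 have "app L0 (e (s(k := j)) v) r = (\<Sum>t\<in>UNIV. if t = j then (if r(k := j) = s(k := j) then l (r k) j * v else 0) else 0)"
 unfolding app_matO
 proof (rule sum.cong[OF refl])
 fix t
 have "r(k := t) = s(k := j) \<longleftrightarrow> t = j \<and> r(k := j) = s(k := j)"
 by (metis fun_upd_same)
 then show "l (r k) t * e (s(k := j)) v (r(k := t))
 = (if t = j then (if r(k := j) = s(k := j) then l (r k) j * v else 0) else 0)"
 by (auto simp: e_def)
 qed
 also have "\<dots> = (if r(k := j) = s(k := j) then l (r k) j * v else 0)" by simp
 also have "\<dots> = (\<Sum>t\<in>UNIV. if t = r k then (if r(k := j) = s(k := j) then l (r k) j * v else 0) else 0)"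
 by simp
 also have "\<dots> = (\<Sum>t\<in>UNIV. e (s(k := t)) (l t j * v) r)"
 proof (rule sum.cong[OF refl])
 fix t
 have "r = s(k := t) \<longleftrightarrow> t = r k \<and> r(k := j) = s(k := j)"
 by (metis fun_upd_same fun_upd_triv fun_upd_upd)
 then show "(if t = r k then (if r(k := j) = s(k := j) then l (r k) j * v else 0) else 0)
 = e (s(k := t)) (l t j * v) r"
 by (auto simp: e_def)
 qed
 finally show "app L0 (e (s(k := j)) v) r = (\<Sum>t\<in>UNIV. e (s(k := t)) (l t j * v)) r"
 by (simp add: sum_fun_apply)
 qed
 then have "PT i j (U * L0) v = (\<Sum>s\<in>S. \<Sum>t\<in>UNIV. app U (e (s(k := t)) (l t j * v)) (s(k := i)))"
 by (simp add: PT_def app_sum_arg sum_fun_apply)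
 also have "\<dots> = (\<Sum>t\<in>UNIV. PT i t U (l t j * v))"
 unfolding PT_def by (rule sum.swap)
 finally show ?thesis .
qed

text \<open>A trace of matrices with non-commuting entries is not cyclic in general. Permutations
  only relabel the basis vectors, which is why \<open>A\<close> may be moved around.\<close>

lemma PT_cyclic: "PT i j (A * U) v = PT i j (U * A) v"
proof -
 have 1: "PT i j (prO \<sigma> * U) v = PT i j (U * prO \<sigma>) v" if \<sigma>: "\<sigma> permutes {..<k}" for \<sigma>
 proof -
 have k: "\<sigma> k = k" "inv \<sigma> k = k" and b: "bij \<sigma>"
 using permutes_not_in[OF \<sigma>] permutes_not_in[OF permutes_inv[OF \<sigma>]] permutes_bij[OF \<sigma>] by auto
 have upd: "(s(k := i)) \<circ> \<sigma> = (s \<circ> \<sigma>)(k := i)" for s i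
 using inj_eq[OF permutes_inj[OF \<sigma>], of _ k] k by (auto simp: fun_eq_iff)
 have pe: "app (prO \<sigma>) (e (s \<circ> \<sigma>) v) = e s v" for s
 proof -
 have "r \<circ> \<sigma> = s \<circ> \<sigma> \<longleftrightarrow> r = s" for r
 using b by (metis bij_is_surj surj_fun_eq comp_apply fun_eq_iff)
 then show ?thesis by (auto simp: e_def fun_eq_iff)
 qed
 have bij: "bij_betw (\<lambda>s. s \<circ> \<sigma>) S S"
 proof (rule bij_betw_byWitness[where f' = "\<lambda>s. s \<circ> inv \<sigma>"])
 show "\<forall>s\<in>S. s \<circ> \<sigma> \<circ> inv \<sigma> = s" "\<forall>s\<in>S. s \<circ> inv \<sigma> \<circ> \<sigma> = s"
 using b by (auto simp: o_assoc[symmetric] permutes_inv_o[OF \<sigma>])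
 show "(\<lambda>s. s \<circ> \<sigma>) ` S \<subseteq> S" "(\<lambda>s. s \<circ> inv \<sigma>) ` S \<subseteq> S"
 using \<sigma> permutes_inv[OF \<sigma>] by (auto simp: S_def permutes_not_in)
 qed
 have "PT i j (U * prO \<sigma>) v = (\<Sum>s\<in>S. app (U * prO \<sigma>) (e ((s \<circ> \<sigma>)(k := j)) v) ((s \<circ> \<sigma>)(k := i)))"
 unfolding PT_def by (rule sum.reindex_bij_betw[OF bij, symmetric])
 also have "\<dots> = PT i j (prO \<sigma> * U) v"
 unfolding PT_def by (simp add: upd[symmetric] pe)
 finally show ?thesis by simp
 qed
 have c: "U * (scO (of_int (sign \<sigma>)) * prO \<sigma>) = scO (of_int (sign \<sigma>)) * (U * prO \<sigma>)" for \<sigma>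
 by (cases \<sigma> rule: sign_cases) (simp_all add: scO_uminus)
 show ?thesis
 unfolding A_def sum_distrib_left sum_distrib_right PT_sum c mult.assoc PT_lin
 by (rule sum.cong[OF refl]) (simp add: 1)
qed

lemma nat_comm: "scO (of_nat z) * U = U * scO (of_nat z)" for U :: "('n, 't) ivec endo"
proof (induction z)
 case 0
 have "scO (0 :: 't) = (0 :: ('n, 't) ivec endo)" by (rule vec_endo_eqI) simp
 then show ?case by simp
next
 case (Suc z)
 then show ?case by (simp add: scO_add[symmetric] distrib_left distrib_right)
qed

lemma A_scO: "scO p * A = A * scO p"
 unfolding A_def sum_distrib_left sum_distrib_right
proof (rule sum.cong[OF refl])
 fix \<sigma> :: "nat \<Rightarrow> nat"
 have c: "scO p * scO (of_int (sign \<sigma>)) = scO (of_int (sign \<sigma>)) * (scO p :: ('n, 't) ivec endo)"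
 by (simp add: scO_mult mult_of_int_commute)
 show "scO p * (scO (of_int (sign \<sigma>)) * prO \<sigma>)
 = scO (of_int (sign \<sigma>)) * (prO \<sigma> :: ('n, 't) ivec endo) * scO p"
 using commute_left[OF c, of "prO \<sigma>"] unfolding mult.assoc scO_prO[of p \<sigma>] .
qed

lemma A_fixed: "A * matO k m = matO k m * A" "epsO k t t' * A = A * epsO k t t'"
proof -
 have 1: "prO \<sigma> * matO k m = matO k m * prO \<sigma>" "epsO k t t' * prO \<sigma> = prO \<sigma> * epsO k t t'"
 if "\<sigma> \<in> {\<sigma>. \<sigma> permutes {..<k}}" for \<sigma>
 using that by (simp_all add: prO_matO_fixed[of \<sigma> "{..<k}"] prO_epsO_fixed[of \<sigma> "{..<k}"])
 have 2: "scO (of_int z) * matO k m = matO k m * scO (of_int z)" for z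
 by (rule scO_matO) (rule mult_of_int_commute)
 show "A * matO k m = matO k m * A"
 unfolding A_def sum_distrib_left sum_distrib_right
 by (intro sum.cong[OF refl]) (simp only: mult.assoc 1 commute_left[OF 2[symmetric]])
 show "epsO k t t' * A = A * epsO k t t'"
 unfolding A_def sum_distrib_left sum_distrib_right
 by (intro sum.cong[OF refl]) (simp only: mult.assoc 1 commute_left[OF scO_epsO[symmetric]])
qed

definition "PTm m i j U v = (\<Sum>s\<in>{s \<in> S. s m = d}. app U (e (s(k := j)) v) (s(k := i)))"

text \<open>U and V act trivially on copy m, so the trace over that copy can be taken on the middle
  factor R alone, where it is the scalar z. What remains, \<open>PTm\<close>, is the trace over the
  other copies with the index in copy m held at \<open>d\<close>.\<close>

lemma PT_split:
 assumes m: "m < k" and U: "\<And>t t'. epsO m t t' * U = U * epsO m t t'"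
 and V: "\<And>t t'. epsO m t t' * V = V * epsO m t t'"
 and R: "(\<Sum>t\<in>UNIV. epsO m d t * R * epsO m t d) = scO z * (epsO m d d :: ('n, 't) ivec endo)"
 and z: "scO z * U = U * scO z"
 shows "PT i j (U * R * V) v = z * PTm m i j (U * V) v"
proof -
 let ?Sm = "{s \<in> S. s m = d}"
 let ?f = "\<lambda>(s, t). s(m := t)"
 have inj: "inj_on ?f (?Sm \<times> UNIV)"
 by (rule inj_onI) (auto simp: fun_eq_iff split: if_splits, metis)
 have img: "?f ` (?Sm \<times> UNIV) = S"
 proof
 show "?f ` (?Sm \<times> UNIV) \<subseteq> S" using m by (auto simp: S_def)
 show "S \<subseteq> ?f ` (?Sm \<times> UNIV)"
 proof
 fix s assume "s \<in> S"
 then have "(s(m := d), s m) \<in> ?Sm \<times> UNIV" "s = ?f (s(m := d), s m)"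
 by (auto simp: S_def)
 then show "s \<in> ?f ` (?Sm \<times> UNIV)" by (rule rev_image_eqI)
 qed
 qed
 have mk: "m \<noteq> k" using m by simp
 have "PT i j (U * R * V) v = (\<Sum>s\<in>?Sm. \<Sum>t\<in>UNIV. app (U * R * V) (e (s(m := t, k := j)) v) (s(m := t, k := i)))"
 unfolding PT_def by (subst img[symmetric], subst sum.reindex[OF inj]) (simp add: sum.cartesian_product case_prod_unfold)
 also have "\<dots> = (\<Sum>s\<in>?Sm. z * app (U * V) (e (s(k := j)) v) (s(k := i)))"
 proof (rule sum.cong[OF refl])
 fix s assume s: "s \<in> ?Sm"
 let ?j = "s(k := j)" and ?i = "s(k := i)"
 have jm: "?j m = d" "?i m = d" using s mk by auto
 have t: "app (U * R * V) (e (s(m := t, k := j)) v) (s(m := t, k := i))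
 = app (U * (epsO m d t * R * epsO m t d) * V) (e ?j v) ?i" for t
 proof -
 have "app (U * R * V) (e (s(m := t, k := j)) v) (s(m := t, k := i))
 = app (U * R * V) (e (?j(m := t)) v) (?i(m := t))"
 by (simp only: fun_upd_twist[OF mk])
 also have "\<dots> = app (epsO m d t * (U * R * V) * epsO m t d) (e ?j v) ?i"
 unfolding e_upd[of ?j m d t v, OF jm(1)] eval_upd[of ?i m d _ t, OF jm(2)] app_simps(4) ..
 also have "epsO m d t * (U * R * V) * epsO m t d = U * (epsO m d t * R * epsO m t d) * V"
 by (simp only: mult.assoc commute_left[OF U] V[symmetric])
 finally show ?thesis .
 qed
 have "(\<Sum>t\<in>UNIV. app (U * R * V) (e (s(m := t, k := j)) v) (s(m := t, k := i)))
 = app (U * (\<Sum>t\<in>UNIV. epsO m d t * R * epsO m t d) * V) (e ?j v) ?i"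
 unfolding t by (simp add: sum_distrib_left sum_distrib_right app_sum sum_fun_apply)
 also have "U * (\<Sum>t\<in>UNIV. epsO m d t * R * epsO m t d) * V = scO z * (epsO m d d * (U * V))"
 unfolding R by (simp only: mult.assoc commute_left[OF z] commute_left[OF U])
 finally show "(\<Sum>t\<in>UNIV. app (U * R * V) (e (s(m := t, k := j)) v) (s(m := t, k := i)))
 = z * app (U * V) (e ?j v) ?i"
 using fun_upd_idem[of ?i m d, OF jm(2)]
 by (simp only: app_simps(4)[of "scO z"] app_scO app_simps(4)[of "epsO m d d"] app_epsO jm(2) if_True simp_thms)
 qed
 finally show ?thesis by (simp add: PTm_def sum_distrib_left)
qed

lemma MN_epsO:
 assumes "a \<noteq> m" "m < k"
 shows "epsO m t t' * M a = M a * epsO m t t'" "epsO m t t' * N a = N a * epsO m t t'"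
proof -
 have "P a * epsO m t t' = epsO m t t' * P a"
 by (rule prO_epsO_fixed[OF permutes_swap_id[of k "{k, a}" a]]) (use assms in auto)
 then have "epsO m t t' * (scO \<eta> * P a) = scO \<eta> * P a * epsO m t t'"
 by (simp only: mult.assoc commute_left[OF scO_epsO[symmetric]])
 then show "epsO m t t' * M a = M a * epsO m t t'" "epsO m t t' * N a = N a * epsO m t t'"
 unfolding M_def N_def
 by (simp_all only: distrib_left distrib_right left_diff_distrib right_diff_distrib scO_epsO)
qed

lemma MM_NN_epsO:
 assumes "m < k"
 shows "epsO m t t' * MM m = MM m * epsO m t t'" "epsO m t t' * NN m = NN m * epsO m t t'"
 unfolding MM_def NN_def by (rule commute_prod_list; use MN_epsO assms in force)+

text \<open>V acts trivially on copy k, hence W = P V P acts trivially on copy m, and P V = W P, V P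
  = P W. In the expansion of M V N the three terms besides \<alpha> \<beta> V therefore have partial
  traces that are multiples of one quantity q. The total coefficient of q is \<eta> (\<beta> -
  \<alpha> - n \<eta>), which \<open>cross\<close> makes zero.\<close>

lemma PT_cross:
 assumes m: "m < k" and V: "\<And>t t'. epsO k t t' * V = V * epsO k t t'"
 and Vc: "\<And>p. p \<in> Sc \<Longrightarrow> scO p * V = V * scO p"
 shows "PT i j (MM (Suc m) * V * NN (Suc m)) v = \<alpha> m * \<beta> m * PT i j (MM m * V * NN m) v"
proof -
 define W where "W = P m * V * P m"
 have PP: "P m * P m = 1" by (rule transpose_involutory)
 have PV: "P m * V = W * P m" "V * P m = P m * W"
 unfolding W_def using PP by (simp_all add: mult.assoc) (simp add: mult.assoc[symmetric])
 have e1: "epsO m t t' * P m = P m * epsO k t t'" for t t'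
 by (simp add: prO_transpose_epsO)
 have e2: "P m * epsO m t t' = epsO k t t' * P m" for t t'
 using prO_transpose_epsO[of m k t t'] by (simp add: transpose_commute)
 have W: "epsO m t t' * W = W * epsO m t t'" for t t'
 proof -
 have "epsO m t t' * (P m * z) = P m * (epsO k t t' * z)" for z
 by (simp only: mult.assoc[symmetric] e1)
 then show ?thesis unfolding W_def by (simp only: mult.assoc commute_left[OF V] e2)
 qed
 have cm: "MM m * scO p = scO p * MM m" "NN m * scO p = scO p * NN m" if "p \<in> cen" for p
 using cen_comm_prods[OF that] by simp_all
 have MVN: "M m * V * N m = scO (\<alpha> m * \<beta> m) * V + scO (\<eta> * \<beta> m) * (P m * V)
 - scO (\<alpha> m * \<eta>) * (V * P m) - scO (\<eta> * \<eta>) * W"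
 proof -
 have cV: "V * (scO p * z) = scO p * (V * z)" if "p \<in> Sc" for p z
 using commute_left[OF Vc[OF that, symmetric]] .
 have cP: "P m * (scO p * z) = scO p * (P m * z)" for p z
 using commute_left[OF scO_prO[symmetric]] .
 show ?thesis unfolding M_def N_def W_def
 by (simp add: distrib_left distrib_right left_diff_distrib right_diff_distrib mult.assoc
 cV Sc cP scO_mult[symmetric] Vc[symmetric])
 qed
 have "MM (Suc m) * V * NN (Suc m) = MM m * (M m * V * N m) * NN m"
 by (simp add: prods_Suc mult.assoc)
 also have "\<dots> = MM m * (scO (\<alpha> m * \<beta> m) * V + scO (\<eta> * \<beta> m) * (W * P m)
 - scO (\<alpha> m * \<eta>) * (P m * W) - scO (\<eta> * \<eta>) * W) * NN m"
 by (simp only: MVN PV)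
 also have "\<dots> = scO (\<alpha> m * \<beta> m) * (MM m * V * NN m) + scO (\<eta> * \<beta> m) * (MM m * W * P m * NN m)
 - scO (\<alpha> m * \<eta>) * (MM m * P m * (W * NN m)) - scO (\<eta> * \<eta>) * (MM m * W * 1 * NN m)"
 by (simp only: distrib_left distrib_right left_diff_distrib right_diff_distrib mult.assoc
 commute_left[OF cm(1)[OF cen_mult[OF Sc_cen(2) Sc_cen(3)]]] commute_left[OF cm(1)[OF cen_mult[OF Sc_cen(1) Sc_cen(3)]]]
 commute_left[OF cm(1)[OF cen_mult[OF Sc_cen(2) Sc_cen(1)]]] commute_left[OF cm(1)[OF cen_mult[OF Sc_cen(1) Sc_cen(1)]]]
 mult_1_left)
 finally have exp: "PT i j (MM (Suc m) * V * NN (Suc m)) v = \<alpha> m * \<beta> m * PT i j (MM m * V * NN m) v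
 + \<eta> * \<beta> m * PT i j (MM m * W * P m * NN m) v
 - \<alpha> m * \<eta> * PT i j (MM m * P m * (W * NN m)) v - \<eta> * \<eta> * PT i j (MM m * W * 1 * NN m) v"
 by (simp only: PT_lin)
 have mk: "m \<noteq> k" using m by simp
 have R1: "(\<Sum>t\<in>UNIV. epsO m d t * P m * epsO m t d) = scO 1 * (epsO m d d :: ('n, 't) ivec endo)"
 using eps_swap_sum[OF mk, of d] by simp
 have R2: "(\<Sum>t\<in>UNIV. epsO m d t * 1 * epsO m t d) = scO (of_nat CARD('n)) * (epsO m d d :: ('n, 't) ivec endo)"
 using eps_sum[of m d] by simp
 have U1: "epsO m t t' * (MM m * W) = MM m * W * epsO m t t'" for t t'
 by (simp only: mult.assoc commute_left[OF MM_NN_epsO(1)[OF m]] W)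
 have U2: "epsO m t t' * (W * NN m) = W * NN m * epsO m t t'" for t t'
 by (simp only: mult.assoc commute_left[OF W] MM_NN_epsO(2)[OF m])
 define q where "q = PTm m i j (MM m * W * NN m) v"
 have "PT i j (MM m * W * P m * NN m) v = q"
 using PT_split[OF m U1 MM_NN_epsO(2)[OF m] R1] by (simp add: q_def)
 moreover have "PT i j (MM m * P m * (W * NN m)) v = q"
 using PT_split[OF m MM_NN_epsO(1)[OF m] U2 R1] by (simp add: q_def mult.assoc)
 moreover have "PT i j (MM m * W * 1 * NN m) v = of_nat CARD('n) * q"
 using PT_split[OF m U1 MM_NN_epsO(2)[OF m] R2 nat_comm] by (simp add: q_def)
 moreover have "\<eta> * \<beta> m * q - \<alpha> m * \<eta> * q - \<eta> * \<eta> * (of_nat CARD('n) * q) = 0"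
 proof -
 have "\<alpha> m * \<eta> = \<eta> * \<alpha> m" using Sc_comm Sc by blast
 moreover have "of_nat CARD('n) * \<eta> * \<eta> = \<eta> * \<eta> * of_nat CARD('n)"
 "\<eta> * of_nat CARD('n) * \<eta> = \<eta> * \<eta> * of_nat CARD('n)"
 by (simp_all add: mult.assoc mult_of_nat_commute)
 ultimately show ?thesis
 by (simp add: cross distrib_left distrib_right mult.assoc[symmetric])
 qed
 ultimately show ?thesis using exp by (simp add: algebra_simps)
qed

lemma PT_cross_all:
 assumes V: "\<And>t t'. epsO k t t' * V = V * epsO k t t'"
 and Vc: "\<And>p. p \<in> Sc \<Longrightarrow> scO p * V = V * scO p" and "m \<le> k"
 shows "PT i j (MM m * V * NN m) v = AB m * PT i j V v"
 using \<open>m \<le> k\<close>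
proof (induction m)
 case (Suc m)
 have c: "\<alpha> m * AB m = AB m * \<alpha> m" "\<beta> m * AB m = AB m * \<beta> m"
 using cen_prods(1)[of m] Sc unfolding cen_def by auto
 have "(\<alpha> m * \<beta> m) * AB m = AB m * (\<alpha> m * \<beta> m)"
 by (simp only: mult.assoc c(2) commute_left[OF c(1)])
 then show ?case using Suc PT_cross[OF _ V Vc, of m i j v] by (simp add: prods_Suc mult.assoc[symmetric])
qed simp

definition "ell = PT d d (A * Z) 1"

text \<open>Linearity for the multiplication of scalars from the right, which left multiplications
  respect. It is what allows the argument of \<open>PT\<close> to be pulled out.\<close>

definition "rlin U \<longleftrightarrow> (\<forall>\<phi> w. app U (\<lambda>r. \<phi> r * w) = (\<lambda>r. app U \<phi> r * (w :: 't)))"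

lemma rlin_mult: "rlin U \<Longrightarrow> rlin V \<Longrightarrow> rlin (U * V)"
 unfolding rlin_def by simp

lemma rlin_prod_list: "(\<And>z. z \<in> set zs \<Longrightarrow> rlin z) \<Longrightarrow> rlin (prod_list zs)"
 by (induction zs) (simp_all add: rlin_mult, simp add: rlin_def)

lemma rlin_basic: "rlin (scO p)" "rlin (matO a m)" "rlin (prO \<sigma>)"
 unfolding rlin_def by (simp_all add: fun_eq_iff mult.assoc app_matO sum_distrib_right)

lemma rlin_sum: "(\<And>z. z \<in> I \<Longrightarrow> rlin (F z)) \<Longrightarrow> rlin (sum F I)"
 unfolding rlin_def by (simp add: app_sum sum_fun_apply sum_distrib_right fun_eq_iff)

lemma rlin_AZ: "rlin (A * Z)"
 unfolding A_def Z_def XX_def YY_def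
 by (intro rlin_mult rlin_sum rlin_prod_list rlin_basic) (auto simp: rlin_basic)

lemma PT_rlin: "rlin U \<Longrightarrow> PT i j U v = PT i j U 1 * v"
proof -
 assume U: "rlin U"
 have "e s v = (\<lambda>r. e s 1 r * v)" for s by (auto simp: e_def)
 then have "app U (e s v) = (\<lambda>r. app U (e s 1) r * v)" for s
 using U unfolding rlin_def by metis
 then show ?thesis by (simp add: PT_def sum_distrib_right)
qed

theorem ell_commutes: "AB k * CC k * (l i j * ell - ell * l i j) = 0"
proof -
 let ?F = "scO (of_nat (fact k)) :: ('n, 't) ivec endo"
 have eZ: "epsO k t t' * Z = Z * epsO k t t'" for t t'
 proof -
 have xy: "epsO k t t' * XX k = XX k * epsO k t t'" "epsO k t t' * YY k = YY k * epsO k t t'"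
 unfolding XX_def YY_def by (rule commute_prod_list; force simp: matO_epsO)+
 show ?thesis unfolding Z_def
 by (simp only: mult.assoc commute_left[OF xy(1)] commute_left[OF scO_epsO[symmetric]] xy(2))
 qed
 have eAZ: "epsO k t t' * (A * Z) = A * Z * epsO k t t'" for t t'
 by (simp only: mult.assoc commute_left[OF A_fixed(2)] eZ)
 have cAZ: "scO p * (A * Z) = A * Z * scO p" if p: "p \<in> Sc" for p
 proof -
 have pc: "p \<in> cen" using p cen_Sc by auto
 have "scO p * A = A * scO p"
 by (rule A_scO)
 moreover have "scO p * Z = Z * scO p" unfolding Z_def
 by (simp only: mult.assoc commute_left[OF cen_comm_prods(1)[OF pc]] commute_left[OF cen_comm(4)[OF pc]]
 cen_comm_prods(2)[OF pc])
 ultimately show ?thesis by (simp only: mult.assoc commute_left)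
 qed
 have aMM: "A * MM k * A = ?F * (A * MM k)" by (rule absorb_A) (rule A_MM_Q)
 have aXX: "A * XX k * A = ?F * (A * XX k)" by (rule absorb_A) (rule A_XX_Q)
 have aZQ: "A * Z * Q a = - (A * Z)" if "Suc a < k" for a
 proof (rule vec_torsion[of "fact k"])
 have iA: "scO \<iota> * A = A * scO \<iota>"
 by (rule A_scO)
 have "?F * (A * Z) = A * XX k * A * scO \<iota> * YY k" unfolding aXX Z_def by (simp add: mult.assoc)
 also have "\<dots> = A * XX k * scO \<iota> * (A * YY k)" by (simp only: mult.assoc commute_left[OF iA] iA[symmetric])
 finally have 1: "?F * (A * Z) = A * XX k * scO \<iota> * (A * YY k)" .
 have "?F * (A * Z * Q a) = A * XX k * scO \<iota> * (A * YY k * Q a)"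
 using arg_cong[OF 1, of "\<lambda>z. z * Q a"] by (simp add: mult.assoc)
 also have "\<dots> = - (?F * (A * Z))" unfolding 1 A_YY_Q[OF that] by simp
 finally show "?F * (A * Z * Q a) = ?F * (- (A * Z))" by simp
 qed simp
 have aZ: "A * Z * A = ?F * (A * Z)" by (rule absorb_A) (rule aZQ)
 have aZN: "A * Z * NN k * A = ?F * (A * Z * NN k)"
 proof (rule absorb_A)
 fix a assume a: "Suc a < k"
 show "A * Z * NN k * Q a = - (A * Z * NN k)"
 proof (rule vec_torsion[of "fact k"])
 have "?F * (A * Z * NN k * Q a) = A * Z * (A * NN k * Q a)"
 using arg_cong[OF aZ, of "\<lambda>z. z * NN k * Q a"] by (simp add: mult.assoc)
 also have "\<dots> = - (A * Z * A * NN k)" unfolding A_NN_Q[OF a] by (simp add: mult.assoc)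
 also have "\<dots> = ?F * (- (A * Z * NN k))" unfolding aZ by (simp add: mult.assoc)
 finally show "?F * (A * Z * NN k * Q a) = ?F * (- (A * Z * NN k))" .
 qed simp
 qed
 \<comment> \<open>A second \<open>A\<close> is split off to the right of \<open>MM k\<close>, sent
   around the trace and absorbed at the end of A Z N. Afterwards \<open>MM k\<close> and
   \<open>NN k\<close> enclose \<open>A * Z\<close>, which acts trivially on copy k, so that the
   crossing argument applies.\<close>
 have drop: "PT i t (A * MM k * Z * NN k) v = AB k * PT i t (A * Z) v" for i t v
 proof -
 have "of_nat (fact k) * PT i t (A * MM k * Z * NN k) v = PT i t (?F * (A * MM k) * Z * NN k) v"
 by (simp only: PT_lin mult.assoc)
 also have "\<dots> = PT i t (A * (MM k * A * Z * NN k)) v" unfolding aMM[symmetric] by (simp only: mult.assoc)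
 also have "\<dots> = PT i t (MM k * (A * Z * NN k * A)) v" unfolding PT_cyclic by (simp only: mult.assoc)
 also have "MM k * (A * Z * NN k * A) = ?F * (MM k * (A * Z) * NN k)"
 proof -
 have "MM k * ?F = ?F * MM k"
 by (rule nat_comm[symmetric])
 then show ?thesis unfolding aZN by (simp only: mult.assoc commute_left)
 qed
 finally have "of_nat (fact k) * (PT i t (A * MM k * Z * NN k) v - PT i t (MM k * (A * Z) * NN k) v) = 0"
 by (simp add: PT_lin right_diff_distrib)
 then have "PT i t (A * MM k * Z * NN k) v = PT i t (MM k * (A * Z) * NN k) v"
 using torsion[of "fact k"] by force
 then show ?thesis using PT_cross_all[OF eAZ cAZ order_refl, of i t v] by simp
 qed
 have pAZ: "PT i t (A * Z) v = (if i = t then ell * v else 0)" for i t v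
 proof -
 have "PT i t (A * Z) v = (if i = t then PT d d (A * Z) v else 0)"
 unfolding PT_def by (subst PT_eps[OF eAZ]) simp
 then show ?thesis using PT_rlin[OF rlin_AZ, of d d v] by (simp add: ell_def)
 qed
 have com: "AB k * CC k = CC k * AB k"
 proof -
 have "CC k \<in> cen" by (rule cen_prods)
 then have "CC k * AB m = AB m * CC k" for m
 proof (induction m)
 case (Suc m)
 have c: "CC k * \<alpha> m = \<alpha> m * CC k" "CC k * \<beta> m = \<beta> m * CC k"
 using Suc.prems Sc unfolding cen_def by auto
 show ?case
 by (simp only: prods_Suc mult.assoc commute_left[OF Suc.IH[OF Suc.prems]] commute_left[OF c(1)] c(2))
 qed simp
 then show ?thesis by simp
 qed
 have "AB k * CC k * (l i j * ell) = PT i j (scO (AB k * CC k) * (L0 * (A * Z))) 1"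
 by (simp only: PT_lin PT_L0_left[OF eAZ] ell_def)
 also have "scO (AB k * CC k) * (L0 * (A * Z)) = A * (scO (AB k * CC k) * L0 * Z)"
 proof -
 have "scO z * A = A * scO z" for z
 by (rule A_scO)
 then show ?thesis by (simp only: mult.assoc commute_left[OF A_fixed(1)[symmetric]] commute_left)
 qed
 also have "\<dots> = scO (CC k) * (A * MM k * Z * NN k * L0)"
 proof -
 have "scO z * A = A * scO z" for z
 by (rule A_scO)
 then show ?thesis unfolding L0_Z by (simp only: mult.assoc commute_left)
 qed
 also have "PT i j \<dots> 1 = CC k * (\<Sum>t\<in>UNIV. PT i t (A * MM k * Z * NN k) (l t j * 1))"
 by (simp only: PT_lin PT_L0_right)
 also have "\<dots> = CC k * (AB k * (ell * l i j))"
 unfolding drop pAZ by (simp add: sum_distrib_left[symmetric] if_distrib cong: if_cong)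
 also have "\<dots> = AB k * CC k * (ell * l i j)" by (simp add: com mult.assoc)
 finally show ?thesis by (simp add: right_diff_distrib)
qed

end

unbundle no vec_syntax
unbundle fps_syntax

section \<open>Sums in the \<open>h\<close>-adic topology\<close>

text \<open>Two series are within 2^(-N) as soon as their first N coefficients agree. So a family in
  which each coefficient is met by finitely many members is summable, and each coefficient of its
  sum is a finite sum.\<close>

lemma fps_infsum_nth:
 fixes g :: "'i \<Rightarrow> 'a::ab_group_add fps"
 assumes fin: "\<And>N. finite {x \<in> A. \<exists>i<N. g x $ i \<noteq> 0}"
 and S: "finite S" "S \<subseteq> A" "\<And>x. x \<in> A - S \<Longrightarrow> g x $ i = 0"
 shows "infsum g A $ i = (\<Sum>x\<in>S. g x $ i)"
proof -
 define t where "t = Abs_fps (\<lambda>i. \<Sum>x\<in>{x \<in> A. g x $ i \<noteq> 0}. g x $ i)"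
 have fin': "finite {x \<in> A. g x $ i \<noteq> 0}" for i
 by (rule finite_subset[OF _ fin[of "Suc i"]]) auto
 have t: "sum g Y $ i = t $ i" if "finite Y" "Y \<subseteq> A" "{x \<in> A. g x $ i \<noteq> 0} \<subseteq> Y" for Y i
 proof -
 have "sum g Y $ i = (\<Sum>x\<in>Y. g x $ i)" by (simp add: fps_sum_nth)
 also have "\<dots> = (\<Sum>x\<in>{x \<in> A. g x $ i \<noteq> 0}. g x $ i)"
 by (rule sum.mono_neutral_right) (use that in auto)
 finally show ?thesis by (simp add: t_def)
 qed
 have "(g has_sum t) A"
 unfolding has_sum_def tendsto_iff eventually_finite_subsets_at_top
 proof (intro allI impI)
 fix e :: real assume "e > 0"
 then obtain N where N: "inverse (2 ^ N) < e"
 using real_arch_pow_inv[of e "1/2"] by (auto simp: power_one_over inverse_eq_divide)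
 let ?X = "{x \<in> A. \<exists>i<N. g x $ i \<noteq> 0}"
 have "dist (sum g Y) t < e" if "finite Y" "?X \<subseteq> Y" "Y \<subseteq> A" for Y
 proof (cases "sum g Y = t")
 case False
 have "(sum g Y - t) $ i = 0" if "i < N" for i
 using t[of Y i] that \<open>finite Y\<close> \<open>?X \<subseteq> Y\<close> \<open>Y \<subseteq> A\<close> by auto
 then have "N \<le> subdegree (sum g Y - t)"
 using False by (intro subdegree_geI) auto
 then have "dist (sum g Y) t \<le> inverse (2 ^ N)"
 using False by (simp add: dist_fps_def power_increasing)
 then show ?thesis using N by simp
 qed (use \<open>e > 0\<close> in simp)
 then show "\<exists>X. finite X \<and> X \<subseteq> A \<and> (\<forall>Y. finite Y \<and> X \<subseteq> Y \<and> Y \<subseteq> A \<longrightarrow> dist (sum g Y) t < e)"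
 using fin[of N] by (intro exI[of _ ?X]) auto
 qed
 then have "infsum g A = t" by (rule infsumI)
 moreover have "(\<Sum>x\<in>S. g x $ i) = t $ i"
 using t[of S i] S by (auto simp: fps_sum_nth)
 ultimately show ?thesis by simp
qed

section \<open>Coefficientwise maps\<close>

definition fmap :: "('a \<Rightarrow> 'b) \<Rightarrow> 'a fps \<Rightarrow> 'b fps" where
 "fmap f g = Abs_fps (\<lambda>n. f (g $ n))"

lemma fmap_nth [simp]: "fmap f g $ n = f (g $ n)"
 by (simp add: fmap_def)

text \<open>Ring homomorphisms that need not preserve the unit.\<close>

definition rhom :: "('a::ring \<Rightarrow> 'b::ring) \<Rightarrow> bool" where
 "rhom f \<longleftrightarrow> (\<forall>x y. f (x + y) = f x + f y) \<and> (\<forall>x y. f (x * y) = f x * f y)"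

lemma rhomD:
 assumes "rhom f"
 shows "f (x + y) = f x + f y" "f (x * y) = f x * f y" "f 0 = 0" "f (- x) = - f x"
 "f (x - y) = f x - f y" "f (sum g A) = (\<Sum>a\<in>A. f (g a))"
proof -
 show add: "f (x + y) = f x + f y" and "f (x * y) = f x * f y" for x y
 using assms by (auto simp: rhom_def)
 show 0: "f 0 = 0" using add[of 0 0] by simp
 show m: "f (- x) = - f x" for x using add[of x "- x"] 0 by (simp add: eq_neg_iff_add_eq_0 add.commute)
 show "f (x - y) = f x - f y" using add[of x "- y"] m by simp
 show "f (sum g A) = (\<Sum>a\<in>A. f (g a))"
 by (induction A rule: infinite_finite_induct) (simp_all add: 0 add)
qed

lemma rhom_fmap:
 assumes "rhom f"
 shows "rhom (fmap f)"
 unfolding rhom_def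
 by (auto simp: fps_eq_iff fps_mult_nth rhomD[OF assms])

lemma rhom_comp: "rhom f \<Longrightarrow> rhom g \<Longrightarrow> rhom (\<lambda>x. f (g x))"
 by (simp add: rhom_def)

lemma fmap_const: "f 0 = 0 \<Longrightarrow> fmap f (fps_const c) = fps_const (f c)"
 by (auto simp: fps_eq_iff)

lemma fmap_X: "f 0 = 0 \<Longrightarrow> f 1 = 1 \<Longrightarrow> fmap f fps_X = fps_X"
 by (auto simp: fps_eq_iff fps_X_def)

lemma fmap_1: "f 0 = 0 \<Longrightarrow> f 1 = 1 \<Longrightarrow> fmap f 1 = 1"
 by (auto simp: fps_eq_iff)

lemma rhom_fps_const: "rhom fps_const"
 by (simp add: rhom_def)

lemma rhom_power: "rhom f \<Longrightarrow> f 1 = 1 \<Longrightarrow> f (x ^ n) = f x ^ n" for f :: "'a::ring_1 \<Rightarrow> 'b::ring_1"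
 by (induction n) (simp_all add: rhomD)

lemma fmap_compose:
 fixes f :: "'a::ring_1 \<Rightarrow> 'b::ring_1"
 assumes f: "rhom f" "f 1 = 1"
 shows "fmap f (a oo b) = fmap f a oo fmap f b"
proof -
 have "fmap f b ^ i = fmap f (b ^ i)" for i
 using rhom_power[OF rhom_fmap[OF f(1)]] fmap_1[of f] f rhomD(3)[OF f(1)] by metis
 then show ?thesis
 by (simp add: fps_eq_iff fps_compose_nth rhomD[OF f(1)])
qed

lemma fmap_inv_minus:
 fixes f :: "'a::ring_1 \<Rightarrow> 'b::ring_1"
 assumes "rhom f" "f 1 = 1"
 shows "fmap f (inv_minus a) = inv_minus (f a)"
 using rhom_power[OF assms] rhomD[OF assms(1)] by (auto simp: fps_eq_iff inv_minus_def)

section \<open>The canonical homomorphism and its kernel\<close>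

lemma to_cr_hom [simp]:
 "to_cr (x + y) = to_cr x + to_cr y" "to_cr (x * y) = to_cr x * to_cr y"
 "to_cr (x - y) = to_cr x - to_cr y" "to_cr (- x) = - to_cr x" "to_cr 0 = 0" "to_cr 1 = 1"
 unfolding to_cr_def
 by (simp_all add: plus_dy.abs_eq plus_dycr.abs_eq times_dy.abs_eq times_dycr.abs_eq
 minus_dy.abs_eq minus_dycr.abs_eq uminus_dy.abs_eq uminus_dycr.abs_eq
 zero_dy_def zero_dycr_def one_dy_def one_dycr_def)

lemma to_cr_power: "to_cr (x ^ n) = to_cr x ^ n"
 by (induction n) simp_all

lemma to_cr_sum: "to_cr (sum f A) = (\<Sum>a\<in>A. to_cr (f a))"
 by (induction A rule: infinite_finite_induct) simp_all

lemma to_cr_surj: "\<exists>y. x = to_cr y"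
proof (induct x rule: dycr.abs_induct)
 case (1 z)
 show ?case by (induct z rule: dy.abs_induct) (auto simp: to_cr_def)
qed

lemma to_cr_eq_0_if_dy_ideal: "x \<in> dy_ideal \<Longrightarrow> to_cr x = 0"
 unfolding to_cr_def zero_dycr_def zero_dy_def by (metis diff_zero dy.abs_eq_iff)

lemma to_cr_cancelled: "x \<in> cancelled_relators \<Longrightarrow> to_cr x = 0"
 by (rule to_cr_eq_0_if_dy_ideal) (auto simp: dy_ideal_def)

lemma to_cr_Cen: "to_cr (gen Cen + of_nat CARD('n)) = (0 :: 'n::finite dycr)"
proof -
 have "abs_dy (gen Cen + of_nat CARD('n)) \<in> (crit_ideal :: 'n dy set)"
 by (auto simp: crit_ideal_def)
 then show ?thesis
 unfolding to_cr_def zero_dycr_def by (simp add: dycr.abs_eq_iff)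
qed

lemma hh_central: "hh * x = x * hh" "hh ^ N * x = x * hh ^ N" for x :: "'n free"
 by (simp_all add: fps_mult_fps_X_commute fps_mult_fps_X_power_commute)

lemma hh_cancel: "hh ^ N * x = hh ^ N * y \<Longrightarrow> x = y" for x :: "'n free"
proof (rule fps_ext)
 fix n assume "hh ^ N * x = hh ^ N * y"
 then have "(hh ^ N * x) $ (n + N) = (hh ^ N * y) $ (n + N)" by simp
 then show "x $ n = y $ n" by (simp add: fps_X_power_mult_nth)
qed

lemma hh_divI:
 fixes x :: "'n free"
 assumes "\<And>i. i < N \<Longrightarrow> x $ i = 0"
 obtains z where "x = hh ^ N * z"
proof
 show "x = hh ^ N * Abs_fps (\<lambda>n. x $ (n + N))"
 using assms by (auto simp: fps_eq_iff fps_X_power_mult_nth)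
qed

text \<open>The ideal of the critical level is generated algebraically, without closing it, so
  elements divisible by all powers of h cannot be assumed to vanish in the quotient. They are
  therefore included here.\<close>

definition Icr :: "'n::finite free set" where
 "Icr = {x. \<forall>N. \<exists>z. to_cr x = to_cr hh ^ N * z}"

lemma Icr_zero: "to_cr x = 0 \<Longrightarrow> x \<in> Icr"
 unfolding Icr_def by (auto intro!: exI[of _ 0])

lemma to_cr_hh_central: "to_cr hh ^ N * z = z * to_cr hh ^ N"
 using to_cr_surj[of z] hh_central(2) by (metis to_cr_hom(2) to_cr_power)

lemma two_sided_Icr: "two_sided_ideal (Icr :: 'n::finite free set)"
 unfolding two_sided_ideal_def Icr_def
proof (intro conjI ballI allI, goal_cases)
 case 1
 show ?case by (auto intro!: exI[of _ 0])
next
 case (2 x y)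
 show ?case
 proof (standard, standard)
 fix N
 obtain z z' where "to_cr x = to_cr hh ^ N * z" "to_cr y = to_cr hh ^ N * z'" using 2 by blast
 then show "\<exists>z. to_cr (x + y) = to_cr hh ^ N * z" by (auto intro!: exI[of _ "z + z'"] simp: distrib_left)
 qed
next
 case (3 x a)
 show ?case
 proof (standard, standard)
 fix N
 obtain z where z: "to_cr x = to_cr hh ^ N * z" using 3 by blast
 have "to_cr (a * x) = to_cr hh ^ N * (to_cr a * z)"
 by (simp add: z) (simp add: to_cr_hh_central mult.assoc)
 then show "\<exists>z. to_cr (a * x) = to_cr hh ^ N * z" by blast
 qed
next
 case (4 x a)
 show ?case
 proof (standard, standard)
 fix N
 obtain z where z: "to_cr x = to_cr hh ^ N * z" using 4 by blast
 have "to_cr (x * a) = to_cr hh ^ N * (z * to_cr a)"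
 by (simp add: z mult.assoc)
 then show "\<exists>z. to_cr (x * a) = to_cr hh ^ N * z" by blast
 qed
qed

text \<open>
 The relations between the series \<open>L^\<plusminus>(u)\<close> hold modulo \<open>h^2\<close> times the kernel, since the
 generators enter these series multiplied by \<open>h\<close>. As the free algebra has no \<open>h\<close>-torsion, this
 allows one to divide by \<open>h\<close> in the end.
\<close>

definition I2 :: "'n::finite free set" where
 "I2 = {hh ^ 2 * x | x. x \<in> Icr}"

lemma I2_iff: "hh ^ 2 * x \<in> I2 \<longleftrightarrow> x \<in> Icr"
 unfolding I2_def using hh_cancel by blast

lemma two_sided_I2: "two_sided_ideal (I2 :: 'n::finite free set)"
 unfolding two_sided_ideal_def
proof (intro conjI ballI allI)
 have Z: "0 \<in> Icr" "\<And>x y. x \<in> Icr \<Longrightarrow> y \<in> Icr \<Longrightarrow> x + y \<in> Icr"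
 "\<And>x a. x \<in> Icr \<Longrightarrow> a * x \<in> Icr" "\<And>x a. x \<in> Icr \<Longrightarrow> x * a \<in> (Icr :: 'n free set)"
 using two_sided_Icr unfolding two_sided_ideal_def by blast+
 show "0 \<in> I2" using Z(1) unfolding I2_def by force
 fix x :: "'n free" assume "x \<in> I2"
 then obtain x' where x: "x = hh ^ 2 * x'" "x' \<in> Icr" by (auto simp: I2_def)
 {
 fix y :: "'n free" assume "y \<in> I2"
 then obtain y' where "y = hh ^ 2 * y'" "y' \<in> Icr" by (auto simp: I2_def)
 then show "x + y \<in> I2" using x Z by (simp add: distrib_left[symmetric] I2_iff)
 }
 fix a
 have "a * x = hh ^ 2 * (a * x')" unfolding x by (metis hh_central(2) mult.assoc)
 then show "a * x \<in> I2" using x Z by (simp only: I2_iff)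
 show "x * a \<in> I2" using x Z by (simp add: I2_iff mult.assoc)
qed

quotient_type (overloaded) 'n ecr = "'n::finite free" / "\<lambda>x y. x - y \<in> I2"
 by (rule two_sided_ideal_equivp[OF two_sided_I2])

instantiation ecr :: (finite) ring_1
begin

lift_definition zero_ecr :: "'a ecr" is 0 .
lift_definition one_ecr :: "'a ecr" is 1 .
lift_definition plus_ecr :: "'a ecr \<Rightarrow> 'a ecr \<Rightarrow> 'a ecr" is "(+)"
 by (rule two_sided_ideal_cong(1)[OF two_sided_I2])
lift_definition minus_ecr :: "'a ecr \<Rightarrow> 'a ecr \<Rightarrow> 'a ecr" is "(-)"
 by (rule two_sided_ideal_cong(2)[OF two_sided_I2])
lift_definition uminus_ecr :: "'a ecr \<Rightarrow> 'a ecr" is "uminus"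
 by (rule two_sided_ideal_cong(3)[OF two_sided_I2])
lift_definition times_ecr :: "'a ecr \<Rightarrow> 'a ecr \<Rightarrow> 'a ecr" is "times"
 by (rule two_sided_ideal_cong(4)[OF two_sided_I2])

instance
proof -
 have z: "(0 :: 'a free) \<in> I2"
 using two_sided_I2 unfolding two_sided_ideal_def by blast
 have o: "(0 :: 'a ecr) \<noteq> 1"
 proof (transfer, rule)
 assume "(0 :: 'a free) - 1 \<in> I2"
 then obtain x where "(0 :: 'a free) - 1 = hh ^ 2 * x" by (auto simp: I2_def)
 then have "((0 :: 'a free) - 1) $ 0 = (hh ^ 2 * x) $ 0" by simp
 then show False by (simp add: fps_X_power_mult_nth)
 qed
 show "OFCLASS('a ecr, ring_1_class)"
 by (intro_classes; (rule o)?; transfer) (simp_all add: algebra_simps z)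
qed

end

definition e2 :: "'n::finite free \<Rightarrow> 'n ecr" where
 "e2 = abs_ecr"

lemma e2_hom [simp]:
 "e2 (x + y) = e2 x + e2 y" "e2 (x * y) = e2 x * e2 y"
 "e2 (x - y) = e2 x - e2 y" "e2 (- x) = - e2 x" "e2 0 = 0" "e2 1 = 1"
 unfolding e2_def
 by (simp_all add: plus_ecr.abs_eq times_ecr.abs_eq minus_ecr.abs_eq uminus_ecr.abs_eq
 zero_ecr_def one_ecr_def)

lemma rhom_e2: "rhom e2" by (simp add: rhom_def)

lemma e2_sum: "e2 (sum f A) = (\<Sum>a\<in>A. e2 (f a))"
 by (rule rhomD(6)[OF rhom_e2])

lemma e2_power: "e2 (x ^ n) = e2 x ^ n"
 by (rule rhom_power[OF rhom_e2]) simp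

lemma e2_surj: "\<exists>y. x = e2 y"
 by (induct x rule: ecr.abs_induct) (auto simp: e2_def)

lemma e2_eq_0_iff: "e2 x = 0 \<longleftrightarrow> x \<in> I2"
 unfolding e2_def zero_ecr_def by (simp add: ecr.abs_eq_iff)

lemma e2_hh2_eq_0_iff: "e2 (hh ^ 2 * x) = 0 \<longleftrightarrow> x \<in> Icr"
 by (simp only: e2_eq_0_iff I2_iff)

section \<open>Divisibility by powers of h\<close>

definition hE :: "'n::finite ecr" where
 "hE = e2 hh"

lemma hE_central: "hE * x = x * hE" "hE ^ N * x = x * hE ^ N"
proof -
 show 1: "hE * x = x * hE" for x :: "'a ecr"
 using e2_surj[of x] hh_central(1) unfolding hE_def by (metis e2_hom(2))
 show "hE ^ N * x = x * hE ^ N"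
 by (rule power_commuting_commutes) (rule 1)
qed

definition hdiv :: "nat \<Rightarrow> 'n::finite ecr \<Rightarrow> bool" where
 "hdiv N x \<longleftrightarrow> (\<exists>z. x = hE ^ N * z)"

text \<open>Divisibility by h^2 writes a lift as h^2 w. Divisibility by h^(N+2), with h^2 cancelled
  in the free algebra, then shows that w is divisible by h^N modulo \<open>Icr\<close>, for every N;
  as \<open>Icr\<close> is h-adically closed, w belongs to it.\<close>

lemma hdiv_separated:
 assumes "\<And>N. hdiv N x"
 shows "x = 0"
proof -
 obtain y where y: "x = e2 y" using e2_surj by blast
 have *: "\<exists>z. y - hh ^ N * z \<in> I2" for N
 proof -
 obtain z where "e2 y = hE ^ N * z" using assms[of N] unfolding hdiv_def y by blast
 moreover obtain z' where "z = e2 z'" using e2_surj by blast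
 ultimately have "e2 (y - hh ^ N * z') = 0" by (simp add: hE_def e2_power)
 then show ?thesis unfolding e2_eq_0_iff by blast
 qed
 obtain z u where "y - hh ^ 2 * z = hh ^ 2 * u" using *[of 2] by (auto simp: I2_def)
 then have w: "y = hh ^ 2 * (u + z)" by (simp add: algebra_simps)
 have "u + z \<in> Icr"
 unfolding Icr_def
 proof (standard, standard)
 fix N
 obtain z' where "y - hh ^ (2 + N) * z' \<in> I2" using * by blast
 moreover have "y - hh ^ (2 + N) * z' = hh ^ 2 * (u + z - hh ^ N * z')"
 unfolding w by (simp only: power_add right_diff_distrib mult.assoc)
 ultimately have "u + z - hh ^ N * z' \<in> Icr" by (simp only: I2_iff)
 then obtain v where "to_cr (u + z - hh ^ N * z') = to_cr hh ^ N * v" unfolding Icr_def by blast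
 then have "to_cr (u + z) = to_cr hh ^ N * (v + to_cr z')"
 by (simp add: to_cr_power distrib_left) (simp add: algebra_simps)
 then show "\<exists>v. to_cr (u + z) = to_cr hh ^ N * v" by blast
 qed
 then show ?thesis unfolding y w by (simp only: e2_hh2_eq_0_iff)
qed

lemma hdiv_simps [intro]:
 "hdiv N 0" "hdiv N x \<Longrightarrow> hdiv N y \<Longrightarrow> hdiv N (x + y)" "hdiv N x \<Longrightarrow> hdiv N y \<Longrightarrow> hdiv N (x - y)"
 "hdiv N x \<Longrightarrow> hdiv N (- x)" "hdiv N x \<Longrightarrow> hdiv N (x * y)" "hdiv N y \<Longrightarrow> hdiv N (x * y)" "hdiv 0 x"
proof -
 show "hdiv N 0" unfolding hdiv_def by (auto intro: exI[of _ 0])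
 show "hdiv 0 x" unfolding hdiv_def by simp
 show "hdiv N x \<Longrightarrow> hdiv N y \<Longrightarrow> hdiv N (x + y)" "hdiv N x \<Longrightarrow> hdiv N y \<Longrightarrow> hdiv N (x - y)"
 "hdiv N x \<Longrightarrow> hdiv N (- x)" "hdiv N x \<Longrightarrow> hdiv N (x * y)"
 unfolding hdiv_def by (metis distrib_left, metis right_diff_distrib, metis mult_minus_right, metis mult.assoc)
 show "hdiv N y \<Longrightarrow> hdiv N (x * y)" unfolding hdiv_def by (metis hE_central(2) mult.assoc)
qed

lemma hdiv_sum: "(\<And>i. i \<in> A \<Longrightarrow> hdiv N (f i)) \<Longrightarrow> hdiv N (sum f A)"
 by (induction A rule: infinite_finite_induct) auto

lemma hdiv_mult: "hdiv M x \<Longrightarrow> hdiv N y \<Longrightarrow> hdiv (M + N) (x * y)"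
proof -
 assume "hdiv M x" "hdiv N y"
 then obtain z w where "x = hE ^ M * z" "y = hE ^ N * w" by (auto simp: hdiv_def)
 then have "x * y = hE ^ (M + N) * (z * w)"
 by (simp add: power_add mult.assoc) (metis hE_central(2) mult.assoc)
 then show ?thesis unfolding hdiv_def by blast
qed

lemma hdiv_mono: "hdiv M x \<Longrightarrow> N \<le> M \<Longrightarrow> hdiv N x"
 unfolding hdiv_def by (metis le_add_diff_inverse mult.assoc power_add)

lemma hdiv_e2: "(\<And>i. i < N \<Longrightarrow> x $ i = y $ i) \<Longrightarrow> hdiv N (e2 x - e2 y)"
proof -
 assume "\<And>i. i < N \<Longrightarrow> x $ i = y $ i"
 then obtain z where "x - y = hh ^ N * z" using hh_divI[of N "x - y"] by auto
 then have "e2 (x - y) = hE ^ N * e2 z" by (simp only: e2_hom(2) hE_def e2_power)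
 then show ?thesis unfolding hdiv_def by auto
qed

section \<open>Scalars inside the free algebra\<close>

lemma single_sum: "Poly_Mapping.single k (sum f A) = (\<Sum>a\<in>A. Poly_Mapping.single k (f a))"
 by (induction A rule: infinite_finite_induct) (simp_all add: single_add)

lemma rhom_scal: "rhom (scal :: complex fps \<Rightarrow> 'n free)"
 unfolding rhom_def
proof (intro conjI allI; rule fps_ext)
 fix x y :: "complex fps" and n
 show "(scal (x + y) :: 'n free) $ n = (scal x + scal y) $ n"
 by (simp add: scal_def single_add)
 show "(scal (x * y) :: 'n free) $ n = (scal x * scal y) $ n"
 by (simp add: scal_def fps_mult_nth mult_single single_sum)
qed

lemma scal_1 [simp]: "scal 1 = 1"
 by (auto simp: scal_def fps_eq_iff)

lemma scal_0 [simp]: "scal 0 = 0"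
 by (auto simp: scal_def fps_eq_iff)

lemma scal_X: "scal fps_X = hh"
 by (auto simp: scal_def fps_eq_iff fps_X_def)

lemma poly_mapping_update_eq: "a \<notin> Poly_Mapping.keys f \<Longrightarrow> Poly_Mapping.update a b f = f + Poly_Mapping.single a b"
 for b :: "'b::monoid_add"
 by (rule poly_mapping_eqI)
 (auto simp: lookup_update lookup_add lookup_single in_keys_iff when_def)

lemma scal_central: "scal c * x = x * scal c" for x :: "'n free"
proof (rule fps_ext)
 fix n
 have c: "Poly_Mapping.single 0 a * w = w * Poly_Mapping.single 0 a" for a and w :: "'n gen free_monoid \<Rightarrow>\<^sub>0 complex"
 proof (induction w rule: update_induct)
 case const
 show ?case by simp
 next
 case (update f a' b)
 have "Poly_Mapping.single 0 a * Poly_Mapping.single a' b = Poly_Mapping.single a' b * Poly_Mapping.single 0 a"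
 by (simp add: mult_single mult.commute)
 then show ?case
 using update by (simp add: poly_mapping_update_eq distrib_left distrib_right)
 qed
 have "(scal c * x) $ n = (\<Sum>i=0..n. Poly_Mapping.single 0 (c $ i) * x $ (n - i))"
 by (simp add: fps_mult_nth scal_def)
 also have "\<dots> = (\<Sum>i=0..n. Poly_Mapping.single 0 (c $ (n - i)) * x $ i)"
 by (rule sum.reindex_bij_witness[of _ "\<lambda>i. n - i" "\<lambda>i. n - i"]) auto
 also have "\<dots> = (x * scal c) $ n"
 by (simp add: fps_mult_nth scal_def c)
 finally show "(scal c * x) $ n = (x * scal c) $ n" .
qed

section \<open>The series \<open>f\<close>\<close>

lemma inv_minus_mult: "inv_minus a * (1 - fps_const a * fps_X) = (fps_X :: 'a::comm_ring_1 fps)"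
proof (rule fps_ext)
 fix n
 show "(inv_minus a * (1 - fps_const a * fps_X)) $ n = (fps_X :: 'a fps) $ n"
 proof (cases n)
 case (Suc m)
 have "(inv_minus a * (1 - fps_const a * fps_X)) $ n = inv_minus a $ Suc m - (fps_const a * inv_minus a * fps_X) $ Suc m"
 by (simp add: Suc algebra_simps)
 also have "\<dots> = inv_minus a $ Suc m - a * inv_minus a $ m" by simp
 also have "\<dots> = (if m = 0 then 1 else 0)" by (cases m) (auto simp: inv_minus_def)
 finally show ?thesis by (simp add: Suc fps_X_def)
 qed (simp add: inv_minus_def)
qed

lemma inv_minus_0 [simp]: "inv_minus a $ 0 = 0" "inv_minus a $ Suc 0 = 1"
 by (simp_all add: inv_minus_def)

lemma inv_minus_power_nth:
 fixes a :: "'a::comm_ring_1"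
 shows "m < k \<Longrightarrow> (inv_minus a ^ k) $ m = 0" "(inv_minus a ^ k) $ k = 1"
 "(inv_minus a ^ k) $ Suc k = of_nat k * a"
proof -
 have eq: "inv_minus a = fps_X * Abs_fps (\<lambda>j. a ^ j)"
 by (auto simp: fps_eq_iff inv_minus_def)
 have p: "inv_minus a ^ k = fps_X ^ k * Abs_fps (\<lambda>j. a ^ j) ^ k" for k
 unfolding eq by (simp add: power_mult_distrib)
 show "m < k \<Longrightarrow> (inv_minus a ^ k) $ m = 0" "(inv_minus a ^ k) $ k = 1"
 by (simp_all add: p fps_X_power_mult_nth fps_nth_power_0)
 have "(Abs_fps (\<lambda>j. a ^ j) ^ k) $ Suc 0 = of_nat k * a"
 proof (induction k)
 case (Suc k)
 then show ?case by (simp add: fps_mult_nth fps_nth_power_0 algebra_simps)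
 qed simp
 then show "(inv_minus a ^ k) $ Suc k = of_nat k * a"
 by (simp add: p fps_X_power_mult_nth)
qed

context
 fixes n :: nat
begin

text \<open>The recursion comes from the coefficient of u^(-m-1) in the functional equation with h =
  1. The unknown of index m + 1 occurs on both sides and cancels, and the substitution contributes m
  n times the coefficient of index m, which is solved for.\<close>

fun fcoef :: "nat \<Rightarrow> complex" where
 "fcoef m = (if m = 0 then 1 else
 - (fcoef (m - 1) + (\<Sum>k<m. fcoef k * (inv_minus (of_nat n) ^ k) $ Suc m)) / (of_nat m * of_nat n))"

end

declare fcoef.simps [simp del]

lemma fcoef_compose:
 assumes "n > 0"
 shows "Abs_fps (fcoef n) oo inv_minus (of_nat n) = (1 - fps_X ^ 2) * Abs_fps (fcoef n)"
proof (rule fps_ext)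
 fix j
 let ?P = "\<lambda>k. (inv_minus (of_nat n :: complex) ^ k)"
 show "(Abs_fps (fcoef n) oo inv_minus (of_nat n)) $ j = ((1 - fps_X ^ 2) * Abs_fps (fcoef n)) $ j"
 proof (cases j)
 case 0
 then show ?thesis by (simp add: fps_X_power_mult_nth left_diff_distrib fcoef.simps)
 next
 case (Suc m)
 have "(Abs_fps (fcoef n) oo inv_minus (of_nat n)) $ j = (\<Sum>k=0..Suc m. fcoef n k * ?P k $ Suc m)"
 by (simp add: fps_compose_nth Suc)
 also have "\<dots> = fcoef n (Suc m) + fcoef n m * (of_nat m * of_nat n) + (\<Sum>k<m. fcoef n k * ?P k $ Suc m)"
 by (simp add: inv_minus_power_nth atLeast0AtMost lessThan_Suc_atMost[symmetric] del: power_Suc)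
 finally have 1: "(Abs_fps (fcoef n) oo inv_minus (of_nat n)) $ j
 = fcoef n (Suc m) + fcoef n m * (of_nat m * of_nat n) + (\<Sum>k<m. fcoef n k * ?P k $ Suc m)" .
 show ?thesis
 proof (cases m)
 case 0
 then show ?thesis unfolding 1 by (simp add: Suc fps_X_power_mult_nth left_diff_distrib)
 next
 case (Suc m')
 have "fcoef n m * (of_nat m * of_nat n) = - (fcoef n (m - 1) + (\<Sum>k<m. fcoef n k * ?P k $ Suc m))"
 proof -
 have "fcoef n m = - (fcoef n (m - 1) + (\<Sum>k<m. fcoef n k * ?P k $ Suc m)) / (of_nat m * of_nat n)"
 using Suc by (subst fcoef.simps) simp
 moreover have "of_nat m * of_nat n \<noteq> (0 :: complex)" using assms Suc by (simp del: of_nat_Suc)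
 ultimately show ?thesis by simp
 qed
 then show ?thesis unfolding 1
 by (simp add: \<open>j = Suc m\<close> Suc fps_X_power_mult_nth left_diff_distrib)
 qed
 qed
qed

text \<open>Replacing u^(-1) by h u^(-1) reduces the equation to the case h = 1, which also shows
  that the p-th coefficient is a complex multiple of h^p. For uniqueness, if s is the order of the
  difference D of two solutions, comparing coefficients of index s + 1 gives s n h D_s = 0.\<close>

lemma fser_spec:
 assumes "n > 0"
 shows "fser n $ p = fps_const (fcoef n p) * fps_X ^ p"
 "fser n oo inv_minus (of_nat n * fps_X) = (1 - fps_const (fps_X ^ 2) * fps_X ^ 2) * fser n"
proof -
 let ?h = "fps_X :: complex fps"
 let ?E = "\<lambda>f. f $ 0 = 1 \<and> f oo inv_minus (of_nat n * ?h) = (1 - fps_const (?h ^ 2) * fps_X ^ 2) * f"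
 let ?c = "\<lambda>f :: complex fps. fmap fps_const f"
 let ?s = "fps_const ?h * fps_X"
 define f where "f = ?c (Abs_fps (fcoef n)) oo ?s"
 have c: "rhom (fps_const :: complex \<Rightarrow> complex fps)" "fps_const (1 :: complex) = 1" by (simp_all add: rhom_def)
 have fp: "f $ p = fps_const (fcoef n p) * ?h ^ p" for p
 unfolding f_def fps_compose_linear by (simp add: mult.commute)
 have "?s oo inv_minus (of_nat n * ?h) = inv_minus (of_nat n) oo ?s"
 proof -
 have 1: "(inv_minus (of_nat n) oo ?s) * (1 - fps_const (of_nat n) * ?s) = ?s"
 proof -
 have "(inv_minus (of_nat n) * (1 - fps_const (of_nat n) * fps_X)) oo ?s = (fps_X :: complex fps fps) oo ?s"
 by (simp only: inv_minus_mult)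
 then show ?thesis
 by (simp add: fps_compose_mult_distrib fps_compose_sub_distrib fps_X_fps_compose_startby0 mult.assoc)
 qed
 have 2: "fps_const ?h * inv_minus (of_nat n * ?h) * (1 - fps_const (of_nat n) * ?s) = ?s"
 proof -
 have "1 - fps_const (of_nat n) * ?s = 1 - fps_const (of_nat n * ?h) * fps_X"
 by (simp add: mult.assoc[symmetric])
 then show ?thesis using inv_minus_mult[of "of_nat n * ?h"] by (simp only: mult.assoc)
 qed
 have "(1 - fps_const (of_nat n) * ?s) $ 0 \<noteq> 0" by simp
 then have "1 - fps_const (of_nat n) * ?s \<noteq> 0" by (metis fps_zero_nth)
 then have "fps_const ?h * inv_minus (of_nat n * ?h) = inv_minus (of_nat n) oo ?s"
 using 1 2 by (metis mult_right_cancel)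
 then show ?thesis
 by (simp add: fps_compose_mult_distrib fps_X_fps_compose_startby0)
 qed
 then have "f oo inv_minus (of_nat n * ?h) = ?c (Abs_fps (fcoef n)) oo (inv_minus (of_nat n) oo ?s)"
 unfolding f_def by (subst fps_compose_assoc[symmetric]) simp_all
 also have "\<dots> = (?c (Abs_fps (fcoef n)) oo inv_minus (of_nat n)) oo ?s"
 by (subst fps_compose_assoc) simp_all
 also have "?c (Abs_fps (fcoef n)) oo inv_minus (of_nat n) = ?c (Abs_fps (fcoef n) oo inv_minus (of_nat n))"
 using fmap_inv_minus[OF c, of "of_nat n"] by (simp add: fmap_compose[OF c] fps_of_nat)
 also have "\<dots> = (1 - fps_X ^ 2) * ?c (Abs_fps (fcoef n))"
 unfolding fcoef_compose[OF assms] rhomD[OF rhom_fmap[OF c(1)]]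
 using rhom_power[OF rhom_fmap[OF c(1)] fmap_1[OF rhomD(3)[OF c(1)] c(2)], of fps_X 2]
 fmap_X[OF rhomD(3)[OF c(1)] c(2)] fmap_1[OF rhomD(3)[OF c(1)] c(2)]
 by simp
 also have "\<dots> oo ?s = (1 - fps_const (?h ^ 2) * fps_X ^ 2) * f"
 unfolding f_def
 by (simp add: fps_compose_mult_distrib fps_compose_sub_distrib fps_compose_power[symmetric]
 power_mult_distrib fps_const_power)
 finally have E: "?E f" using fp[of 0] by (simp add: fcoef.simps)
 have uniq: "g = f" if g: "?E g" for g
 proof (rule ccontr)
 assume "g \<noteq> f"
 define D where "D = g - f"
 have D0: "D \<noteq> 0" "D $ 0 = 0" using \<open>g \<noteq> f\<close> E g by (simp_all add: D_def)
 have D: "D oo inv_minus (of_nat n * ?h) = (1 - fps_const (?h ^ 2) * fps_X ^ 2) * D"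
 unfolding D_def using E g by (simp add: fps_compose_sub_distrib right_diff_distrib)
 define s where "s = subdegree D"
 have s: "D $ s \<noteq> 0" "\<And>i. i < s \<Longrightarrow> D $ i = 0"
 using D0 unfolding s_def by (auto simp: nth_subdegree_nonzero nth_less_subdegree_zero)
 then have "s > 0" using D0(2) by (metis gr0I)
 note s = this s
 have "(D oo inv_minus (of_nat n * ?h)) $ Suc s = (\<Sum>k=0..Suc s. D $ k * (inv_minus (of_nat n * ?h) ^ k) $ Suc s)"
 by (simp add: fps_compose_nth)
 also have "\<dots> = (\<Sum>k\<in>{s, Suc s}. D $ k * (inv_minus (of_nat n * ?h) ^ k) $ Suc s)"
 by (rule sum.mono_neutral_right) (use s in \<open>auto simp: less_Suc_eq le_Suc_eq\<close>)
 also have "\<dots> = D $ s * (of_nat s * (of_nat n * ?h)) + D $ Suc s"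
 by (simp add: inv_minus_power_nth del: power_Suc)
 also have "((1 - fps_const (?h ^ 2) * fps_X ^ 2) * D) $ Suc s = D $ Suc s"
 proof -
 have "((1 - fps_const (?h ^ 2) * fps_X ^ 2) * D) $ Suc s = D $ Suc s - ?h ^ 2 * (fps_X ^ 2 * D) $ Suc s"
 by (simp add: left_diff_distrib mult.assoc)
 also have "(fps_X ^ 2 * D) $ Suc s = 0" using s by (simp add: fps_X_power_mult_nth)
 finally show ?thesis by simp
 qed
 ultimately have "D $ s * (of_nat s * (of_nat n * ?h)) = 0" using D by simp
 then show False using s assms by simp
 qed
 have "fser n = f"
 unfolding fser_def by (rule the_equality[of ?E, OF E uniq])
 then show "fser n $ p = fps_const (fcoef n p) * fps_X ^ p"
 "fser n oo inv_minus (of_nat n * fps_X) = (1 - fps_const (fps_X ^ 2) * fps_X ^ 2) * fser n"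
 by (simp_all only: fp E[THEN conjunct2])
qed

section \<open>Coefficients of the \<open>R\<close>-matrix\<close>

text \<open>Homogeneity of degree \<open>- d\<close> in \<open>u\<close>, \<open>v\<close> and \<open>h\<close>; the outer variable is \<open>u^(-1)\<close>, the inner ones are \<open>v\<close> and \<open>h\<close>.\<close>

definition homog :: "nat \<Rightarrow> 'a::ring_1 fps fps fps \<Rightarrow> bool" where
 "homog d W \<longleftrightarrow> (\<forall>P q i. W $ P $ q $ i \<noteq> 0 \<longrightarrow> q + i + d = P)"

lemma homogD: "homog d W \<Longrightarrow> W $ P $ q $ i \<noteq> 0 \<Longrightarrow> q + i + d = P"
 by (simp add: homog_def)

lemma sum_neq_0E:
 assumes "sum f A \<noteq> (0 :: 'a::comm_monoid_add)"
 obtains a where "a \<in> A" "f a \<noteq> 0"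
 using assms by (meson sum.neutral)

lemma fps_mult_nth_neq_0E:
 assumes "(x * y) $ n \<noteq> (0 :: 'a::ring_1)"
 obtains i where "i \<le> n" "x $ i * y $ (n - i) \<noteq> 0"
 using assms unfolding fps_mult_nth by (auto elim: sum_neq_0E)

lemma fps_mult_nth2_neq_0E:
 assumes "(x * y) $ n $ m \<noteq> (0 :: 'a::ring_1)"
 obtains i j where "i \<le> n" "j \<le> m" "x $ i $ j * y $ (n - i) $ (m - j) \<noteq> 0"
proof -
 have "(\<Sum>i=0..n. (x $ i * y $ (n - i)) $ m) \<noteq> 0"
 using assms by (simp add: fps_mult_nth fps_sum_nth)
 then obtain i where "i \<in> {0..n}" "(x $ i * y $ (n - i)) $ m \<noteq> 0" by (rule sum_neq_0E)
 then show ?thesis using that by (auto elim!: fps_mult_nth_neq_0E)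
qed

lemma fps_mult_nth3_neq_0E:
 assumes "(x * y) $ n $ m $ l \<noteq> (0 :: 'a::ring_1)"
 obtains i j k where "i \<le> n" "j \<le> m" "k \<le> l" "x $ i $ j $ k * y $ (n - i) $ (m - j) $ (l - k) \<noteq> 0"
proof -
 have "(\<Sum>i=0..n. (x $ i * y $ (n - i)) $ m $ l) \<noteq> 0"
 using assms by (simp add: fps_mult_nth fps_sum_nth)
 then obtain i where "i \<in> {0..n}" "(x $ i * y $ (n - i)) $ m $ l \<noteq> 0" by (rule sum_neq_0E)
 then show ?thesis using that by (auto elim!: fps_mult_nth2_neq_0E)
qed

lemma homog_mult: "homog d V \<Longrightarrow> homog e W \<Longrightarrow> homog (d + e) (V * W)"
 unfolding homog_def
proof (intro allI impI)
 fix P q i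
 assume VW: "\<forall>P q i. V $ P $ q $ i \<noteq> 0 \<longrightarrow> q + i + d = P" "\<forall>P q i. W $ P $ q $ i \<noteq> 0 \<longrightarrow> q + i + e = P"
 assume "(V * W) $ P $ q $ i \<noteq> 0"
 then obtain a b c where abc: "a \<le> P" "b \<le> q" "c \<le> i" "V $ a $ b $ c * W $ (P - a) $ (q - b) $ (i - c) \<noteq> 0"
 by (rule fps_mult_nth3_neq_0E)
 then have "V $ a $ b $ c \<noteq> 0" "W $ (P - a) $ (q - b) $ (i - c) \<noteq> 0" by auto
 then have "b + c + d = a" "q - b + (i - c) + e = P - a" using VW by blast+
 then show "q + i + (d + e) = P" using abc by linarith
qed

lemma homog_1: "homog 0 1"
 by (auto simp: homog_def split: if_splits)

lemma homog_power: "homog d W \<Longrightarrow> homog (d * n) (W ^ n)"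
 by (induction n) (auto simp: homog_1 intro: homog_mult)

lemma homog_inv_minus:
 assumes "\<forall>z. \<kappa> $ z \<noteq> 0 \<longrightarrow> z = 1"
 shows "homog 1 (inv_minus (fps_X + fps_const \<kappa>))"
proof -
 have 1: "((fps_X + fps_const \<kappa>) ^ m) $ q $ i \<noteq> 0 \<Longrightarrow> q + i = m" for m q i
 proof (induction m arbitrary: q i)
 case 0
 then show ?case by (auto split: if_splits)
 next
 case (Suc m)
 obtain a b where ab: "a \<le> q" "b \<le> i"
 "(fps_X + fps_const \<kappa>) $ a $ b * ((fps_X + fps_const \<kappa>) ^ m) $ (q - a) $ (i - b) \<noteq> 0"
 using Suc.prems by (auto elim: fps_mult_nth2_neq_0E)
 then have "(fps_X + fps_const \<kappa>) $ a $ b \<noteq> 0" "((fps_X + fps_const \<kappa>) ^ m) $ (q - a) $ (i - b) \<noteq> 0"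
 using mult_not_zero by blast+
 moreover have "a + b = 1"
 using \<open>(fps_X + fps_const \<kappa>) $ a $ b \<noteq> 0\<close> assms
 by (cases "a = 0"; cases "a = 1"; cases "b = 0") (auto simp: fps_X_def)
 ultimately show ?case using Suc.IH[of "q - a" "i - b"] ab by linarith
 qed
 show ?thesis
 unfolding homog_def
 proof (intro allI impI)
 fix P q i assume "inv_minus (fps_X + fps_const \<kappa>) $ P $ q $ i \<noteq> 0"
 then have "P \<noteq> 0" "((fps_X + fps_const \<kappa>) ^ (P - 1)) $ q $ i \<noteq> 0"
 by (auto simp: inv_minus_def split: if_splits)
 then show "q + i + 1 = P" using 1 by force
 qed
qed

lemma Rentry_nth: "Rentry i j k l $ p =
 fser CARD('n) $ p * (if i = k \<and> j = l then 1 else 0) +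
 (if p = 0 then 0 else fps_X * fser CARD('n) $ (p - 1)) * (if i = l \<and> j = k then 1 else 0)"
 for i :: "'n::finite"
proof -
 have 1: "(if Q then 1 else 0 :: 'a::comm_ring_1 fps) = fps_const (if Q then 1 else 0)" for Q
 by simp
 have "(F * (fps_const x + fps_const c * fps_X * fps_const y)) $ p
 = F $ p * x + (if p = 0 then 0 else c * F $ (p - 1)) * y" for F :: "complex fps fps" and c x y
 proof -
 have "F * (fps_const x + fps_const c * fps_X * fps_const y)
 = F * fps_const x + fps_X * (fps_const c * F * fps_const y)"
 by (simp add: algebra_simps)
 then show ?thesis by (simp add: fps_X_mult_nth)
 qed
 then show ?thesis unfolding Rentry_def 1 .
qed

lemma Rentry_nth_nth: "Rentry i j k l $ p $ m \<noteq> 0 \<Longrightarrow> m = p" for i :: "'n::finite"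
proof -
 have 0: "CARD('n) > 0" by simp
 assume "Rentry i j k l $ p $ m \<noteq> 0"
 then show "m = p"
 proof (rule contrapos_np)
 assume mp: "m \<noteq> p"
 have 1: "fser CARD('n) $ p $ m = 0"
 unfolding fser_spec(1)[OF 0] using mp by (simp add: fps_X_power_nth)
 have 2: "(fps_X * fser CARD('n) $ (p - 1)) $ m = 0" if "p \<noteq> 0"
 unfolding fser_spec(1)[OF 0] using mp that by (auto simp: fps_X_mult_nth fps_X_power_nth)
 have 3: "(if p = 0 then 0 else fps_X * fser CARD('n) $ (p - 1)) $ m = 0"
 using 2 by (cases "p = 0") simp_all
 have z: "F $ m = 0 \<Longrightarrow> (F * (if Q then 1 else 0)) $ m = 0" for F :: "complex fps" and Q
 by (cases Q) simp_all
 show "Rentry i j k l $ p $ m = 0"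
 by (simp only: Rentry_nth fps_add_nth z[OF 1] z[OF 3] add_0_right)
 qed
qed

lemma Rentry_0: "Rentry i j k l $ 0 = (if i = k \<and> j = l then 1 else 0)" for i :: "'n::finite"
proof -
 have 0: "CARD('n) > 0" by simp
 have 1: "fcoef CARD('n) 0 = 1" by (subst fcoef.simps) simp
 show ?thesis unfolding Rentry_nth fser_spec(1)[OF 0] 1
 by (simp only: fps_const_1_eq_1 power_0 mult_1_left mult_zero_left add_0_right simp_thms if_True)
qed

lemma Rshift_nth: "Rshift \<kappa> i j k l $ P $ q =
 (\<Sum>r=0..P. scal (Rentry i j k l $ r) * (inv_minus (fps_X + fps_const \<kappa>) ^ r) $ P $ q)"
 by (simp add: Rshift_def fps_compose_nth fps_sum_nth)

lemma scal_nth: "scal c $ n = Poly_Mapping.single 0 (c $ n)"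
 by (simp add: scal_def)

text \<open>The R-matrix has total degree 0 when u, v and h have degree 1, provided that the shift
  has degree 1 in h. Thus the coefficient of u^(-P) v^q lives in degree P - q in h only, and is zero
  for q > P. All finiteness and divisibility statements about the relations rest on this.\<close>

lemma Rshift_homog:
 fixes i :: "'n::finite"
 assumes "\<forall>z. \<kappa> $ z \<noteq> 0 \<longrightarrow> z = 1"
 shows "homog 0 (Rshift \<kappa> i j k l)"
 unfolding homog_def
proof (intro allI impI)
 fix P q m assume "Rshift \<kappa> i j k l $ P $ q $ m \<noteq> 0"
 then have "(\<Sum>r=0..P. (scal (Rentry i j k l $ r) * (inv_minus (fps_X + fps_const \<kappa>) ^ r) $ P $ q) $ m) \<noteq> 0"
 by (simp add: Rshift_nth fps_sum_nth)
 then obtain r where "(scal (Rentry i j k l $ r) * (inv_minus (fps_X + fps_const \<kappa>) ^ r) $ P $ q) $ m \<noteq> 0"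
 by (rule sum_neq_0E)
 then obtain a where a: "a \<le> m"
 "scal (Rentry i j k l $ r) $ a * (inv_minus (fps_X + fps_const \<kappa>) ^ r) $ P $ q $ (m - a) \<noteq> 0"
 by (rule fps_mult_nth_neq_0E)
 then have "scal (Rentry i j k l $ r) $ a \<noteq> (0 :: 'n gen free_monoid \<Rightarrow>\<^sub>0 complex)"
 and b: "(inv_minus (fps_X + fps_const \<kappa>) ^ r) $ P $ q $ (m - a) \<noteq> 0" by auto
 then have "Rentry i j k l $ r $ a \<noteq> 0" by (auto simp: scal_nth)
 then have "a = r" by (rule Rentry_nth_nth)
 moreover have "q + (m - a) + 1 * r = P"
 using homogD[OF homog_power[OF homog_inv_minus[OF assms], where n = r] b] by simp
 ultimately show "q + m + 0 = P" using a by simp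
qed

lemma Rshift_nth_0:
 "Rshift \<kappa> i j k l $ p $ q $ 0 = (if p = 0 \<and> q = 0 \<and> i = k \<and> j = l then 1 else 0)"
 for i :: "'n::finite"
proof -
 have "Rshift \<kappa> i j k l $ p $ q $ 0 =
 (\<Sum>r=0..p. scal (Rentry i j k l $ r) $ 0 * (inv_minus (fps_X + fps_const \<kappa>) ^ r) $ p $ q $ 0)"
 by (simp add: Rshift_nth fps_sum_nth)
 also have "\<dots> = (\<Sum>r\<in>{0}. scal (Rentry i j k l $ r) $ 0 * (inv_minus (fps_X + fps_const \<kappa>) ^ r) $ p $ q $ 0)"
 proof (rule sum.mono_neutral_right)
 show "\<forall>r\<in>{0..p} - {0}. scal (Rentry i j k l $ r) $ 0 * (inv_minus (fps_X + fps_const \<kappa>) ^ r) $ p $ q $ 0 = 0"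
 using Rentry_nth_nth[of i j k l _ 0] by (force simp: scal_nth)
 qed auto
 finally show ?thesis by (simp add: Rentry_0)
qed

lemma inv_minus_power_nth_0:
 fixes \<kappa> :: "'a::ring_1 fps"
 assumes "\<kappa> $ 0 = 0"
 shows "(inv_minus (fps_X + fps_const \<kappa>) ^ r) $ p $ q $ 0 = (inv_minus fps_X ^ r) $ p $ q"
proof -
 have h: "rhom (\<lambda>x :: 'a fps. x $ 0)" by (simp add: rhom_def)
 have h1: "fmap (\<lambda>x :: 'a fps. x $ 0) 1 = 1" by (rule fmap_1) simp_all
 have h2: "rhom (fmap (\<lambda>x :: 'a fps. x $ 0))" using rhom_fmap[OF h] .
 have "fmap (fmap (\<lambda>x :: 'a fps. x $ 0)) (inv_minus (fps_X + fps_const \<kappa>) ^ r)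
 = inv_minus (fmap (\<lambda>x. x $ 0) (fps_X + fps_const \<kappa>)) ^ r"
 using rhom_power[OF rhom_fmap[OF h2] fmap_1[OF rhomD(3)[OF h2] h1]] fmap_inv_minus[OF h2 h1] by metis
 also have "fmap (\<lambda>x. x $ 0) (fps_X + fps_const \<kappa>) = fps_X"
 using assms by (auto simp: fps_eq_iff fps_X_def)
 finally show ?thesis by (auto simp: fps_eq_iff)
qed

text \<open>To first order in h the shift is invisible: each non-constant coefficient of R already
  carries an h, and \<kappa> would contribute another.\<close>

lemma Rshift_nth_1:
 fixes i :: "'n::finite"
 assumes "\<kappa> $ 0 = 0" "\<kappa>' $ 0 = 0"
 shows "Rshift \<kappa> i j k l $ p $ q $ 1 = Rshift \<kappa>' i j k l $ p $ q $ 1"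
proof -
 have e: "(scal (Rentry i j k l $ r) * (inv_minus (fps_X + fps_const \<kappa>) ^ r) $ p $ q) $ 1
 = (scal (Rentry i j k l $ r) * (inv_minus (fps_X + fps_const \<kappa>') ^ r) $ p $ q) $ 1" for r
 proof (cases r)
 case (Suc r')
 then have "Rentry i j k l $ r $ 0 = 0" using Rentry_nth_nth[of i j k l r 0] by auto
 then show ?thesis
 by (simp add: fps_mult_nth scal_nth inv_minus_power_nth_0[OF assms(1)] inv_minus_power_nth_0[OF assms(2)])
 qed simp
 show ?thesis unfolding Rshift_nth fps_sum_nth e ..
qed

section \<open>The defining relations as congruences modulo powers of \<open>h\<close>\<close>

lemma lcoeff_eq_0: "e > 0 \<Longrightarrow> lcoeff True i j e = 0" "e < 0 \<Longrightarrow> lcoeff False i j e = 0"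
 by (auto simp: lcoeff_def)

lemma lcoeff_nth_0: "lcoeff s i j e $ 0 = (if e = 0 \<and> i = j then 1 else 0)"
 by (auto simp: lcoeff_def)

definition left_term where
 "left_term s t \<kappa> i j k l a b p q = (\<Sum>i'\<in>UNIV. \<Sum>j'\<in>UNIV.
 Rshift \<kappa> i j i' j' $ p $ q * lcoeff s i' k (a + int p) * lcoeff t j' l (b - int q))"

definition right_term where
 "right_term s t \<kappa> i j k l a b p q = (\<Sum>k'\<in>UNIV. \<Sum>l'\<in>UNIV.
 lcoeff t j l' (b - int q) * lcoeff s i k' (a + int p) * Rshift \<kappa> k' l' k l $ p $ q)"

text \<open>K bounds the pairs (p, q) that matter modulo h^N. With L^- in the second copy, q is at
  most b, and then p < q + N by homogeneity; with L^+ in the first copy, p is at most -a, and q is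
  at most p. For L^- in the first and L^+ in the second copy there is no such bound.\<close>

definition large :: "bool \<Rightarrow> bool \<Rightarrow> int \<Rightarrow> int \<Rightarrow> nat \<Rightarrow> nat \<Rightarrow> bool" where
 "large s t a b N K \<longleftrightarrow> (\<not> t \<and> nat b + N < K) \<or> (s \<and> nat (- a) + 1 < K)"

lemma term_eq_0:
 fixes i :: "'n::finite"
 assumes \<kappa>: "\<forall>z. \<kappa> $ z \<noteq> 0 \<longrightarrow> z = 1" and K: "large s t a b N K"
 and pq: "\<not> (p < K \<and> q < K)" and m: "m < N"
 shows "left_term s t \<kappa> i j k l a b p q $ m = 0" "right_term s t \<kappa> i j k l a b p q $ m = 0"
proof -
 have H: "homog 0 (Rshift \<kappa> i j i' j')" for i j i' j' :: 'n
 by (rule Rshift_homog[OF \<kappa>])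
 have *: "Rshift \<kappa> i j i' j' $ p $ q $ m' = 0 \<or> lcoeff s i1 k1 (a + int p) = 0 \<or> lcoeff t j1 l1 (b - int q) = 0"
 if "m' \<le> m" for m' i1 k1 j1 l1 and i j i' j' :: 'n
 proof (rule ccontr)
 assume c: "\<not> ?thesis"
 then have "Rshift \<kappa> i j i' j' $ p $ q $ m' \<noteq> 0" by blast
 then have "q + m' = p" using homogD[OF H] by fastforce
 moreover have "s \<Longrightarrow> a + int p \<le> 0" "\<not> t \<Longrightarrow> b - int q \<ge> 0"
 using c lcoeff_eq_0 by (metis (full_types) not_le)+
 ultimately show False using K pq m that unfolding large_def by linarith
 qed
 have l: "(Rshift \<kappa> i j i' j' $ p $ q * lcoeff s i' k (a + int p) * lcoeff t j' l (b - int q)) $ m = 0" for i' j'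
 proof (rule ccontr)
 assume "(Rshift \<kappa> i j i' j' $ p $ q * lcoeff s i' k (a + int p) * lcoeff t j' l (b - int q)) $ m \<noteq> 0"
 then obtain m' where "m' \<le> m" "Rshift \<kappa> i j i' j' $ p $ q $ m' * (lcoeff s i' k (a + int p) * lcoeff t j' l (b - int q)) $ (m - m') \<noteq> 0"
 unfolding mult.assoc by (rule fps_mult_nth_neq_0E)
 then show False using *[of m' i j i' j' i' k j' l] by auto
 qed
 have r: "(lcoeff t j l' (b - int q) * lcoeff s i k' (a + int p) * Rshift \<kappa> k' l' k l $ p $ q) $ m = 0" for k' l'
 proof (rule ccontr)
 assume "(lcoeff t j l' (b - int q) * lcoeff s i k' (a + int p) * Rshift \<kappa> k' l' k l $ p $ q) $ m \<noteq> 0"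
 then obtain m' where "m' \<le> m" "(lcoeff t j l' (b - int q) * lcoeff s i k' (a + int p)) $ m' * Rshift \<kappa> k' l' k l $ p $ q $ (m - m') \<noteq> 0"
 by (rule fps_mult_nth_neq_0E)
 then show False using *[of "m - m'" k' l' k l i k' j l'] by auto
 qed
 show "left_term s t \<kappa> i j k l a b p q $ m = 0" "right_term s t \<kappa> i j k l a b p q $ m = 0"
 unfolding left_term_def right_term_def by (simp_all add: fps_sum_nth l r)
qed

lemma rll_box:
 fixes i :: "'n::finite"
 assumes \<kappa>: "\<forall>z. \<kappa> $ z \<noteq> 0 \<longrightarrow> z = 1" and K: "large s t a b N K" and m: "m < N"
 shows "rll_left s t \<kappa> i j k l a b $ m = (\<Sum>p<K. \<Sum>q<K. left_term s t \<kappa> i j k l a b p q) $ m"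
 "rll_right s t \<kappa> i j k l a b $ m = (\<Sum>p<K. \<Sum>q<K. right_term s t \<kappa> i j k l a b p q) $ m"
proof -
 have box: "infsum g UNIV $ m = (\<Sum>p<K. \<Sum>q<K. g (p, q)) $ m"
 if g: "\<And>N K p q m. large s t a b N K \<Longrightarrow> \<not> (p < K \<and> q < K) \<Longrightarrow> m < N \<Longrightarrow> g (p, q) $ m = 0"
 for g :: "nat \<times> nat \<Rightarrow> 'n free"
 proof -
 have "infsum g UNIV $ m = (\<Sum>x\<in>{..<K} \<times> {..<K}. g x $ m)"
 proof (rule fps_infsum_nth)
 fix N'
 obtain K' where K': "large s t a b N' K'"
 proof
 show "large s t a b N' (nat b + N' + nat (- a) + 2)" using K by (auto simp: large_def)
 qed
 have "{x \<in> UNIV. \<exists>i<N'. g x $ i \<noteq> 0} \<subseteq> {..<K'} \<times> {..<K'}"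
 using g[OF K'] by fastforce
 then show "finite {x \<in> UNIV. \<exists>i<N'. g x $ i \<noteq> 0}" by (rule finite_subset) simp
 qed (use g[OF K _ m] in auto)
 then show ?thesis by (simp add: fps_sum_nth sum.cartesian_product)
 qed
 show "rll_left s t \<kappa> i j k l a b $ m = (\<Sum>p<K. \<Sum>q<K. left_term s t \<kappa> i j k l a b p q) $ m"
 unfolding rll_left_def left_term_def[symmetric]
 by (subst box) (auto simp: term_eq_0(1)[OF \<kappa>] left_term_def[symmetric])
 show "rll_right s t \<kappa> i j k l a b $ m = (\<Sum>p<K. \<Sum>q<K. right_term s t \<kappa> i j k l a b p q) $ m"
 unfolding rll_right_def right_term_def[symmetric]
 by (subst box) (auto simp: term_eq_0(2)[OF \<kappa>] right_term_def[symmetric])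
qed

text \<open>Both sides agree in the free algebra up to first order in h: at order 0 all factors are
  constants, and at order 1 only one factor departs from its constant, so there is nothing to
  commute. The relator is thus h^2 z, where z is a cancelled relator and hence lies in
  \<open>Icr\<close>.\<close>

lemma relator_e2:
 fixes i :: "'n::finite"
 assumes rel: "rll_left s t \<kappa> i j k l a b - rll_right s t \<kappa>' i j k l a b \<in> relators"
 and \<kappa>: "\<forall>z. \<kappa> $ z \<noteq> 0 \<longrightarrow> z = 1" "\<forall>z. \<kappa>' $ z \<noteq> 0 \<longrightarrow> z = 1"
 and K: "\<And>N. \<exists>K. large s t a b N K"
 shows "e2 (rll_left s t \<kappa> i j k l a b) = e2 (rll_right s t \<kappa>' i j k l a b)"
proof -
 obtain K where K: "large s t a b 2 K" using K by blast
 have K0: "K > 0" using K by (auto simp: large_def)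
 define \<delta> where "\<delta> p q = (if a + int p = 0 \<and> b - int q = 0 then 1 else 0 :: 'n gen free_monoid \<Rightarrow>\<^sub>0 complex)" for p q
 have k0: "\<kappa> $ 0 = 0" "\<kappa>' $ 0 = 0" using \<kappa> by (metis zero_neq_one)+
 let ?l = "\<lambda>i k. lcoeff s i k" and ?t = "\<lambda>j l. lcoeff t j l"
 have l0: "(lcoeff s' i' k' e) $ 0 * w = w * (lcoeff s' i' k' e) $ 0" for s' i' k' e w
 by (simp add: lcoeff_nth_0)
 have c0: "?t j l' e $ 0 * ?l i k' e' $ 0 = ?l i k' e' $ 0 * ?t j l' e $ 0" for l' k' e e'
 by (rule l0)
 have sum2: "(\<Sum>i'\<in>UNIV. \<Sum>j'\<in>UNIV. if i' = k \<and> j' = l then F i' j' else 0) = F k l"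
 for F :: "'n \<Rightarrow> 'n \<Rightarrow> 'n gen free_monoid \<Rightarrow>\<^sub>0 complex" and k l
 proof -
 have "(\<Sum>j'\<in>UNIV. if i' = k \<and> j' = l then F i' j' else 0) = (if i' = k then F i' l else 0)" for i'
 by (cases "i' = k") simp_all
 then show ?thesis by simp
 qed
 have L0: "left_term s t \<kappa> i j k l a b p q $ 0 = (if p = 0 \<and> q = 0 then ?l i k a $ 0 * ?t j l b $ 0 else 0)" for p q
 proof -
 have "left_term s t \<kappa> i j k l a b p q $ 0 = (\<Sum>i'\<in>UNIV. \<Sum>j'\<in>UNIV. if i' = i \<and> j' = j then
 (if p = 0 \<and> q = 0 then ?l i' k a $ 0 * ?t j' l b $ 0 else 0) else 0)"
 unfolding left_term_def fps_sum_nth fps_mult_nth_0 Rshift_nth_0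
 by (intro sum.cong[OF refl]) auto
 then show ?thesis by (simp only: sum2)
 qed
 have R0: "right_term s t \<kappa>' i j k l a b p q $ 0 = (if p = 0 \<and> q = 0 then ?l i k a $ 0 * ?t j l b $ 0 else 0)" for p q
 proof -
 have "right_term s t \<kappa>' i j k l a b p q $ 0 = (\<Sum>i'\<in>UNIV. \<Sum>j'\<in>UNIV. if i' = k \<and> j' = l then
 (if p = 0 \<and> q = 0 then ?l i i' a $ 0 * ?t j j' b $ 0 else 0) else 0)"
 unfolding right_term_def fps_sum_nth fps_mult_nth_0 Rshift_nth_0
 by (intro sum.cong[OF refl]) (auto simp: c0)
 then show ?thesis by (simp only: sum2)
 qed
 have nth1: "(x * y * z) $ 1 = x $ 0 * (y * z) $ 1 + x $ 1 * (y $ 0 * z $ 0)" for x y z :: "'n free"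
 by (simp add: mult.assoc fps_mult_nth)
 have nth1': "(x * y * z) $ 1 = (x * y) $ 1 * z $ 0 + x $ 0 * y $ 0 * z $ 1" for x y z :: "'n free"
 by (simp add: fps_mult_nth algebra_simps)
 define m where "m p q = (if p = 0 \<and> q = 0 then (?l i k a * ?t j l b) $ 1 else 0)
 + Rshift \<kappa> i j k l $ p $ q $ 1 * \<delta> p q" for p q
 have L1: "left_term s t \<kappa> i j k l a b p q $ 1 = m p q" for p q
 proof -
 have "left_term s t \<kappa> i j k l a b p q $ 1 =
 (\<Sum>i'\<in>UNIV. \<Sum>j'\<in>UNIV. if i' = i \<and> j' = j then (if p = 0 \<and> q = 0 then (?l i' k a * ?t j' l b) $ 1 else 0) else 0)
 + (\<Sum>i'\<in>UNIV. \<Sum>j'\<in>UNIV. if i' = k \<and> j' = l then Rshift \<kappa> i j i' j' $ p $ q $ 1 * \<delta> p q else 0)"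
 unfolding left_term_def fps_sum_nth nth1 Rshift_nth_0 sum.distrib[symmetric]
 by (intro sum.cong[OF refl]) (auto simp: lcoeff_nth_0 \<delta>_def)
 then show ?thesis by (simp only: sum2 m_def)
 qed
 have comm: "(?t j l b * ?l i k a) $ 1 = (?l i k a * ?t j l b) $ 1"
 by (simp add: fps_mult_nth lcoeff_nth_0)
 have R1: "right_term s t \<kappa>' i j k l a b p q $ 1 = m p q" for p q
 proof -
 have "right_term s t \<kappa>' i j k l a b p q $ 1 =
 (\<Sum>i'\<in>UNIV. \<Sum>j'\<in>UNIV. if i' = k \<and> j' = l then (if p = 0 \<and> q = 0 then (?t j j' b * ?l i i' a) $ 1 else 0) else 0)
 + (\<Sum>i'\<in>UNIV. \<Sum>j'\<in>UNIV. if i' = i \<and> j' = j then Rshift \<kappa>' i' j' k l $ p $ q $ 1 * \<delta> p q else 0)"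
 unfolding right_term_def fps_sum_nth nth1' Rshift_nth_0 sum.distrib[symmetric]
 by (intro sum.cong[OF refl]) (auto simp: lcoeff_nth_0 \<delta>_def)
 then show ?thesis by (simp only: sum2 m_def comm Rshift_nth_1[OF k0])
 qed
 have pr: "rll_left s t \<kappa> i j k l a b $ m - rll_right s t \<kappa>' i j k l a b $ m = 0" if "m < 2" for m
 proof (cases "m = 0")
 case True
 then show ?thesis
 unfolding rll_box(1)[OF \<kappa>(1) K that] rll_box(2)[OF \<kappa>(2) K that]
 unfolding True fps_sum_nth L0 R0 by simp
 next
 case False
 then have m1: "m = 1" using that by simp
 show ?thesis
 unfolding rll_box(1)[OF \<kappa>(1) K that] rll_box(2)[OF \<kappa>(2) K that]
 unfolding m1 fps_sum_nth L1 R1 by simp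
 qed
 then obtain z where z: "rll_left s t \<kappa> i j k l a b - rll_right s t \<kappa>' i j k l a b = hh ^ 2 * z"
 using hh_divI[of 2 "rll_left s t \<kappa> i j k l a b - rll_right s t \<kappa>' i j k l a b"] by auto
 then have "hh ^ 2 * z \<in> relators" using rel by metis
 then have "z \<in> cancelled_relators" unfolding cancelled_relators_def by blast
 then have "z \<in> Icr" by (intro Icr_zero to_cr_cancelled)
 then have "e2 (hh ^ 2 * z) = 0" by (simp only: e2_hh2_eq_0_iff)
 then show ?thesis using z by (metis e2_hom(3) right_minus_eq)
qed

section \<open>The relations between \<open>L^+\<close> and \<open>L^-\<close>\<close>

definition lc :: "bool \<Rightarrow> 'n::finite \<Rightarrow> 'n \<Rightarrow> int \<Rightarrow> 'n ecr" where
 "lc s i j e = e2 (lcoeff s i j e)"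

lemma lc_eq_0: "e > 0 \<Longrightarrow> lc True i j e = 0" "e < 0 \<Longrightarrow> lc False i j e = 0"
 by (simp_all add: lc_def lcoeff_eq_0)

definition es :: "complex fps \<Rightarrow> 'n::finite ecr" where
 "es c = e2 (scal c)"

lemma rhom_es: "rhom es"
 using rhom_comp[OF rhom_e2 rhom_scal] by (simp add: es_def[abs_def])

lemma es_simps [simp]: "es 1 = 1" "es 0 = 0" "es fps_X = hE"
 by (simp_all add: es_def scal_X hE_def)

lemma es_central: "es c * x = x * es c"
 using e2_surj[of x] scal_central[of c] unfolding es_def by (metis e2_hom(2))

text \<open>The expansion of (u - v - \<kappa>)^(-1), with u^(-1) as outer, v as inner and h as
  innermost variable; \<open>fom n \<kappa>\<close> below is f(u - v - \<kappa>).\<close>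

definition omega :: "complex fps \<Rightarrow> complex fps fps fps" where
 "omega \<kappa> = inv_minus (fps_X + fps_const \<kappa>)"

definition lft :: "complex fps fps \<Rightarrow> complex fps fps fps" where
 "lft = fmap fps_const"

definition fom :: "nat \<Rightarrow> complex fps \<Rightarrow> complex fps fps fps" where
 "fom n \<kappa> = lft (fser n) oo omega \<kappa>"

lemma rhom_lft: "rhom lft"
 unfolding lft_def by (intro rhom_fmap rhom_fps_const)

lemma lft_simps: "lft 1 = 1" "lft fps_X = fps_X" "lft (fps_const c) = fps_const (fps_const c)"
 unfolding lft_def by (simp_all add: fmap_1 fmap_X fmap_const)

lemma omega_0: "omega \<kappa> $ 0 = 0"
 by (simp add: omega_def)

lemma omega_mult: "omega \<kappa> * (1 - fps_const (fps_X + fps_const \<kappa>) * fps_X) = fps_X"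
 unfolding omega_def by (rule inv_minus_mult)

lemma inv_minus_omega: "inv_minus (fps_const c) oo omega \<kappa> = omega (\<kappa> + c)"
proof -
 let ?y = "inv_minus (fps_const c) oo omega \<kappa>"
 let ?d = "1 - fps_const (fps_X + fps_const \<kappa>) * fps_X :: complex fps fps fps"
 let ?d' = "1 - fps_const (fps_X + fps_const (\<kappa> + c)) * fps_X :: complex fps fps fps"
 have "(inv_minus (fps_const c) * (1 - fps_const (fps_const c) * fps_X)) oo omega \<kappa> = fps_X oo omega \<kappa>"
 by (simp only: inv_minus_mult)
 then have 1: "?y * (1 - fps_const (fps_const c) * omega \<kappa>) = omega \<kappa>"
 by (simp add: omega_0 fps_compose_mult_distrib fps_compose_sub_distrib fps_X_fps_compose_startby0)
 have "?y * ?d' = ?y * (?d - fps_const (fps_const c) * (omega \<kappa> * ?d))"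
 unfolding omega_mult by (simp add: fps_const_add[symmetric] distrib_right del: fps_const_add)
 also have "\<dots> = ?y * (1 - fps_const (fps_const c) * omega \<kappa>) * ?d" by (simp add: algebra_simps)
 also have "\<dots> = omega (\<kappa> + c) * ?d'" unfolding 1 omega_mult ..
 finally have "?y * ?d' = omega (\<kappa> + c) * ?d'" .
 moreover have "?d' \<noteq> 0"
 proof
 assume "?d' = 0"
 then have "?d' $ 0 = 0" by (metis fps_zero_nth)
 then show False by simp
 qed
 ultimately show ?thesis by simp
qed

lemma fom_shift:
 assumes "n > 0"
 shows "fom n (\<kappa> + of_nat n * fps_X) = (1 - fps_const (fps_const (fps_X ^ 2)) * omega \<kappa> ^ 2) * fom n \<kappa>"
proof -
 let ?a = "of_nat n * fps_X :: complex fps"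
 have h: "rhom (fps_const :: complex fps \<Rightarrow> complex fps fps)" "fps_const (1 :: complex fps) = 1"
 by (simp_all add: rhom_fps_const)
 have "lft (fser n oo inv_minus ?a) = lft (fser n) oo inv_minus (fps_const ?a)"
 unfolding lft_def fmap_compose[OF h] fmap_inv_minus[OF h] ..
 then have 1: "lft (fser n) oo inv_minus (fps_const ?a) = (1 - fps_const (fps_const (fps_X ^ 2)) * fps_X ^ 2) * lft (fser n)"
 unfolding fser_spec(2)[OF assms] rhomD[OF rhom_lft] lft_simps rhom_power[OF rhom_lft lft_simps(1)] by simp
 have "fom n (\<kappa> + ?a) = lft (fser n) oo (inv_minus (fps_const ?a) oo omega \<kappa>)"
 unfolding fom_def inv_minus_omega ..
 also have "\<dots> = (lft (fser n) oo inv_minus (fps_const ?a)) oo omega \<kappa>"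
 by (rule fps_compose_assoc) (simp_all add: omega_0)
 finally show ?thesis
 unfolding 1 fom_def
 by (simp add: omega_0 fps_compose_mult_distrib fps_compose_sub_distrib fps_compose_power[symmetric])
qed

lemma Rentry_compose:
 fixes i :: "'n::finite"
 shows "lft (Rentry i j k l) oo omega \<kappa> = fom CARD('n) \<kappa> * ((if i = k \<and> j = l then 1 else 0)
 + fps_const (fps_const fps_X) * omega \<kappa> * (if i = l \<and> j = k then 1 else 0))"
proof -
 have 1: "lft (if Q then 1 else 0) oo omega \<kappa> = (if Q then 1 else 0)" for Q
 by (simp add: lft_simps rhomD(3)[OF rhom_lft])
 have "lft (Rentry i j k l) = lft (fser CARD('n)) * (lft (if i = k \<and> j = l then 1 else 0)
 + fps_const (fps_const fps_X) * fps_X * lft (if i = l \<and> j = k then 1 else 0))"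
 unfolding Rentry_def rhomD(1,2)[OF rhom_lft] lft_simps ..
 then have "lft (Rentry i j k l) oo omega \<kappa> = (lft (fser CARD('n)) oo omega \<kappa>) *
 ((lft (if i = k \<and> j = l then 1 else 0) oo omega \<kappa>)
 + fps_const (fps_const fps_X) * omega \<kappa> * (lft (if i = l \<and> j = k then 1 else 0) oo omega \<kappa>))"
 by (simp only: omega_0 fps_compose_mult_distrib fps_compose_add_distrib
 fps_X_fps_compose_startby0 fps_const_compose)
 then show ?thesis unfolding 1 fom_def .
qed

lemma Rshift_scal:
 fixes i :: "'n::finite"
 shows "Rshift (scal \<kappa>) i j k l $ p $ q = scal ((lft (Rentry i j k l) oo omega \<kappa>) $ p $ q)"
proof -
 have s: "rhom (scal :: complex fps \<Rightarrow> 'n free)" "scal 1 = (1 :: 'n free)" by (simp_all add: rhom_scal)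
 have s1: "rhom (fmap (scal :: complex fps \<Rightarrow> 'n free))" "fmap scal 1 = (1 :: 'n free fps)"
 using rhom_fmap[OF s(1)] by (simp_all add: fmap_1)
 have "fmap (fmap (scal :: complex fps \<Rightarrow> 'n free)) (lft (Rentry i j k l) oo omega \<kappa>)
 = fmap (fmap scal) (lft (Rentry i j k l)) oo inv_minus (fmap scal (fps_X + fps_const \<kappa>))"
 unfolding fmap_compose[OF s1] omega_def fmap_inv_minus[OF s1] ..
 also have "fmap scal (fps_X + fps_const \<kappa>) = (fps_X + fps_const (scal \<kappa>) :: 'n free fps)"
 unfolding rhomD[OF s1(1)] by (simp add: fmap_X fmap_const)
 also have "fmap (fmap scal) (lft (Rentry i j k l)) = Abs_fps (\<lambda>p. fps_const (scal (Rentry i j k l $ p) :: 'n free))"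
 by (simp add: fps_eq_iff lft_def)
 also have "\<dots> oo inv_minus (fps_X + fps_const (scal \<kappa>)) = Rshift (scal \<kappa>) i j k l"
 by (simp add: Rshift_def)
 finally have eq: "Rshift (scal \<kappa>) i j k l = fmap (fmap scal) (lft (Rentry i j k l) oo omega \<kappa>)" by (rule sym)
 show ?thesis unfolding eq by simp
qed

lemma central_power_eq:
 fixes H :: "'a::monoid_mult"
 assumes "H * y = H * y'" and c: "\<And>x. H * x = x * H"
 shows "H * y ^ m = H * y' ^ m"
proof (induction m)
 case (Suc m)
 have "H * y ^ Suc m = (H * y) * y ^ m" by (simp add: mult.assoc)
 also have "\<dots> = y' * (H * y ^ m)" unfolding assms(1) c[of y'] by (simp only: mult.assoc)
 also have "\<dots> = (H * y') * y' ^ m" unfolding Suc c[of y'] by (simp only: mult.assoc)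
 finally show ?case by (simp add: mult.assoc)
qed simp

text \<open>The shift occurs only in coefficients of positive order of R, which are divisible by h.
  So it matters only after multiplication by h, and in this form the central element can be replaced
  by -n.\<close>

lemma e2_Rshift_cong:
 fixes i :: "'n::finite"
 assumes "hE * e2 \<kappa> = hE * e2 \<kappa>'"
 shows "e2 (Rshift \<kappa> i j k l $ p $ q) = e2 (Rshift \<kappa>' i j k l $ p $ q)"
proof -
 have h: "rhom (fmap (e2 :: 'n free \<Rightarrow> _))" "fmap e2 1 = (1 :: 'n ecr fps)"
 using rhom_fmap[OF rhom_e2] by (simp_all add: fmap_1)
 have h2: "rhom (fmap (fmap (e2 :: 'n free \<Rightarrow> _)))" "fmap (fmap e2) 1 = (1 :: 'n ecr fps fps)"
 using rhom_fmap[OF h(1)] h by (simp_all add: fmap_1 rhomD(3)[OF h(1)])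
 let ?H1 = "fps_const hE :: 'n ecr fps" and ?H = "fps_const (fps_const hE) :: 'n ecr fps fps"
 have c1: "?H1 * x = x * ?H1" for x by (simp add: fps_eq_iff hE_central)
 have c2: "?H * x = x * ?H" for x by (simp add: fps_eq_iff c1)
 have e: "fmap (fmap e2) (inv_minus (fps_X + fps_const \<kappa>) ^ r) = inv_minus (fps_X + fps_const (e2 \<kappa>)) ^ r" for r and \<kappa> :: "'n free"
 unfolding rhom_power[OF h2] fmap_inv_minus[OF h] rhomD(1)[OF h(1)] by (simp add: fmap_X fmap_const)
 have "?H1 * (fps_X + fps_const (e2 \<kappa>)) = ?H1 * (fps_X + fps_const (e2 \<kappa>'))"
 using assms by (simp add: distrib_left)
 then have "?H1 * (fps_X + fps_const (e2 \<kappa>)) ^ m = ?H1 * (fps_X + fps_const (e2 \<kappa>')) ^ m" for m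
 using c1 by (rule central_power_eq)
 then have "?H * inv_minus (fps_X + fps_const (e2 \<kappa>)) = ?H * inv_minus (fps_X + fps_const (e2 \<kappa>'))"
 by (simp add: fps_eq_iff inv_minus_def)
 then have "?H * inv_minus (fps_X + fps_const (e2 \<kappa>)) ^ r = ?H * inv_minus (fps_X + fps_const (e2 \<kappa>')) ^ r" for r
 using c2 by (rule central_power_eq)
 then have "(?H * fmap (fmap e2) (inv_minus (fps_X + fps_const \<kappa>) ^ r)) $ p $ q
 = (?H * fmap (fmap e2) (inv_minus (fps_X + fps_const \<kappa>') ^ r)) $ p $ q" for r
 unfolding e by simp
 then have 1: "hE * e2 ((inv_minus (fps_X + fps_const \<kappa>) ^ r) $ p $ q) = hE * e2 ((inv_minus (fps_X + fps_const \<kappa>') ^ r) $ p $ q)" for r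
 by simp
 have "e2 (scal (Rentry i j k l $ r)) * e2 ((inv_minus (fps_X + fps_const \<kappa>) ^ r) $ p $ q)
 = e2 (scal (Rentry i j k l $ r)) * e2 ((inv_minus (fps_X + fps_const \<kappa>') ^ r) $ p $ q)" for r
 proof (cases "r = 0")
 case False
 have "Rentry i j k l $ r $ 0 = 0" using False Rentry_nth_nth[of i j k l r 0] by auto
 then have "Rentry i j k l $ r = fps_shift 1 (Rentry i j k l $ r) * fps_X"
 by (simp add: fps_eq_iff fps_mult_fps_X_plus_1_nth split: nat.split)
 then obtain w where "Rentry i j k l $ r = w * fps_X" by blast
 then have "e2 (scal (Rentry i j k l $ r)) = e2 (scal w) * (hE :: 'n ecr)"
 using rhomD(2)[OF rhom_es[where 'a = 'n]] es_simps(3) unfolding es_def by metis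
 then show ?thesis using 1[of r] by (simp add: mult.assoc)
 qed simp
 then show ?thesis unfolding Rshift_nth e2_sum e2_hom by (intro sum.cong[OF refl])
qed

lemma fps_cancel_unit:
 fixes F :: "'a::ring_1 fps"
 assumes "F $ 0 = 1" "F * x = F * y"
 shows "x = y"
proof -
 have z: "F * (x - y) = 0" using assms(2) by (simp add: right_diff_distrib)
 have "(x - y) $ n = 0" for n
 proof (induction n rule: less_induct)
 case (less n)
 have "0 = (\<Sum>i=0..n. F $ i * (x - y) $ (n - i))"
 using arg_cong[OF z, of "\<lambda>g. g $ n"] by (simp add: fps_mult_nth)
 also have "\<dots> = (\<Sum>i\<in>{0}. F $ i * (x - y) $ (n - i))"
 by (rule sum.mono_neutral_right) (use less in auto)
 finally show ?case using assms(1) by simp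
 qed
 then show ?thesis by (simp add: fps_eq_iff)
qed

definition Phi :: "complex fps fps fps \<Rightarrow> 'n::finite ecr fps fps" where
 "Phi = fmap (fmap es)"

lemma rhom_Phi: "rhom (Phi :: _ \<Rightarrow> 'n::finite ecr fps fps)"
 unfolding Phi_def by (intro rhom_fmap rhom_es)

lemma Phi_simps: "Phi 1 = 1" "Phi x $ p $ q = es (x $ p $ q)" "Phi fps_X = fps_X"
 "Phi (fps_const (fps_const c)) = fps_const (fps_const (es c))" "Phi (fps_const fps_X) = fps_const fps_X"
 by (auto simp: Phi_def fps_eq_iff fps_X_def)

lemma fps_central:
 fixes x :: "'a::ring_1 fps"
 assumes "\<And>n z. x $ n * z = z * x $ n"
 shows "x * y = y * x"
proof (rule fps_ext)
 fix n
 have "(x * y) $ n = (\<Sum>i=0..n. x $ (n - i) * y $ i)"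
 unfolding fps_mult_nth by (rule sum.reindex_bij_witness[of _ "\<lambda>i. n - i" "\<lambda>i. n - i"]) auto
 then show "(x * y) $ n = (y * x) $ n" by (simp add: fps_mult_nth assms)
qed

lemma Phi_central: "Phi x * y = y * Phi x"
 by (intro fps_central) (simp add: Phi_simps es_central)

definition lp :: "'n::finite \<Rightarrow> 'n \<Rightarrow> 'n ecr fps fps" where
 "lp i k = Abs_fps (\<lambda>p. fps_const (lc True i k (- int p)))"

definition lm :: "'n::finite \<Rightarrow> 'n \<Rightarrow> 'n ecr fps fps" where
 "lm j l = fps_const (Abs_fps (\<lambda>q. lc False j l (int q)))"

definition half_n :: "nat \<Rightarrow> complex fps" where
 "half_n n = fps_const (of_nat n / 2) * fps_X"

lemma half_hc_eq: "(half_hc :: 'n free) = hh * fps_const (Poly_Mapping.single 0 (1 / 2) * Poly_Mapping.single (Word [Cen]) 1)"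
proof -
 have "(scal (fps_const (1 / 2)) :: 'n free) = fps_const (Poly_Mapping.single 0 (1 / 2))"
 by (auto simp: scal_def fps_eq_iff)
 then show ?thesis unfolding half_hc_def gen_def
 by (simp add: hh_central(1)[symmetric] mult.assoc)
qed

lemma half_hc_deg: "\<forall>z. half_hc $ z \<noteq> 0 \<longrightarrow> z = 1" "\<forall>z. (- half_hc) $ z \<noteq> 0 \<longrightarrow> z = 1"
 unfolding half_hc_eq by (auto simp: fps_X_mult_nth split: if_splits)

text \<open>The difference of the two shifts, multiplied by h, is h^2 times half of c + n, and c + n
  goes to zero in the critical quotient.\<close>

lemma half_hc_crit:
 "hE * e2 (half_hc :: 'n::finite free) = hE * e2 (scal (- half_n CARD('n)))"
 "hE * e2 (- half_hc :: 'n::finite free) = hE * e2 (scal (half_n CARD('n)))"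
proof -
 have s: "scal (fps_const (of_nat CARD('n) / 2) * fps_X) = scal (fps_const (1 / 2)) * hh * (of_nat CARD('n) :: 'n free)"
 proof -
 have "scal (of_nat m) = (of_nat m :: 'n free)" for m
 by (induction m) (simp_all add: rhomD[OF rhom_scal])
 then have "scal (fps_const (1 / 2)) * hh * (of_nat CARD('n) :: 'n free) = scal (fps_const (1 / 2) * fps_X * of_nat CARD('n))"
 by (simp only: rhomD(2)[OF rhom_scal] scal_X)
 also have "fps_const (1 / 2) * fps_X * of_nat CARD('n) = fps_const (of_nat CARD('n) / 2 :: complex) * fps_X"
 by (simp add: fps_of_nat[symmetric] mult.assoc)
 finally show ?thesis by simp
 qed
 have "hh * (half_hc - scal (- half_n CARD('n))) = hh ^ 2 * (scal (fps_const (1 / 2)) * (gen Cen + of_nat CARD('n)) :: 'n free)"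
 unfolding half_hc_def half_n_def rhomD(4)[OF rhom_scal] s
 by (simp add: power2_eq_square algebra_simps)
 (simp add: scal_central[of "fps_const (1/2)"] mult.assoc hh_central(1)[of "scal (fps_const (1/2)) * _"]
 hh_central(1)[of "scal (fps_const (1/2))"] distrib_left)
 moreover have "scal (fps_const (1 / 2)) * (gen Cen + of_nat CARD('n)) \<in> (Icr :: 'n free set)"
 by (rule Icr_zero) (simp only: to_cr_hom(2) to_cr_Cen mult_zero_right)
 ultimately have "e2 (hh * (half_hc - scal (- half_n CARD('n)) :: 'n free)) = 0"
 by (simp only: e2_hh2_eq_0_iff)
 then show 1: "hE * e2 (half_hc :: 'n free) = hE * e2 (scal (- half_n CARD('n)))"
 by (simp add: hE_def right_diff_distrib)
 then show "hE * e2 (- half_hc :: 'n free) = hE * e2 (scal (half_n CARD('n)))"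
 by (simp add: rhomD(4)[OF rhom_scal])
qed

lemma relatorI:
 "rll_left s s 0 i j k l a b - rll_right s s 0 i j k l a b \<in> relators"
 "rll_left True False half_hc i j k l a b - rll_right True False (- half_hc) i j k l a b \<in> relators"
 unfolding relators_def by blast+

lemma mult_fps_lc:
 "(Phi x * lp i k * lm j l) $ A $ B = (\<Sum>p=0..A. \<Sum>q=0..B.
 es (x $ p $ q) * lc True i k (- int A + int p) * lc False j l (int B - int q))"
 "(lm j l * lp i k * Phi x) $ A $ B = (\<Sum>p=0..A. \<Sum>q=0..B.
 lc False j l (int B - int q) * lc True i k (- int A + int p) * es (x $ p $ q))"
proof -
 have 1: "(Phi x * lp i k * lm j l) $ A $ B = (\<Sum>p=0..A. \<Sum>q=0..B. es (x $ p $ q) * (lc True i k (- int (A - p)) * lc False j l (int (B - q))))"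
 unfolding lp_def lm_def
 by (simp add: mult.assoc fps_mult_nth[of "Phi x"] fps_sum_nth)
 (simp add: fps_mult_nth[of "Phi x $ _"] Phi_simps)
 show "(Phi x * lp i k * lm j l) $ A $ B = (\<Sum>p=0..A. \<Sum>q=0..B.
 es (x $ p $ q) * lc True i k (- int A + int p) * lc False j l (int B - int q))"
 unfolding 1 by (intro sum.cong[OF refl]) (simp add: of_nat_diff mult.assoc)
 have c: "lm j l * lp i k * Phi x = Phi x * (lm j l * lp i k)" by (rule Phi_central[symmetric])
 have 2: "(lm j l * lp i k * Phi x) $ A $ B = (\<Sum>p=0..A. \<Sum>q=0..B. es (x $ p $ q) * (lc False j l (int (B - q)) * lc True i k (- int (A - p))))"
 unfolding c unfolding lp_def lm_def
 by (simp add: fps_mult_nth[of "Phi x"] fps_sum_nth)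
 (simp add: fps_mult_nth[of "Phi x $ _"] Phi_simps)
 show "(lm j l * lp i k * Phi x) $ A $ B = (\<Sum>p=0..A. \<Sum>q=0..B.
 lc False j l (int B - int q) * lc True i k (- int A + int p) * es (x $ p $ q))"
 unfolding 2 by (intro sum.cong[OF refl]) (simp add: of_nat_diff es_central mult.assoc)
qed

definition omw :: "complex fps \<Rightarrow> 'n::finite ecr fps fps" where
 "omw \<kappa> = Phi (omega \<kappa>)"

abbreviation hEE :: "'n::finite ecr fps fps" where
 "hEE \<equiv> fps_const (fps_const hE)"

text \<open>For L^+ in the first and L^- in the second copy only p \<le> A and q \<le> B contribute
  to the coefficient of u^(-A) v^B. The infinite sums are finite, and the relation becomes an
  identity between products of formal series.\<close>

lemma PM_raw:
 fixes i j k l :: "'n::finite"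
 defines "\<kappa> \<equiv> half_n CARD('n)"
 shows "(\<Sum>i'\<in>UNIV. \<Sum>j'\<in>UNIV. Phi (lft (Rentry i j i' j') oo omega (- \<kappa>)) * lp i' k * lm j' l)
 = (\<Sum>k'\<in>UNIV. \<Sum>l'\<in>UNIV. lm j l' * lp i k' * Phi (lft (Rentry k' l' k l) oo omega \<kappa>))"
proof (rule fps_ext, rule fps_ext)
 fix A B :: nat
 define K where "K = A + B + 2"
 have large: "large True False (- int A) (int B) N K" for N by (simp add: large_def K_def)
 note box = rll_box[OF _ large]
 have bl: "rll_left True False half_hc i j k l (- int A) (int B) = (\<Sum>p<K. \<Sum>q<K. left_term True False half_hc i j k l (- int A) (int B) p q)"
 by (rule fps_ext) (rule box(1)[OF half_hc_deg(1) lessI])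
 have br: "rll_right True False (- half_hc) i j k l (- int A) (int B) = (\<Sum>p<K. \<Sum>q<K. right_term True False (- half_hc) i j k l (- int A) (int B) p q)"
 by (rule fps_ext) (rule box(2)[OF half_hc_deg(2) lessI])
 have "e2 (rll_left True False half_hc i j k l (- int A) (int B)) = e2 (rll_right True False (- half_hc) i j k l (- int A) (int B))"
 by (rule relator_e2[OF relatorI(2) half_hc_deg]) (use large in blast)
 then have eq: "(\<Sum>p<K. \<Sum>q<K. e2 (left_term True False half_hc i j k l (- int A) (int B) p q))
 = (\<Sum>p<K. \<Sum>q<K. e2 (right_term True False (- half_hc) i j k l (- int A) (int B) p q))"
 unfolding bl br by (simp only: e2_sum)
 have restrict: "(\<Sum>p<K. \<Sum>q<K. f p q) = (\<Sum>p=0..A. \<Sum>q=0..B. f p q)"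
 if "\<And>p q. p > A \<or> q > B \<Longrightarrow> f p q = 0" for f :: "nat \<Rightarrow> nat \<Rightarrow> 'n ecr"
 proof -
 have "(\<Sum>p<K. \<Sum>q<K. f p q) = (\<Sum>p=0..A. \<Sum>q<K. f p q)"
 by (rule sum.mono_neutral_right) (use that in \<open>auto simp: K_def\<close>)
 also have "\<dots> = (\<Sum>p=0..A. \<Sum>q=0..B. f p q)"
 by (intro sum.cong[OF refl] sum.mono_neutral_right) (use that in \<open>auto simp: K_def\<close>)
 finally show ?thesis .
 qed
 have R1: "e2 (Rshift half_hc i1 j1 k1 l1 $ p $ q) = es ((lft (Rentry i1 j1 k1 l1) oo omega (- \<kappa>)) $ p $ q)" for i1 j1 k1 l1 :: 'n and p q
 unfolding e2_Rshift_cong[OF half_hc_crit(1)] Rshift_scal es_def \<kappa>_def ..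
 have R2: "e2 (Rshift (- half_hc) i1 j1 k1 l1 $ p $ q) = es ((lft (Rentry i1 j1 k1 l1) oo omega \<kappa>) $ p $ q)" for i1 j1 k1 l1 :: 'n and p q
 unfolding e2_Rshift_cong[OF half_hc_crit(2)] Rshift_scal es_def \<kappa>_def ..
 have L: "(\<Sum>p<K. \<Sum>q<K. e2 (left_term True False half_hc i j k l (- int A) (int B) p q))
 = (\<Sum>i'\<in>UNIV. \<Sum>j'\<in>UNIV. Phi (lft (Rentry i j i' j') oo omega (- \<kappa>)) * lp i' k * lm j' l) $ A $ B"
 proof -
 have "(\<Sum>p<K. \<Sum>q<K. e2 (left_term True False half_hc i j k l (- int A) (int B) p q))
 = (\<Sum>p=0..A. \<Sum>q=0..B. \<Sum>i'\<in>UNIV. \<Sum>j'\<in>UNIV. es ((lft (Rentry i j i' j') oo omega (- \<kappa>)) $ p $ q) *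
 lc True i' k (- int A + int p) * lc False j' l (int B - int q))"
 unfolding left_term_def e2_sum e2_hom(2) R1 lc_def[symmetric]
 by (rule restrict) (auto simp: lc_eq_0)
 also have "\<dots> = (\<Sum>i'\<in>UNIV. \<Sum>j'\<in>UNIV. \<Sum>p=0..A. \<Sum>q=0..B. es ((lft (Rentry i j i' j') oo omega (- \<kappa>)) $ p $ q) *
 lc True i' k (- int A + int p) * lc False j' l (int B - int q))"
 by (simp only: sum.swap[of _ "UNIV :: 'n set" "{0..A}"] sum.swap[of _ "UNIV :: 'n set" "{0..B}"])
 finally show ?thesis by (simp only: fps_sum_nth mult_fps_lc)
 qed
 have R: "(\<Sum>p<K. \<Sum>q<K. e2 (right_term True False (- half_hc) i j k l (- int A) (int B) p q))
 = (\<Sum>k'\<in>UNIV. \<Sum>l'\<in>UNIV. lm j l' * lp i k' * Phi (lft (Rentry k' l' k l) oo omega \<kappa>)) $ A $ B"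
 proof -
 have "(\<Sum>p<K. \<Sum>q<K. e2 (right_term True False (- half_hc) i j k l (- int A) (int B) p q))
 = (\<Sum>p=0..A. \<Sum>q=0..B. \<Sum>k'\<in>UNIV. \<Sum>l'\<in>UNIV. lc False j l' (int B - int q) *
 lc True i k' (- int A + int p) * es ((lft (Rentry k' l' k l) oo omega \<kappa>) $ p $ q))"
 unfolding right_term_def e2_sum e2_hom(2) R2 lc_def[symmetric]
 by (rule restrict) (auto simp: lc_eq_0)
 also have "\<dots> = (\<Sum>k'\<in>UNIV. \<Sum>l'\<in>UNIV. \<Sum>p=0..A. \<Sum>q=0..B. lc False j l' (int B - int q) *
 lc True i k' (- int A + int p) * es ((lft (Rentry k' l' k l) oo omega \<kappa>) $ p $ q))"
 by (simp only: sum.swap[of _ "UNIV :: 'n set" "{0..A}"] sum.swap[of _ "UNIV :: 'n set" "{0..B}"])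
 finally show ?thesis by (simp only: fps_sum_nth mult_fps_lc)
 qed
 show "(\<Sum>i'\<in>UNIV. \<Sum>j'\<in>UNIV. Phi (lft (Rentry i j i' j') oo omega (- \<kappa>)) * lp i' k * lm j' l) $ A $ B
 = (\<Sum>k'\<in>UNIV. \<Sum>l'\<in>UNIV. lm j l' * lp i k' * Phi (lft (Rentry k' l' k l) oo omega \<kappa>)) $ A $ B"
 using eq unfolding L R .
qed

lemma sum_delta2:
 fixes F :: "'n::finite \<Rightarrow> 'n \<Rightarrow> 'a::comm_monoid_add"
 shows "(\<Sum>i'\<in>UNIV. \<Sum>j'\<in>UNIV. if i' = k \<and> j' = l then F i' j' else 0) = F k l"
proof -
 have "(\<Sum>j'\<in>UNIV. if i' = k \<and> j' = l then F i' j' else 0) = (if i' = k then F i' l else 0)" for i'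
 by (cases "i' = k") simp_all
 then show ?thesis by simp
qed

lemma sum_delta2':
 fixes F :: "'n::finite \<Rightarrow> 'n \<Rightarrow> 'a::comm_monoid_add"
 shows "(\<Sum>i'\<in>UNIV. \<Sum>j'\<in>UNIV. if k = i' \<and> l = j' then F i' j' else 0) = F k l"
 "(\<Sum>i'\<in>UNIV. \<Sum>j'\<in>UNIV. if l = j' \<and> k = i' then F i' j' else 0) = F k l"
 using sum_delta2[of k l F] by (simp_all only: eq_commute[of k] eq_commute[of l] conj_commute)

text \<open>At the critical level the two arguments of f differ by nh, which is the shift in its
  functional equation: with w = h / (u - v + hn/2), the f on the right is 1 - w^2 times the f on the
  left. So f cancels and leaves the rational factor 1 - w^2.\<close>

theorem PM:
 fixes i j k l :: "'n::finite"
 defines "\<kappa> \<equiv> half_n CARD('n)"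
 shows "lp i k * lm j l = lm j l * lp i k + hEE * omw \<kappa> * lm j k * lp i l
 - hEE * omw (- \<kappa>) * lm i l * lp j k - hEE * omw (- \<kappa>) * hEE * omw \<kappa> * lm i k * lp j l"
proof -
 let ?f = "Phi (fom CARD('n) (- \<kappa>)) :: 'n ecr fps fps"
 define w z where "w = hEE * (omw (- \<kappa>) :: 'n ecr fps fps)" and "z = hEE * (omw \<kappa> :: 'n ecr fps fps)"
 have hP: "hEE = (Phi (fps_const (fps_const fps_X)) :: 'n ecr fps fps)" by (simp add: Phi_simps)
 have wP: "w = Phi (fps_const (fps_const fps_X) * omega (- \<kappa>))" "z = Phi (fps_const (fps_const fps_X) * omega \<kappa>)"
 unfolding w_def z_def omw_def hP by (simp_all only: rhomD(2)[OF rhom_Phi])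
 have cw: "w * x = x * w" "z * x = x * z" for x unfolding wP by (rule Phi_central)+
 have PR: "Phi (lft (Rentry a b c d) oo omega \<kappa>') = Phi (fom CARD('n) \<kappa>') * ((if a = c \<and> b = d then 1 else 0) +
 Phi (fps_const (fps_const fps_X) * omega \<kappa>') * (if a = d \<and> b = c then 1 else 0) :: 'n ecr fps fps)" for a b c d :: 'n and \<kappa>'
 proof -
 have "Phi (if Q then 1 else 0) = (if Q then 1 else 0 :: 'n ecr fps fps)" for Q
 by (simp add: Phi_simps rhomD(3)[OF rhom_Phi])
 then show ?thesis unfolding Rentry_compose rhomD(1,2)[OF rhom_Phi] by simp
 qed
 have fz: "Phi (fom CARD('n) \<kappa>) = ?f * (1 - w * w)"
 proof -
 have "fom CARD('n) \<kappa> = fom CARD('n) (- \<kappa>) * (1 - (fps_const (fps_const fps_X) * omega (- \<kappa>)) * (fps_const (fps_const fps_X) * omega (- \<kappa>)))"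
 proof -
 have "of_nat CARD('n) = (fps_const (of_nat CARD('n) / 2) + fps_const (of_nat CARD('n) / 2) :: complex fps)"
 by (simp flip: fps_of_nat)
 then have "\<kappa> = - \<kappa> + of_nat CARD('n) * fps_X"
 unfolding \<kappa>_def half_n_def by (simp only: distrib_right) simp
 then have "fom CARD('n) \<kappa> = fom CARD('n) (- \<kappa> + of_nat CARD('n) * fps_X)" by (rule arg_cong)
 moreover have "(1 - (c * c) * w' ^ 2) * f = f * (1 - (c * w') * (c * w'))" for c w' f :: "complex fps fps fps"
 by (simp add: power2_eq_square algebra_simps)
 moreover have "fps_const (fps_const (fps_X ^ 2)) = fps_const (fps_const fps_X) * (fps_const (fps_const fps_X) :: complex fps fps fps)"
 by (simp add: power2_eq_square)
 ultimately show ?thesis unfolding fom_shift[OF zero_less_card_finite] by (simp only:)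
 qed
 then show ?thesis unfolding wP rhomD(5)[OF rhom_Phi, symmetric] by (simp only: rhomD[OF rhom_Phi] Phi_simps(1))
 qed
 have f0: "?f $ 0 = 1"
 proof -
 have "fom CARD('n) (- \<kappa>) $ 0 = 1"
 unfolding fom_def by (simp add: lft_def fser_spec(1) fcoef.simps[of _ 0])
 then show ?thesis unfolding Phi_def by (simp add: fmap_1)
 qed
 have aux: "F * ((if P then 1 else 0) + W * (if Q then 1 else 0)) * X * Y
 = (if P then F * (X * Y) else 0) + (if Q then F * (W * (X * Y)) else 0)"
 for F W X Y :: "'n ecr fps fps" and P Q
 by (cases P; cases Q) (simp_all add: distrib_left distrib_right mult.assoc)
 have pc: "lm j l * lp i k * Phi r = Phi r * lm j l * lp i k" for i j k l :: 'n and r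
 unfolding mult.assoc[of "Phi r"] by (rule Phi_central[symmetric])
 have star: "lp i k * lm j l + w * (lp j k * lm i l) = (1 - w * w) * (lm j l * lp i k + z * (lm j k * lp i l))" for i j k l :: 'n
 proof -
 have "(\<Sum>i'\<in>UNIV. \<Sum>j'\<in>UNIV. Phi (lft (Rentry i j i' j') oo omega (- \<kappa>)) * lp i' k * lm j' l)
 = (\<Sum>i'\<in>UNIV. \<Sum>j'\<in>UNIV. if i = i' \<and> j = j' then ?f * (lp i' k * lm j' l) else 0)
 + (\<Sum>i'\<in>UNIV. \<Sum>j'\<in>UNIV. if i = j' \<and> j = i' then ?f * (w * (lp i' k * lm j' l)) else 0)"
 by (simp only: PR wP[symmetric] sum.distrib[symmetric] aux)
 also have "\<dots> = ?f * (lp i k * lm j l + w * (lp j k * lm i l))"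
 by (simp only: sum_delta2' distrib_left)
 finally have l: "(\<Sum>i'\<in>UNIV. \<Sum>j'\<in>UNIV. Phi (lft (Rentry i j i' j') oo omega (- \<kappa>)) * lp i' k * lm j' l) = \<dots>" .
 have "(\<Sum>k'\<in>UNIV. \<Sum>l'\<in>UNIV. lm j l' * lp i k' * Phi (lft (Rentry k' l' k l) oo omega \<kappa>))
 = (\<Sum>k'\<in>UNIV. \<Sum>l'\<in>UNIV. if k' = k \<and> l' = l then ?f * ((1 - w * w) * (lm j l' * lp i k')) else 0)
 + (\<Sum>k'\<in>UNIV. \<Sum>l'\<in>UNIV. if k' = l \<and> l' = k then ?f * ((1 - w * w) * (z * (lm j l' * lp i k'))) else 0)"
 unfolding pc unfolding PR fz wP(2)[symmetric] sum.distrib[symmetric] aux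
 by (simp only: mult.assoc)
 also have "\<dots> = ?f * ((1 - w * w) * (lm j l * lp i k + z * (lm j k * lp i l)))"
 by (simp only: sum_delta2 distrib_left)
 finally have r: "(\<Sum>k'\<in>UNIV. \<Sum>l'\<in>UNIV. lm j l' * lp i k' * Phi (lft (Rentry k' l' k l) oo omega \<kappa>)) = \<dots>" .
 show ?thesis
 by (rule fps_cancel_unit[OF f0]) (use PM_raw[of i j k l, folded \<kappa>_def] in \<open>simp only: l r\<close>)
 qed
 \<comment> \<open>Multiplication by 1 - w P inverts the factor 1 + w P on the left up to 1 - w^2,
   which is invertible because w has no constant term.\<close>
 have "(1 - w * w) * (lp i k * lm j l) = (lp i k * lm j l + w * (lp j k * lm i l)) - w * (lp j k * lm i l + w * (lp i k * lm j l))"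
 by (simp add: algebra_simps)
 also have "\<dots> = (1 - w * w) * (lm j l * lp i k + z * (lm j k * lp i l) - w * (lm i l * lp j k + z * (lm i k * lp j l)))"
 unfolding star by (simp add: algebra_simps)
 finally have "lp i k * lm j l = lm j l * lp i k + z * (lm j k * lp i l) - w * (lm i l * lp j k + z * (lm i k * lp j l))"
 proof (rule fps_cancel_unit[rotated])
 have "(Phi (omega (- \<kappa>)) :: 'n ecr fps fps) $ 0 = 0"
 by (rule fps_ext) (simp add: Phi_simps omega_0)
 then show "(1 - w * w) $ 0 = 1" by (simp add: w_def omw_def)
 qed
 then show ?thesis by (simp add: w_def z_def algebra_simps)
qed

section \<open>The relations between series of the same sign\<close>

text \<open>Let D be the coefficients of (u - v) [L(u), L(v)] plus the h-term. The defining relation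
  says that the convolution of D with g, the coefficients of f(u - v) / (u - v), vanishes. As g
  starts with u^(-1), has no terms with p \<le> q, and its coefficients are divisible by h^(p-q-1),
  the convolution can be inverted and D itself is zero.\<close>

theorem SS:
 fixes i j k l :: "'n::finite"
 shows "lc s i k (a - 1) * lc s j l b - lc s j l b * lc s i k (a - 1)
 - (lc s i k a * lc s j l (b - 1) - lc s j l (b - 1) * lc s i k a)
 + hE * (lc s j k a * lc s i l b - lc s j k b * lc s i l a) = 0"
proof -
 define G where "G a b = lc s i k a * lc s j l b - lc s j l b * lc s i k a" for a b
 define Hf where "Hf a b = lc s j k a * lc s i l b - lc s j k b * lc s i l a" for a b
 define D where "D a b = G (a - 1) b - G a (b - 1) + hE * Hf a b" for a b
 define \<gamma> where "\<gamma> = fom CARD('n) 0 * omega 0"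
 define g where "g p q = (es (\<gamma> $ p $ q) :: 'n ecr)" for p q
 have homO: "homog 1 (omega 0)" unfolding omega_def by (rule homog_inv_minus) simp
 have "homog 0 (fom CARD('n) 0)"
 unfolding homog_def
 proof (intro allI impI)
 fix P q m assume "fom CARD('n) 0 $ P $ q $ m \<noteq> 0"
 then have "(\<Sum>r=0..P. (fps_const (fser CARD('n) $ r) * (omega 0 ^ r) $ P) $ q $ m) \<noteq> 0"
 by (simp add: fom_def lft_def fps_compose_nth fps_sum_nth)
 then obtain r where "(fps_const (fser CARD('n) $ r) * (omega 0 ^ r) $ P) $ q $ m \<noteq> 0" by (rule sum_neq_0E)
 then have "(fps_X ^ r * (omega 0 ^ r) $ P $ q) $ m \<noteq> 0"
 unfolding fser_spec(1)[OF zero_less_card_finite] by (auto simp: mult.assoc)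
 then have "m \<ge> r" "(omega 0 ^ r) $ P $ q $ (m - r) \<noteq> 0" by (auto simp: fps_X_power_mult_nth split: if_splits)
 moreover from this have "q + (m - r) + 1 * r = P" using homogD[OF homog_power[OF homO]] by blast
 ultimately show "q + m + 0 = P" by simp
 qed
 then have hom\<gamma>: "homog 1 \<gamma>" unfolding \<gamma>_def using homog_mult[OF _ homO] by fastforce
 have g0: "g p q = 0" if "p \<le> q" for p q
 proof -
 have "\<gamma> $ p $ q = 0" using homogD[OF hom\<gamma>, of p q] that by (auto simp: fps_eq_iff)
 then show ?thesis by (simp add: g_def)
 qed
 have gdiv: "hdiv N (g p q)" if "N + q + 1 \<le> p" for N p q
 proof -
 have "(scal (\<gamma> $ p $ q) :: 'n free) $ m = 0 $ m" if "m < N" for m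
 proof -
 have "\<gamma> $ p $ q $ m = 0" using homogD[OF hom\<gamma>, of p q m] that \<open>N + q + 1 \<le> p\<close> by linarith
 then show ?thesis by (simp add: scal_nth)
 qed
 then have "hdiv N (e2 (scal (\<gamma> $ p $ q) :: 'n free) - e2 0)" by (rule hdiv_e2)
 then show ?thesis by (simp add: g_def es_def)
 qed
 have f0: "fom CARD('n) 0 $ 0 = 1"
 unfolding fom_def by (simp add: lft_def fser_spec(1) fcoef.simps[of _ 0])
 have g10: "g 1 0 = 1"
 unfolding g_def \<gamma>_def by (simp add: fps_mult_nth f0 omega_def)
 have fo: "es (fom CARD('n) 0 $ p $ q) = g (Suc p) q - (if q = 0 then 0 else g p (q - 1))" for p q
 proof -
 have "\<gamma> * (1 - fps_const fps_X * fps_X) = fps_X * fom CARD('n) 0"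
 using omega_mult[of 0] unfolding \<gamma>_def by (simp add: mult.assoc mult.commute)
 moreover have "\<gamma> - fps_X * (fps_const fps_X * \<gamma>) = \<gamma> * (1 - fps_const fps_X * fps_X)"
 by (simp add: algebra_simps)
 ultimately have "(\<gamma> - fps_X * (fps_const fps_X * \<gamma>)) $ Suc p $ q = (fps_X * fom CARD('n) 0) $ Suc p $ q"
 by (simp only:)
 then have "fom CARD('n) 0 $ p $ q = \<gamma> $ Suc p $ q - (fps_X * \<gamma> $ p) $ q"
 by (simp add: fps_X_mult_nth)
 then show ?thesis
 by (simp add: g_def rhomD(5)[OF rhom_es] fps_X_mult_nth)
 qed
 have gc: "g p q * x = x * g p q" for p q x by (simp add: g_def es_central)
 have sc0: "scal 0 = (0 :: 'n free)" by simp
 have R: "e2 (Rshift 0 i1 j1 k1 l1 $ p $ q) = (if i1 = k1 \<and> j1 = l1 then es (fom CARD('n) 0 $ p $ q) else 0)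
 + (if i1 = l1 \<and> j1 = k1 then hE * g p q else 0)" for i1 j1 k1 l1 :: 'n and p q
 proof -
 have "(lft (Rentry i1 j1 k1 l1) oo omega 0) $ p $ q = (if i1 = k1 \<and> j1 = l1 then fom CARD('n) 0 $ p $ q else 0)
 + (if i1 = l1 \<and> j1 = k1 then fps_X * \<gamma> $ p $ q else 0)"
 proof -
 have "(F * ((if P then 1 else 0) + fps_const (fps_const fps_X) * W * (if Q then 1 else 0))) $ p $ q
 = (if P then F $ p $ q else 0) + (if Q then fps_X * (F * W) $ p $ q else 0)"
 for F W :: "complex fps fps fps" and P Q
 proof -
 have e: "F * (fps_const (fps_const fps_X) * W) = fps_const (fps_const fps_X) * (F * W)"
 by (rule mult.left_commute)
 show ?thesis by (cases P; cases Q) (simp_all add: distrib_left e)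
 qed
 then show ?thesis unfolding Rentry_compose \<gamma>_def .
 qed
 then show ?thesis
 using Rshift_scal[of 0 i1 j1 k1 l1 p q] unfolding sc0 g_def
 by (simp only: es_def[symmetric] rhomD[OF rhom_es] if_distrib[of es] es_simps)
 qed
 have ax1: "((if P then F else 0) + (if Q then F' else 0)) * X * Y
 = (if P then F * X * Y else 0) + (if Q then F' * X * Y else 0)"
 and ax2: "Y * X * ((if P then F else 0) + (if Q then F' else 0))
 = (if P then Y * X * F else 0) + (if Q then Y * X * F' else 0)" for F F' X Y :: "'n ecr" and P Q
 by (cases P; cases Q; simp add: distrib_left distrib_right)+
 have tm: "e2 (left_term s s 0 i j k l a b p q) - e2 (right_term s s 0 i j k l a b p q)
 = es (fom CARD('n) 0 $ p $ q) * G (a + int p) (b - int q) + g p q * (hE * Hf (a + int p) (b - int q))" for a b p q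
 proof -
 have "e2 (left_term s s 0 i j k l a b p q) =
 (\<Sum>i'\<in>UNIV. \<Sum>j'\<in>UNIV. if i = i' \<and> j = j' then es (fom CARD('n) 0 $ p $ q) * lc s i' k (a + int p) * lc s j' l (b - int q) else 0)
 + (\<Sum>i'\<in>UNIV. \<Sum>j'\<in>UNIV. if i = j' \<and> j = i' then hE * g p q * lc s i' k (a + int p) * lc s j' l (b - int q) else 0)"
 unfolding left_term_def e2_sum e2_hom(2) R lc_def[symmetric] sum.distrib[symmetric]
 by (simp only: ax1)
 then have l: "e2 (left_term s s 0 i j k l a b p q) = es (fom CARD('n) 0 $ p $ q) * lc s i k (a + int p) * lc s j l (b - int q)
 + hE * g p q * lc s j k (a + int p) * lc s i l (b - int q)" by (simp only: sum_delta2')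
 have "e2 (right_term s s 0 i j k l a b p q) =
 (\<Sum>k'\<in>UNIV. \<Sum>l'\<in>UNIV. if k' = k \<and> l' = l then lc s j l' (b - int q) * lc s i k' (a + int p) * es (fom CARD('n) 0 $ p $ q) else 0)
 + (\<Sum>k'\<in>UNIV. \<Sum>l'\<in>UNIV. if k' = l \<and> l' = k then lc s j l' (b - int q) * lc s i k' (a + int p) * (hE * g p q) else 0)"
 unfolding right_term_def e2_sum e2_hom(2) R lc_def[symmetric] sum.distrib[symmetric]
 by (simp only: ax2)
 then have r: "e2 (right_term s s 0 i j k l a b p q) = lc s j l (b - int q) * lc s i k (a + int p) * es (fom CARD('n) 0 $ p $ q)
 + lc s j k (b - int q) * lc s i l (a + int p) * (hE * g p q)" by (simp only: sum_delta2)
 have 1: "x * es (fom CARD('n) 0 $ p $ q) = es (fom CARD('n) 0 $ p $ q) * x" "x * (hE * g p q) = g p q * (hE * x)"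
 "hE * g p q * x = g p q * (hE * x)" "hE * (g p q * x) = g p q * (hE * x)" for x
 proof -
 show "x * es (fom CARD('n) 0 $ p $ q) = es (fom CARD('n) 0 $ p $ q) * x" by (rule es_central[symmetric])
 have "x * (hE * g p q) = hE * (g p q * x)"
 unfolding gc[of p q x] by (rule commute_left[OF hE_central(1)[symmetric]])
 then show "x * (hE * g p q) = g p q * (hE * x)"
 unfolding commute_left[OF hE_central(1)] .
 show "hE * g p q * x = g p q * (hE * x)"
 unfolding mult.assoc by (rule commute_left[OF hE_central(1)])
 show "hE * (g p q * x) = g p q * (hE * x)" by (rule commute_left[OF hE_central(1)])
 qed
 show ?thesis unfolding l r 1 mult.assoc G_def Hf_def by (simp add: 1 mult.assoc right_diff_distrib)
 qed
 have Gz: "G a b = 0" "Hf a b = 0" if "(s \<and> (a > 0 \<or> b > 0)) \<or> (\<not> s \<and> (a < 0 \<or> b < 0))" for a b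
 proof -
 have "(\<forall>i j :: 'n. lc s i j a = 0) \<or> (\<forall>i j :: 'n. lc s i j b = 0)"
 using that by (cases s) (auto simp: lc_eq_0)
 then show "G a b = 0" "Hf a b = 0" by (auto simp: G_def Hf_def)
 qed
 \<comment> \<open>f is written as u - v times f / (u - v), and the factor u - v is moved to the
   commutators by summation by parts. The bound on K makes the single boundary term divisible by
   h^N.\<close>
 have key: "hdiv N (\<Sum>p<K. \<Sum>q<K. g p q * D (a + int p) (b - int q))"
 if K: "K \<ge> nat (- a) + nat b + N + 3" for a b N K
 proof -
 have large: "large s s a b N' K" if "s \<or> N' = N" for N' using K that by (auto simp: large_def)
 have dl: "hdiv N (e2 (rll_left s s 0 i j k l a b) - e2 (\<Sum>p<K. \<Sum>q<K. left_term s s 0 i j k l a b p q))"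
 "hdiv N (e2 (rll_right s s 0 i j k l a b) - e2 (\<Sum>p<K. \<Sum>q<K. right_term s s 0 i j k l a b p q))"
 by (rule hdiv_e2, rule rll_box[OF _ large], simp_all)+
 have "e2 (rll_left s s 0 i j k l a b) = e2 (rll_right s s 0 i j k l a b)"
 proof (rule relator_e2[OF relatorI(1)])
 show "\<exists>K. large s s a b N K" for N
 by (rule exI[of _ "nat b + nat (- a) + N + 2"]) (auto simp: large_def)
 qed simp_all
 then have "hdiv N (e2 (\<Sum>p<K. \<Sum>q<K. left_term s s 0 i j k l a b p q) - e2 (\<Sum>p<K. \<Sum>q<K. right_term s s 0 i j k l a b p q))"
 using hdiv_simps(3)[OF dl(2,1)] by simp
 then have 1: "hdiv N (\<Sum>p<K. \<Sum>q<K. es (fom CARD('n) 0 $ p $ q) * G (a + int p) (b - int q) + g p q * (hE * Hf (a + int p) (b - int q)))"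
 by (simp only: e2_sum sum_subtractf[symmetric] tm)
 have s1: "(\<Sum>p<K. \<Sum>q<K. g (Suc p) q * G (a + int p) (b - int q))
 = (\<Sum>p<K. \<Sum>q<K. g p q * G (a + int p - 1) (b - int q)) + (\<Sum>q<K. g K q * G (a + int K - 1) (b - int q))"
 proof -
 define F where "F p = (\<Sum>q<K. g p q * G (a + int p - 1) (b - int q))" for p
 have "F 0 = 0" by (simp add: F_def g0)
 then have "(\<Sum>p<K. F (Suc p)) = (\<Sum>p<K. F p) + F K"
 using sum.lessThan_Suc_shift[of F K] by simp
 then show ?thesis by (simp add: F_def algebra_simps)
 qed
 have s2: "(\<Sum>q<K. (if q = 0 then 0 else g p (q - 1)) * G (a + int p) (b - int q))
 = (\<Sum>q<K. g p q * G (a + int p) (b - int q - 1))" if "p < K" for p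
 proof -
 define F where "F q = (if q = 0 then 0 else g p (q - 1)) * G (a + int p) (b - int q)" for q
 have FK: "F K = 0" using g0[of p "K - 1"] that by (auto simp: F_def)
 have "(\<Sum>q<K. F (Suc q)) = (\<Sum>q<K. F q)"
 using sum.lessThan_Suc_shift[of F K] FK by (simp add: F_def)
 then show ?thesis by (simp add: F_def algebra_simps)
 qed
 have "(\<Sum>p<K. \<Sum>q<K. es (fom CARD('n) 0 $ p $ q) * G (a + int p) (b - int q) + g p q * (hE * Hf (a + int p) (b - int q)))
 = (\<Sum>p<K. \<Sum>q<K. g (Suc p) q * G (a + int p) (b - int q))
 - (\<Sum>p<K. \<Sum>q<K. (if q = 0 then 0 else g p (q - 1)) * G (a + int p) (b - int q))
 + (\<Sum>p<K. \<Sum>q<K. g p q * (hE * Hf (a + int p) (b - int q)))"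
 unfolding fo left_diff_distrib by (simp only: sum.distrib sum_subtractf)
 also have "\<dots> = (\<Sum>p<K. \<Sum>q<K. g p q * D (a + int p) (b - int q)) + (\<Sum>q<K. g K q * G (a + int K - 1) (b - int q))"
 unfolding s1 using s2 by (simp add: D_def distrib_left right_diff_distrib sum.distrib sum_subtractf)
 finally have e: "(\<Sum>p<K. \<Sum>q<K. g p q * D (a + int p) (b - int q)) = (\<Sum>p<K. \<Sum>q<K. es (fom CARD('n) 0 $ p $ q) * G (a + int p) (b - int q) + g p q * (hE * Hf (a + int p) (b - int q)))
 - (\<Sum>q<K. g K q * G (a + int K - 1) (b - int q))" by simp
 have "hdiv N (\<Sum>q<K. g K q * G (a + int K - 1) (b - int q))"
 proof (rule hdiv_sum)
 fix q
 show "hdiv N (g K q * G (a + int K - 1) (b - int q))"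
 proof (cases "s \<or> int q > b")
 case True
 then have "G (a + int K - 1) (b - int q) = 0" using K by (intro Gz) auto
 then show ?thesis by auto
 next
 case False
 then have "q \<le> nat b" by linarith
 then have "N + q + 1 \<le> K" using K by linarith
 then show ?thesis using gdiv by auto
 qed
 qed
 with 1 show ?thesis unfolding e by auto
 qed
 have Dz: "D a b = 0" if "(s \<and> a > 1) \<or> (\<not> s \<and> b < 0)" for a b
 using that unfolding D_def by (auto simp: Gz)
 have step: "D a b - (\<Sum>p<K. \<Sum>q<K. g p q * D (a - 1 + int p) (b - int q))
 = - (\<Sum>x\<in>{..<K} \<times> {..<K} - {(1, 0)}. g (fst x) (snd x) * D (a - 1 + int (fst x)) (b - int (snd x)))"
 if "K \<ge> 2" for a b K
 proof -
 have "(\<Sum>p<K. \<Sum>q<K. g p q * D (a - 1 + int p) (b - int q))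
 = (\<Sum>x\<in>{..<K} \<times> {..<K}. g (fst x) (snd x) * D (a - 1 + int (fst x)) (b - int (snd x)))"
 by (simp add: sum.cartesian_product case_prod_unfold)
 also have "\<dots> = g 1 0 * D a b + (\<Sum>x\<in>{..<K} \<times> {..<K} - {(1, 0)}. g (fst x) (snd x) * D (a - 1 + int (fst x)) (b - int (snd x)))"
 by (subst sum.remove[of _ "(1, 0)"]) (use that in auto)
 finally show ?thesis unfolding g10 by simp
 qed
 have "D a b = 0" for a b
 proof (cases s)
 case True
 \<comment> \<open>D vanishes for a > 1, so the induction runs downwards from a = 2. The pair (1, 0)
   gives D a b; every other pair with p > q has p \<ge> 2 and refers to a larger first
   index.\<close>
 have "D (2 - int m) b = 0" for m b
 proof (induction m arbitrary: b rule: less_induct)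
 case (less m)
 show ?case
 proof (rule hdiv_separated)
 fix N
 define a where "a = 2 - int m"
 define K where "K = nat (- (a - 1)) + nat b + N + 3"
 have "(\<Sum>x\<in>{..<K} \<times> {..<K} - {(1, 0)}. g (fst x) (snd x) * D (a - 1 + int (fst x)) (b - int (snd x))) = 0"
 proof (rule sum.neutral, rule ballI)
 fix x assume "x \<in> {..<K} \<times> {..<K} - {(1, 0)}"
 then have "fst x \<le> snd x \<or> fst x \<ge> 2" by (cases x) auto
 then consider "fst x \<le> snd x" | "fst x \<ge> 2" by blast
 then show "g (fst x) (snd x) * D (a - 1 + int (fst x)) (b - int (snd x)) = 0"
 proof cases
 case 2
 have "D (a - 1 + int (fst x)) (b - int (snd x)) = 0"
 proof (cases "fst x - 1 \<le> m")
 case True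
 have e: "a - 1 + int (fst x) = 2 - int (m - (fst x - 1))" using 2 True by (simp add: a_def)
 have "m - (fst x - 1) < m" using 2 True by auto
 then show ?thesis unfolding e by (rule less)
 next
 case False
 then show ?thesis using \<open>s\<close> by (intro Dz) (auto simp: a_def)
 qed
 then show ?thesis by simp
 qed (simp add: g0)
 qed
 then show "hdiv N (D (2 - int m) b)"
 using key[of "a - 1" b N K] step[of K a b] by (simp add: K_def a_def)
 qed
 qed
 from this[of "nat (2 - a)"] show ?thesis
 using Dz[of a b] True by (cases "a \<le> 2") auto
 next
 case False
 have "D a (int m) = 0" for m a
 proof (induction m arbitrary: a rule: less_induct)
 case (less m)
 have IH: "D a b' = 0" if "b' < int m" for a b'
 using less[of "nat b'" a] that Dz[of a b'] False by (cases "b' \<ge> 0") auto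
 \<comment> \<open>Pairs with q > 0 are covered by the induction on m. Pairs with q = 0 and p \<ge>
   2 keep the second index, but there g is divisible by h; this gains one power of h per
   step.\<close>
 have "hdiv N (D a (int m))" for N a
 proof (induction N arbitrary: a)
 case (Suc N)
 define K where "K = nat (- (a - 1)) + nat (int m) + Suc N + 3"
 have "hdiv (Suc N) (\<Sum>x\<in>{..<K} \<times> {..<K} - {(1, 0)}. g (fst x) (snd x) * D (a - 1 + int (fst x)) (int m - int (snd x)))"
 proof (rule hdiv_sum)
 fix x assume "x \<in> {..<K} \<times> {..<K} - {(1, 0)}"
 then have "fst x \<le> snd x \<or> snd x > 0 \<or> (snd x = 0 \<and> fst x \<ge> 2)" by (cases x) auto
 then consider "fst x \<le> snd x" | "snd x > 0" | "snd x = 0" "fst x \<ge> 2" by metis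
 then show "hdiv (Suc N) (g (fst x) (snd x) * D (a - 1 + int (fst x)) (int m - int (snd x)))"
 proof cases
 case 3
 then have "hdiv 1 (g (fst x) (snd x))" by (intro gdiv) simp
 from hdiv_mult[OF this Suc[of "a - 1 + int (fst x)"]] show ?thesis using 3 by simp
 qed (auto simp: g0 IH)
 qed
 note small = this
 have K2: "K \<ge> 2" and KK: "K \<ge> nat (- (a - 1)) + nat (int m) + Suc N + 3" by (simp_all add: K_def)
 have e: "A - B = D a (int m)" if "D a (int m) - A = - B" for A B
 using that by (simp add: algebra_simps)
 from hdiv_simps(3)[OF key[OF KK] small] show ?case unfolding e[OF step[OF K2]] .
 qed auto
 then show ?case by (rule hdiv_separated)
 qed
 from this[of a "nat b"] show ?thesis
 using Dz[of a b] False by (cases "b \<ge> 0") auto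
 qed
 then show ?thesis unfolding D_def G_def Hf_def .
qed

section \<open>Evaluation of power series\<close>

text \<open>Membership in the K-th power of the ideal generated by h and the variable.\<close>

definition fil :: "nat \<Rightarrow> 'n::finite ecr fps \<Rightarrow> bool" where
 "fil K y \<longleftrightarrow> (\<forall>m. hdiv (K - m) (y $ m))"

lemma fil_simps: "fil K 0" "fil 0 y" "fil K x \<Longrightarrow> fil K y \<Longrightarrow> fil K (x + y)"
 "fil K x \<Longrightarrow> fil K y \<Longrightarrow> fil K (x - y)"
 unfolding fil_def by (auto intro: hdiv_simps)

lemma fil_mult: "fil K x \<Longrightarrow> fil M y \<Longrightarrow> fil (K + M) (x * y)"
 unfolding fil_def
proof
 fix m assume x: "\<forall>m. hdiv (K - m) (x $ m)" and y: "\<forall>m. hdiv (M - m) (y $ m)"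
 show "hdiv (K + M - m) ((x * y) $ m)"
 unfolding fps_mult_nth
 proof (rule hdiv_sum)
 fix i assume i: "i \<in> {0..m}"
 have "hdiv ((K - i) + (M - (m - i))) (x $ i * y $ (m - i))" using x y by (intro hdiv_mult) auto
 then show "hdiv (K + M - m) (x $ i * y $ (m - i))" by (rule hdiv_mono) (use i in auto)
 qed
qed

lemma fil_separated:
 assumes "\<And>K. fil K y"
 shows "y = 0"
proof (rule fps_ext)
 fix m
 have "hdiv N (y $ m)" for N using assms[of "N + m"] unfolding fil_def by (metis diff_add_inverse2)
 then have "y $ m = 0" by (rule hdiv_separated)
 then show "y $ m = 0 $ m" by simp
qed

lemma fil_power: "fil 1 p \<Longrightarrow> fil e (p ^ e)"
proof (induction e)
 case (Suc e)
 then show ?case using fil_mult[of 1 p e "p ^ e"] by simp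
qed (simp add: fil_simps)

text \<open>The sum is built in the free algebra, coefficient by coefficient. For the coefficient m,
  the first m summands carry no guaranteed power of h and form a finite sum; the others are
  divisible by increasing powers of h and are summed h-adically.\<close>

lemma fil_complete:
 fixes z :: "nat \<Rightarrow> 'n::finite ecr fps"
 assumes "\<And>e. fil e (z e)"
 shows "\<exists>y. \<forall>K. fil K (y - (\<Sum>e<K. z e))"
proof -
 have "\<exists>w. z e $ m = e2 (hh ^ (e - m) * w)" for e m
 proof -
 obtain v where "z e $ m = hE ^ (e - m) * v" using assms[of e] unfolding fil_def hdiv_def by blast
 moreover obtain w where "v = e2 w" using e2_surj by blast
 ultimately show ?thesis by (auto simp: hE_def e2_power)
 qed
 then obtain x where x: "\<And>e m. z e $ m = e2 (hh ^ (e - m) * x e m)" by metis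
 define S where "S m = Abs_fps (\<lambda>n. \<Sum>j\<le>n. (hh ^ j * x (m + j) m) $ n)" for m
 define y where "y = Abs_fps (\<lambda>m. e2 ((\<Sum>e<m. x e m) + S m))"
 have "fil K (y - (\<Sum>e<K. z e))" for K
 unfolding fil_def
 proof
 fix m
 show "hdiv (K - m) ((y - (\<Sum>e<K. z e)) $ m)"
 proof (cases "K \<le> m")
 case False
 have "(\<Sum>e<K. z e $ m) = (\<Sum>e<m. z e $ m) + (\<Sum>e=m..<K. z e $ m)"
 using False sum.atLeastLessThan_concat[of 0 m K "\<lambda>e. z e $ m"] by (simp add: lessThan_atLeast0)
 also have "(\<Sum>e=m..<K. z e $ m) = (\<Sum>j<K - m. z (m + j) $ m)"
 by (rule sum.reindex_bij_witness[of _ "\<lambda>j. m + j" "\<lambda>e. e - m"]) auto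
 finally have "(\<Sum>e<K. z e $ m) = e2 ((\<Sum>e<m. x e m) + (\<Sum>j<K - m. hh ^ j * x (m + j) m))"
 by (simp add: x e2_sum)
 then have "(y - (\<Sum>e<K. z e)) $ m = e2 (S m) - e2 (\<Sum>j<K - m. hh ^ j * x (m + j) m)"
 by (simp add: y_def fps_sum_nth)
 moreover have "S m $ n = (\<Sum>j<K - m. hh ^ j * x (m + j) m) $ n" if "n < K - m" for n
 proof -
 have "(\<Sum>j<K - m. (hh ^ j * x (m + j) m) $ n) = (\<Sum>j\<le>n. (hh ^ j * x (m + j) m) $ n)"
 by (rule sum.mono_neutral_right) (use that in \<open>auto simp: fps_X_power_mult_nth\<close>)
 then show ?thesis by (simp add: S_def fps_sum_nth)
 qed
 ultimately show ?thesis by (simp only: hdiv_e2)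
 qed (auto intro: hdiv_simps)
 qed
 then show ?thesis by blast
qed

text \<open>The value z(p) as a limit of partial sums. Formal composition does not suffice since p =
  u + \<kappa> has a constant term that is only h-adically small. The limit exists and is unique for
  p as in the locale \<open>evp\<close>.\<close>

definition ev :: "'n::finite ecr fps \<Rightarrow> 'n ecr fps fps \<Rightarrow> 'n ecr fps" where
 "ev p z = (SOME y. \<forall>K. fil K (y - (\<Sum>e<K. z $ e * p ^ e)))"

text \<open>The series y(p). Its counterpart \<open>shm p\<close> for two variables substitutes p
  for the inner variable and leaves the outer one alone.\<close>

definition sh :: "'n::finite ecr fps \<Rightarrow> 'n ecr fps \<Rightarrow> 'n ecr fps" where
 "sh p y = ev p (fmap fps_const y)"

definition shm :: "'n::finite ecr fps \<Rightarrow> 'n ecr fps fps \<Rightarrow> 'n ecr fps fps" where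
 "shm p z = fmap (sh p) z"

locale evp =
 fixes p :: "'n::finite ecr fps"
 assumes p1: "fil 1 p" and pc: "p * y = y * p"
begin

lemma ev: "fil K (ev p z - (\<Sum>e<K. z $ e * p ^ e))"
proof -
 have "\<exists>y. \<forall>K. fil K (y - (\<Sum>e<K. z $ e * p ^ e))"
 by (rule fil_complete) (use fil_mult[OF fil_simps(2) fil_power[OF p1]] in simp)
 then have "\<forall>K. fil K (ev p z - (\<Sum>e<K. z $ e * p ^ e))" unfolding ev_def by (rule someI_ex)
 then show ?thesis by blast
qed

lemma ev_unique:
 assumes "\<And>K. fil K (y - (\<Sum>e<K. z $ e * p ^ e))"
 shows "ev p z = y"
proof -
 have "fil K (ev p z - y)" for K using fil_simps(4)[OF ev[of K z] assms[of K]] by simp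
 then have "ev p z - y = 0" by (rule fil_separated)
 then show ?thesis by simp
qed

lemma pow_c: "p ^ e * y = y * p ^ e"
 by (rule power_commuting_commutes) (rule pc)

lemma ev_add: "ev p (x + y) = ev p x + ev p y"
proof (rule ev_unique)
 show "fil K (ev p x + ev p y - (\<Sum>e<K. (x + y) $ e * p ^ e))" for K
 using fil_simps(3)[OF ev[of K x] ev[of K y]] by (simp add: distrib_right sum.distrib algebra_simps)
qed

lemma ev_uminus: "ev p (- x) = - ev p x"
proof (rule ev_unique)
 show "fil K (- ev p x - (\<Sum>e<K. (- x) $ e * p ^ e))" for K
 using fil_simps(4)[OF fil_simps(1) ev[of K x]] by (simp add: sum_negf)
qed

lemma ev_diff: "ev p (x - y) = ev p x - ev p y"
 using ev_add[of x "- y"] ev_uminus[of y] by simp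

lemma ev_const: "ev p (fps_const c * z) = c * ev p z" "ev p (z * fps_const c) = ev p z * c"
proof -
 show "ev p (fps_const c * z) = c * ev p z"
 proof (rule ev_unique)
 show "fil K (c * ev p z - (\<Sum>e<K. (fps_const c * z) $ e * p ^ e))" for K
 using fil_mult[OF fil_simps(2)[of c] ev[of K z]]
 by (simp add: sum_distrib_left right_diff_distrib mult.assoc)
 qed
 show "ev p (z * fps_const c) = ev p z * c"
 proof (rule ev_unique)
 have "(\<Sum>e<K. z $ e * p ^ e) * c = (\<Sum>e<K. (z * fps_const c) $ e * p ^ e)" for K
 by (simp add: sum_distrib_right mult.assoc pow_c)
 then show "fil K (ev p z * c - (\<Sum>e<K. (z * fps_const c) $ e * p ^ e))" for K
 using fil_mult[OF ev[of K z] fil_simps(2)[of c]] by (simp add: left_diff_distrib)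
 qed
qed

lemma ev_X: "ev p (fps_X * z) = p * ev p z"
proof (rule ev_unique)
 fix K
 show "fil K (p * ev p z - (\<Sum>e<K. (fps_X * z) $ e * p ^ e))"
 proof (cases K)
 case (Suc M)
 have "(\<Sum>e<K. (fps_X * z) $ e * p ^ e) = (\<Sum>e<M. z $ e * p ^ Suc e)"
 unfolding Suc sum.lessThan_Suc_shift by simp
 also have "\<dots> = p * (\<Sum>e<M. z $ e * p ^ e)"
 by (simp add: sum_distrib_left commute_left[OF pc])
 finally show ?thesis using fil_mult[OF p1 ev[of M z]] by (simp add: Suc right_diff_distrib)
 qed (simp add: fil_simps)
qed

lemma ev_0: "ev p 0 = 0"
 using ev_add[of 0 0] by simp

lemma sh_lin: "sh p (x + y) = sh p x + sh p y" "sh p (x - y) = sh p x - sh p y" "sh p (- x) = - sh p x" "sh p 0 = 0"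
proof -
 have 1: "fmap fps_const (x + y) = fmap fps_const x + fmap fps_const y" "fmap fps_const (x - y) = fmap fps_const x - fmap fps_const y"
 "fmap fps_const (- x) = - fmap fps_const x" "fmap fps_const (0 :: 'n ecr fps) = 0" for x y :: "'n ecr fps"
 by (simp_all add: fps_eq_iff)
 show "sh p (x + y) = sh p x + sh p y" "sh p (x - y) = sh p x - sh p y" "sh p (- x) = - sh p x" "sh p 0 = 0"
 unfolding sh_def 1 ev_add ev_diff ev_uminus ev_0 by (rule refl)+
qed

lemma sh_mult: "sh p (fps_const c * x) = fps_const c * sh p x" "sh p (x * fps_const c) = sh p x * fps_const c"
 "sh p (fps_X * x) = p * sh p x"
proof -
 have 1: "fmap fps_const (fps_const c * x) = fps_const (fps_const c) * fmap fps_const x"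
 "fmap fps_const (x * fps_const c) = fmap fps_const x * fps_const (fps_const c)"
 "fmap fps_const (fps_X * x) = fps_X * fmap fps_const x" for x :: "'n ecr fps"
 by (simp_all add: fps_eq_iff)
 show "sh p (fps_const c * x) = fps_const c * sh p x" "sh p (x * fps_const c) = sh p x * fps_const c"
 "sh p (fps_X * x) = p * sh p x"
 unfolding sh_def 1 ev_const ev_X by (rule refl)+
qed

lemma sh_sum: "sh p (sum f A) = (\<Sum>a\<in>A. sh p (f a))"
 by (induction A rule: infinite_finite_induct) (simp_all add: sh_lin)

lemma shm_lin: "shm p (x + y) = shm p x + shm p y" "shm p (x - y) = shm p x - shm p y" "shm p (- x) = - shm p x" "shm p 0 = 0"
 unfolding shm_def by (simp_all add: fps_eq_iff sh_lin)

lemma shm_mult: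
 "shm p (fps_X * x) = fps_X * shm p x"
 "shm p (fps_const fps_X * x) = fps_const p * shm p x"
 "shm p (hEE * x) = hEE * shm p x"
 "shm p (fps_const (fps_const c) * x) = fps_const (fps_const c) * shm p x"
 "shm p (fmap fps_const l * x) = fmap fps_const l * shm p x"
 "shm p (x * fmap fps_const l) = shm p x * fmap fps_const l"
 "shm p (fps_const y) = fps_const (sh p y)"
proof -
 show "shm p (fps_X * x) = fps_X * shm p x" by (rule fps_ext) (simp add: shm_def sh_lin)
 show "shm p (fps_const fps_X * x) = fps_const p * shm p x"
 "shm p (hEE * x) = hEE * shm p x" "shm p (fps_const (fps_const c) * x) = fps_const (fps_const c) * shm p x"
 "shm p (fps_const y) = fps_const (sh p y)" for c
 by (rule fps_ext; simp add: shm_def sh_lin sh_mult)+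
 show "shm p (fmap fps_const l * x) = fmap fps_const l * shm p x"
 "shm p (x * fmap fps_const l) = shm p x * fmap fps_const l"
 by (rule fps_ext; simp add: shm_def fps_mult_nth sh_sum sh_mult)+
qed

end

section \<open>The relations for shifted series\<close>

definition Lm :: "'n::finite \<Rightarrow> 'n \<Rightarrow> 'n ecr fps" where
 "Lm i j = Abs_fps (\<lambda>q. lc False i j (int q))"

definition Lp :: "'n::finite \<Rightarrow> 'n \<Rightarrow> 'n ecr fps" where
 "Lp i j = Abs_fps (\<lambda>q. lc True i j (- int q))"

abbreviation outer :: "'n::finite ecr fps \<Rightarrow> 'n ecr fps fps" where
 "outer \<equiv> fmap fps_const"

lemma lp_lm: "lp i j = outer (Lp i j)" "lm i j = fps_const (Lm i j)"
 by (simp_all add: fps_eq_iff lp_def lm_def Lp_def Lm_def)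

definition hn :: "'n::finite ecr" where
 "hn = es (half_n CARD('n))"

lemma hn_central: "hn * x = x * hn"
 unfolding hn_def by (rule es_central)

lemma central_consts:
 "hEE * z = z * hEE" "fps_X * z = z * fps_X" "fps_const (fps_const hn) * z = z * fps_const (fps_const hn)"
 "fps_const fps_X * z = z * fps_const fps_X"
 for z :: "'n::finite ecr fps fps"
proof -
 have c: "fps_const c * y = y * fps_const c" if "\<And>x. c * x = x * c" for c and y :: "'n ecr fps"
 by (simp add: fps_eq_iff that)
 show "hEE * z = z * hEE" "fps_const (fps_const hn) * z = z * fps_const (fps_const hn)"
 by (simp_all add: fps_eq_iff c[OF hE_central(1)] c[OF hn_central])
 show "fps_X * z = z * fps_X" by (rule fps_mult_fps_X_commute)
 show "fps_const fps_X * z = z * fps_const fps_X" by (simp add: fps_eq_iff fps_mult_fps_X_commute)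
qed

abbreviation hnn :: "'n::finite ecr fps fps" where
 "hnn \<equiv> fps_const (fps_const hn)"

text \<open>The two fractions of \<open>PM\<close> are cleared: A and B are u^(-1) times u - v +
  hn/2 and u - v - hn/2, where \<open>hn\<close> stands for nh/2. A relation with polynomial
  coefficients allows a substitution for either variable.\<close>

lemma PM_poly:
 fixes i j k l :: "'n::finite"
 defines "A \<equiv> 1 - fps_X * (fps_const fps_X - hnn) :: 'n ecr fps fps" and "B \<equiv> 1 - fps_X * (fps_const fps_X + hnn)"
 shows "A * (B * (lp i k * lm j l)) = A * (B * (lm j l * lp i k)) + hEE * (fps_X * (A * (lm j k * lp i l)))
 - hEE * (fps_X * (B * (lm i l * lp j k))) - hEE * (fps_X * (hEE * (fps_X * (lm i k * lp j l))))"
proof -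
 let ?\<kappa> = "half_n CARD('n)"
 have AB: "A = Phi (1 - fps_const (fps_X + fps_const (- ?\<kappa>)) * fps_X)" "B = Phi (1 - fps_const (fps_X + fps_const ?\<kappa>) * fps_X)"
 unfolding A_def B_def hn_def
 by (simp_all add: Phi_simps rhomD[OF rhom_Phi] fps_eq_iff rhomD[OF rhom_es] fps_mult_nth_0)
 have Ac: "A * x = x * A" and Bc: "B * x = x * B" for x unfolding AB by (rule Phi_central)+
 have om: "A * omw (- ?\<kappa>) = fps_X" "B * omw ?\<kappa> = fps_X"
 unfolding Ac Bc unfolding omw_def AB rhomD(2)[OF rhom_Phi, symmetric] omega_mult Phi_simps by simp_all
 have wc: "omw c * x = x * omw c" for x and c unfolding omw_def by (rule Phi_central)
 have om': "A * (omw (- ?\<kappa>) * x) = fps_X * x" "B * (omw ?\<kappa> * x) = fps_X * x" for x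
 by (simp_all only: mult.assoc[symmetric] om)
 have cl: "B * (hEE * x) = hEE * (B * x)" "A * (hEE * x) = hEE * (A * x)" "B * (omw c * x) = omw c * (B * x)"
 "A * (fps_X * x) = fps_X * (A * x)" "B * (omw (- ?\<kappa>) * (hEE * (omw ?\<kappa> * x))) = omw (- ?\<kappa>) * (hEE * (B * (omw ?\<kappa> * x)))" for x c
 by (rule commute_left[OF Bc] commute_left[OF Ac] | simp only: commute_left[OF Bc])+
 show ?thesis
 unfolding PM[of i k j l] mult.assoc distrib_left right_diff_distrib
 by (simp only: cl(5) cl(1) om' cl(3)[of "- ?\<kappa>"] cl(2,4) mult.assoc)
qed

lemma outer_coeffs [simp]: "(fps_const f * outer g) $ b $ a = f $ a * g $ b" "(outer g * fps_const f) $ b $ a = g $ b * f $ a"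
 by simp_all

lemma SSm:
 fixes i j k l :: "'n::finite"
 defines "G \<equiv> fps_const (Lm i k) * outer (Lm j l) - outer (Lm j l) * fps_const (Lm i k)"
 shows "fps_const fps_X * G - fps_X * G + hEE * (fps_const (Lm j k) * outer (Lm i l) - outer (Lm j k) * fps_const (Lm i l)) = 0"
proof (rule fps_ext, rule fps_ext)
 fix b a
 have 1: "lc False i k (int a - 1) = (if a = 0 then 0 else Lm i k $ (a - 1))" for a and i k :: 'n
 by (cases a) (simp_all add: lc_eq_0 Lm_def)
 have 2: "lc False i k (int a) = Lm i k $ a" for a and i k :: 'n by (simp add: Lm_def)
 show "(fps_const fps_X * G - fps_X * G + hEE * (fps_const (Lm j k) * outer (Lm i l) - outer (Lm j k) * fps_const (Lm i l))) $ b $ a = 0 $ b $ a"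
 using SS[of False i k "int a" j l "int b"] unfolding 1 2 G_def
 by (cases a; cases b) simp_all
qed

lemma SSp:
 fixes i j k l :: "'n::finite"
 defines "G \<equiv> fps_const (Lp i k) * outer (Lp j l) - outer (Lp j l) * fps_const (Lp i k)"
 shows "fps_X * G - fps_const fps_X * G + hEE * (fps_X * (fps_const fps_X *
 (fps_const (Lp j k) * outer (Lp i l) - outer (Lp j k) * fps_const (Lp i l)))) = 0"
proof (rule fps_ext, rule fps_ext)
 fix b a
 have 1: "lc True i k (1 - int a) = (if a = 0 then 0 else Lp i k $ (a - 1))" for a and i k :: 'n
 by (cases a) (simp_all add: lc_eq_0 Lp_def)
 have 2: "lc True i k (1 - int a - 1) = Lp i k $ a" for a and i k :: 'n by (simp add: Lp_def)
 show "(fps_X * G - fps_const fps_X * G + hEE * (fps_X * (fps_const fps_X *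
 (fps_const (Lp j k) * outer (Lp i l) - outer (Lp j k) * fps_const (Lp i l))))) $ b $ a = 0 $ b $ a"
 using SS[of True i k "1 - int a" j l "1 - int b"] unfolding 1 2 G_def
 by (cases a; cases b) simp_all
qed

text \<open>Substitution acts on the inner variable. Exchanging the two variables makes it possible
  to shift the argument of L^+ in a relation where L^+ is the outer series.\<close>

definition sw :: "'a fps fps \<Rightarrow> 'a fps fps" where
 "sw z = Abs_fps (\<lambda>p. Abs_fps (\<lambda>q. z $ q $ p))"

lemma sw_nth [simp]: "sw z $ p $ q = z $ q $ p" by (simp add: sw_def)

lemma rhom_sw: "rhom (sw :: 'a::ring_1 fps fps \<Rightarrow> _)"
 unfolding rhom_def
proof (intro conjI allI; rule fps_ext, rule fps_ext)
 fix x y :: "'a fps fps" and p q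
 show "sw (x + y) $ p $ q = (sw x + sw y) $ p $ q" by simp
 show "sw (x * y) $ p $ q = (sw x * sw y) $ p $ q"
 by (simp add: fps_mult_nth fps_sum_nth) (rule sum.swap)
qed

lemma sw_simps: "sw 1 = 1" "sw fps_X = fps_const fps_X" "sw (fps_const fps_X) = fps_X"
 "sw (fps_const (fps_const c)) = fps_const (fps_const c)" "sw (fmap fps_const y) = fps_const y"
 "sw (fps_const y) = fmap fps_const y" "fmap fps_const (fps_const c) = fps_const (fps_const c)"
 "fmap fps_const fps_X = fps_X"
 by (auto simp: fps_eq_iff fps_X_def)

lemma PM_sw:
 fixes i j k l :: "'n::finite"
 defines "A \<equiv> 1 - fps_const fps_X * (fps_X - hnn) :: 'n ecr fps fps" and "B \<equiv> 1 - fps_const fps_X * (fps_X + hnn)"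
 shows "A * (B * (fps_const (Lp i k) * outer (Lm j l))) = A * (B * (outer (Lm j l) * fps_const (Lp i k)))
 + hEE * (fps_const fps_X * (A * (outer (Lm j k) * fps_const (Lp i l))))
 - hEE * (fps_const fps_X * (B * (outer (Lm i l) * fps_const (Lp j k))))
 - hEE * (fps_const fps_X * (hEE * (fps_const fps_X * (outer (Lm i k) * fps_const (Lp j l)))))"
 using arg_cong[OF PM_poly[of i k j l], of sw] unfolding A_def B_def lp_lm
 by (simp only: rhomD[OF rhom_sw] sw_simps)

lemma cancel_X: "fps_X * (x :: 'a::ring_1 fps) = 0 \<Longrightarrow> x = 0"
proof (rule fps_ext)
 fix n assume "fps_X * x = 0"
 then have "(fps_X * x) $ Suc n = 0" by simp
 then show "x $ n = 0 $ n" by simp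
qed

lemma power_mult_distrib_commute: "a * b = b * a \<Longrightarrow> (a * b) ^ n = b ^ n * a ^ n" for a b :: "'a::monoid_mult"
proof (induction n)
 case (Suc n)
 have 1: "b ^ Suc n * a = a * b ^ Suc n"
 by (rule power_commuting_commutes) (rule Suc.prems[symmetric])
 have "(a * b) ^ Suc n = a * b ^ Suc n * a ^ n"
 unfolding power_Suc Suc.IH[OF Suc.prems] by (simp only: mult.assoc)
 then show ?case unfolding 1[symmetric] by (simp add: mult.assoc)
qed simp

lemma rhom_of_nat: "rhom f \<Longrightarrow> f 1 = 1 \<Longrightarrow> f (of_nat n) = of_nat n"
 by (induction n) (simp_all add: rhomD)

context evp
begin

lemma shm_AB:
 "shm p ((1 - fps_X * (fps_const fps_X - hnn)) * z) = (1 - fps_X * (fps_const p - hnn)) * shm p z"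
 "shm p ((1 - fps_X * (fps_const fps_X + hnn)) * z) = (1 - fps_X * (fps_const p + hnn)) * shm p z"
 "shm p ((1 - fps_const fps_X * (fps_X - hnn)) * z) = (1 - fps_const p * (fps_X - hnn)) * shm p z"
 "shm p ((1 - fps_const fps_X * (fps_X + hnn)) * z) = (1 - fps_const p * (fps_X + hnn)) * shm p z"
 by (simp_all only: left_diff_distrib distrib_right right_diff_distrib distrib_left mult.assoc mult_1_left shm_lin shm_mult)

text \<open>\<open>R1\<close> to \<open>R4\<close> have p in place of the inner variable: L^-(p)
  against L^+(v), L^-(p) against L^-(v), L^+(p) against L^+(v), and L^+(p) against L^-(v).\<close>

lemma R1:
 defines "A \<equiv> 1 - fps_X * (fps_const p - hnn)" and "B \<equiv> 1 - fps_X * (fps_const p + hnn)"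
 shows "A * (B * (outer (Lp i k) * fps_const (sh p (Lm j l)))) = A * (B * (fps_const (sh p (Lm j l)) * outer (Lp i k)))
 + hEE * (fps_X * (A * (fps_const (sh p (Lm j k)) * outer (Lp i l))))
 - hEE * (fps_X * (B * (fps_const (sh p (Lm i l)) * outer (Lp j k))))
 - hEE * (fps_X * (hEE * (fps_X * (fps_const (sh p (Lm i k)) * outer (Lp j l)))))"
 using arg_cong[OF PM_poly[of i k j l], of "shm p"] unfolding A_def B_def lp_lm
 by (simp only: shm_lin shm_AB shm_mult)

lemma R2:
 defines "G i k j l \<equiv> fps_const (sh p (Lm i k)) * outer (Lm j l) - outer (Lm j l) * fps_const (sh p (Lm i k))"
 shows "fps_const p * G i k j l - fps_X * G i k j l
 + hEE * (fps_const (sh p (Lm j k)) * outer (Lm i l) - outer (Lm j k) * fps_const (sh p (Lm i l))) = 0"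
 using arg_cong[OF SSm[of i k j l], of "shm p"] unfolding G_def
 by (simp only: shm_lin shm_mult)

lemma R3:
 defines "G i k j l \<equiv> fps_const (sh p (Lp i k)) * outer (Lp j l) - outer (Lp j l) * fps_const (sh p (Lp i k))"
 shows "fps_X * G i k j l - fps_const p * G i k j l
 + hEE * (fps_X * (fps_const p * (fps_const (sh p (Lp j k)) * outer (Lp i l) - outer (Lp j k) * fps_const (sh p (Lp i l))))) = 0"
 using arg_cong[OF SSp[of i k j l], of "shm p"] unfolding G_def
 by (simp only: shm_lin shm_mult)

lemma R4:
 defines "A \<equiv> 1 - fps_const p * (fps_X - hnn)" and "B \<equiv> 1 - fps_const p * (fps_X + hnn)"
 shows "A * (B * (fps_const (sh p (Lp i k)) * outer (Lm j l))) = A * (B * (outer (Lm j l) * fps_const (sh p (Lp i k))))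
 + hEE * (fps_const p * (A * (outer (Lm j k) * fps_const (sh p (Lp i l)))))
 - hEE * (fps_const p * (B * (outer (Lm i l) * fps_const (sh p (Lp j k)))))
 - hEE * (fps_const p * (hEE * (fps_const p * (outer (Lm i k) * fps_const (sh p (Lp j l))))))"
 using arg_cong[OF PM_sw[of i k j l], of "shm p"] unfolding A_def B_def
 by (simp only: shm_lin shm_AB shm_mult)

lemma ev_simps: "ev p (outer y) = sh p y" "ev p (fps_const x * outer y) = x * sh p y" "ev p (outer y * fps_const x) = sh p y * x"
 "ev p (fps_const x * z) = x * ev p z" "ev p (fps_X * z) = p * ev p z"
 by (simp_all only: ev_const ev_X sh_def)

end

text \<open>If the outer variable is also specialized, to q = p + h, the factor p - q becomes -h and
  the two terms of the relation acquire the same coefficient. That factor h cannot be cancelled in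
  \<open>ecr\<close>.\<close>

lemma R5:
 assumes "evp p" "evp q" and pq: "q = p + fps_const hE"
 defines "X \<equiv> \<lambda>i j. sh p (Lm i j)" and "X' \<equiv> \<lambda>i j. sh q (Lm i j)"
 shows "fps_const hE * (X i k * X' j l - X' j l * X i k - (X j k * X' i l - X' j k * X i l)) = 0"
proof -
 interpret p: evp p by fact
 interpret q: evp q by fact
 define E where "E = X i k * X' j l - X' j l * X i k"
 have "p * E - q * E + fps_const hE * (X j k * X' i l - X' j k * X i l) = 0"
 using arg_cong[OF p.R2[of i k j l], of "ev q"] unfolding E_def X_def X'_def
 by (simp only: q.ev_add q.ev_diff q.ev_simps q.ev_0)
 then have "fps_const hE * E = fps_const hE * (X j k * X' i l - X' j k * X i l)"
 unfolding pq by (simp add: distrib_right algebra_simps)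
 then show ?thesis unfolding E_def[symmetric] right_diff_distrib[of _ E] by simp
qed

text \<open>In terms of u^(-1), adding h to u reads p - q = h q p, so h q p is a common factor of
  the relation. The element c turns q p into the square of the variable, which can be cancelled; h
  stays.\<close>

lemma R6:
 assumes "evp p" "evp q" and pq: "p - q = fps_const hE * (q * p)" and c: "c * (q * p) = fps_X * fps_X"
 defines "X \<equiv> \<lambda>i j. sh p (Lp i j)" and "X' \<equiv> \<lambda>i j. sh q (Lp i j)"
 shows "fps_const hE * (X i k * X' j l - X' j l * X i k - (X j k * X' i l - X' j k * X i l)) = 0"
proof -
 interpret p: evp p by fact
 interpret q: evp q by fact
 define E where "E = X i k * X' j l - X' j l * X i k"
 define H where "H = X j k * X' i l - X' j k * X i l"
 have hc: "fps_const hE * y = y * fps_const hE" for y :: "'a ecr fps"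
 by (simp add: fps_eq_iff hE_central(1))
 have "q * E - p * E + fps_const hE * (q * (p * H)) = 0"
 using arg_cong[OF p.R3[of i k j l], of "ev q"] unfolding E_def H_def X_def X'_def
 by (simp only: q.ev_add q.ev_diff q.ev_simps q.ev_0)
 moreover have "q * E - p * E = - (fps_const hE * (q * (p * E)))"
 proof -
 have "q * E - p * E = - ((p - q) * E)" by (simp add: left_diff_distrib)
 then show ?thesis unfolding pq by (simp only: mult.assoc)
 qed
 ultimately have "fps_const hE * (q * (p * (E - H))) = 0" by (simp only: right_diff_distrib) simp
 then have "c * (fps_const hE * (q * (p * (E - H)))) = 0" by simp
 moreover have "c * (fps_const hE * (q * (p * (E - H)))) = fps_const hE * (c * (q * p) * (E - H))"
 by (simp only: mult.assoc commute_left[OF hc])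
 ultimately have z: "fps_const hE * (c * (q * p) * (E - H)) = 0" by (simp only:)
 have "fps_X * (fps_X * (fps_const hE * (E - H))) = fps_const hE * (fps_X * fps_X * (E - H))"
 by (simp only: mult.assoc commute_left[OF hc])
 also have "\<dots> = 0" by (rule z[unfolded c])
 finally have "fps_X * (fps_X * (fps_const hE * (E - H))) = 0" .
 then show ?thesis unfolding E_def[symmetric] H_def[symmetric] by (rule cancel_X[OF cancel_X])
qed

text \<open>The argument u + \<kappa>, for series in u; \<open>pp \<kappa>\<close> is its inverse
  expanded in u^(-1), for series in u^(-1). One notion of substitution thus shifts both L^- and
  L^+.\<close>

definition px :: "complex fps \<Rightarrow> 'n::finite ecr fps" where
 "px \<kappa> = fps_X + fps_const (es \<kappa>)"

definition pp :: "complex fps \<Rightarrow> 'n::finite ecr fps" where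
 "pp \<kappa> = inv_minus (- es \<kappa>)"

lemma pp_eq: "pp \<kappa> = fmap es (inv_minus (- \<kappa>))"
 unfolding pp_def by (simp add: fmap_inv_minus[OF rhom_es] rhomD(4)[OF rhom_es])

lemma pp_mult: "(1 + fps_const (es \<kappa>) * fps_X) * pp \<kappa> = (fps_X :: 'a::finite ecr fps)"
 "pp \<kappa> * (1 + fps_const (es \<kappa>) * fps_X) = (fps_X :: 'a ecr fps)"
proof -
 have "fmap es (inv_minus (- \<kappa>) * (1 + fps_const \<kappa> * fps_X)) = (pp \<kappa> * (1 + fps_const (es \<kappa>) * fps_X) :: 'a ecr fps)"
 unfolding pp_eq by (simp add: rhomD[OF rhom_fmap[OF rhom_es]] fmap_1 fmap_const fmap_X)
 moreover have "inv_minus (- \<kappa>) * (1 + fps_const \<kappa> * fps_X) = fps_X"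
 proof -
 have "1 - fps_const (- \<kappa>) * fps_X = 1 + fps_const \<kappa> * fps_X" by (simp add: fps_eq_iff)
 then show ?thesis using inv_minus_mult[of "- \<kappa>"] by (simp only:)
 qed
 ultimately show "pp \<kappa> * (1 + fps_const (es \<kappa>) * fps_X) = (fps_X :: 'a ecr fps)"
 by (simp only: fmap_X[OF es_simps(2,1)])
 moreover have "pp \<kappa> * y = y * pp \<kappa>" for y :: "'a ecr fps"
 by (rule fps_central) (simp add: pp_eq es_central)
 ultimately show "(1 + fps_const (es \<kappa>) * fps_X) * pp \<kappa> = (fps_X :: 'a ecr fps)" by metis
qed

lemma hdiv_es: "\<kappa> $ 0 = 0 \<Longrightarrow> hdiv 1 (es \<kappa> :: 'n::finite ecr)"
proof -
 assume "\<kappa> $ 0 = 0"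
 then have "\<kappa> = fps_X * Abs_fps (\<lambda>n. \<kappa> $ Suc n)" by (auto simp: fps_eq_iff)
 then obtain \<kappa>' where k: "\<kappa> = fps_X * \<kappa>'" by blast
 have "es \<kappa> = (hE ^ 1 * es \<kappa>' :: 'n ecr)"
 unfolding k rhomD(2)[OF rhom_es] by simp
 then show ?thesis unfolding hdiv_def by blast
qed

lemma evp_px: "\<kappa> $ 0 = 0 \<Longrightarrow> evp (px \<kappa> :: 'n::finite ecr fps)"
proof
 assume k: "\<kappa> $ 0 = 0"
 show "fil 1 (px \<kappa> :: 'n ecr fps)"
 unfolding fil_def
 proof
 fix m show "hdiv (1 - m) ((px \<kappa> :: 'n ecr fps) $ m)"
 using hdiv_es[OF k] by (cases m) (auto simp: px_def)
 qed
 show "px \<kappa> * y = y * px \<kappa>" for y :: "'n ecr fps"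
 by (rule fps_central) (simp add: px_def fps_X_def distrib_left distrib_right es_central)
qed

lemma evp_pp: "evp (pp \<kappa> :: 'n::finite ecr fps)"
proof
 show "fil 1 (pp \<kappa> :: 'n ecr fps)"
 unfolding fil_def
 proof
 fix m show "hdiv (1 - m) ((pp \<kappa> :: 'n ecr fps) $ m)"
 by (cases m) (auto simp: pp_def inv_minus_def)
 qed
 show "pp \<kappa> * y = y * pp \<kappa>" for y :: "'n ecr fps"
 by (rule fps_central) (simp add: pp_eq es_central)
qed

lemma power_X_add_nth:
 fixes c :: "'a::ring_1"
 assumes c: "\<And>x. c * x = x * c"
 shows "((fps_X + fps_const c) ^ e) $ m = of_nat (e choose m) * c ^ (e - m)"
proof (induction e arbitrary: m)
 case 0
 show ?case by (cases m) simp_all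
next
 case (Suc e)
 have oc: "c * (of_nat a * z) = of_nat a * (c * z)" for a z by (rule commute_left[OF c])
 show ?case
 proof (cases m)
 case 0
 then show ?thesis using Suc by (simp add: distrib_right)
 next
 case (Suc m')
 have "((fps_X + fps_const c) ^ Suc e) $ m = of_nat (e choose m') * c ^ (e - m') + c * (of_nat (e choose m) * c ^ (e - m))"
 using Suc.IH by (simp add: distrib_right Suc)
 moreover have "c * (of_nat (e choose m) * c ^ (e - m)) = of_nat (e choose m) * c ^ (e - m')"
 proof (cases "m \<le> e")
 case True
 then have "e - m' = Suc (e - m)" using Suc by simp
 then show ?thesis by (simp add: oc)
 qed (simp add: binomial_eq_0)
 ultimately show ?thesis by (simp add: Suc algebra_simps)
 qed
qed

text \<open>The argument (u + ah)^(-1) has no constant term as a series in u^(-1), so that formal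
  composition and evaluation agree.\<close>

lemma fmap_Lplus:
 fixes i j :: "'b::finite"
 shows
 "fmap e2 (vec_nth (vec_nth (Lplus a) i) j) = sh (pp (fps_const a * fps_X)) (Lp i j)"
proof -
 interpret evp "pp (fps_const a * fps_X)" by (rule evp_pp)
 have "fmap e2 (vec_nth (vec_nth (Lplus a) i) j) = Lp i j oo pp (fps_const a * fps_X)"
 unfolding Lplus_def vec_lambda_beta fmap_compose[OF rhom_e2 e2_hom(6)] fmap_inv_minus[OF rhom_e2 e2_hom(6)]
 unfolding pp_def es_def e2_hom
 by (rule arg_cong2[of _ _ _ _ fps_compose]) (simp_all add: fps_eq_iff Lp_def lc_def)
 moreover have "sh (pp (fps_const a * fps_X)) (Lp i j) = Lp i j oo pp (fps_const a * fps_X)"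
 unfolding sh_def
 proof (rule ev_unique, unfold fil_def, rule)
 fix K m
 let ?p = "pp (fps_const a * fps_X) :: 'b ecr fps"
 show "hdiv (K - m) (((Lp i j oo ?p) - (\<Sum>e<K. outer (Lp i j) $ e * ?p ^ e)) $ m)"
 proof (cases "K \<le> m")
 case False
 have z: "(?p ^ e) $ m = 0" if "m < e" for e
 using startsby_zero_power_prefix[of ?p e] that by (simp add: pp_def)
 have "(\<Sum>e<K. Lp i j $ e * (?p ^ e) $ m) = (\<Sum>e=0..m. Lp i j $ e * (?p ^ e) $ m)"
 by (rule sum.mono_neutral_right) (use False z in auto)
 then show ?thesis by (simp add: fps_compose_nth fps_sum_nth) (auto intro: hdiv_simps)
 qed (auto intro: hdiv_simps)
 qed
 ultimately show ?thesis by simp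
qed

text \<open>By the binomial formula the m-th coefficient of (u + ah)^e is divisible by h^(e-m). The
  h-adic sum in the definition therefore agrees with the K-th partial sum of the evaluation modulo
  h^(K-m).\<close>

lemma fmap_Lminus:
 fixes i j :: "'a::finite"
 shows
 "fmap e2 (vec_nth (vec_nth (Lminus a) i) j) = sh (px (fps_const a * fps_X)) (Lm i j)"
proof -
 interpret evp "px (fps_const a * fps_X)" by (rule evp_px) simp
 let ?c = "fps_const a * fps_X :: complex fps"
 show ?thesis
 unfolding sh_def
 proof (rule ev_unique[symmetric], unfold fil_def, rule)
 fix K m
 let ?p = "px ?c :: 'a ecr fps"
 define t where "t e = of_nat (e choose m) * scal ?c ^ (e - m) * lcoeff False i j (int e)" for e
 show "hdiv (K - m) ((fmap e2 (vec_nth (vec_nth (Lminus a) i) j) - (\<Sum>e<K. outer (Lm i j) $ e * ?p ^ e)) $ m)"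
 proof (cases "K \<le> m")
 case False
 have L: "vec_nth (vec_nth (Lminus a) i) j $ m = infsum t {m..}" by (simp add: Lminus_def t_def[abs_def])
 have pw: "(?p ^ e) $ m = of_nat (e choose m) * es ?c ^ (e - m)" for e
 unfolding px_def by (rule power_X_add_nth) (rule es_central)
 have tn: "t e $ n = 0" if "m + n < e" for e n
 proof -
 have "scal ?c ^ (e - m) = (hh ^ (e - m) * scal (fps_const a) ^ (e - m) :: 'a free)"
 unfolding rhomD(2)[OF rhom_scal] scal_X
 by (rule power_mult_distrib_commute) (rule hh_central(1)[symmetric])
 then have "t e = hh ^ (e - m) * (of_nat (e choose m) * scal (fps_const a) ^ (e - m) * lcoeff False i j (int e))"
 unfolding t_def by (simp only: mult.assoc commute_left[OF hh_central(2)])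
 moreover have "n < e - m" using that by simp
 ultimately show ?thesis by (simp only: fps_X_power_mult_nth if_True)
 qed
 have te: "e2 (t e) = Lm i j $ e * (?p ^ e) $ m" for e
 proof -
 have "e2 (t e) = of_nat (e choose m) * es ?c ^ (e - m) * Lm i j $ e"
 unfolding t_def e2_hom(2) e2_power es_def
 by (simp add: Lm_def lc_def rhom_of_nat[OF rhom_e2])
 moreover have "of_nat (e choose m) * es ?c ^ (e - m) * z = z * (of_nat (e choose m) * es ?c ^ (e - m))" for z :: "'a ecr"
 unfolding pw[symmetric] using arg_cong[OF pow_c[of e "fps_const z"], of "\<lambda>y. y $ m"] by simp
 ultimately show ?thesis unfolding pw by simp
 qed
 have "infsum t {m..} $ n = (\<Sum>e=m..<K. t e) $ n" if "n < K - m" for n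
 unfolding fps_sum_nth
 proof (rule fps_infsum_nth)
 fix N
 have "{x \<in> {m..}. \<exists>i<N. t x $ i \<noteq> 0} \<subseteq> {..m + N}"
 proof (rule subsetI)
 fix x assume "x \<in> {x \<in> {m..}. \<exists>i<N. t x $ i \<noteq> 0}"
 then obtain i where i: "i < N" "t x $ i \<noteq> 0" by blast
 then have "\<not> m + i < x" using tn by blast
 then show "x \<in> {..m + N}" using i by simp
 qed
 then show "finite {x \<in> {m..}. \<exists>i<N. t x $ i \<noteq> 0}" by (rule finite_subset) simp
 qed (use that tn in auto)
 then have "hdiv (K - m) (e2 (infsum t {m..}) - e2 (\<Sum>e=m..<K. t e))" by (rule hdiv_e2)
 moreover have "(\<Sum>e<K. Lm i j $ e * (?p ^ e) $ m) = (\<Sum>e=m..<K. Lm i j $ e * (?p ^ e) $ m)"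
 by (rule sum.mono_neutral_right) (use False in \<open>auto simp: pw binomial_eq_0\<close>)
 ultimately show ?thesis by (simp add: L fps_sum_nth e2_sum te)
 qed (auto intro: hdiv_simps)
 qed
qed

section \<open>Continuity of the multiplication\<close>

lemma J_props:
 fixes i j :: "'n::finite"
 shows "left_ideal (J p :: 'n dycr set)" "h_closed (J p :: 'n dycr set)"
 "r \<ge> int p \<Longrightarrow> to_cr (gen (Ell i j r)) \<in> J p"
proof -
 let ?F = "{I :: 'n dycr set. left_ideal I \<and> h_closed I \<and> (\<forall>i j r. r \<ge> int p \<longrightarrow> to_cr (gen (Ell i j r)) \<in> I)}"
 show "left_ideal (J p :: 'n dycr set)" unfolding J_def left_ideal_def by auto
 show "h_closed (J p :: 'n dycr set)" unfolding J_def
 proof (subst h_closed_def, intro allI impI InterI)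
 fix x and I :: "'n dycr set"
 assume *: "\<forall>N. \<exists>y\<in>\<Inter>?F. \<exists>z. x - y = to_cr hh ^ N * z" and I: "I \<in> ?F"
 have "\<exists>y\<in>I. \<exists>z. x - y = to_cr hh ^ N * z" for N using * I by blast
 moreover have "h_closed I" using I by blast
 ultimately show "x \<in> I" unfolding h_closed_def by blast
 qed
 show "r \<ge> int p \<Longrightarrow> to_cr (gen (Ell i j r)) \<in> J p" unfolding J_def by auto
qed

lemma J_least:
 assumes "left_ideal I" "h_closed I" "\<And>i j r. r \<ge> int p \<Longrightarrow> to_cr (gen (Ell i j r)) \<in> I"
 shows "J p \<subseteq> I"
 unfolding J_def by (rule Inter_lower) (use assms in blast)

lemma J_mono: "p \<le> q \<Longrightarrow> J q \<subseteq> J p"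
 by (intro J_least J_props) auto

lemma J_D: "0 \<in> J p" "x \<in> J p \<Longrightarrow> y \<in> J p \<Longrightarrow> x + y \<in> J p" "x \<in> J p \<Longrightarrow> a * x \<in> J p"
 "x \<in> J p \<Longrightarrow> - x \<in> J p" "x \<in> J p \<Longrightarrow> y \<in> J p \<Longrightarrow> x - y \<in> J p"
proof -
 show *: "0 \<in> J p" "x \<in> J p \<Longrightarrow> y \<in> J p \<Longrightarrow> x + y \<in> J p" "x \<in> J p \<Longrightarrow> a * x \<in> J p" for x y a
 using J_props(1)[of p] unfolding left_ideal_def by blast+
 show m: "x \<in> J p \<Longrightarrow> - x \<in> J p" for x using *(3)[of x "- 1"] by simp
 show "x \<in> J p \<Longrightarrow> y \<in> J p \<Longrightarrow> x - y \<in> J p" using *(2)[of x "- y"] m[of y] by simp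
qed

lemma nbhd_D: "0 \<in> nbhd p N" "x \<in> nbhd p N \<Longrightarrow> y \<in> nbhd p N \<Longrightarrow> x + y \<in> nbhd p N"
 "x \<in> nbhd p N \<Longrightarrow> a * x \<in> nbhd p N" "x \<in> nbhd p N \<Longrightarrow> - x \<in> nbhd p N"
 "x \<in> nbhd p N \<Longrightarrow> y \<in> nbhd p N \<Longrightarrow> x - y \<in> nbhd p N"
 "x \<in> J p \<Longrightarrow> x \<in> nbhd p N" "to_cr hh ^ N * z \<in> nbhd p N"
proof -
 show j: "x \<in> J p \<Longrightarrow> x \<in> nbhd p N" for x
 unfolding nbhd_def by (simp, rule exI[of _ x]) (auto intro!: exI[of _ 0])
 show "to_cr hh ^ N * z \<in> nbhd p N"
 unfolding nbhd_def mem_Collect_eq by (rule exI[of _ 0], rule exI[of _ z]) (simp add: J_D(1))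
 show "0 \<in> nbhd p N" using j J_D(1) by blast
 show a: "x \<in> nbhd p N \<Longrightarrow> y \<in> nbhd p N \<Longrightarrow> x + y \<in> nbhd p N" for x y
 proof -
 assume "x \<in> nbhd p N" "y \<in> nbhd p N"
 then obtain a b z w where "x = a + to_cr hh ^ N * z" "y = b + to_cr hh ^ N * w" "a \<in> J p" "b \<in> J p"
 unfolding nbhd_def by blast
 then have "x + y = (a + b) + to_cr hh ^ N * (z + w)" "a + b \<in> J p"
 by (simp_all add: distrib_left J_D)
 then show ?thesis unfolding nbhd_def by blast
 qed
 show m: "x \<in> nbhd p N \<Longrightarrow> a * x \<in> nbhd p N" for x a
 proof -
 assume "x \<in> nbhd p N"
 then obtain b z where "x = b + to_cr hh ^ N * z" "b \<in> J p" unfolding nbhd_def by blast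
 then have "a * x = a * b + to_cr hh ^ N * (a * z)" "a * b \<in> J p"
 by (simp_all add: distrib_left J_D commute_left[OF to_cr_hh_central])
 then show ?thesis unfolding nbhd_def by blast
 qed
 show n: "x \<in> nbhd p N \<Longrightarrow> - x \<in> nbhd p N" for x using m[of x "- 1"] by simp
 show "x \<in> nbhd p N \<Longrightarrow> y \<in> nbhd p N \<Longrightarrow> x - y \<in> nbhd p N" using a[of x "- y"] n[of y] by simp
qed

lemma nbhd_mono: "p \<le> q \<Longrightarrow> N \<le> M \<Longrightarrow> nbhd q M \<subseteq> nbhd p N"
proof
 fix x assume "p \<le> q" "N \<le> M" "x \<in> nbhd q M"
 then obtain a z where "x = a + to_cr hh ^ M * z" "a \<in> J p" unfolding nbhd_def using J_mono[of p q] by blast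
 moreover have "to_cr hh ^ M * z = to_cr hh ^ N * (to_cr hh ^ (M - N) * z)"
 unfolding mult.assoc[symmetric] power_add[symmetric] using \<open>N \<le> M\<close> by simp
 ultimately have "x = a + to_cr hh ^ N * (to_cr hh ^ (M - N) * z)" "a \<in> J p" by simp_all
 then show "x \<in> nbhd p N" unfolding nbhd_def by blast
qed

definition Ipn :: "nat \<Rightarrow> nat \<Rightarrow> 'n::finite free set" where
 "Ipn p N = {x. to_cr x \<in> nbhd p N}"

lemma Ipn_D: "0 \<in> Ipn p N" "x \<in> Ipn p N \<Longrightarrow> y \<in> Ipn p N \<Longrightarrow> x + y \<in> Ipn p N"
 "x \<in> Ipn p N \<Longrightarrow> a * x \<in> Ipn p N" "x \<in> Ipn p N \<Longrightarrow> - x \<in> Ipn p N"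
 "x \<in> Ipn p N \<Longrightarrow> y \<in> Ipn p N \<Longrightarrow> x - y \<in> Ipn p N"
 "r \<ge> int p \<Longrightarrow> gen (Ell i j r) \<in> Ipn p N" "hh ^ N * z \<in> Ipn p N" "x \<in> Icr \<Longrightarrow> x \<in> Ipn p N"
proof -
 show "0 \<in> Ipn p N" "x \<in> Ipn p N \<Longrightarrow> y \<in> Ipn p N \<Longrightarrow> x + y \<in> Ipn p N"
 "x \<in> Ipn p N \<Longrightarrow> a * x \<in> Ipn p N" "x \<in> Ipn p N \<Longrightarrow> - x \<in> Ipn p N"
 "x \<in> Ipn p N \<Longrightarrow> y \<in> Ipn p N \<Longrightarrow> x - y \<in> Ipn p N"
 unfolding Ipn_def by (simp_all add: nbhd_D(1-5))
 show "r \<ge> int p \<Longrightarrow> gen (Ell i j r) \<in> Ipn p N"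
 unfolding Ipn_def using nbhd_D(6)[OF J_props(3)] by blast
 show "hh ^ N * z \<in> Ipn p N" unfolding Ipn_def by (simp add: to_cr_power nbhd_D(7))
 show "x \<in> Ipn p N" if x: "x \<in> Icr"
 proof -
 obtain z where "to_cr x = to_cr hh ^ N * z" using x unfolding Icr_def by blast
 then show ?thesis unfolding Ipn_def using nbhd_D(7)[of N z p] by simp
 qed
qed

lemma Ipn_mono: "p \<le> q \<Longrightarrow> N \<le> M \<Longrightarrow> Ipn q M \<subseteq> Ipn p N"
 unfolding Ipn_def using nbhd_mono by blast

text \<open>Products of two generators occur in the relations with a factor h^2. This is h^2 times
  the neighbourhood \<open>Ipn\<close>, and \<open>LL_iff\<close> recovers the neighbourhood from
  it.\<close>

definition LL :: "nat \<Rightarrow> nat \<Rightarrow> 'n::finite ecr set" where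
 "LL p N = {e2 (hh ^ 2 * x) | x. x \<in> Ipn p N}"

lemma LL_iff: "e2 (hh ^ 2 * x) \<in> LL p N \<longleftrightarrow> x \<in> Ipn p N"
proof
 assume "e2 (hh ^ 2 * x) \<in> LL p N"
 then obtain y where y: "e2 (hh ^ 2 * x) = e2 (hh ^ 2 * y)" "y \<in> Ipn p N" unfolding LL_def by blast
 then have "e2 (hh ^ 2 * (x - y)) = 0" by (simp only: right_diff_distrib e2_hom(3) diff_self)
 then have "x - y \<in> Ipn p N" by (simp only: e2_hh2_eq_0_iff Ipn_D(8))
 then show "x \<in> Ipn p N" using Ipn_D(2)[OF _ y(2)] by fastforce
qed (auto simp: LL_def)

lemma LL_D: "0 \<in> LL p N" "x \<in> LL p N \<Longrightarrow> y \<in> LL p N \<Longrightarrow> x + y \<in> LL p N"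
 "x \<in> LL p N \<Longrightarrow> a * x \<in> LL p N" "x \<in> LL p N \<Longrightarrow> - x \<in> LL p N"
 "x \<in> LL p N \<Longrightarrow> y \<in> LL p N \<Longrightarrow> x - y \<in> LL p N" "hdiv (N + 2) x \<Longrightarrow> x \<in> LL p N"
 "r \<ge> int p \<Longrightarrow> a * hE ^ 2 * b * e2 (gen (Ell i j r)) \<in> LL p N"
proof -
 show "0 \<in> LL p N" unfolding LL_def by (auto intro!: exI[of _ 0] Ipn_D(1))
 show "x \<in> LL p N \<Longrightarrow> y \<in> LL p N \<Longrightarrow> x + y \<in> LL p N" for x y
 proof -
 assume "x \<in> LL p N" "y \<in> LL p N"
 then obtain x' y' where xy: "x = e2 (hh ^ 2 * x')" "y = e2 (hh ^ 2 * y')" "x' \<in> Ipn p N" "y' \<in> Ipn p N"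
 unfolding LL_def by blast
 have "x + y = e2 (hh ^ 2 * (x' + y'))" unfolding xy e2_hom(1)[symmetric] distrib_left ..
 then show ?thesis using Ipn_D(2)[OF xy(3,4)] by (simp only: LL_iff)
 qed
 show m: "x \<in> LL p N \<Longrightarrow> a * x \<in> LL p N" for x a
 proof -
 assume "x \<in> LL p N"
 then obtain y where y: "x = e2 (hh ^ 2 * y)" "y \<in> Ipn p N" unfolding LL_def by blast
 obtain b where "a = e2 b" using e2_surj by blast
 then have "a * x = e2 (hh ^ 2 * (b * y))"
 unfolding y \<open>a = e2 b\<close> e2_hom(2)[symmetric] by (simp only: commute_left[OF hh_central(2)])
 then show ?thesis using Ipn_D(3)[OF y(2)] by (simp only: LL_iff)
 qed
 show "x \<in> LL p N \<Longrightarrow> - x \<in> LL p N" for x using m[of x "- 1"] by simp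
 then show "x \<in> LL p N \<Longrightarrow> y \<in> LL p N \<Longrightarrow> x - y \<in> LL p N" for x y
 using \<open>\<And>x y. x \<in> LL p N \<Longrightarrow> y \<in> LL p N \<Longrightarrow> x + y \<in> LL p N\<close>[of x "- y"] \<open>\<And>x. x \<in> LL p N \<Longrightarrow> - x \<in> LL p N\<close>[of y] by simp
 show "hdiv (N + 2) x \<Longrightarrow> x \<in> LL p N"
 proof -
 assume "hdiv (N + 2) x"
 then obtain z where z: "x = hE ^ (N + 2) * z" unfolding hdiv_def by blast
 obtain w where w: "z = e2 w" using e2_surj by blast
 have "x = e2 (hh ^ 2 * (hh ^ N * w))"
 unfolding z w hE_def e2_power[symmetric] e2_hom(2)[symmetric] mult.assoc[symmetric] power_add[symmetric]
 by (simp add: add.commute)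
 then show ?thesis by (simp only: LL_iff Ipn_D(7))
 qed
 assume r: "r \<ge> int p"
 have "hE ^ 2 * e2 (gen (Ell i j r)) = e2 (hh ^ 2 * gen (Ell i j r))"
 by (simp add: hE_def e2_power)
 then have "hE ^ 2 * e2 (gen (Ell i j r)) \<in> LL p N" using Ipn_D(6)[OF r] by (simp only: LL_iff)
 then have "(a * b) * (hE ^ 2 * e2 (gen (Ell i j r))) \<in> LL p N" by (rule m)
 then show "a * hE ^ 2 * b * e2 (gen (Ell i j r)) \<in> LL p N"
 by (simp only: mult.assoc commute_left[OF hE_central(2)])
qed

lemma LL_sum: "(\<And>i. i \<in> A \<Longrightarrow> f i \<in> LL p N) \<Longrightarrow> sum f A \<in> LL p N"
 by (induction A rule: infinite_finite_induct) (auto intro: LL_D)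

abbreviation eg :: "'n::finite \<Rightarrow> 'n \<Rightarrow> int \<Rightarrow> 'n ecr" where
 "eg i j r \<equiv> e2 (gen (Ell i j r))"

lemma lc_eq:
 "lc True i j (- int (Suc r)) = - (hE * eg i j (int r))"
 "lc True i j 0 = (if i = j then 1 else 0)"
 "lc False i j (int q) = (if q = 0 \<and> i = j then 1 else 0) + hE * eg i j (- int q - 1)"
 unfolding lc_def lcoeff_def hE_def by auto

lemma hE_pull: "lc s i j e * (hE * z) = hE * (lc s i j e * z)" "e2 g * (hE * z) = hE * (e2 g * z)"
 "V $ p $ q * (hE * z) = hE * (V $ p $ q * z)"
 by (rule commute_left[OF hE_central(1)[symmetric]])+

text \<open>\<open>SS\<close> trades the product with indices r, s for the one with r + 1, s - 1.
  The other terms either end in a generator of index at least r, hence lie in the left ideal, or are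
  h times a product with r, s - 1. For s = 0 the coefficient of index s - 1 is the constant of
  L^+.\<close>

lemma eg_prod_nonneg:
 "\<exists>q. \<forall>r\<ge>q. \<forall>i j k l. hE ^ 2 * (eg i k (int r) * eg j l (int s)) \<in> (LL p N :: 'n::finite ecr set)"
proof (induction s arbitrary: p N rule: less_induct)
 case (less s)
 have IH: "\<exists>q. \<forall>r\<ge>q. \<forall>i j k l. hE ^ 2 * (eg i k (int r) * eg j l (int (s - 1))) \<in> (LL p N :: 'n ecr set)" if "s \<noteq> 0"
 by (rule less) (use that in simp)
 then obtain q where q: "\<And>r i j k l. s \<noteq> 0 \<Longrightarrow> r \<ge> q \<Longrightarrow> hE ^ 2 * (eg i k (int r) * eg j l (int (s - 1))) \<in> (LL p N :: 'n ecr set)"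
 by blast
 have "hE ^ 2 * (eg i k (int r) * eg j l (int s)) \<in> LL p N" if r: "r \<ge> max p q" for r and i j k l :: 'n
 proof -
 have large: "int r \<ge> int p" "int (Suc r) \<ge> int p" using r by auto
 have a: "(- int (Suc r)) - 1 = - int (Suc (Suc r))" "- int s - 1 = - int (Suc s)" by simp_all
 have hh: "hE * x * (hE * y) = hE ^ 2 * (x * y)" for x y :: "'n ecr"
 by (simp only: power2_eq_square mult.assoc commute_left[OF hE_central(1)[of x, symmetric]])
 note ss = SS[of True i k "- int (Suc r)" j l "- int s", unfolded a]
 have e: "hE ^ 2 * (eg i k (int r) * eg j l (int s)) =
 (lc True i k (- int (Suc (Suc r))) * lc True j l (- int s) - lc True j l (- int s) * lc True i k (- int (Suc (Suc r))))
 + hE ^ 2 * eg j l (int s) * eg i k (int r)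
 + hE * (lc True j k (- int (Suc r)) * lc True i l (- int s) - lc True j k (- int s) * lc True i l (- int (Suc r)))"
 proof -
 have x: "lc True i k (- int (Suc r)) * lc True j l (- int (Suc s)) = hE ^ 2 * (eg i k (int r) * eg j l (int s))"
 "lc True j l (- int (Suc s)) * lc True i k (- int (Suc r)) = hE ^ 2 * eg j l (int s) * eg i k (int r)"
 unfolding lc_eq(1) minus_mult_minus hh by (simp_all only: mult.assoc)
 have "E = A + B + C" if "A - (E - B) + C = 0" for A B C E :: "'n ecr"
 using that by (simp add: algebra_simps)
 from this[OF ss[unfolded x]] show ?thesis .
 qed
 have t2: "hE ^ 2 * eg j l (int s) * eg i k (int r) \<in> LL p N"
 using LL_D(7)[OF large(1), of 1] by simp
 have t4: "hE * (lc True j k (- int s) * lc True i l (- int (Suc r))) \<in> LL p N"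
 proof -
 have "hE * (lc True j k (- int s) * lc True i l (- int (Suc r))) = - (1 * hE ^ 2 * lc True j k (- int s) * eg i l (int r))"
 unfolding lc_eq(1) by (simp add: power2_eq_square mult.assoc hE_pull)
 then show ?thesis using LL_D(4)[OF LL_D(7)[OF large(1), of 1 "lc True j k (- int s)" i l N]] by simp
 qed
 show ?thesis
 proof (cases s)
 case 0
 have l0: "lc True i j (- int s) = (if i = j then 1 else 0)" for i j :: 'n using 0 lc_eq(2)[of i j] by simp
 have "hE * lc True j k (- int (Suc r)) \<in> LL p N"
 using LL_D(4)[OF LL_D(7)[OF large(1), of 1 1 j k N]] unfolding lc_eq(1) by (simp add: power2_eq_square mult.assoc)
 then have t3: "hE * (lc True j k (- int (Suc r)) * lc True i l (- int s)) \<in> LL p N"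
 unfolding l0 using LL_D(1) by auto
 have t1: "lc True i k (- int (Suc (Suc r))) * lc True j l (- int s) - lc True j l (- int s) * lc True i k (- int (Suc (Suc r))) = 0"
 unfolding l0 by simp
 show ?thesis unfolding e t1 right_diff_distrib add_0 by (intro LL_D(2,5) t2 t3 t4)
 next
 case (Suc s')
 have ls: "lc True i j (- int s) = - (hE * eg i j (int (s - 1)))" for i j :: 'n
 unfolding Suc using lc_eq(1)[of i j s'] by simp
 have qr: "r \<ge> q" "Suc r \<ge> q" "s \<noteq> 0" using r Suc by auto
 have "lc True i k (- int (Suc (Suc r))) * lc True j l (- int s) = hE ^ 2 * (eg i k (int (Suc r)) * eg j l (int (s - 1)))"
 unfolding ls lc_eq(1) by (simp add: hh)
 then have t1: "lc True i k (- int (Suc (Suc r))) * lc True j l (- int s) \<in> LL p N"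
 using q[OF qr(3,2)] by simp
 have "lc True j l (- int s) * lc True i k (- int (Suc (Suc r))) = 1 * hE ^ 2 * eg j l (int (s - 1)) * eg i k (int (Suc r))"
 unfolding ls lc_eq(1) by (simp add: power2_eq_square hE_pull mult.assoc)
 then have t1': "lc True j l (- int s) * lc True i k (- int (Suc (Suc r))) \<in> LL p N"
 using LL_D(7)[OF large(2), of 1 "eg j l (int (s - 1))" i k N] by simp
 have "hE * (lc True j k (- int (Suc r)) * lc True i l (- int s)) = hE * (hE ^ 2 * (eg j k (int r) * eg i l (int (s - 1))))"
 unfolding ls lc_eq(1) by (simp add: hh)
 then have t3: "hE * (lc True j k (- int (Suc r)) * lc True i l (- int s)) \<in> LL p N"
 using LL_D(3)[OF q[OF qr(3,1)]] by simp
 show ?thesis unfolding e right_diff_distrib[of hE] by (intro LL_D(2,5) t1 t1' t2 t3 t4)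
 qed
 qed
 then show ?case by blast
qed

definition gd :: "nat \<Rightarrow> 'n::finite ecr fps fps \<Rightarrow> bool" where
 "gd d V \<longleftrightarrow> (\<forall>p q N. N + q + d \<le> p \<longrightarrow> hdiv N (V $ p $ q))"

lemma gd_omw:
 assumes "\<forall>z. \<kappa> $ z \<noteq> 0 \<longrightarrow> z = 1"
 shows "gd 1 (omw \<kappa> :: 'n::finite ecr fps fps)"
 unfolding gd_def
proof (intro allI impI)
 fix p q N :: nat assume N: "N + q + 1 \<le> p"
 have "(scal (omega \<kappa> $ p $ q) :: 'n free) $ m = 0 $ m" if "m < N" for m
 proof -
 have "omega \<kappa> $ p $ q $ m = 0"
 using homogD[OF homog_inv_minus[OF assms], folded omega_def, of p q m] N that by linarith
 then show ?thesis by (simp add: scal_nth)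
 qed
 then have "hdiv N (e2 (scal (omega \<kappa> $ p $ q) :: 'n free) - e2 0)" by (rule hdiv_e2)
 then show "hdiv N ((omw \<kappa> :: 'n ecr fps fps) $ p $ q)" by (simp add: omw_def Phi_simps es_def)
qed

lemma gd_mult: "gd d V \<Longrightarrow> gd d' W \<Longrightarrow> gd (d + d' - 1 + 1) (V * W)"
 unfolding gd_def
proof (intro allI impI)
 fix p q N
 assume V: "\<forall>p q N. N + q + d \<le> p \<longrightarrow> hdiv N (V $ p $ q)" and W: "\<forall>p q N. N + q + d' \<le> p \<longrightarrow> hdiv N (W $ p $ q)"
 and N: "N + q + (d + d' - 1 + 1) \<le> p"
 have "hdiv N ((V $ i * W $ (p - i)) $ q)" if i: "i \<le> p" for i
 unfolding fps_mult_nth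
 proof (rule hdiv_sum)
 fix m assume m: "m \<in> {0..q}"
 have "hdiv (i - m - d) (V $ i $ m)" using V by (cases "m + d \<le> i") auto
 moreover have "hdiv (p - i - (q - m) - d') (W $ (p - i) $ (q - m))"
 using W by (cases "q - m + d' \<le> p - i") auto
 ultimately have "hdiv ((i - m - d) + (p - i - (q - m) - d')) (V $ i $ m * W $ (p - i) $ (q - m))" by (rule hdiv_mult)
 moreover have "N \<le> (i - m - d) + (p - i - (q - m) - d')" using N i m by simp
 ultimately show "hdiv N (V $ i $ m * W $ (p - i) $ (q - m))" by (rule hdiv_mono)
 qed
 then show "hdiv N ((V * W) $ p $ q)" unfolding fps_mult_nth[of V] fps_sum_nth by (intro hdiv_sum) simp
qed

lemma half_n_deg: "\<forall>z. half_n n $ z \<noteq> 0 \<longrightarrow> z = 1" "\<forall>z. (- half_n n) $ z \<noteq> 0 \<longrightarrow> z = 1"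
 by (auto simp: half_n_def fps_X_def)

text \<open>For each summand, either the coefficient of V is divisible by h^(N+2), or the
  coefficient of L^+ at the right end carries a generator of index at least p. The bound on A leaves
  no third case.\<close>

lemma LL_term:
 assumes V: "gd 2 V" and A: "A \<ge> B + N + p + 5"
 shows "(hEE * V * lm j k * lp i l) $ A $ B \<in> LL p N"
proof -
 have "(hEE * V * lm j k * lp i l) $ A $ B =
 (\<Sum>p'=0..A. \<Sum>q=0..B. hE * (V $ p' $ q * lc False j k (int (B - q))) * lc True i l (- int (A - p')))"
 unfolding lm_def lp_def
 by (simp add: fps_mult_nth[of "hEE * V * _"] fps_sum_nth) (simp add: fps_mult_nth[of "V $ _"] sum_distrib_left sum_distrib_right mult.assoc)
 also have "\<dots> \<in> LL p N"
 proof (intro LL_sum)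
 fix p' q assume p': "p' \<in> {0..A}" and q: "q \<in> {0..B}"
 show "hE * (V $ p' $ q * lc False j k (int (B - q))) * lc True i l (- int (A - p')) \<in> LL p N"
 proof (cases "p' \<ge> B + N + 4")
 case True
 then have "hdiv (N + 2) (V $ p' $ q)" using V q unfolding gd_def by auto
 then have "hdiv (N + 2) (hE * (V $ p' $ q * lc False j k (int (B - q))) * lc True i l (- int (A - p')))"
 by blast
 then show ?thesis by (rule LL_D(6))
 next
 case False
 define r where "r = A - p' - 1"
 have r: "A - p' = Suc r" "int r \<ge> int p" using False A by (auto simp: r_def)
 have "hE * (V $ p' $ q * lc False j k (int (B - q))) * lc True i l (- int (A - p'))
 = - (1 * hE ^ 2 * (V $ p' $ q * lc False j k (int (B - q))) * eg i l (int r))"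
 unfolding r(1) lc_eq(1) by (simp add: power2_eq_square mult.assoc hE_pull)
 then show ?thesis using LL_D(4)[OF LL_D(7)[OF r(2), of 1 "V $ p' $ q * lc False j k (int (B - q))" i l N]] by (simp only:)
 qed
 qed
 finally show ?thesis .
qed

lemma gd_weaken: "gd d V \<Longrightarrow> d \<le> d' \<Longrightarrow> gd d' V"
 unfolding gd_def by auto

text \<open>For s < 0 the second generator is the coefficient of v^(-s-1) in L^-. \<open>PM\<close>
  exchanges it with the first one, and all three correction terms have L^+ on the right with a
  coefficient of controlled degree.\<close>

lemma eg_prod_neg:
 assumes "s < 0"
 shows "\<exists>q. \<forall>r\<ge>q. \<forall>i j k l. hE ^ 2 * (eg i k (int r) * eg j l s) \<in> LL p N"
proof (intro exI allI impI)
 define B where "B = nat (- s - 1)"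
 have s: "s = - int B - 1" using assms by (simp add: B_def)
 fix r :: nat and i j k l :: 'a
 assume r: "r \<ge> B + N + p + 5"
 let ?A = "Suc r"
 let ?\<kappa> = "half_n CARD('a)"
 have A: "?A \<ge> B + N + p + 5" using r by simp
 have pr: "int r \<ge> int p" using r by simp
 have "fps_const hE * y = y * fps_const hE" for y :: "'a ecr fps"
 by (rule fps_ext) (simp add: hE_central(1))
 then have h: "hEE * x = x * hEE" for x :: "'a ecr fps fps"
 by (intro fps_ext[where 'a = "'a ecr fps"]) simp
 have g1: "gd 2 (omw ?\<kappa> :: 'a ecr fps fps)" "gd 2 (omw (- ?\<kappa>) :: 'a ecr fps fps)"
 by (rule gd_weaken[OF gd_omw[OF half_n_deg(1)]], simp) (rule gd_weaken[OF gd_omw[OF half_n_deg(2)]], simp)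
 have "gd (1 + 1 - 1 + 1) (omw (- ?\<kappa>) * omw ?\<kappa> :: 'a ecr fps fps)"
 by (rule gd_mult[OF gd_omw[OF half_n_deg(2)] gd_omw[OF half_n_deg(1)]])
 then have "gd 2 (omw (- ?\<kappa>) * omw ?\<kappa> :: 'a ecr fps fps)" by (rule gd_weaken) simp
 then have g2: "gd 2 (hEE * (omw (- ?\<kappa>) * omw ?\<kappa>) :: 'a ecr fps fps)"
 unfolding gd_def by auto
 have t3: "hEE * omw (- ?\<kappa>) * hEE * omw ?\<kappa> = hEE * (hEE * (omw (- ?\<kappa>) * omw ?\<kappa>) :: 'a ecr fps fps)"
 by (simp only: mult.assoc commute_left[OF h[of "omw (- ?\<kappa>)", symmetric]])
 have "(lp i k * lm j l) $ ?A $ B - (lm j l * lp i k) $ ?A $ B \<in> LL p N"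
 proof -
 have e: "(x + y - z - w) $ ?A $ B - x $ ?A $ B = y $ ?A $ B - z $ ?A $ B - w $ ?A $ B" for x y z w :: "'a ecr fps fps"
 by simp
 show ?thesis unfolding PM[of i k j l] t3 e
 by (intro LL_D(5) LL_term[OF g1(1) A] LL_term[OF g1(2) A] LL_term[OF g2 A])
 qed
 moreover have "(lp i k * lm j l) $ ?A $ B - (lm j l * lp i k) $ ?A $ B
 = lc True i k (- int ?A) * lc False j l (int B) - lc False j l (int B) * lc True i k (- int ?A)"
 unfolding lp_def lm_def by simp
 moreover have "\<dots> = 1 * hE ^ 2 * eg j l s * eg i k (int r) - hE ^ 2 * (eg i k (int r) * eg j l s)"
 unfolding lc_eq s by (simp add: power2_eq_square distrib_left distrib_right mult.assoc hE_pull)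
 ultimately have *: "1 * hE ^ 2 * eg j l s * eg i k (int r) - hE ^ 2 * (eg i k (int r) * eg j l s) \<in> LL p N" by (simp only:)
 show "hE ^ 2 * (eg i k (int r) * eg j l s) \<in> LL p N"
 using LL_D(5)[OF LL_D(7)[OF pr, of 1 "eg j l s" i k N] *] by simp
qed

lemma gen_prod_Ipn: "\<exists>q. \<forall>r\<ge>int q. \<forall>i j. gen (Ell i j r) * gen g \<in> (Ipn p N :: 'n::finite free set)"
proof (cases g)
 case (Ell j l s)
 have "\<exists>q. \<forall>r\<ge>q. \<forall>i j k l. hE ^ 2 * (eg i k (int r) * eg j l s) \<in> (LL p N :: 'n ecr set)"
 using eg_prod_neg[of s p N] eg_prod_nonneg[of "nat s" p N] by (cases "s < 0") auto
 then obtain q where q: "\<And>r i j k l. r \<ge> q \<Longrightarrow> hE ^ 2 * (eg i k (int r) * eg j l s) \<in> (LL p N :: 'n ecr set)" by blast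
 have "gen (Ell i k r) * gen g \<in> Ipn p N" if "r \<ge> int q" for r i k
 proof -
 have "hE ^ 2 * (eg i k (int (nat r)) * eg j l s) \<in> LL p N" using that by (intro q) simp
 then have "e2 (hh ^ 2 * (gen (Ell i k r) * gen g)) \<in> LL p N"
 using that by (simp add: Ell hE_def e2_power)
 then show ?thesis by (simp only: LL_iff)
 qed
 then show ?thesis by blast
next
 case Cen
 have "gen (Ell i j r) * gen g \<in> Ipn p N" if "r \<ge> int p" for r i j
 proof -
 have "lcoeff True i j (- r - 1) * gen Cen - gen Cen * lcoeff True i j (- r - 1) \<in> relators"
 unfolding relators_def by blast
 moreover have "lcoeff True i j (- r - 1) * gen Cen - gen Cen * lcoeff True i j (- r - 1)
 = hh ^ 1 * (gen Cen * gen (Ell i j r) - gen (Ell i j r) * gen Cen :: 'n free)"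
 using that by (simp add: lcoeff_def right_diff_distrib mult.assoc commute_left[OF hh_central(1)])
 ultimately have "hh ^ 1 * (gen Cen * gen (Ell i j r) - gen (Ell i j r) * gen Cen :: 'n free) \<in> relators" by (simp only:)
 then have "gen Cen * gen (Ell i j r) - gen (Ell i j r) * gen Cen \<in> (cancelled_relators :: 'n free set)"
 unfolding cancelled_relators_def by blast
 then have "to_cr (gen Cen * gen (Ell i j r) - gen (Ell i j r) * gen Cen) = (0 :: 'n dycr)" by (rule to_cr_cancelled)
 then have "to_cr (gen (Ell i j r) * gen Cen) = (to_cr (gen Cen * gen (Ell i j r)) :: 'n dycr)" by simp
 moreover have "gen Cen * gen (Ell i j r) \<in> (Ipn p N :: 'n free set)" using Ipn_D(3,6) that by blast
 ultimately show ?thesis unfolding Cen Ipn_def by simp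
 qed
 then show ?thesis by blast
qed

text \<open>Noncommutative polynomials are h-adically dense: the constant coefficient of the
  remainder is a combination of words, and splitting it off gains one power of h.\<close>

lemma free_approx:
 assumes add: "\<And>x y. P x \<Longrightarrow> P y \<Longrightarrow> P (x + y)" and mult: "\<And>x y. P x \<Longrightarrow> P y \<Longrightarrow> P (x * y)"
 and scal: "\<And>c. P (scal c)" and gen: "\<And>g. P (gen g)"
 shows "\<exists>y z. P y \<and> (x :: 'n free) = y + hh ^ N * z"
proof -
 have w: "P (fps_const (Poly_Mapping.single (Word gs) c))" for gs c
 proof (induction gs arbitrary: c)
 case Nil
 have "(fps_const (Poly_Mapping.single (Word []) c) :: 'n free) = scal (fps_const c)"
 by (auto simp: fps_eq_iff scal_nth zero_free_monoid_def)
 then show ?case using scal by simp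
 next
 case (Cons g gs)
 have "(fps_const (Poly_Mapping.single (Word (g # gs)) c) :: 'n free) = gen g * fps_const (Poly_Mapping.single (Word gs) c)"
 by (simp add: gen_def mult_single)
 then show ?case using mult gen Cons by simp
 qed
 have c: "P (fps_const v)" for v
 proof (induction v rule: update_induct)
 case const
 then show ?case using scal[of 0] by simp
 next
 case (update f a b)
 obtain gs where "a = Word gs" by (cases a)
 then show ?case using update add[OF update(3) w[of gs b]] by (simp add: poly_mapping_update_eq)
 qed
 show ?thesis
 proof (induction N)
 case 0
 have "P 0" using scal[of 0] by simp
 then show ?case by (intro exI[of _ 0] exI[of _ x]) simp
 next
 case (Suc N)
 then obtain y z where y: "P y" "x = y + hh ^ N * z" by blast
 obtain z' where z': "z - fps_const (z $ 0) = hh ^ 1 * z'" using hh_divI[of 1 "z - fps_const (z $ 0)"] by auto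
 have "x = (y + scal (fps_X ^ N) * fps_const (z $ 0)) + hh ^ Suc N * z'"
 proof -
 have "scal (fps_X ^ N) = (hh ^ N :: 'n free)" using rhom_power[OF rhom_scal scal_1, of fps_X N] by (simp only: scal_X)
 moreover have "z = fps_const (z $ 0) + hh * z'" using z' by (simp add: algebra_simps)
 ultimately show ?thesis using y(2) by (metis add.assoc distrib_left mult.assoc power_Suc2)
 qed
 then show ?case using add[OF y(1) mult[OF scal c]] by blast
 qed
qed

definition rcont :: "'n::finite free \<Rightarrow> bool" where
 "rcont x \<longleftrightarrow> (\<forall>p N. \<exists>q. \<forall>y\<in>Ipn q N. y * x \<in> Ipn p N)"

text \<open>The y for which y times the generator lies in a fixed neighbourhood form a left ideal,
  and it is h-closed since the neighbourhood contains all multiples of h^N. By minimality of J_q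
  only the generators of J_q have to be tested.\<close>

lemma rcont_gen: "rcont (gen g :: 'n::finite free)"
 unfolding rcont_def
proof (intro allI)
 fix p N
 obtain q where q: "\<And>r i j. r \<ge> int q \<Longrightarrow> gen (Ell i j r) * gen g \<in> (Ipn p N :: 'n free set)" using gen_prod_Ipn by blast
 let ?I = "{y. y * to_cr (gen g) \<in> nbhd p N} :: 'n dycr set"
 have "J q \<subseteq> ?I"
 proof (rule J_least)
 show "left_ideal ?I" unfolding left_ideal_def by (auto simp: nbhd_D distrib_right mult.assoc)
 show "h_closed ?I" unfolding h_closed_def
 proof (intro allI impI)
 fix x :: "'n dycr" assume "\<forall>N. \<exists>y\<in>?I. \<exists>z. x - y = to_cr hh ^ N * z"
 then obtain y z where y: "y \<in> ?I" "x - y = to_cr hh ^ N * z" by blast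
 have "x * to_cr (gen g) = y * to_cr (gen g) + to_cr hh ^ N * (z * to_cr (gen g))"
 using arg_cong[OF y(2), of "\<lambda>w. w * to_cr (gen g)"] by (simp add: left_diff_distrib mult.assoc diff_eq_eq add.commute)
 then show "x \<in> ?I" using y(1) nbhd_D(2)[OF _ nbhd_D(7)] by simp
 qed
 show "to_cr (gen (Ell i j r)) \<in> ?I" if "r \<ge> int q" for i j r
 using q[OF that] by (simp add: Ipn_def)
 qed
 then have "y * gen g \<in> Ipn p N" if "y \<in> Ipn q N" for y
 proof -
 obtain a z where "to_cr y = a + to_cr hh ^ N * z" "a \<in> J q" using \<open>y \<in> Ipn q N\<close> unfolding Ipn_def nbhd_def by blast
 then have "to_cr y * to_cr (gen g) = a * to_cr (gen g) + to_cr hh ^ N * (z * to_cr (gen g))" "a * to_cr (gen g) \<in> nbhd p N"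
 using \<open>J q \<subseteq> ?I\<close> by (auto simp: distrib_right mult.assoc)
 then have "to_cr y * to_cr (gen g) \<in> nbhd p N" by (simp add: nbhd_D(2)[OF _ nbhd_D(7)])
 then show ?thesis by (simp add: Ipn_def)
 qed
 then show "\<exists>q. \<forall>y\<in>Ipn q N. y * gen g \<in> Ipn p N" by blast
qed

text \<open>Source and target use the same exponent N, so approximating x modulo h^N costs
  nothing.\<close>

lemma rcont: "rcont x"
 unfolding rcont_def
proof (intro allI)
 fix p N
 have "\<exists>y z. rcont y \<and> x = y + hh ^ N * z"
 proof (rule free_approx)
 show "rcont (x + y)" if xy: "rcont x" "rcont y" for x y :: "'a free"
 unfolding rcont_def
 proof (intro allI)
 fix p N
 obtain q q' where q: "\<forall>w\<in>Ipn q N. w * x \<in> Ipn p N" "\<forall>w\<in>Ipn q' N. w * y \<in> Ipn p N"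
 using xy unfolding rcont_def by metis
 have "Ipn (max q q') N \<subseteq> Ipn q N" "Ipn (max q q') N \<subseteq> Ipn q' N" by (intro Ipn_mono; simp)+
 then show "\<exists>q. \<forall>w\<in>Ipn q N. w * (x + y) \<in> Ipn p N"
 using q by (intro exI[of _ "max q q'"]) (auto simp: distrib_left intro!: Ipn_D(2))
 qed
 show "rcont (x * y)" if xy: "rcont x" "rcont y" for x y :: "'a free"
 unfolding rcont_def
 proof (intro allI)
 fix p N
 obtain q where q: "\<forall>w\<in>Ipn q N. w * y \<in> Ipn p N" using xy unfolding rcont_def by metis
 obtain q' where "\<forall>w\<in>Ipn q' N. w * x \<in> Ipn q N" using xy unfolding rcont_def by metis
 with q show "\<exists>q. \<forall>w\<in>Ipn q N. w * (x * y) \<in> Ipn p N" by (auto simp flip: mult.assoc)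
 qed
 show "rcont (scal c :: 'a free)" for c
 unfolding rcont_def scal_central[symmetric] using Ipn_D(3) by blast
 qed (rule rcont_gen)
 then obtain y z where y: "rcont y" "x = y + hh ^ N * z" by blast
 obtain q where q: "\<forall>w\<in>Ipn q N. w * y \<in> Ipn p N" using y unfolding rcont_def by metis
 have "w * x \<in> Ipn p N" if "w \<in> Ipn q N" for w
 proof -
 have "w * x = w * y + hh ^ N * (w * z)"
 unfolding y(2) distrib_left by (simp only: commute_left[OF hh_central(2)])
 then show ?thesis using q that by (simp add: Ipn_D(2)[OF _ Ipn_D(7)])
 qed
 then show "\<exists>q. \<forall>w\<in>Ipn q N. w * x \<in> Ipn p N" by blast
qed

section \<open>The completion\<close>

lemma nbhd_Inter: "(\<And>N. x \<in> nbhd p N) \<Longrightarrow> x \<in> J p"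
proof -
 assume x: "\<And>N. x \<in> nbhd p N"
 have "\<exists>y\<in>J p. \<exists>z. x - y = to_cr hh ^ N * z" for N
 proof -
 obtain y z where "x = y + to_cr hh ^ N * z" "y \<in> J p" using x[of N] unfolding nbhd_def by blast
 then have "x - y = to_cr hh ^ N * z" by simp
 then show ?thesis using \<open>y \<in> J p\<close> by blast
 qed
 then show ?thesis using J_props(2)[of p] unfolding h_closed_def by blast
qed

text \<open>Consecutive differences along a fast subsequence are elements of J_p plus h^N times some
  w_N. The parts in J_p are dropped; the others are lifted and summed in the free algebra, which is
  h-adically complete, and the image of the sum gives the limit.\<close>

lemma cauchy_limit:
 fixes \<sigma> :: "nat \<Rightarrow> 'n::finite dycr"
 assumes "\<forall>N. \<exists>Q. \<forall>q\<ge>Q. \<sigma> q - \<sigma> Q \<in> nbhd p N"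
 shows "\<exists>z. \<forall>N. \<exists>Q. \<forall>q\<ge>Q. \<sigma> q - z \<in> nbhd p N"
proof -
 obtain Q where Q: "\<forall>N. \<forall>q\<ge>Q N. \<sigma> q - \<sigma> (Q N) \<in> nbhd p N"
 using choice[OF assms] by blast
 \<comment> \<open>Summing the thresholds produces a non-decreasing sequence of them.\<close>
 define R where "R N = (\<Sum>i\<le>N. Q i)" for N
 have RQ: "Q N \<le> R N" "R N \<le> R (Suc N)" for N
 unfolding R_def by (rule member_le_sum) simp_all
 have R: "\<sigma> q - \<sigma> (R N) \<in> nbhd p N" if q: "q \<ge> R N" for q N
 proof -
 have "\<sigma> q - \<sigma> (Q N) \<in> nbhd p N" "\<sigma> (R N) - \<sigma> (Q N) \<in> nbhd p N"
 using Q RQ(1)[of N] q le_trans by blast+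
 from nbhd_D(5)[OF this] show ?thesis by simp
 qed
 have "\<exists>j w. \<sigma> (R (Suc N)) - \<sigma> (R N) = j + to_cr (hh ^ N * w) \<and> j \<in> J p" for N
 proof -
 obtain j z where "\<sigma> (R (Suc N)) - \<sigma> (R N) = j + to_cr hh ^ N * z" "j \<in> J p"
 using R[OF RQ(2)[of N]] unfolding nbhd_def by blast
 moreover obtain w where "z = to_cr w" using to_cr_surj by blast
 ultimately show ?thesis by (auto simp: to_cr_power)
 qed
 then obtain j w where jw: "\<And>N. \<sigma> (R (Suc N)) - \<sigma> (R N) = j N + to_cr (hh ^ N * w N)" "\<And>N. j N \<in> J p" by metis
 define W where "W = Abs_fps (\<lambda>n. \<Sum>N\<le>n. (hh ^ N * w N) $ n)"
 define z where "z = \<sigma> (R 0) + to_cr W"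
 have RK: "\<sigma> (R K) - z \<in> nbhd p K" for K
 proof -
 have "(W - (\<Sum>N<K. hh ^ N * w N)) $ n = 0" if n: "n < K" for n
 proof -
 have "(\<Sum>N<K. (hh ^ N * w N) $ n) = (\<Sum>N\<le>n. (hh ^ N * w N) $ n)"
 by (rule sum.mono_neutral_right) (use n in \<open>auto simp: fps_X_power_mult_nth\<close>)
 then show ?thesis by (simp add: W_def fps_sum_nth)
 qed
 then obtain v where v: "W - (\<Sum>N<K. hh ^ N * w N) = hh ^ K * v" by (rule hh_divI)
 have tW: "to_cr W = (\<Sum>N<K. to_cr (hh ^ N * w N)) + to_cr hh ^ K * to_cr v"
 using arg_cong[OF v, of to_cr] unfolding to_cr_hom(3) to_cr_sum by (simp add: to_cr_power algebra_simps)
 have "\<sigma> (R K) - \<sigma> (R 0) = (\<Sum>N<K. j N + to_cr (hh ^ N * w N))"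
 unfolding jw(1)[symmetric] by (rule sum_lessThan_telescope[symmetric])
 then have "\<sigma> (R K) - z = (\<Sum>N<K. j N) + to_cr hh ^ K * (- to_cr v)"
 unfolding z_def tW sum.distrib by (simp add: algebra_simps)
 moreover have "(\<Sum>N<K. j N) \<in> J p" by (induction K) (simp_all add: J_D jw(2))
 ultimately show ?thesis using nbhd_D(2)[OF nbhd_D(6) nbhd_D(7)] by metis
 qed
 have "\<sigma> q - z \<in> nbhd p N" if "q \<ge> R N" for q N
 using nbhd_D(2)[OF R[OF that] RK[of N]] by simp
 then show ?thesis by blast
qed

text \<open>A common form of \<open>completion_lim\<close> and \<open>completion_mult\<close>: the
  limit, modulo J_p, of a sequence of sets, along which every choice of members must
  converge.\<close>

definition climit :: "(nat \<Rightarrow> 'n::finite dycr set) \<Rightarrow> nat \<Rightarrow> 'n dycr set" where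
 "climit A p = {z. \<forall>N. \<exists>Q. \<forall>q\<ge>Q. \<forall>a\<in>A q. a - z \<in> nbhd p N}"

lemma climit_coset:
 assumes z0: "z0 \<in> climit A p" and ne: "\<And>q. A q \<noteq> {}"
 shows "climit A p = (+) z0 ` J p"
proof (intro set_eqI iffI)
 fix z assume z: "z \<in> climit A p"
 have "z - z0 \<in> nbhd p N" for N
 proof -
 obtain Q Q' where Q: "\<forall>q\<ge>Q. \<forall>a\<in>A q. a - z \<in> nbhd p N" "\<forall>q\<ge>Q'. \<forall>a\<in>A q. a - z0 \<in> nbhd p N"
 using z z0 unfolding climit_def by blast
 obtain a where a: "a \<in> A (max Q Q')" using ne by blast
 have m: "Q \<le> max Q Q'" "Q' \<le> max Q Q'" by simp_all
 have "a - z0 \<in> nbhd p N" using Q(2) m(2) a by blast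
 moreover have "a - z \<in> nbhd p N" using Q(1) m(1) a by blast
 ultimately have "a - z0 \<in> nbhd p N" "a - z \<in> nbhd p N" by blast+
 from nbhd_D(5)[OF this] show ?thesis by simp
 qed
 then have "z - z0 \<in> J p" by (rule nbhd_Inter)
 then show "z \<in> (+) z0 ` J p" by (intro image_eqI[of _ _ "z - z0"]) simp_all
next
 fix z assume "z \<in> (+) z0 ` J p"
 then obtain j where j: "z = z0 + j" "j \<in> J p" by blast
 show "z \<in> climit A p"
 unfolding climit_def
 proof (intro CollectI allI)
 fix N
 obtain Q where Q: "\<forall>q\<ge>Q. \<forall>a\<in>A q. a - z0 \<in> nbhd p N" using z0 unfolding climit_def by blast
 have "a - z \<in> nbhd p N" if "a - z0 \<in> nbhd p N" for a
 using nbhd_D(5)[OF that nbhd_D(6)[OF j(2)]] by (simp add: j(1) diff_diff_eq)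
 then show "\<exists>Q. \<forall>q\<ge>Q. \<forall>a\<in>A q. a - z \<in> nbhd p N" using Q by blast
 qed
qed

lemma climit_completion:
 assumes "\<And>p. \<exists>z. z \<in> climit A p" "\<And>q. A q \<noteq> {}"
 shows "climit A \<in> completion"
proof -
 have "\<exists>a. climit A p = (+) a ` J p" for p
 proof -
 obtain z where "z \<in> climit A p" using assms(1) by blast
 from climit_coset[OF this assms(2)] show ?thesis by blast
 qed
 moreover have "climit A q \<subseteq> climit A p" if "p \<le> q" for p q
 unfolding climit_def using nbhd_mono[OF that order_refl] by blast
 ultimately show ?thesis unfolding completion_def by blast
qed

lemma completion_D:
 assumes y: "y \<in> completion"
 shows "\<exists>a. a \<in> y p" "a \<in> y p \<Longrightarrow> b \<in> y q \<Longrightarrow> p \<le> q \<Longrightarrow> b - a \<in> J p"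
proof -
 have c: "\<exists>a. y p = (+) a ` J p" and m: "p \<le> q \<Longrightarrow> y q \<subseteq> y p" for p q using y unfolding completion_def by blast+
 show "\<exists>a. a \<in> y p" using c[of p] J_D(1) by blast
 assume a: "a \<in> y p" and b: "b \<in> y q" and pq: "p \<le> q"
 obtain d where d: "y p = (+) d ` J p" using c by blast
 obtain j j' where "a = d + j" "j \<in> J p" "b = d + j'" "j' \<in> J p" using a b m[OF pq] d by blast
 then show "b - a \<in> J p" using J_D(5) by simp
qed

lemma rcont_nbhd: "\<exists>q\<ge>r. \<forall>y\<in>nbhd q N. y * b \<in> nbhd p N"
proof -
 obtain x where x: "b = to_cr x" using to_cr_surj by blast
 obtain q where q: "\<forall>y\<in>Ipn q N. y * x \<in> Ipn p N" using rcont[of x] unfolding rcont_def by blast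
 have "y * b \<in> nbhd p N" if y: "y \<in> nbhd (max q r) N" for y
 proof -
 obtain y' where y': "y = to_cr y'" using to_cr_surj by blast
 have "y' \<in> Ipn q N" using y nbhd_mono[of q "max q r" N N] unfolding y' Ipn_def by auto
 then show ?thesis using q unfolding x y' Ipn_def by simp
 qed
 then show ?thesis by (intro exI[of _ "max q r"]) simp
qed

definition prods :: "(nat \<Rightarrow> 'n::finite dycr set) \<Rightarrow> (nat \<Rightarrow> 'n dycr set) \<Rightarrow> nat \<Rightarrow> 'n dycr set" where
 "prods x y q = {a * b | a b. a \<in> x q \<and> b \<in> y q}"

lemma completion_mult_climit: "completion_mult x y = climit (prods x y)"
 unfolding completion_mult_def climit_def prods_def by (rule ext) blast

lemma completion_lim_climit: "completion_lim s = climit (\<lambda>q. {s q})"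
 unfolding completion_lim_def climit_def by (rule ext) simp

lemma prods_ne: "x \<in> completion \<Longrightarrow> y \<in> completion \<Longrightarrow> prods x y q \<noteq> {}"
 using completion_D(1)[of x q] completion_D(1)[of y q] unfolding prods_def by blast

text \<open>With a fixed representative b0 modulo J_p, the products a b0 converge because right
  multiplication is continuous. Another representative b changes a b0 by a multiple from the left of
  an element of J_p, uniformly in a.\<close>

lemma completion_mult_closed:
 assumes x: "x \<in> completion" and y: "y \<in> completion"
 shows "completion_mult x y \<in> completion"
 unfolding completion_mult_climit
proof (rule climit_completion)
 fix p
 obtain b0 where b0: "b0 \<in> y p" using completion_D(1)[OF y] by blast
 have "\<forall>q. \<exists>a. a \<in> x q" using completion_D(1)[OF x] by blast
 then obtain \<alpha> where \<alpha>: "\<And>q. \<alpha> q \<in> x q" using choice[of "\<lambda>q a. a \<in> x q"] by blast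
 have d: "a - a' \<in> nbhd q' N" if "a \<in> x q" "a' \<in> x q'" "q' \<le> q" for a a' q q' N
 using completion_D(2)[OF x that(2,1,3)] by (rule nbhd_D(6))
 have "\<forall>N. \<exists>Q. \<forall>q\<ge>Q. \<alpha> q * b0 - \<alpha> Q * b0 \<in> nbhd p N"
 proof
 fix N
 obtain Q where "\<forall>z\<in>nbhd Q N. z * b0 \<in> nbhd p N" using rcont_nbhd by blast
 then have "\<forall>q\<ge>Q. (\<alpha> q - \<alpha> Q) * b0 \<in> nbhd p N" using d[OF \<alpha> \<alpha>] by blast
 then show "\<exists>Q. \<forall>q\<ge>Q. \<alpha> q * b0 - \<alpha> Q * b0 \<in> nbhd p N" by (auto simp: left_diff_distrib)
 qed
 from cauchy_limit[OF this] obtain z where z: "\<forall>N. \<exists>Q. \<forall>q\<ge>Q. \<alpha> q * b0 - z \<in> nbhd p N" by blast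
 have "z \<in> climit (prods x y) p"
 unfolding climit_def
 proof (intro CollectI allI)
 fix N
 obtain Q1 where Q1: "\<forall>q\<ge>Q1. \<alpha> q * b0 - z \<in> nbhd p N" using z by blast
 obtain Q where Q: "\<forall>z\<in>nbhd Q N. z * b0 \<in> nbhd p N" using rcont_nbhd by blast
 have "a * b - z \<in> nbhd p N" if q: "q \<ge> max p (max Q Q1)" and ab: "a \<in> x q" "b \<in> y q" for q a b
 proof -
 have "b - b0 \<in> J p" using completion_D(2)[OF y b0 ab(2)] q by simp
 then have 1: "a * (b - b0) \<in> nbhd p N" by (intro nbhd_D(3) nbhd_D(6))
 have "a - \<alpha> q \<in> nbhd Q N" using d[OF ab(1) \<alpha>[of q], of N] nbhd_mono[of Q q N N] q by auto
 then have 2: "(a - \<alpha> q) * b0 \<in> nbhd p N" using Q by blast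
 have "a * b - z = a * (b - b0) + (a - \<alpha> q) * b0 + (\<alpha> q * b0 - z)" by (simp add: algebra_simps)
 moreover have "\<alpha> q * b0 - z \<in> nbhd p N" using Q1 q by simp
 ultimately show ?thesis using nbhd_D(2)[OF nbhd_D(2)[OF 1 2], of "\<alpha> q * b0 - z"] by (simp only:)
 qed
 then show "\<exists>Q. \<forall>q\<ge>Q. \<forall>a\<in>prods x y q. a - z \<in> nbhd p N" unfolding prods_def by blast
 qed
 then show "\<exists>z. z \<in> climit (prods x y) p" by blast
qed (rule prods_ne[OF x y])

text \<open>The elements that commute with the partial sums in the limit are closed under sums,
  under products by continuity of right multiplication, and under h-adic limits; hence the
  generators suffice.\<close>

theorem central_limit:
 fixes t :: "nat \<Rightarrow> 'n::finite free"
 assumes T1: "\<And>p N. \<exists>B. \<forall>b\<ge>B. t b \<in> Ipn p N"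
 and T2: "\<And>p N g. \<exists>B0. \<forall>B\<ge>B0. (\<Sum>b<B. t b) * gen g - gen g * (\<Sum>b<B. t b) \<in> Ipn p N"
 shows "completion_lim (\<lambda>B. \<Sum>b<B. to_cr (t b)) \<in> completion_center"
proof -
 define s where "s B = (\<Sum>b<B. t b)" for B
 define c where "c = completion_lim (\<lambda>B. \<Sum>b<B. to_cr (t b))"
 have c: "c = climit (\<lambda>B. {to_cr (s B)})" unfolding c_def completion_lim_climit s_def to_cr_sum ..
 have sB: "\<exists>B. \<forall>q\<ge>B. \<forall>r\<ge>B. s q - s r \<in> Ipn p N" for p N
 proof -
 obtain B where B: "\<forall>b\<ge>B. t b \<in> Ipn p N" using T1 by blast
 have 1: "s q - s B \<in> Ipn p N" if "q \<ge> B" for q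
 using that
 proof (induction q rule: dec_induct)
 case (step q)
 have "s (Suc q) - s B = (s q - s B) + t q" by (simp add: s_def)
 then show ?case using Ipn_D(2)[OF step.IH, of "t q"] B step(1) by (simp only: le_refl simp_thms)
 qed (simp add: Ipn_D)
 have "s q - s r \<in> Ipn p N" if "q \<ge> B" "r \<ge> B" for q r
 using Ipn_D(5)[OF 1[OF that(1)] 1[OF that(2)]] by simp
 then show ?thesis by blast
 qed
 have cc: "c \<in> completion"
 unfolding c
 proof (rule climit_completion)
 fix p
 have "\<forall>N. \<exists>Q. \<forall>q\<ge>Q. to_cr (s q) - to_cr (s Q) \<in> nbhd p N"
 using sB[of p] unfolding Ipn_def by (simp only: mem_Collect_eq to_cr_hom(3)) blast
 from cauchy_limit[OF this] show "\<exists>z. z \<in> climit (\<lambda>B. {to_cr (s B)}) p" unfolding climit_def by simp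
 qed simp
 define P where "P y \<longleftrightarrow> (\<forall>p N. \<exists>B0. \<forall>B\<ge>B0. s B * y - y * s B \<in> Ipn p N)" for y
 have P: "P x" for x
 unfolding P_def
 proof (intro allI)
 fix p N
 have "\<exists>y z. P y \<and> x = y + hh ^ N * z"
 proof (rule free_approx)
 fix x y :: "'n free" assume xy: "P x" "P y"
 show "P (x + y)" unfolding P_def
 proof (intro allI)
 fix p N
 obtain B1 where 1: "\<forall>B\<ge>B1. s B * x - x * s B \<in> Ipn p N" using xy(1) unfolding P_def by blast
 obtain B2 where 2: "\<forall>B\<ge>B2. s B * y - y * s B \<in> Ipn p N" using xy(2) unfolding P_def by blast
 have "s B * (x + y) - (x + y) * s B = (s B * x - x * s B) + (s B * y - y * s B)" for B
 by (simp add: algebra_simps)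
 then show "\<exists>B0. \<forall>B\<ge>B0. s B * (x + y) - (x + y) * s B \<in> Ipn p N"
 using 1 2 by (intro exI[of _ "max B1 B2"]) (simp add: Ipn_D(2))
 qed
 show "P (x * y)" unfolding P_def
 proof (intro allI)
 fix p N
 obtain q where q: "\<forall>z\<in>Ipn q N. z * y \<in> Ipn p N" using rcont[of y] unfolding rcont_def by blast
 obtain B1 where 1: "\<forall>B\<ge>B1. s B * x - x * s B \<in> Ipn q N" using xy(1) unfolding P_def by blast
 obtain B2 where 2: "\<forall>B\<ge>B2. s B * y - y * s B \<in> Ipn p N" using xy(2) unfolding P_def by blast
 have "s B * (x * y) - (x * y) * s B = (s B * x - x * s B) * y + x * (s B * y - y * s B)" for B
 by (simp add: algebra_simps)
 then show "\<exists>B0. \<forall>B\<ge>B0. s B * (x * y) - (x * y) * s B \<in> Ipn p N"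
 using 1 2 q by (intro exI[of _ "max B1 B2"]) (simp add: Ipn_D(2,3))
 qed
 next
 show "P (scal e)" for e unfolding P_def by (simp add: scal_central Ipn_D)
 show "P (gen g)" for g using T2[of g] unfolding P_def s_def by blast
 qed
 then obtain y z where y: "P y" "x = y + hh ^ N * z" by blast
 obtain B0 where B0: "\<forall>B\<ge>B0. s B * y - y * s B \<in> Ipn p N" using y unfolding P_def by blast
 have "s B * x - x * s B = (s B * y - y * s B) + hh ^ N * (s B * z - z * s B)" for B
 unfolding y(2) distrib_left distrib_right right_diff_distrib commute_left[OF hh_central(2)[symmetric]] mult.assoc
 by (simp add: algebra_simps)
 then show "\<exists>B0. \<forall>B\<ge>B0. s B * x - x * s B \<in> Ipn p N"
 using B0 by (intro exI[of _ B0]) (simp add: Ipn_D(2)[OF _ Ipn_D(7)])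
 qed
 have "completion_mult c y \<in> completion \<and> completion_mult c y = completion_mult y c" if y: "y \<in> completion" for y
 proof
 show "completion_mult c y \<in> completion" by (rule completion_mult_closed[OF cc y])
 have key: "\<exists>Q. \<forall>q\<ge>Q. \<forall>a\<in>c q. \<forall>b\<in>y q. a * b - b * a \<in> nbhd p N" for p N
 proof -
 \<comment> \<open>Smallness of (b - b1) s B cannot be had for all B at once, since right
   multiplication is continuous for one factor at a time. Thus B' is fixed before q2 is chosen, and
   s B - s B' is small by itself and only multiplied from the left.\<close>
 obtain B' where B': "\<And>q r. q \<ge> B' \<Longrightarrow> r \<ge> B' \<Longrightarrow> s q - s r \<in> Ipn p N" using sB by blast
 obtain q2 where q2: "q2 \<ge> p" "\<forall>z\<in>nbhd q2 N. z * to_cr (s B') \<in> nbhd p N" using rcont_nbhd by blast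
 obtain b1 where b1: "b1 \<in> y q2" using completion_D(1)[OF y] by blast
 obtain x1 where x1: "b1 = to_cr x1" using to_cr_surj by blast
 obtain q1 where q1: "q1 \<ge> p" "\<forall>z\<in>nbhd q1 N. z * b1 \<in> nbhd p N" using rcont_nbhd by blast
 obtain B2 where B2: "\<forall>B\<ge>B2. s B * x1 - x1 * s B \<in> Ipn p N" using P[of x1] unfolding P_def by blast
 have "a * b - b * a \<in> nbhd p N" if q: "q \<ge> max q1 q2" and ab: "a \<in> c q" "b \<in> y q" for q a b
 proof -
 obtain B3 where B3: "\<forall>B\<ge>B3. to_cr (s B) - a \<in> nbhd q N"
 using ab(1) unfolding c climit_def by blast
 define B where "B = max B' (max B2 B3)"
 have sa: "to_cr (s B) - a \<in> nbhd q1 N" "to_cr (s B) - a \<in> nbhd p N"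
 using B3 nbhd_mono[of q1 q N N] nbhd_mono[of p q N N] q q1(1) unfolding B_def by auto
 have bJ: "b - b1 \<in> J q2" using completion_D(2)[OF y b1 ab(2)] q by simp
 have e1: "a * (b - b1) \<in> nbhd p N"
 using nbhd_D(6)[OF bJ, of N] nbhd_mono[OF q2(1), of N N] by (intro nbhd_D(3)) auto
 have e2: "(to_cr (s B) - a) * b1 \<in> nbhd p N" using q1(2) sa(1) by blast
 have e3: "to_cr (s B) * b1 - b1 * to_cr (s B) \<in> nbhd p N"
 using B2 unfolding x1 B_def Ipn_def by simp
 have e4: "b * (to_cr (s B) - a) \<in> nbhd p N" by (rule nbhd_D(3)[OF sa(2)])
 have e5: "(b - b1) * to_cr (s B') \<in> nbhd p N" using q2(2) nbhd_D(6)[OF bJ, of N] by blast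
 have "to_cr (s B) - to_cr (s B') \<in> nbhd p N" using B'[of B B'] unfolding B_def Ipn_def by simp
 then have e6: "(b - b1) * (to_cr (s B) - to_cr (s B')) \<in> nbhd p N" by (rule nbhd_D(3))
 have "a * b - b * a = a * (b - b1) - (to_cr (s B) - a) * b1 + (to_cr (s B) * b1 - b1 * to_cr (s B))
 + b * (to_cr (s B) - a) - (b - b1) * to_cr (s B') - (b - b1) * (to_cr (s B) - to_cr (s B'))"
 by (simp add: algebra_simps)
 then show ?thesis by (simp only:) (intro nbhd_D(5) nbhd_D(2) e1 e2 e3 e4 e5 e6)
 qed
 then show ?thesis by blast
 qed
 have "z \<in> climit (prods c y) p \<longleftrightarrow> z \<in> climit (prods y c) p" for z p
 proof -
 have "(\<exists>Q. \<forall>q\<ge>Q. \<forall>v\<in>prods c y q. v - z \<in> nbhd p N) \<longleftrightarrow> (\<exists>Q. \<forall>q\<ge>Q. \<forall>v\<in>prods y c q. v - z \<in> nbhd p N)" for N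
 proof -
 obtain Q0 where Q0: "\<forall>q\<ge>Q0. \<forall>a\<in>c q. \<forall>b\<in>y q. a * b - b * a \<in> nbhd p N" using key by blast
 have iff: "a * b - z \<in> nbhd p N \<longleftrightarrow> b * a - z \<in> nbhd p N" if "q \<ge> Q0" "a \<in> c q" "b \<in> y q" for a b q
 proof -
 have d: "a * b - b * a \<in> nbhd p N" using Q0 that by blast
 have "b * a - z = (a * b - z) - (a * b - b * a)" "a * b - z = (b * a - z) + (a * b - b * a)" by simp_all
 then show ?thesis using nbhd_D(5)[OF _ d, of "a * b - z"] nbhd_D(2)[OF _ d, of "b * a - z"] by metis
 qed
 show ?thesis
 proof
 assume "\<exists>Q. \<forall>q\<ge>Q. \<forall>v\<in>prods c y q. v - z \<in> nbhd p N"
 then obtain Q where "\<forall>q\<ge>Q. \<forall>v\<in>prods c y q. v - z \<in> nbhd p N" by blast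
 then have "\<forall>q\<ge>max Q Q0. \<forall>v\<in>prods y c q. v - z \<in> nbhd p N"
 using iff unfolding prods_def by fastforce
 then show "\<exists>Q. \<forall>q\<ge>Q. \<forall>v\<in>prods y c q. v - z \<in> nbhd p N" by blast
 next
 assume "\<exists>Q. \<forall>q\<ge>Q. \<forall>v\<in>prods y c q. v - z \<in> nbhd p N"
 then obtain Q where "\<forall>q\<ge>Q. \<forall>v\<in>prods y c q. v - z \<in> nbhd p N" by blast
 then have "\<forall>q\<ge>max Q Q0. \<forall>v\<in>prods c y q. v - z \<in> nbhd p N"
 using iff unfolding prods_def by fastforce
 then show "\<exists>Q. \<forall>q\<ge>Q. \<forall>v\<in>prods c y q. v - z \<in> nbhd p N" by blast
 qed
 qed
 then show ?thesis unfolding climit_def by simp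
 qed
 then show "completion_mult c y = completion_mult y c" unfolding completion_mult_climit by blast
 qed
 then show ?thesis using cc unfolding completion_center_def c_def[symmetric] by blast
qed

section \<open>A smooth module\<close>

text \<open>The choice p = N = j is cofinal among the neighbourhoods. The factor h is the one which
  accompanies the generators in L^+ and L^-.\<close>

definition hI :: "nat \<Rightarrow> 'n::finite free set" where
 "hI j = {hh * x | x. x \<in> Ipn j j}"

lemma hI_iff: "hh * x \<in> hI j \<longleftrightarrow> x \<in> Ipn j j"
 unfolding hI_def using hh_cancel[of 1] by auto

lemma hI_D: "0 \<in> hI j" "x \<in> hI j \<Longrightarrow> y \<in> hI j \<Longrightarrow> x + y \<in> hI j" "x \<in> hI j \<Longrightarrow> a * x \<in> hI j"
 "x \<in> hI j \<Longrightarrow> - x \<in> hI j" "x \<in> hI j \<Longrightarrow> y \<in> hI j \<Longrightarrow> x - y \<in> hI j"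
 "x \<in> I2 \<Longrightarrow> x * y \<in> hI j" "hh ^ Suc j * x \<in> hI j"
proof -
 show "0 \<in> hI j" unfolding hI_def by (auto intro!: exI[of _ 0] Ipn_D)
 show a: "x + y \<in> hI j" if "x \<in> hI j" "y \<in> hI j" for x y
 proof -
 obtain x' y' where "x = hh * x'" "y = hh * y'" "x' \<in> Ipn j j" "y' \<in> Ipn j j" using \<open>x \<in> hI j\<close> \<open>y \<in> hI j\<close> unfolding hI_def by blast
 then show ?thesis by (simp add: hI_iff Ipn_D flip: distrib_left)
 qed
 show m: "a * x \<in> hI j" if x: "x \<in> hI j" for x a
 proof -
 obtain x' where "x = hh * x'" "x' \<in> Ipn j j" using x unfolding hI_def by blast
 moreover have "a * (hh * x') = hh * (a * x')" by (rule commute_left[OF hh_central(1)[symmetric]])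
 ultimately show ?thesis by (simp add: hI_iff Ipn_D)
 qed
 show n: "- x \<in> hI j" if "x \<in> hI j" for x using m[OF that, of "- 1"] by simp
 show "x - y \<in> hI j" if "x \<in> hI j" "y \<in> hI j" for x y using a[OF that(1) n[OF that(2)]] by simp
 show "hh ^ Suc j * x \<in> hI j" by (simp add: hI_iff mult.assoc Ipn_D)
 show "x * y \<in> hI j" if x: "x \<in> I2" for x
 proof -
 have "x * y \<in> I2" using two_sided_I2 x unfolding two_sided_ideal_def by blast
 then obtain z where z: "x * y = hh ^ 2 * z" "z \<in> Icr" unfolding I2_def by blast
 then show ?thesis by (simp add: power2_eq_square mult.assoc hI_iff Ipn_D)
 qed
qed

definition wrel :: "(nat \<Rightarrow>\<^sub>0 'n::finite free) \<Rightarrow> (nat \<Rightarrow>\<^sub>0 'n free) \<Rightarrow> bool" where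
 "wrel f g \<longleftrightarrow> (\<forall>j. Poly_Mapping.lookup f j - Poly_Mapping.lookup g j \<in> hI j)"

lemma equivp_wrel: "equivp (wrel :: (nat \<Rightarrow>\<^sub>0 'a::finite free) \<Rightarrow> _)"
proof (rule equivpI)
 show "reflp (wrel :: (nat \<Rightarrow>\<^sub>0 'a free) \<Rightarrow> _)" by (auto simp: reflp_def wrel_def hI_D(1))
 show "symp (wrel :: (nat \<Rightarrow>\<^sub>0 'a free) \<Rightarrow> _)"
 proof (rule sympI)
 fix f g :: "nat \<Rightarrow>\<^sub>0 'a free" assume "wrel f g"
 then have "- (Poly_Mapping.lookup f j - Poly_Mapping.lookup g j) \<in> hI j" for j
 unfolding wrel_def by (intro hI_D(4)) blast
 then show "wrel g f" unfolding wrel_def by simp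
 qed
 show "transp (wrel :: (nat \<Rightarrow>\<^sub>0 'a free) \<Rightarrow> _)"
 proof (rule transpI)
 fix f g k :: "nat \<Rightarrow>\<^sub>0 'a free" assume "wrel f g" "wrel g k"
 then have "(Poly_Mapping.lookup f j - Poly_Mapping.lookup g j) + (Poly_Mapping.lookup g j - Poly_Mapping.lookup k j) \<in> hI j" for j
 unfolding wrel_def by (intro hI_D(2)) blast+
 then show "wrel f k" unfolding wrel_def by simp
 qed
qed

\<comment> \<open>The sequences have finite support; therefore a power of h annihilates each vector,
  which underlies both smoothness and the cancellation of scalars.\<close>
quotient_type (overloaded) 'n wmod = "nat \<Rightarrow>\<^sub>0 'n::finite free" / wrel
 by (rule equivp_wrel)

instantiation wmod :: (finite) ab_group_add
begin

lift_definition zero_wmod :: "'a wmod" is 0 .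
lift_definition plus_wmod :: "'a wmod \<Rightarrow> 'a wmod \<Rightarrow> 'a wmod" is "(+)"
proof -
 fix a b c d :: "nat \<Rightarrow>\<^sub>0 'a free" assume ab: "wrel a b" "wrel c d"
 have "Poly_Mapping.lookup (a + c) j - Poly_Mapping.lookup (b + d) j
 = (Poly_Mapping.lookup a j - Poly_Mapping.lookup b j) + (Poly_Mapping.lookup c j - Poly_Mapping.lookup d j)" for j
 by (simp add: lookup_add)
 then show "wrel (a + c) (b + d)" using ab unfolding wrel_def by (simp add: hI_D(2))
qed
lift_definition minus_wmod :: "'a wmod \<Rightarrow> 'a wmod \<Rightarrow> 'a wmod" is "(-)"
proof -
 fix a b c d :: "nat \<Rightarrow>\<^sub>0 'a free" assume ab: "wrel a b" "wrel c d"
 have "Poly_Mapping.lookup (a - c) j - Poly_Mapping.lookup (b - d) j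
 = (Poly_Mapping.lookup a j - Poly_Mapping.lookup b j) - (Poly_Mapping.lookup c j - Poly_Mapping.lookup d j)" for j
 by (simp add: lookup_minus)
 then show "wrel (a - c) (b - d)" using ab unfolding wrel_def by (simp add: hI_D(5))
qed
lift_definition uminus_wmod :: "'a wmod \<Rightarrow> 'a wmod" is "uminus"
proof -
 fix a b :: "nat \<Rightarrow>\<^sub>0 'a free" assume ab: "wrel a b"
 have "- (Poly_Mapping.lookup a j - Poly_Mapping.lookup b j) \<in> hI j" for j
 using ab unfolding wrel_def by (intro hI_D(4)) blast
 moreover have "Poly_Mapping.lookup (- a) j - Poly_Mapping.lookup (- b) j = - (Poly_Mapping.lookup a j - Poly_Mapping.lookup b j)" for j
 by simp
 ultimately show "wrel (- a) (- b)" unfolding wrel_def by (simp only: simp_thms)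
qed

instance
proof
 fix a b c :: "'a wmod"
 show "a + b + c = a + (b + c)" by transfer (simp add: add.assoc wrel_def hI_D)
 show "a + b = b + a" by transfer (simp add: add.commute wrel_def hI_D)
 show "0 + a = a" by transfer (simp add: wrel_def hI_D)
 show "- a + a = 0" by transfer (simp add: wrel_def hI_D)
 show "a - b = a + - b" by transfer (simp add: wrel_def hI_D)
qed

end

lemma wmod_eq_0_iff: "abs_wmod f = 0 \<longleftrightarrow> (\<forall>j. Poly_Mapping.lookup f j \<in> hI j)"
 unfolding zero_wmod_def by (simp add: wmod.abs_eq_iff wrel_def)

instance wmod :: (finite) nontrivial_group
proof
 have "abs_wmod (Poly_Mapping.single 0 1) \<noteq> (0 :: 'a wmod)"
 proof
 assume "abs_wmod (Poly_Mapping.single 0 1) = (0 :: 'a wmod)"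
 then have "Poly_Mapping.lookup (Poly_Mapping.single (0 :: nat) 1) 0 \<in> (hI 0 :: 'a free set)"
 unfolding wmod_eq_0_iff by blast
 then obtain x :: "'a free" where "1 = hh * x" by (auto simp: hI_def)
 then have "(1 :: 'a free) $ 0 = (hh * x) $ 0" by simp
 then show False by simp
 qed
 then show "\<exists>x :: 'a wmod. x \<noteq> 0" by blast
qed

lemma lookup_map_times: "Poly_Mapping.lookup (Poly_Mapping.map (times x) f) j = x * Poly_Mapping.lookup f j"
 for x :: "'a::{mult_zero}"
 by (simp add: Poly_Mapping.map.rep_eq when_def)

definition act :: "'n::finite free \<Rightarrow> 'n wmod \<Rightarrow> 'n wmod" where
 "act x w = abs_wmod (Poly_Mapping.map (times x) (rep_wmod w))"

lemma act_abs: "act x (abs_wmod f) = abs_wmod (Poly_Mapping.map (times x) f)"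
proof -
 have "abs_wmod (rep_wmod (abs_wmod f)) = abs_wmod f" by (rule Quotient3_abs_rep[OF Quotient3_wmod])
 then have w: "wrel (rep_wmod (abs_wmod f)) f" by (simp only: wmod.abs_eq_iff)
 have "x * Poly_Mapping.lookup (rep_wmod (abs_wmod f)) j - x * Poly_Mapping.lookup f j \<in> hI j" for j
 using w hI_D(3) unfolding wrel_def right_diff_distrib[symmetric] by blast
 then show ?thesis unfolding act_def wmod.abs_eq_iff wrel_def lookup_map_times by blast
qed

lemma act_lin: "act (x + y) w = act x w + act y w" "act x (w + w') = act x w + act x w'"
 "act (x * y) w = act x (act y w)" "act 1 w = w"
proof -
 obtain f g where w: "w = abs_wmod f" "w' = abs_wmod g" by (metis Quotient3_abs_rep[OF Quotient3_wmod])
 show "act (x + y) w = act x w + act y w" "act x (w + w') = act x w + act x w'"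
 "act (x * y) w = act x (act y w)" "act 1 w = w"
 unfolding w act_abs plus_wmod.abs_eq wmod.abs_eq_iff wrel_def lookup_map_times lookup_add
 by (simp_all add: algebra_simps hI_D)
qed

lemma act_I2: "x \<in> I2 \<Longrightarrow> act x w = 0"
proof (induct w rule: wmod.abs_induct)
 case (1 f)
 then show ?case unfolding act_abs wmod_eq_0_iff lookup_map_times by (simp add: hI_D)
qed

definition actE :: "'n::finite ecr \<Rightarrow> 'n wmod \<Rightarrow> 'n wmod" where
 "actE x = act (SOME y. e2 y = x)"

lemma actE_e2: "actE (e2 x) w = act x w"
proof -
 define y where "y = (SOME y. e2 y = e2 x)"
 have "e2 y = e2 x" unfolding y_def by (rule someI_ex) blast
 then have "y - x \<in> I2" by (simp add: e2_eq_0_iff[symmetric])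
 then have "act (y - x) w = 0" by (rule act_I2)
 then have "act y w = act x w" using act_lin(1)[of "y - x" x w] by simp
 then show ?thesis by (simp add: actE_def y_def)
qed

lemma actE_lin: "actE (x + y) w = actE x w + actE y w" "actE x (w + w') = actE x w + actE x w'"
 "actE (x * y) w = actE x (actE y w)" "actE 1 w = w"
proof -
 obtain x' y' where xy: "x = e2 x'" "y = e2 y'" using e2_surj by blast
 show "actE (x + y) w = actE x w + actE y w" "actE x (w + w') = actE x w + actE x w'"
 "actE (x * y) w = actE x (actE y w)"
 unfolding xy e2_hom(1,2)[symmetric] actE_e2 by (rule act_lin)+
 show "actE 1 w = w" using actE_e2[of 1 w] by (simp add: act_lin)
qed

lemma actE_simps [simp]: "actE 0 w = 0" "actE x 0 = 0" "actE (- x) w = - actE x w" "actE (x - y) w = actE x w - actE y w"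
 "actE x (- w) = - actE x w" "actE x (w - w') = actE x w - actE x w'"
proof -
 show 1: "actE 0 w = 0" for w using actE_lin(1)[of 0 0 w] by simp
 show 2: "actE x 0 = 0" using actE_lin(2)[of x 0 0] by simp
 show 3: "actE (- x) w = - actE x w" for x
 proof -
 have "actE (x + - x) w = 0" unfolding right_minus by (rule 1)
 then show ?thesis unfolding actE_lin(1) by (rule minus_unique[symmetric])
 qed
 show "actE (x - y) w = actE x w - actE y w" using actE_lin(1)[of x "- y" w] 3 by simp
 show 4: "actE x (- w) = - actE x w" for w
 proof -
 have "actE x (w + - w) = 0" unfolding right_minus by (rule 2)
 then show ?thesis unfolding actE_lin(2) by (rule minus_unique[symmetric])
 qed
 show "actE x (w - w') = actE x w - actE x w'" using actE_lin(2)[of x w "- w'"] 4 by simp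
qed

lemma actE_sum: "actE (sum f A) w = (\<Sum>a\<in>A. actE (f a) w)" "actE x (sum g A) = (\<Sum>a\<in>A. actE x (g a))"
 by (induction A rule: infinite_finite_induct; simp add: actE_lin)+

text \<open>A lift of x lies in h \<open>Icr\<close>, and \<open>Icr\<close> is contained in every
  \<open>Ipn\<close>, so it acts by zero. Relations known only after multiplication by h become true
  relations on the module.\<close>

lemma actE_hE_torsion: "hE * x = 0 \<Longrightarrow> actE x w = 0"
proof -
 assume h: "hE * x = 0"
 obtain y where y: "x = e2 y" using e2_surj by blast
 have "e2 (hh * y) = 0" using h by (simp add: hE_def y)
 then obtain z where "hh * y = hh ^ 2 * z" "z \<in> Icr" unfolding e2_eq_0_iff I2_def by blast
 then have y: "y = hh * z" "z \<in> Icr" and xy: "x = e2 y" using hh_cancel[of 1 y "hh * z"] y by (simp_all add: power2_eq_square mult.assoc)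
 have "act y w = 0"
 proof (induct w rule: wmod.abs_induct)
 case (1 f)
 have "y * v \<in> hI j" for v j
 proof -
 have "z * v \<in> Icr" using two_sided_Icr y(2) unfolding two_sided_ideal_def by blast
 then show ?thesis by (simp add: y(1) mult.assoc hI_iff Ipn_D)
 qed
 then show ?case by (simp add: act_abs wmod_eq_0_iff lookup_map_times)
 qed
 then show ?thesis by (simp add: xy actE_e2)
qed

lemma hE_nilpotent: "\<exists>N. \<forall>M\<ge>N. actE (hE ^ M) w = 0"
proof -
 have "\<exists>N. act (hh ^ N) w = 0"
 proof (induct w rule: wmod.abs_induct)
 case (1 f)
 define N where "N = Suc (Max (insert 0 (Poly_Mapping.keys f)))"
 have "hh ^ N * Poly_Mapping.lookup f j \<in> hI j" for j
 proof (cases "j \<in> Poly_Mapping.keys f")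
 case True
 then have "N = (N - Suc j) + Suc j" unfolding N_def by simp
 then have "hh ^ N = (hh ^ (N - Suc j) * hh ^ Suc j :: 'a free)" by (metis power_add)
 then have "hh ^ N * Poly_Mapping.lookup f j = hh ^ (N - Suc j) * (hh ^ Suc j * Poly_Mapping.lookup f j)"
 by (simp only: mult.assoc)
 then show ?thesis using hI_D(3)[OF hI_D(7)] by (simp only:)
 qed (simp add: in_keys_iff hI_D)
 then have "act (hh ^ N) (abs_wmod f) = 0"
 by (simp add: act_abs wmod_eq_0_iff lookup_map_times)
 then show ?case by blast
 qed
 then obtain N where N: "actE (hE ^ N) w = 0" unfolding hE_def e2_power[symmetric] actE_e2 by blast
 have "actE (hE ^ M) w = 0" if "M \<ge> N" for M
 proof -
 have e: "hE ^ M = (hE ^ (M - N) * hE ^ N :: 'a ecr)" using that by (simp flip: power_add)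
 show ?thesis unfolding e actE_lin(3) N by simp
 qed
 then show ?thesis by blast
qed

text \<open>A vector has finitely many components, and continuity of right multiplication by each of
  them yields a bound on the index.\<close>

lemma gen_smooth: "\<exists>q. \<forall>r\<ge>int q. \<forall>i j. actE (hE * eg i j r) w = 0"
proof (induct w rule: wmod.abs_induct)
 case (1 f)
 have "\<exists>q. \<forall>y\<in>Ipn q j. y * Poly_Mapping.lookup f j \<in> Ipn j j" for j
 using rcont[of "Poly_Mapping.lookup f j"] unfolding rcont_def by blast
 then obtain q where q: "\<And>j y. y \<in> Ipn (q j) j \<Longrightarrow> y * Poly_Mapping.lookup f j \<in> Ipn j j" by metis
 define Q where "Q = Max (insert 0 (q ` Poly_Mapping.keys f))"
 have "hh * gen (Ell i k r) * Poly_Mapping.lookup f j \<in> hI j" if r: "r \<ge> int Q" for r i k j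
 proof (cases "j \<in> Poly_Mapping.keys f")
 case True
 then have "q j \<le> Q" unfolding Q_def by simp
 then have "gen (Ell i k r) \<in> Ipn (q j) j" using r by (intro Ipn_D) simp
 from q[OF this] show ?thesis by (simp add: mult.assoc hI_iff)
 qed (simp add: in_keys_iff hI_D)
 then have "act (hh * gen (Ell i k r)) (abs_wmod f) = 0" if "r \<ge> int Q" for r i k
 using that by (simp add: act_abs wmod_eq_0_iff lookup_map_times)
 then show ?case unfolding hE_def e2_hom(2)[symmetric] actE_e2 by blast
qed

lemma wmod_torsion: "m \<noteq> 0 \<Longrightarrow> actE (of_nat m) w = 0 \<Longrightarrow> w = 0"
proof -
 assume m: "m \<noteq> 0" and w: "actE (of_nat m) w = 0"
 have "(of_nat m :: 'a ecr) = es (of_nat m)" for m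
 by (induction m) (simp_all add: rhomD[OF rhom_es])
 then have "es (fps_const (1 / of_nat m)) * of_nat m = (es (fps_const (1 / of_nat m) * of_nat m) :: 'a ecr)"
 by (simp add: rhomD[OF rhom_es])
 also have "fps_const (1 / of_nat m) * of_nat m = (1 :: complex fps)" using m by (simp flip: fps_of_nat)
 finally have "es (fps_const (1 / of_nat m)) * of_nat m = (1 :: 'a ecr)" by simp
 then have "w = actE (es (fps_const (1 / of_nat m))) (actE (of_nat m) w)"
 by (simp flip: actE_lin(3)) (simp add: actE_lin)
 then show ?thesis using w by simp
qed

definition om :: "nat \<Rightarrow> 'n::finite wmod" where
 "om j = abs_wmod (Poly_Mapping.single j 1)"

lemma act_om: "act x (om j) = 0 \<longleftrightarrow> x \<in> hI j"
 unfolding om_def by (auto simp: act_abs wmod_eq_0_iff lookup_map_times lookup_single when_def hI_D)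

section \<open>Convolution\<close>

text \<open>The product of a power series with a Laurent series of vectors. The index set is finite
  when g vanishes at all sufficiently small indices, a hypothesis carried along below.\<close>

definition cv :: "'n::finite ecr fps \<Rightarrow> (int \<Rightarrow> 'n wmod) \<Rightarrow> int \<Rightarrow> 'n wmod" where
 "cv x g m = (\<Sum>e\<in>{e. g (m - int e) \<noteq> 0}. actE (x $ e) (g (m - int e)))"

lemma cv_eq:
 assumes "\<forall>m<N. g m = 0" "m - N < int K"
 shows "cv x g m = (\<Sum>e<K. actE (x $ e) (g (m - int e)))"
 unfolding cv_def
proof (rule sum.mono_neutral_left)
 show "{e. g (m - int e) \<noteq> 0} \<subseteq> {..<K}"
 proof
 fix e assume "e \<in> {e. g (m - int e) \<noteq> 0}"
 then have "\<not> m - int e < N" using assms(1) by auto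
 then show "e \<in> {..<K}" using assms(2) by simp
 qed
qed auto

lemma cv_bounded: "\<forall>m<N. g m = 0 \<Longrightarrow> m < N \<Longrightarrow> cv x g m = 0"
 using cv_eq[of N g m 0 x] by simp

lemma cv_lin:
 assumes "\<forall>m<N. g m = 0" "\<forall>m<N. g' m = 0"
 shows "cv (x + y) g m = cv x g m + cv y g m" "cv x (\<lambda>m. g m + g' m) m = cv x g m + cv x g' m"
proof -
 have K: "m - N < int (nat (m - N) + 1)" by simp
 have s: "\<forall>m<N. g m + g' m = 0" using assms by simp
 show "cv (x + y) g m = cv x g m + cv y g m" "cv x (\<lambda>m. g m + g' m) m = cv x g m + cv x g' m"
 unfolding cv_eq[OF assms(1) K] cv_eq[OF assms(2) K] cv_eq[OF s K]
 by (simp_all add: actE_lin sum.distrib)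
qed

lemma cv_mult:
 assumes N: "\<forall>m<N. g m = 0"
 shows "cv (x * y) g m = cv x (cv y g) m"
proof -
 define K where "K = nat (m - N) + 1"
 have K: "m - N < int K" by (simp add: K_def)
 have N': "\<forall>m<N. cv y g m = 0" using cv_bounded[OF N] by blast
 have "cv x (cv y g) m = (\<Sum>i<K. \<Sum>j<K - i. actE (x $ i) (actE (y $ j) (g (m - int (i + j)))))"
 unfolding cv_eq[OF N' K]
 proof (rule sum.cong[OF refl])
 fix i assume "i \<in> {..<K}"
 then have "m - int i - N < int (K - i)" using K by (simp add: of_nat_diff)
 then show "actE (x $ i) (cv y g (m - int i)) = (\<Sum>j<K - i. actE (x $ i) (actE (y $ j) (g (m - int (i + j)))))"
 by (simp add: cv_eq[OF N] actE_sum algebra_simps)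
 qed
 also have "\<dots> = (\<Sum>(i, j)\<in>{(i, j). i + j < K}. actE (x $ i) (actE (y $ j) (g (m - int (i + j)))))"
 proof -
 have "{(i, j). i + j < K} = Sigma {..<K} (\<lambda>i. {..<K - i})" by auto
 then show ?thesis by (simp add: sum.Sigma)
 qed
 also have "\<dots> = (\<Sum>e<K. \<Sum>i\<le>e. actE (x $ i) (actE (y $ (e - i)) (g (m - int (i + (e - i))))))"
 by (rule sum.triangle_reindex)
 also have "\<dots> = cv (x * y) g m"
 unfolding cv_eq[OF N K] by (simp add: fps_mult_nth actE_sum actE_lin atLeast0AtMost)
 finally show ?thesis by simp
qed

lemma cv_fps_X:
 assumes N: "\<forall>m<N. g m = 0"
 shows "cv (fps_X * x) g m = cv x g (m - 1)"
proof -
 define K where "K = nat (m - 1 - N) + 1"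
 have K: "m - 1 - N < int K" "m - N < int (Suc K)" by (simp_all add: K_def)
 show ?thesis unfolding cv_eq[OF N K(1)] cv_eq[OF N K(2)] sum.lessThan_Suc_shift
 by (simp add: algebra_simps)
qed

lemma cv_fps_const:
 assumes N: "\<forall>m<N. g m = 0"
 shows "cv (fps_const c * x) g m = actE c (cv x g m)" "cv (x * fps_const c) g m = cv x (\<lambda>m. actE c (g m)) m"
proof -
 have K: "m - N < int (nat (m - N) + 1)" by simp
 have N': "\<forall>m<N. actE c (g m) = 0" using N by simp
 show "cv (fps_const c * x) g m = actE c (cv x g m)" "cv (x * fps_const c) g m = cv x (\<lambda>m. actE c (g m)) m"
 unfolding cv_eq[OF N K] cv_eq[OF N' K] by (simp_all add: actE_lin actE_sum)
qed

lemma cv_1: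
 assumes N: "\<forall>m<N. g m = 0"
 shows "cv 1 g m = g m"
proof (cases "m < N")
 case True
 then show ?thesis using cv_bounded[OF N] N by simp
next
 case False
 then have K: "m - N < int (Suc (nat (m - N)))" by simp
 show ?thesis unfolding cv_eq[OF N K] sum.lessThan_Suc_shift by (simp add: actE_lin)
qed

lemma cv_shift:
 assumes N: "\<forall>m<N. g m = 0"
 shows "cv x (\<lambda>m. g (m + d)) m = cv x g (m + d)"
proof -
 have N': "\<forall>m<N - d. g (m + d) = 0" using N by simp
 have K: "m - (N - d) < int (nat (m + d - N) + 1)" "m + d - N < int (nat (m + d - N) + 1)" by simp_all
 show ?thesis unfolding cv_eq[OF N' K(1)] cv_eq[OF N K(2)] by (simp add: algebra_simps)
qed

text \<open>Only finitely many coefficients act on a given vector; as a result, multiplication by y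
  preserves Laurent polynomials.\<close>

definition sm :: "'n::finite ecr fps \<Rightarrow> bool" where
 "sm y \<longleftrightarrow> (\<forall>w. \<exists>q. \<forall>b\<ge>q. actE (y $ b) w = 0)"

lemma sm_lin:
 fixes x y :: "'a::finite ecr fps"
 shows "sm x \<Longrightarrow> sm y \<Longrightarrow> sm (x + y)" "sm x \<Longrightarrow> sm (- x)" "sm x \<Longrightarrow> sm y \<Longrightarrow> sm (x - y)" "sm (0 :: 'a ecr fps)"
 "sm (fps_const c :: 'a ecr fps)" "sm (fps_X :: 'a ecr fps)" "sm (1 :: 'a ecr fps)"
proof -
 show a: "sm x \<Longrightarrow> sm y \<Longrightarrow> sm (x + y)" for x y :: "'a ecr fps"
 unfolding sm_def
 proof
 fix w assume "\<forall>w. \<exists>q. \<forall>b\<ge>q. actE (x $ b) w = 0" "\<forall>w. \<exists>q. \<forall>b\<ge>q. actE (y $ b) w = 0"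
 then obtain q q' where "\<forall>b\<ge>q. actE (x $ b) w = 0" "\<forall>b\<ge>q'. actE (y $ b) w = 0" by metis
 then show "\<exists>q. \<forall>b\<ge>q. actE ((x + y) $ b) w = 0"
 by (intro exI[of _ "max q q'"]) (simp add: actE_lin)
 qed
 show n: "sm x \<Longrightarrow> sm (- x)" for x :: "'a ecr fps" unfolding sm_def by simp
 show "sm x \<Longrightarrow> sm y \<Longrightarrow> sm (x - y)" using a[of x "- y"] n[of y] by simp
 show "sm (0 :: 'a ecr fps)" "sm (fps_const c)" "sm (fps_X :: 'a ecr fps)" "sm (1 :: 'a ecr fps)"
 unfolding sm_def by (auto simp: fps_X_def intro!: exI[of _ 2])
qed

lemma sm_mult: "sm x \<Longrightarrow> sm y \<Longrightarrow> sm (x * y)"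
 unfolding sm_def
proof
 fix w assume x: "\<forall>w. \<exists>q. \<forall>b\<ge>q. actE (x $ b) w = 0" and "\<forall>w. \<exists>q. \<forall>b\<ge>q. actE (y $ b) w = 0"
 then obtain q where q: "\<forall>b\<ge>q. actE (y $ b) w = 0" by metis
 have "\<forall>j. \<exists>q. \<forall>b\<ge>q. actE (x $ b) (actE (y $ j) w) = 0" using x by blast
 then obtain Q where Q': "\<forall>j. \<forall>b\<ge>Q j. actE (x $ b) (actE (y $ j) w) = 0"
 using choice[of "\<lambda>j q. \<forall>b\<ge>q. actE (x $ b) (actE (y $ j) w) = 0"] by blast
 then have Q: "\<And>j b. b \<ge> Q j \<Longrightarrow> actE (x $ b) (actE (y $ j) w) = 0" by blast
 define M where "M = q + Max (insert 0 (Q ` {..<q}))"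
 have "actE ((x * y) $ b) w = 0" if b: "b \<ge> M" for b
 proof -
 have "actE (x $ i) (actE (y $ (b - i)) w) = 0" if "i \<le> b" for i
 proof (cases "b - i < q")
 case True
 then have "Q (b - i) \<le> Max (insert 0 (Q ` {..<q}))" by (intro Max_ge) auto
 then have "Q (b - i) \<le> i" using True b that unfolding M_def by linarith
 then show ?thesis by (rule Q)
 qed (use q in simp)
 then show ?thesis by (simp add: fps_mult_nth actE_sum actE_lin)
 qed
 then show "\<exists>q. \<forall>b\<ge>q. actE ((x * y) $ b) w = 0" by blast
qed

lemma cv_finite:
 assumes "sm y" "finite {m. g m \<noteq> 0}"
 shows "finite {m. cv y g m \<noteq> 0}"
proof -
 obtain q where q': "\<forall>w. \<forall>b\<ge>q w. actE (y $ b) w = 0"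
 using choice[OF assms(1)[unfolded sm_def]] by blast
 then have q: "\<And>w b. b \<ge> q w \<Longrightarrow> actE (y $ b) w = 0" by blast
 have "\<exists>m'\<in>{m. g m \<noteq> 0}. \<exists>e\<in>{..<q (g m')}. m = m' + int e" if m: "cv y g m \<noteq> 0" for m
 proof -
 have "(\<Sum>e\<in>{e. g (m - int e) \<noteq> 0}. actE (y $ e) (g (m - int e))) \<noteq> 0" using m unfolding cv_def .
 then obtain e where e: "e \<in> {e. g (m - int e) \<noteq> 0}" "actE (y $ e) (g (m - int e)) \<noteq> 0" by (rule sum_neq_0E)
 have "e < q (g (m - int e))"
 proof (rule ccontr)
 assume "\<not> e < q (g (m - int e))"
 then show False using q[of "g (m - int e)" e] e(2) by simp
 qed
 then show ?thesis using e(1) by (intro bexI[of _ "m - int e"] bexI[of _ e]) simp_all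
 qed
 then have "{m. cv y g m \<noteq> 0} \<subseteq> (\<Union>m\<in>{m. g m \<noteq> 0}. (\<lambda>e. m + int e) ` {..<q (g m)})"
 by blast
 then show ?thesis by (rule finite_subset) (intro finite_UN_I finite_imageI finite_lessThan assms(2))
qed

section \<open>Operators\<close>

definition VV :: "(bool \<Rightarrow> int \<Rightarrow> 'n::finite wmod) set" where
 "VV = {g. finite {m. g False m \<noteq> 0} \<and> (\<exists>N. \<forall>m<N. g True m = 0)}"

text \<open>
 A pair of a Laurent polynomial in \<open>u^(-1)\<close> (flag \<open>False\<close>, indexed by the exponent of \<open>u^(-1)\<close>)
 and a Laurent series in \<open>u\<close> (flag \<open>True\<close>).
\<close>

typedef (overloaded) 'n vv = "VV :: (bool \<Rightarrow> int \<Rightarrow> 'n::finite wmod) set"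
 morphisms vr va
 by (rule exI[of _ "\<lambda>_ _. 0"]) (simp add: VV_def)

setup_lifting type_definition_vv

lemma VV_add: "f \<in> VV \<Longrightarrow> g \<in> VV \<Longrightarrow> (\<lambda>a m. f a m + g a m) \<in> VV"
proof -
 assume f: "f \<in> VV" and g: "g \<in> VV"
 have "{m. f False m + g False m \<noteq> 0} \<subseteq> {m. f False m \<noteq> 0} \<union> {m. g False m \<noteq> 0}" by auto
 then have "finite {m. f False m + g False m \<noteq> 0}" by (rule finite_subset) (use f g in \<open>auto simp: VV_def\<close>)
 moreover obtain N M where "\<forall>m<N. f True m = 0" "\<forall>m<M. g True m = 0" using f g by (auto simp: VV_def)
 ultimately show ?thesis unfolding VV_def by (auto intro!: exI[of _ "min N M"])
qed

lemma VV_uminus: "f \<in> VV \<Longrightarrow> (\<lambda>a m. - f a m) \<in> VV"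
 by (simp add: VV_def)

instantiation vv :: (finite) ab_group_add
begin

lift_definition zero_vv :: "'a vv" is "\<lambda>_ _. 0" by (simp add: VV_def)
lift_definition plus_vv :: "'a vv \<Rightarrow> 'a vv \<Rightarrow> 'a vv" is "\<lambda>f g a m. f a m + g a m" by (rule VV_add)
lift_definition uminus_vv :: "'a vv \<Rightarrow> 'a vv" is "\<lambda>f a m. - f a m" by (rule VV_uminus)
lift_definition minus_vv :: "'a vv \<Rightarrow> 'a vv \<Rightarrow> 'a vv" is "\<lambda>f g a m. f a m - g a m"
 using VV_add[OF _ VV_uminus] by force

instance
 by standard (transfer; simp add: fun_eq_iff algebra_simps)+

end

lemma vr_simps [simp]: "vr (x + y) a m = vr x a m + vr y a m" "vr (x - y) a m = vr x a m - vr y a m"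
 "vr (- x) a m = - vr x a m" "vr 0 a m = 0"
 by (transfer; simp)+

lemma vv_eqI: "(\<And>a m. vr x a m = vr y a m) \<Longrightarrow> x = y"
 by (simp add: vr_inject[symmetric] fun_eq_iff)

lemma vr_sum: "vr (sum f A) a m = (\<Sum>i\<in>A. vr (f i) a m)"
 by (induction A rule: infinite_finite_induct) simp_all

definition inc :: "'n::finite wmod \<Rightarrow> 'n vv" where
 "inc w = va (\<lambda>a m. if \<not> a \<and> m = 0 then w else 0)"

lemma vr_inc: "vr (inc w) a m = (if \<not> a \<and> m = 0 then w else 0)"
proof -
 have "{m :: int. (if m = 0 then w else 0) \<noteq> 0} \<subseteq> {0}" by auto
 then have "finite {m :: int. (if m = 0 then w else 0) \<noteq> 0}" by (rule finite_subset) simp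
 then have "(\<lambda>a m. if \<not> a \<and> m = 0 then w else 0) \<in> VV" by (simp add: VV_def)
 then show ?thesis unfolding inc_def by (simp add: va_inverse)
qed

instance vv :: (finite) nontrivial_group
proof
 obtain w :: "'a wmod" where w: "w \<noteq> 0" using ex_nonzero by blast
 have "inc w \<noteq> 0" using vr_inc[of w False 0] w by (metis vr_simps(4))
 then show "\<exists>x :: 'a vv. x \<noteq> 0" by blast
qed

lemma vr_fin: "finite {m. vr v False m \<noteq> 0}"
 using vr[of v] by (simp add: VV_def)

lemma vr_bounded: "\<exists>N. \<forall>m<N. vr v a m = 0"
proof -
 have 1: "\<exists>N. \<forall>m<N. vr v True m = 0" using vr[of v] unfolding VV_def by blast
 have 2: "vr v False m = 0" if m: "m < Min (insert 0 {m. vr v False m \<noteq> 0})" for m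
 proof (rule ccontr)
 assume "vr v False m \<noteq> 0"
 then have "m \<in> insert 0 {m. vr v False m \<noteq> 0}" by blast
 then have "Min (insert 0 {m. vr v False m \<noteq> 0}) \<le> m" by (intro Min_le finite.insertI vr_fin)
 with m show False by linarith
 qed
 have "\<exists>N. \<forall>m<N. vr v False m = 0"
 by (rule exI[of _ "Min (insert 0 {m. vr v False m \<noteq> 0})"]) (intro allI impI 2)
 with 1 show ?thesis by (cases a) (simp_all only: simp_thms)
qed

definition okF :: "((bool \<Rightarrow> int \<Rightarrow> 'n::finite wmod) \<Rightarrow> bool \<Rightarrow> int \<Rightarrow> 'n wmod) \<Rightarrow> bool" where
 "okF F \<longleftrightarrow> (\<forall>v. F (vr v) \<in> VV) \<and>
 (\<forall>v w a m. F (\<lambda>a m. vr v a m + vr w a m) a m = F (vr v) a m + F (vr w) a m)"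

definition mk :: "((bool \<Rightarrow> int \<Rightarrow> 'n::finite wmod) \<Rightarrow> bool \<Rightarrow> int \<Rightarrow> 'n wmod) \<Rightarrow> 'n vv endo" where
 "mk F = Endo (\<lambda>v. va (F (vr v)))"

lemma vr_mk:
 assumes "okF F"
 shows "vr (app (mk F) v) = F (vr v)"
proof -
 have i: "vr (va (F (vr v))) = F (vr v)" for v using assms by (intro va_inverse) (simp add: okF_def)
 have "va (F (vr (x + y))) = va (F (vr x)) + va (F (vr y))" for x y
 proof (rule vv_eqI)
 fix a m
 have "vr (x + y) = (\<lambda>a m. vr x a m + vr y a m)" by (simp add: fun_eq_iff)
 then show "vr (va (F (vr (x + y)))) a m = vr (va (F (vr x)) + va (F (vr y))) a m"
 using assms unfolding vr_simps i by (simp add: okF_def)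
 qed
 then show ?thesis unfolding mk_def by (simp add: app_Endo i)
qed

definition "Dop c = mk (\<lambda>g a m. actE c (g a m))"
text \<open>Multiplication by u. The first component is indexed by the exponent of u^(-1) and the
  second by that of u, whence the opposite shifts. \<open>Uin\<close> is multiplication by
  u^(-1).\<close>

definition "Uop = mk (\<lambda>g a m. if a then g True (m - 1) else g False (m + 1))"
definition "Uin = mk (\<lambda>g a m. if a then g True (m + 1) else g False (m - 1))"
text \<open>Multiplication by y(u^(-1)) on the first component, zero on the second. For a series
  that is not smooth the result would leave the space of Laurent polynomials, and the operator is
  set to 0.\<close>

definition "P1 y = (if sm y then mk (\<lambda>g a m. if a then 0 else cv y (g False) m) else 0)"
definition "P2 x = mk (\<lambda>g a m. if a then cv x (g True) m else 0)"
definition "io = mk (\<lambda>g a m. if a then g False (- m) else 0)"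
text \<open>The projection to the first component, which is \<open>P1 1\<close>. It replaces the
  unit in all statements about inverses of L^+.\<close>

definition "E1 = mk (\<lambda>g a m. if a then 0 else g False m)"

lemma finite_shift: "finite {m :: int. f m \<noteq> (0 :: 'a::zero)} \<Longrightarrow> finite {m. f (m + d) \<noteq> 0}"
 "finite {m :: int. f m \<noteq> (0 :: 'a::zero)} \<Longrightarrow> finite {m. f (- m) \<noteq> 0}"
proof -
 assume f: "finite {m. f m \<noteq> 0}"
 have "{m. f (m + d) \<noteq> 0} = (\<lambda>m. m - d) ` {m. f m \<noteq> 0}" by (auto intro!: image_eqI[of _ _ "_ + d"])
 then show "finite {m. f (m + d) \<noteq> 0}" using f by simp
 have "{m. f (- m) \<noteq> 0} = uminus ` {m. f m \<noteq> 0}" by (auto intro!: image_eqI[of _ _ "- _"])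
 then show "finite {m. f (- m) \<noteq> 0}" using f by simp
qed

lemma vr_Dop [simp]: "vr (app (Dop c) v) a m = actE c (vr v a m)"
proof -
 have "okF (\<lambda>g a m. actE c (g a m))"
 unfolding okF_def
 proof (intro conjI allI)
 fix v :: "'a vv"
 have "{m. actE c (vr v False m) \<noteq> 0} \<subseteq> {m. vr v False m \<noteq> 0}" by auto
 then have "finite {m. actE c (vr v False m) \<noteq> 0}" by (rule finite_subset) (rule vr_fin)
 moreover obtain N where "\<forall>m<N. vr v True m = 0" using vr_bounded by blast
 ultimately show "(\<lambda>a m. actE c (vr v a m)) \<in> VV" by (auto simp: VV_def intro!: exI[of _ N])
 qed (simp add: actE_lin)
 then show ?thesis unfolding Dop_def by (simp add: vr_mk)
qed

lemma vr_Uop [simp]: "vr (app Uop v) a m = (if a then vr v True (m - 1) else vr v False (m + 1))"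
proof -
 have "(\<lambda>a m. if a then vr v True (m - 1) else vr v False (m + 1)) \<in> VV" for v :: "'a vv"
 proof -
 obtain N where "\<forall>m<N. vr v True m = 0" using vr_bounded by blast
 then show ?thesis using finite_shift(1)[OF vr_fin[of v]] by (auto simp: VV_def intro!: exI[of _ N])
 qed
 then show ?thesis unfolding Uop_def by (subst vr_mk) (auto simp: okF_def)
qed

lemma vr_Uin [simp]: "vr (app Uin v) a m = (if a then vr v True (m + 1) else vr v False (m - 1))"
proof -
 have "(\<lambda>a m. if a then vr v True (m + 1) else vr v False (m - 1)) \<in> VV" for v :: "'a vv"
 proof -
 obtain N where "\<forall>m<N. vr v True m = 0" using vr_bounded by blast
 then show ?thesis using finite_shift(1)[OF vr_fin[of v], of "- 1"] by (auto simp: VV_def intro!: exI[of _ "N - 1"])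
 qed
 then show ?thesis unfolding Uin_def by (subst vr_mk) (auto simp: okF_def)
qed

lemma vr_io [simp]: "vr (app io v) a m = (if a then vr v False (- m) else 0)"
proof -
 have "(\<lambda>a m. if a then vr v False (- m) else 0) \<in> VV" for v :: "'a vv"
 proof -
 define S where "S = {m. vr v False (- m) \<noteq> 0}"
 have S: "finite S" unfolding S_def by (rule finite_shift(2)[OF vr_fin])
 have "vr v False (- m) = 0" if m: "m < Min (insert 0 S)" for m
 proof (rule ccontr)
 assume "vr v False (- m) \<noteq> 0"
 then have "Min (insert 0 S) \<le> m" using S by (intro Min_le) (simp_all add: S_def)
 with m show False by simp
 qed
 then show ?thesis by (auto simp: VV_def)
 qed
 then show ?thesis unfolding io_def by (subst vr_mk) (auto simp: okF_def)
qed

lemma vr_E1 [simp]: "vr (app E1 v) a m = (if a then 0 else vr v False m)"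
proof -
 have "(\<lambda>a m. if a then 0 else vr v False m) \<in> VV" for v :: "'a vv" using vr_fin[of v] by (auto simp: VV_def)
 then show ?thesis unfolding E1_def by (subst vr_mk) (auto simp: okF_def)
qed

lemma cv_add: "cv x (\<lambda>m. vr v a m + vr w a m) m = cv x (vr v a) m + cv x (vr w a) m"
proof -
 obtain N M where "\<forall>m<N. vr v a m = 0" "\<forall>m<M. vr w a m = 0" using vr_bounded by metis
 then have "\<forall>m<min N M. vr v a m = 0" "\<forall>m<min N M. vr w a m = 0" by auto
 then show ?thesis by (rule cv_lin(2))
qed

lemma vr_P2 [simp]: "vr (app (P2 x) v) a m = (if a then cv x (vr v True) m else 0)"
proof -
 have "(\<lambda>a m. if a then cv x (vr v True) m else 0) \<in> VV" for v
 proof -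
 obtain N where N: "\<forall>m<N. vr v True m = 0" using vr_bounded by blast
 then have "\<forall>m<N. cv x (vr v True) m = 0" using cv_bounded[OF N] by blast
 then show ?thesis by (auto simp: VV_def)
 qed
 then show ?thesis unfolding P2_def by (subst vr_mk) (auto simp: okF_def cv_add)
qed

lemma vr_P1 [simp]: "sm y \<Longrightarrow> vr (app (P1 y) v) a m = (if a then 0 else cv y (vr v False) m)"
proof -
 assume y: "sm y"
 have "(\<lambda>a m. if a then 0 else cv y (vr v False) m) \<in> VV" for v
 using cv_finite[OF y vr_fin[of v]] by (simp add: VV_def)
 then have "okF (\<lambda>g a m. if a then 0 else cv y (g False) m)" by (auto simp: okF_def cv_add)
 then show ?thesis by (simp add: P1_def y vr_mk)
qed

lemma op_eqI: "(\<And>v a m. vr (app f v) a m = vr (app g v) a m) \<Longrightarrow> f = g"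
 by (intro endo_eqI vv_eqI)

lemma rhom_Dop: "rhom Dop" and Dop_1: "Dop 1 = 1"
 unfolding rhom_def by (intro conjI allI op_eqI; simp add: actE_lin)+

lemma UU: "Uop * Uin = 1" "Uin * Uop = (1 :: 'n::finite vv endo)"
 by (intro op_eqI; simp)+

lemma Uop_comm: "Uop * Dop c = Dop c * Uop" "Uin * Dop c = Dop c * Uin" "Uop * io = io * (Uop :: 'n::finite vv endo)"
 "io * Dop c = Dop c * io" "E1 * Dop c = Dop c * E1" "Uop * E1 = E1 * (Uop :: 'n vv endo)"
 by (intro op_eqI; simp add: algebra_simps)+

lemma cvr:
 "cv (x + y) (vr v a) m = cv x (vr v a) m + cv y (vr v a) m"
 "cv (x * y) (vr v a) m = cv x (cv y (vr v a)) m"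
 "cv (fps_X * x) (vr v a) m = cv x (vr v a) (m - 1)"
 "cv (fps_const c * x) (vr v a) m = actE c (cv x (vr v a) m)"
 "cv (x * fps_const c) (vr v a) m = cv x (\<lambda>m. actE c (vr v a m)) m"
 "cv 1 (vr v a) m = vr v a m"
 "cv x (\<lambda>m. vr v a (m + d)) m = cv x (vr v a) (m + d)"
 "cv x (\<lambda>m. vr v a (m - d)) m = cv x (vr v a) (m - d)"
proof -
 obtain N where N: "\<forall>m<N. vr v a m = 0" using vr_bounded by blast
 show "cv (x + y) (vr v a) m = cv x (vr v a) m + cv y (vr v a) m"
 "cv (x * y) (vr v a) m = cv x (cv y (vr v a)) m"
 "cv (fps_X * x) (vr v a) m = cv x (vr v a) (m - 1)"
 "cv (fps_const c * x) (vr v a) m = actE c (cv x (vr v a) m)"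
 "cv (x * fps_const c) (vr v a) m = cv x (\<lambda>m. actE c (vr v a m)) m"
 "cv 1 (vr v a) m = vr v a m"
 "cv x (\<lambda>m. vr v a (m + d)) m = cv x (vr v a) (m + d)"
 "cv x (\<lambda>m. vr v a (m - d)) m = cv x (vr v a) (m - d)"
 by (rule cv_lin(1)[OF N N] cv_mult[OF N] cv_fps_X[OF N] cv_fps_const(1)[OF N] cv_fps_const(2)[OF N] cv_1[OF N] cv_shift[OF N]
 cv_shift[OF N, of x "- d" m, unfolded add_uminus_conv_diff])+
qed

lemma vr_fun: "vr (app (Dop c) v) a = (\<lambda>m. actE c (vr v a m))"
 "vr (app (P2 x) v) True = cv x (vr v True)" "sm y \<Longrightarrow> vr (app (P1 y) v) False = cv y (vr v False)"
 "vr (app Uop v) True = (\<lambda>m. vr v True (m + (- 1)))" "vr (app Uop v) False = (\<lambda>m. vr v False (m + 1))"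
 by (simp_all add: fun_eq_iff)

lemma rhom_P2: "rhom P2"
 unfolding rhom_def by (intro conjI allI op_eqI; simp add: vr_fun cvr(1,2))

lemma P2_simps:
 "Dop c * P2 x = P2 (fps_const c * x)" "P2 x * Dop c = P2 (x * fps_const c)"
 "Uop * P2 x = P2 (fps_X * x)" "P2 x * Uop = P2 (fps_X * x)"
 by (intro op_eqI; simp add: vr_fun cvr(3-8))+

lemma P1_simps:
 fixes x y :: "'a::finite ecr fps"
 assumes "sm x" "sm y"
 shows "P1 (x + y) = P1 x + P1 y" "P1 (x * y) = P1 x * P1 y" "P1 (x - y) = P1 x - P1 y" "P1 (- x) = - P1 x"
 "Dop c * P1 x = P1 (fps_const c * x)" "P1 x * Dop c = P1 (x * fps_const c)"
 "Uin * P1 x = P1 (fps_X * x)" "P1 x * Uop = Uop * P1 x" "E1 * P1 x = P1 x" "P1 x * E1 = P1 x"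
proof -
 note s = assms sm_lin(1)[OF assms] sm_mult[OF assms] sm_mult[OF sm_lin(5) assms(1)] sm_mult[OF assms(1) sm_lin(5)]
 sm_mult[OF sm_lin(6) assms(1)]
 have a: "P1 (x + y) = P1 x + P1 y" if "sm x" "sm y" for x y :: "'a ecr fps"
 by (intro op_eqI) (simp add: that sm_lin(1) cvr)
 show "P1 (x + y) = P1 x + P1 y" by (rule a[OF assms])
 show "P1 (x * y) = P1 x * P1 y" by (intro op_eqI) (simp add: s vr_fun cvr(2))
 show "Dop c * P1 x = P1 (fps_const c * x)" "P1 x * Dop c = P1 (x * fps_const c)"
 "Uin * P1 x = P1 (fps_X * x)" "P1 x * Uop = Uop * P1 x" "E1 * P1 x = P1 x"
 by (intro op_eqI; simp add: s vr_fun cvr(3-8))+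
 have "vr (app E1 v) False = vr v False" for v :: "'a vv" by (simp add: fun_eq_iff)
 then show "P1 x * E1 = P1 x" by (intro op_eqI) (simp add: s)
 have neg: "P1 (- z) = - P1 z" if "sm z" for z :: "'a ecr fps"
 proof -
 have "cv (- z) (vr v False) m = - cv z (vr v False) m" for v m by (simp add: cv_def sum_negf)
 then show ?thesis using that sm_lin(2)[OF that] by (intro op_eqI) simp
 qed
 show "P1 (- x) = - P1 x" using neg assms by blast
 have "P1 (x + (- y)) = P1 x + P1 (- y)" by (rule a[OF assms(1) sm_lin(2)[OF assms(2)]])
 then show "P1 (x - y) = P1 x - P1 y" using neg[OF assms(2)] by simp
qed

lemma P1_1: "P1 1 = E1"
 by (intro op_eqI) (simp add: sm_lin cvr)

lemma P_hE_torsion: "fps_const hE * x = 0 \<Longrightarrow> P2 x = 0" "fps_const hE * x = 0 \<Longrightarrow> sm x \<Longrightarrow> P1 x = 0"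
proof -
 have "cv x g m = 0" if "fps_const hE * x = 0" for g m
 proof -
 have "hE * x $ e = 0" for e using arg_cong[OF that, of "\<lambda>y. y $ e"] by simp
 then show ?thesis by (simp add: cv_def actE_hE_torsion)
 qed
 then show "fps_const hE * x = 0 \<Longrightarrow> P2 x = 0" "fps_const hE * x = 0 \<Longrightarrow> sm x \<Longrightarrow> P1 x = 0"
 by (intro op_eqI; simp)+
qed

section \<open>Products of two matrices in different tensor copies\<close>

text \<open>Every placement of the flip is brought to a double sum over the same pairs (s, t), so
  that relations between entries can be inserted under the sum.\<close>

lemma op_terms:
 fixes L m :: "'n::finite \<Rightarrow> 'n \<Rightarrow> 't::ring_1" and \<phi> :: "('n, 't) ivec"
 assumes ab: "a \<noteq> b"
 defines "P \<equiv> prO (swp b a) :: ('n, 't) ivec endo"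
 and "F \<equiv> \<lambda>r s t. \<phi> (r(a := t, b := s))"
 shows "app (matO b m * matO a L) \<phi> r = (\<Sum>s\<in>UNIV. \<Sum>t\<in>UNIV. m (r b) s * L (r a) t * F r s t)"
 "app (matO a L * matO b m) \<phi> r = (\<Sum>s\<in>UNIV. \<Sum>t\<in>UNIV. L (r a) t * m (r b) s * F r s t)"
 "app (matO b m * matO a L * P) \<phi> r = (\<Sum>s\<in>UNIV. \<Sum>t\<in>UNIV. m (r b) t * L (r a) s * F r s t)"
 "app (P * (matO b m * matO a L)) \<phi> r = (\<Sum>s\<in>UNIV. \<Sum>t\<in>UNIV. m (r a) s * L (r b) t * F r s t)"
 "app (P * (matO b m * matO a L) * P) \<phi> r = (\<Sum>s\<in>UNIV. \<Sum>t\<in>UNIV. m (r a) t * L (r b) s * F r s t)"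
 "app (matO a L * matO b m * P) \<phi> r = (\<Sum>s\<in>UNIV. \<Sum>t\<in>UNIV. L (r a) s * m (r b) t * F r s t)"
 "app (P * (matO a L * matO b m)) \<phi> r = (\<Sum>s\<in>UNIV. \<Sum>t\<in>UNIV. L (r b) t * m (r a) s * F r s t)"
proof -
 have 1: "app (matO b m * matO a L) \<psi> r = (\<Sum>s\<in>UNIV. \<Sum>t\<in>UNIV. m (r b) s * L (r a) t * \<psi> (r(a := t, b := s)))"
 for \<psi> :: "('n, 't) ivec" and r and L m :: "'n \<Rightarrow> 'n \<Rightarrow> 't"
 using ab by (simp add: app_matO sum_distrib_left mult.assoc fun_upd_twist)
 have 2: "app (matO a L * matO b m) \<psi> r = (\<Sum>s\<in>UNIV. \<Sum>t\<in>UNIV. L (r a) t * m (r b) s * \<psi> (r(a := t, b := s)))"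
 for \<psi> :: "('n, 't) ivec" and r and L m :: "'n \<Rightarrow> 'n \<Rightarrow> 't"
 using ab by (subst sum.swap) (simp add: app_matO sum_distrib_left mult.assoc)
 have u1: "r(a := t, b := s) \<circ> swp b a = r(a := s, b := t)" for r :: "nat \<Rightarrow> 'n" and s t
 using ab by (auto simp: fun_eq_iff Transposition.transpose_def)
 have u2: "(r \<circ> swp b a)(a := t, b := s) = r(a := t, b := s)" for r :: "nat \<Rightarrow> 'n" and s t
 using ab by (auto simp: fun_eq_iff Transposition.transpose_def)
 show "app (matO b m * matO a L) \<phi> r = (\<Sum>s\<in>UNIV. \<Sum>t\<in>UNIV. m (r b) s * L (r a) t * F r s t)"
 "app (matO a L * matO b m) \<phi> r = (\<Sum>s\<in>UNIV. \<Sum>t\<in>UNIV. L (r a) t * m (r b) s * F r s t)"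
 unfolding 1 2 F_def by (rule refl)+
 have PT: "app (X * P) \<phi> r = app X (\<lambda>r. \<phi> (r \<circ> swp b a)) r" for X r
 by (simp add: P_def) (rule arg_cong[of _ _ "\<lambda>z. app X z r"], simp add: fun_eq_iff)
 show "app (matO b m * matO a L * P) \<phi> r = (\<Sum>s\<in>UNIV. \<Sum>t\<in>UNIV. m (r b) t * L (r a) s * F r s t)"
 "app (matO a L * matO b m * P) \<phi> r = (\<Sum>s\<in>UNIV. \<Sum>t\<in>UNIV. L (r a) s * m (r b) t * F r s t)"
 unfolding PT 1 2 u1 F_def by (subst sum.swap, rule refl)+
 have PL: "app (P * X) \<psi> r = app X \<psi> (r \<circ> swp b a)" for X and \<psi> :: "('n, 't) ivec"
 by (simp add: P_def)
 have ra: "(r \<circ> swp b a) a = r b" "(r \<circ> swp b a) b = r a"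
 using ab by (auto simp: Transposition.transpose_def)
 show "app (P * (matO b m * matO a L)) \<phi> r = (\<Sum>s\<in>UNIV. \<Sum>t\<in>UNIV. m (r a) s * L (r b) t * F r s t)"
 "app (P * (matO a L * matO b m)) \<phi> r = (\<Sum>s\<in>UNIV. \<Sum>t\<in>UNIV. L (r b) t * m (r a) s * F r s t)"
 unfolding PL 1 2 u2 ra F_def by (rule refl)+
 show "app (P * (matO b m * matO a L) * P) \<phi> r = (\<Sum>s\<in>UNIV. \<Sum>t\<in>UNIV. m (r a) t * L (r b) s * F r s t)"
 unfolding PT PL 1 u2 ra u1 F_def by (subst sum.swap) (rule refl)
qed

section \<open>Inverses of \<open>L^+\<close>\<close>

fun rinv :: "('n::finite \<Rightarrow> 'n \<Rightarrow> 'a::ring_1 fps) \<Rightarrow> nat \<Rightarrow> 'n \<Rightarrow> 'n \<Rightarrow> 'a" where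
 "rinv A m i j = (if m = 0 then (if i = j then 1 else 0)
 else - (\<Sum>c<m. \<Sum>t\<in>UNIV. A i t $ (m - c) * rinv A c t j))"

declare rinv.simps [simp del]

lemma rinv_right:
 assumes "\<And>i j. A i j $ 0 = (if i = j then 1 else 0)"
 shows "(\<Sum>t\<in>UNIV. A i t * Abs_fps (\<lambda>m. rinv A m t j)) = (if i = j then 1 else 0)"
proof (rule fps_ext)
 fix m
 have "(\<Sum>t\<in>UNIV. A i t * Abs_fps (\<lambda>m. rinv A m t j)) $ m = (\<Sum>t\<in>UNIV. \<Sum>c\<le>m. A i t $ (m - c) * rinv A c t j)"
 unfolding fps_sum_nth
 proof (rule sum.cong[OF refl])
 fix t
 have "(A i t * Abs_fps (\<lambda>m. rinv A m t j)) $ m = (\<Sum>c=0..m. A i t $ c * rinv A (m - c) t j)"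
 by (simp add: fps_mult_nth)
 also have "\<dots> = (\<Sum>c\<le>m. A i t $ (m - c) * rinv A c t j)"
 by (rule sum.reindex_bij_witness[of _ "\<lambda>c. m - c" "\<lambda>c. m - c"]) auto
 finally show "(A i t * Abs_fps (\<lambda>m. rinv A m t j)) $ m = (\<Sum>c\<le>m. A i t $ (m - c) * rinv A c t j)" .
 qed
 also have "\<dots> = (\<Sum>c\<le>m. \<Sum>t\<in>UNIV. A i t $ (m - c) * rinv A c t j)" by (rule sum.swap)
 also have "\<dots> = (\<Sum>c<m. \<Sum>t\<in>UNIV. A i t $ (m - c) * rinv A c t j) + rinv A m i j"
 proof -
 have "(\<Sum>t\<in>UNIV. A i t $ 0 * rinv A m t j) = (\<Sum>t\<in>UNIV. if i = t then rinv A m t j else 0)"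
 by (rule sum.cong) (auto simp: assms)
 then show ?thesis by (simp add: lessThan_Suc_atMost[symmetric])
 qed
 also have "\<dots> = (if i = j then 1 else 0) $ m"
 unfolding rinv.simps[of A m i j] by (cases "m = 0") simp_all
 finally show "(\<Sum>t\<in>UNIV. A i t * Abs_fps (\<lambda>m. rinv A m t j)) $ m = (if i = j then 1 else 0) $ m" .
qed

lemma matrix_mult_nth: "vec_nth (vec_nth (A ** B) i) j = (\<Sum>t\<in>UNIV. vec_nth (vec_nth A i) t * vec_nth (vec_nth B t) j)"
 by (simp add: matrix_matrix_mult_def)

text \<open>A right inverse B of A is unipotent again and has a right inverse C of its own; then A =
  C, and B is a two-sided inverse. This also settles the choice hidden in
  \<open>matrix_inv\<close>.\<close>

lemma unipotent_invertible:
 fixes A :: "('a::ring_1 fps)^'n^'n"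
 assumes A: "\<And>i j. vec_nth (vec_nth A i) j $ 0 = (if i = j then 1 else 0)"
 shows "A ** matrix_inv A = mat 1" "matrix_inv A ** A = mat 1"
proof -
 have R: "\<exists>B. A ** B = mat 1 \<and> (\<forall>i j. vec_nth (vec_nth B i) j $ 0 = (if i = j then 1 else 0))"
 if A: "\<And>i j. vec_nth (vec_nth A i) j $ 0 = (if i = j then 1 else 0)" for A :: "('a fps)^'n^'n"
 proof (intro exI conjI)
 let ?B = "vec_lambda (\<lambda>i. vec_lambda (\<lambda>j. Abs_fps (\<lambda>m. rinv (\<lambda>i j. vec_nth (vec_nth A i) j) m i j)))"
 show "A ** ?B = mat 1"
 unfolding vec_eq_iff matrix_mult_nth using rinv_right[OF A] by (simp add: mat_def)
 show "\<forall>i j. vec_nth (vec_nth ?B i) j $ 0 = (if i = j then 1 else 0)" by (simp add: rinv.simps)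
 qed
 obtain B where B: "A ** B = mat 1" "\<And>i j. vec_nth (vec_nth B i) j $ 0 = (if i = j then 1 else 0)" using R[OF A] by blast
 obtain C where C: "B ** C = mat 1" using R[OF B(2)] by blast
 have "A = A ** (B ** C)" by (simp add: C)
 also have "\<dots> = C" by (simp add: matrix_mul_assoc B(1))
 finally have "B ** A = mat 1" using C by simp
 then have "\<exists>B. A ** B = mat 1 \<and> B ** A = mat 1" using B by blast
 then have "A ** matrix_inv A = mat 1 \<and> matrix_inv A ** A = mat 1" unfolding matrix_inv_def by (rule someI_ex)
 then show "A ** matrix_inv A = mat 1" "matrix_inv A ** A = mat 1" by blast+
qed

lemma Lplus_0: "vec_nth (vec_nth (Lplus a) i) j $ 0 = (if i = j then 1 else 0)"
 by (simp add: Lplus_def lcoeff_def)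

definition Lh :: "complex \<Rightarrow> 'n::finite \<Rightarrow> 'n \<Rightarrow> 'n ecr fps" where
 "Lh a i j = fmap e2 (vec_nth (vec_nth (Lplus a) i) j)"

definition Yh :: "complex \<Rightarrow> 'n::finite \<Rightarrow> 'n \<Rightarrow> 'n ecr fps" where
 "Yh a i j = fmap e2 (vec_nth (vec_nth (matrix_inv (Lplus a)) i) j)"

lemma Lh_Yh: "(\<Sum>t\<in>UNIV. Lh a i t * Yh a t j) = (if i = j then 1 else 0)"
 "(\<Sum>t\<in>UNIV. Yh a i t * Lh a t j) = (if i = j then 1 else 0)"
proof -
 have 1: "fmap e2 (if i = j then 1 else 0) = (if i = j then 1 else 0 :: 'a ecr fps)" by (simp add: fmap_1 fps_eq_iff)
 note inv = unipotent_invertible[of "Lplus a :: ('a free fps)^'a^'a", OF Lplus_0]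
 show "(\<Sum>t\<in>UNIV. Lh a i t * Yh a t j) = (if i = j then 1 else 0)"
 using arg_cong[OF inv(1), of "\<lambda>M. fmap e2 (vec_nth (vec_nth M i) j)"]
 unfolding matrix_mult_nth by (simp add: Lh_def Yh_def mat_def rhomD[OF rhom_fmap[OF rhom_e2]] 1)
 show "(\<Sum>t\<in>UNIV. Yh a i t * Lh a t j) = (if i = j then 1 else 0)"
 using arg_cong[OF inv(2), of "\<lambda>M. fmap e2 (vec_nth (vec_nth M i) j)"]
 unfolding matrix_mult_nth by (simp add: Lh_def Yh_def mat_def rhomD[OF rhom_fmap[OF rhom_e2]] 1)
qed

lemma sm_Lp: "sm (Lp i j)"
 unfolding sm_def
proof
 fix w :: "'a wmod"
 obtain q where q: "\<forall>r\<ge>int q. \<forall>i j. actE (hE * eg i j r) w = 0" using gen_smooth by blast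
 have "actE (Lp i j $ b) w = 0" if bq: "b \<ge> Suc q" for b
 proof -
 obtain r where b: "b = Suc r" "r \<ge> q" using bq by (cases b) auto
 have "Lp i j $ b = - (hE * eg i j (int r))" unfolding b(1) Lp_def using lc_eq(1)[of i j r] by simp
 then show ?thesis using q b(2) by simp
 qed
 then show "\<exists>q. \<forall>b\<ge>q. actE (Lp i j $ b) w = 0" by blast
qed

lemma Lh_nth: "Lh a i j $ m = (\<Sum>e=0..m. Lp i j $ e * (pp (fps_const a * fps_X) ^ e) $ m)"
proof -
 have "Lh a i j = Lp i j oo pp (fps_const a * fps_X)"
 unfolding Lh_def Lplus_def vec_lambda_beta fmap_compose[OF rhom_e2 e2_hom(6)] fmap_inv_minus[OF rhom_e2 e2_hom(6)]
 unfolding pp_def es_def e2_hom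
 by (rule arg_cong2[of _ _ _ _ fps_compose]) (simp_all add: fps_eq_iff Lp_def lc_def)
 then show ?thesis by (simp add: fps_compose_nth)
qed

lemma hdiv_Lh: "m > 0 \<Longrightarrow> hdiv 1 (Lh a i j $ m)"
 unfolding Lh_nth
proof (rule hdiv_sum)
 fix e assume m: "m > 0" "e \<in> {0..m}"
 show "hdiv 1 (Lp i j $ e * (pp (fps_const a * fps_X) ^ e) $ m)"
 proof (cases e)
 case 0
 then show ?thesis using m by (simp add: hdiv_simps(1))
 next
 case (Suc r)
 have "Lp i j $ e = hE ^ 1 * (- eg i j (int r))" unfolding Suc Lp_def using lc_eq(1)[of i j r] by simp
 then have "hdiv 1 (Lp i j $ e)" unfolding hdiv_def by blast
 then show ?thesis by (rule hdiv_simps(5))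
 qed
qed

text \<open>In the m-th coefficient of L^+(u + ah) the e-th summand contains a coefficient of L^+,
  which kills the vector for large e, and a scalar divisible by h^(m-e), which kills it for small e.
  The scalar is central, so either of them can be applied to the vector first.\<close>

lemma sm_Lh: "sm (Lh a i j)"
proof -
 let ?p = "pp (fps_const a * fps_X) :: 'a ecr fps"
 have p1: "hdiv (m - 1) (?p $ m)" for m
 proof (cases m)
 case (Suc r)
 have "hdiv r (es (fps_const a * fps_X) ^ r :: 'a ecr)"
 proof -
 have "es (fps_const a * fps_X) = (es (fps_const a) * hE :: 'a ecr)" by (simp only: rhomD(2)[OF rhom_es] es_simps)
 then have "es (fps_const a * fps_X) ^ r = (hE ^ r * es (fps_const a) ^ r :: 'a ecr)"
 using power_mult_distrib_commute[OF hE_central(1)[symmetric], of "es (fps_const a)" r] by simp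
 then show ?thesis unfolding hdiv_def by blast
 qed
 then have "hdiv r ((- 1) ^ r * es (fps_const a * fps_X) ^ r :: 'a ecr)" by (rule hdiv_simps(6))
 then show ?thesis unfolding Suc by (simp add: pp_def inv_minus_def power_minus[of "es _"])
 qed (simp add: hdiv_simps)
 have pe: "hdiv (m - e) ((?p ^ e) $ m)" for e m
 proof (induction e arbitrary: m)
 case 0
 show ?case by (cases m) (simp_all add: hdiv_simps)
 next
 case (Suc e)
 have "hdiv (m - Suc e) ((?p * ?p ^ e) $ m)"
 unfolding fps_mult_nth
 proof (rule hdiv_sum)
 fix i assume "i \<in> {0..m}"
 then show "hdiv (m - Suc e) (?p $ i * (?p ^ e) $ (m - i))"
 by (intro hdiv_mono[OF hdiv_mult[OF p1[of i] Suc.IH[of "m - i"]]]) auto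
 qed
 then show ?case by simp
 qed
 interpret evp ?p by (rule evp_pp)
 have pec: "(?p ^ e) $ m * z = z * (?p ^ e) $ m" for e m z
 using arg_cong[OF pow_c[of e "fps_const z"], of "\<lambda>y. y $ m"] by simp
 show ?thesis
 unfolding sm_def
 proof
 fix w :: "'a wmod"
 obtain N where N: "\<forall>M\<ge>N. actE (hE ^ M) w = 0" using hE_nilpotent by blast
 obtain q where q: "\<forall>b\<ge>q. actE (Lp i j $ b) w = 0" using sm_Lp unfolding sm_def by blast
 have "actE (Lh a i j $ m) w = 0" if m: "m \<ge> q + N" for m
 proof -
 have "actE (Lp i j $ e * (?p ^ e) $ m) w = 0" for e
 proof (cases "e \<ge> q")
 case True
 then show ?thesis unfolding pec[of e m "Lp i j $ e", symmetric] actE_lin(3) using q by simp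
 next
 case False
 then have "hdiv N ((?p ^ e) $ m)" using m by (intro hdiv_mono[OF pe]) simp
 then obtain z where "(?p ^ e) $ m = hE ^ N * z" unfolding hdiv_def by blast
 then have "(?p ^ e) $ m = z * hE ^ N" by (simp only: hE_central(2))
 then show ?thesis using N by (simp add: actE_lin)
 qed
 then show ?thesis unfolding Lh_nth actE_sum by simp
 qed
 then show "\<exists>q. \<forall>b\<ge>q. actE (Lh a i j $ b) w = 0" by blast
 qed
qed

text \<open>The argument is an induction on the power of h that kills w. From Y L = 1, the b-th
  coefficient of Y on w is expressed by lower ones on L_d w with d > 0. These vectors are killed by
  a smaller power of h since L_d is divisible by h, and only finitely many are nonzero since L is
  smooth.\<close>

lemma sm_Yh: "sm (Yh a i j)"
proof -
 have "\<exists>q. \<forall>b\<ge>q. actE (Yh a i j $ b) w = 0" if "actE (hE ^ N) w = 0" for N w and i j :: 'a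
 using that
 proof (induction N arbitrary: w i j)
 case 0
 then show ?case by (simp add: actE_lin)
 next
 case (Suc N)
 have "\<forall>t. \<exists>D. \<forall>d\<ge>D. actE (Lh a t j $ d) w = 0" using sm_Lh unfolding sm_def by blast
 then obtain D where D: "\<And>t d. d \<ge> D t \<Longrightarrow> actE (Lh a t j $ d) w = 0" by metis
 define D' where "D' = Max (range D)"
 have D': "d \<ge> D' \<Longrightarrow> actE (Lh a t j $ d) w = 0" for t d
 using D[of t d] Max_ge[of "range D" "D t"] by (simp add: D'_def)
 have "\<exists>q. \<forall>b\<ge>q. actE (Yh a i t $ b) (actE (Lh a t j $ d) w) = 0" if d0: "d > 0" for t d
 proof (rule Suc.IH)
 obtain z where "Lh a t j $ d = hE ^ 1 * z" using hdiv_Lh[OF d0] unfolding hdiv_def by blast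
 then have "hE ^ N * Lh a t j $ d = hE ^ Suc N * z" by (simp only: power_Suc2 mult.assoc power_one_right)
 then have "hE ^ N * Lh a t j $ d = z * hE ^ Suc N" unfolding hE_central(2)[of "Suc N" z] .
 then show "actE (hE ^ N) (actE (Lh a t j $ d) w) = 0"
 using Suc.prems by (simp only: actE_lin(3)[symmetric]) (simp only: actE_lin(3) actE_simps)
 qed
 then have "\<forall>t d. \<exists>q. d > 0 \<longrightarrow> (\<forall>b\<ge>q. actE (Yh a i t $ b) (actE (Lh a t j $ d) w) = 0)" by blast
 then obtain q where q: "\<And>t d b. d > 0 \<Longrightarrow> b \<ge> q t d \<Longrightarrow> actE (Yh a i t $ b) (actE (Lh a t j $ d) w) = 0" by metis
 define Q where "Q = Max ((\<lambda>(t, d). q t d) ` (UNIV \<times> {..D'}))"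
 have Q: "q t d \<le> Q" if "d \<le> D'" for t d
 unfolding Q_def using that by (intro Max_ge) (auto intro!: image_eqI[of _ _ "(t, d)"])
 have "actE (Yh a i j $ b) w = 0" if b: "b \<ge> Q + D' + 1" for b
 proof -
 have "(\<Sum>t\<in>UNIV. \<Sum>c=0..b. Yh a i t $ c * Lh a t j $ (b - c)) = (if i = j then 1 else 0) $ b"
 using arg_cong[OF Lh_Yh(2)[of a i j], of "\<lambda>y. y $ b"] by (simp add: fps_sum_nth fps_mult_nth)
 also have "\<dots> = 0" using b by simp
 finally have "actE (\<Sum>t\<in>UNIV. \<Sum>c=0..b. Yh a i t $ c * Lh a t j $ (b - c)) w = 0" by simp
 then have "0 = (\<Sum>t\<in>UNIV. \<Sum>c=0..b. actE (Yh a i t $ c) (actE (Lh a t j $ (b - c)) w))"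
 by (simp only: actE_sum(1) actE_lin(3))
 also have "\<dots> = (\<Sum>t\<in>UNIV. if t = j then actE (Yh a i j $ b) w else 0)"
 proof (rule sum.cong[OF refl])
 fix t
 have "(\<Sum>c=0..b. actE (Yh a i t $ c) (actE (Lh a t j $ (b - c)) w)) =
 (\<Sum>c\<in>{b}. actE (Yh a i t $ c) (actE (Lh a t j $ (b - c)) w))"
 proof (rule sum.mono_neutral_right)
 show "\<forall>c\<in>{0..b} - {b}. actE (Yh a i t $ c) (actE (Lh a t j $ (b - c)) w) = 0"
 proof
 fix c assume c: "c \<in> {0..b} - {b}"
 show "actE (Yh a i t $ c) (actE (Lh a t j $ (b - c)) w) = 0"
 proof (cases "b - c \<ge> D'")
 case False
 then show ?thesis using c b Q[of "b - c" t] by (intro q) auto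
 qed (simp add: D')
 qed
 qed auto
 then show "(\<Sum>c=0..b. actE (Yh a i t $ c) (actE (Lh a t j $ (b - c)) w)) = (if t = j then actE (Yh a i j $ b) w else 0)"
 by (simp add: Lh_def Lplus_0 actE_lin)
 qed
 finally show ?thesis by simp
 qed
 then show ?case by blast
 qed
 then show ?thesis unfolding sm_def using hE_nilpotent by blast
qed

section \<open>The ring of operators\<close>

definition smm :: "'n::finite ecr fps fps \<Rightarrow> bool" where
 "smm z \<longleftrightarrow> (\<forall>p. sm (z $ p))"

lemma sm_sum: "(\<And>a. a \<in> A \<Longrightarrow> sm (f a)) \<Longrightarrow> sm (sum f A)"
 by (induction A rule: infinite_finite_induct) (auto intro: sm_lin)

lemma smm_lin [simp]: "smm x \<Longrightarrow> smm y \<Longrightarrow> smm (x + y)" "smm x \<Longrightarrow> smm y \<Longrightarrow> smm (x - y)" "smm x \<Longrightarrow> smm y \<Longrightarrow> smm (x * y)"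
 "sm c \<Longrightarrow> smm (fps_const c)" "smm (outer L)" "smm fps_X" "smm hEE" "smm (fps_const fps_X)" "smm hnn" "smm 1"
 by (auto simp: smm_def fps_mult_nth intro!: sm_lin sm_sum sm_mult)

lemma P1_0 [simp]: "P1 0 = 0"
 by (intro op_eqI) (simp add: sm_lin cv_def)

lemma P1_sum: "(\<And>a. a \<in> A \<Longrightarrow> sm (f a)) \<Longrightarrow> P1 (sum f A) = (\<Sum>a\<in>A. P1 (f a))"
 by (induction A rule: infinite_finite_induct) (auto simp: P1_simps(1) sm_sum)

text \<open>Rules for carrying identities in two variables over to operators: the outer variable v
  or v^(-1) stays formal, and the inner variable u becomes \<open>Uop\<close>.\<close>

lemma K2:
 "fmap P2 (x + y) = fmap P2 x + fmap P2 y" "fmap P2 (x - y) = fmap P2 x - fmap P2 y" "fmap P2 (x * y) = fmap P2 x * fmap P2 y"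
 "fps_const (Dop c) * fmap P2 z = fmap P2 (fps_const (fps_const c) * z)"
 "fps_const Uop * fmap P2 z = fmap P2 (fps_const fps_X * z)"
 "fps_X * fmap P2 z = fmap P2 (fps_X * z)"
 "fmap Dop L * fmap P2 z = fmap P2 (outer L * z)"
 "fmap P2 z * fmap Dop L = fmap P2 (z * outer L)"
 "fps_const (P2 u) = fmap P2 (fps_const u)"
proof -
 show "fmap P2 (x + y) = fmap P2 x + fmap P2 y" "fmap P2 (x - y) = fmap P2 x - fmap P2 y" "fmap P2 (x * y) = fmap P2 x * fmap P2 y"
 by (rule rhomD[OF rhom_fmap[OF rhom_P2]])+
 show "fps_const (Dop c) * fmap P2 z = fmap P2 (fps_const (fps_const c) * z)"
 "fps_const Uop * fmap P2 z = fmap P2 (fps_const fps_X * z)"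
 "fps_X * fmap P2 z = fmap P2 (fps_X * z)"
 "fps_const (P2 u) = fmap P2 (fps_const u)"
 by (rule fps_ext; simp add: P2_simps rhomD(3)[OF rhom_P2])+
 show "fmap Dop L * fmap P2 z = fmap P2 (outer L * z)" "fmap P2 z * fmap Dop L = fmap P2 (z * outer L)"
 by (rule fps_ext; simp add: fps_mult_nth rhomD(6)[OF rhom_P2] P2_simps)+
qed

text \<open>The inner variable is u^(-1) here, so multiplication by \<open>Uop\<close> removes one
  inner factor instead of adding one.\<close>

lemma K1:
 assumes z [simp]: "smm z" and x: "smm x" "smm y"
 shows "fmap P1 (x + y) = fmap P1 x + fmap P1 y" "fmap P1 (x - y) = fmap P1 x - fmap P1 y"
 "fps_const (Dop c) * fmap P1 z = fmap P1 (fps_const (fps_const c) * z)"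
 "fps_const Uop * fmap P1 (fps_const fps_X * z) = fmap P1 z"
 "fps_X * fmap P1 z = fmap P1 (fps_X * z)"
 "fmap Dop L * fmap P1 z = fmap P1 (outer L * z)"
 "fmap P1 z * fmap Dop L = fmap P1 (z * outer L)"
 "fps_const (P1 u) = fmap P1 (fps_const u)"
proof -
 have s: "sm (z $ n)" "sm (x $ n)" "sm (y $ n)" for n using z x by (auto simp: smm_def)
 show "fmap P1 (x + y) = fmap P1 x + fmap P1 y" "fmap P1 (x - y) = fmap P1 x - fmap P1 y"
 "fps_const (Dop c) * fmap P1 z = fmap P1 (fps_const (fps_const c) * z)"
 "fps_X * fmap P1 z = fmap P1 (fps_X * z)"
 "fps_const (P1 u) = fmap P1 (fps_const u)"
 by (rule fps_ext; simp add: s P1_simps(1,3)[OF s(2,3)] P1_simps(5)[OF s(1,1)])+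
 have "Uop * P1 (fps_X * z $ n) = P1 (z $ n)" for n
 unfolding P1_simps(7)[OF s(1,1), symmetric] mult.assoc[symmetric] UU by simp
 then show "fps_const Uop * fmap P1 (fps_const fps_X * z) = fmap P1 z" by (intro fps_ext) simp
 have sc: "sm (fps_const c * z $ n)" "sm (z $ n * fps_const c)" for c n by (intro sm_mult s sm_lin)+
 show "fmap Dop L * fmap P1 z = fmap P1 (outer L * z)" "fmap P1 z * fmap Dop L = fmap P1 (z * outer L)"
 by (rule fps_ext; simp add: fps_mult_nth P1_sum sc P1_simps(5,6)[OF s(1,1)])+
qed

section \<open>Products of matrices in different tensor copies\<close>

text \<open>Each factor changes the index of its own copy only, and the copies are distinct. The
  sums over intermediate lists thus collapse to one term, and the entries multiply in the given
  order.\<close>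

lemma tensor_prod_copies:
 fixes M :: "nat \<Rightarrow> 'a::ring_1^'n^'n"
 assumes "distinct as" "set as \<subseteq> {..<k}" "length r = k" "length t = k"
 shows "tensor_prod k (map (\<lambda>a. in_copy k a (M a)) as) r t =
 (if \<forall>b<k. b \<notin> set as \<longrightarrow> r ! b = t ! b then prod_list (map (\<lambda>a. vec_nth (vec_nth (M a) (r ! a)) (t ! a)) as) else 0)"
 using assms
proof (induction as arbitrary: r)
 case Nil
 have "r = t \<longleftrightarrow> (\<forall>b<k. r ! b = t ! b)" using Nil by (auto intro: nth_equalityI)
 then show ?case by (simp add: tensor_prod_def tensor_one_def)
next
 case (Cons a as)
 let ?T = "tensor_prod k (map (\<lambda>a. in_copy k a (M a)) as)"
 let ?c = "\<forall>b<k. b \<notin> set (a # as) \<longrightarrow> r ! b = t ! b"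
 let ?p = "prod_list (map (\<lambda>a. vec_nth (vec_nth (M a) (r ! a)) (t ! a)) as)"
 have a: "a < k" "a \<notin> set as" using Cons.prems by auto
 have fin: "finite {u :: 'n list. length u = k}"
 using finite_lists_length_eq[of "UNIV :: 'n set" k] by simp
 have "tensor_prod k (map (\<lambda>a. in_copy k a (M a)) (a # as)) r t = (\<Sum>u | length u = k. in_copy k a (M a) r u * ?T u t)"
 by (simp add: tensor_prod_def tensor_mult_def)
 also have "\<dots> = (\<Sum>u\<in>(\<lambda>x. r[a := x]) ` UNIV. in_copy k a (M a) r u * ?T u t)"
 proof (rule sum.mono_neutral_right[OF fin])
 show "\<forall>u\<in>{u. length u = k} - range (\<lambda>x. r[a := x]). in_copy k a (M a) r u * ?T u t = 0"
 proof
 fix u assume u: "u \<in> {u. length u = k} - range (\<lambda>x. r[a := x])"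
 have "\<not> (\<forall>b<k. b \<noteq> a \<longrightarrow> r ! b = u ! b)"
 proof
 assume *: "\<forall>b<k. b \<noteq> a \<longrightarrow> r ! b = u ! b"
 have "u = r[a := u ! a]"
 by (rule nth_equalityI) (use u Cons.prems * in \<open>auto simp: nth_list_update\<close>)
 then show False using u by blast
 qed
 then show "in_copy k a (M a) r u * ?T u t = 0" unfolding in_copy_def by auto
 qed
 qed (use Cons.prems in auto)
 also have "\<dots> = (\<Sum>x\<in>UNIV. in_copy k a (M a) r (r[a := x]) * ?T (r[a := x]) t)"
 proof (rule sum.reindex_cong[OF _ refl refl])
 show "inj (\<lambda>x. r[a := x])"
 by (rule injI) (use a Cons.prems in \<open>metis nth_list_update_eq\<close>)
 qed
 also have "\<dots> = (\<Sum>x\<in>UNIV. if x = t ! a then (if ?c then vec_nth (vec_nth (M a) (r ! a)) x * ?p else 0) else 0)"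
 proof (rule sum.cong[OF refl])
 fix x
 have 1: "in_copy k a (M a) r (r[a := x]) = vec_nth (vec_nth (M a) (r ! a)) x"
 using a Cons.prems by (simp add: in_copy_def)
 have 2: "(\<forall>b<k. b \<notin> set as \<longrightarrow> r[a := x] ! b = t ! b) \<longleftrightarrow> x = t ! a \<and> ?c"
 proof
 assume l: "\<forall>b<k. b \<notin> set as \<longrightarrow> r[a := x] ! b = t ! b"
 have "x = t ! a" using l a Cons.prems by auto
 moreover have "r ! b = t ! b" if "b < k" "b \<notin> set (a # as)" for b using l that by auto
 ultimately show "x = t ! a \<and> ?c" by blast
 qed (use a Cons.prems in \<open>auto simp: nth_list_update\<close>)
 have 3: "prod_list (map (\<lambda>b. vec_nth (vec_nth (M b) (r[a := x] ! b)) (t ! b)) as) = ?p"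
 by (rule arg_cong[of _ _ prod_list], rule map_cong[OF refl]) (use a in \<open>metis nth_list_update_neq\<close>)
 show "in_copy k a (M a) r (r[a := x]) * ?T (r[a := x]) t
 = (if x = t ! a then (if ?c then vec_nth (vec_nth (M a) (r ! a)) x * ?p else 0) else 0)"
 using Cons.IH[of "r[a := x]"] Cons.prems unfolding 1 by (simp only: 2 3 length_list_update) auto
 qed
 also have "\<dots> = (if ?c then vec_nth (vec_nth (M a) (r ! a)) (t ! a) * ?p else 0)"
 by (subst sum.delta) auto
 finally show ?case by (simp only: list.map prod_list.Cons)
qed

definition Ag :: "(nat \<Rightarrow> 'n) \<Rightarrow> nat list \<Rightarrow> (nat \<Rightarrow> 'n) set" where
 "Ag r as = {t. \<forall>b. b \<notin> set as \<longrightarrow> t b = r b}"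

lemma Ag_Cons: "Ag r (a # as) = (\<Union>u. Ag (r(a := u)) as)" if "a \<notin> set as"
proof (rule set_eqI)
 fix t
 show "t \<in> Ag r (a # as) \<longleftrightarrow> t \<in> (\<Union>u. Ag (r(a := u)) as)"
 proof
 assume "t \<in> Ag r (a # as)"
 then have "t \<in> Ag (r(a := t a)) as" by (auto simp: Ag_def)
 then show "t \<in> (\<Union>u. Ag (r(a := u)) as)" by blast
 next
 assume "t \<in> (\<Union>u. Ag (r(a := u)) as)"
 then show "t \<in> Ag r (a # as)" by (auto simp: Ag_def)
 qed
qed

lemma finite_Ag: "distinct as \<Longrightarrow> finite (Ag (r :: nat \<Rightarrow> 'n::finite) as)"
proof (induction as arbitrary: r)
 case Nil
 have "Ag r [] = {r}" by (auto simp: Ag_def)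
 then show ?case by simp
next
 case (Cons a as)
 then show ?case by (simp add: Ag_Cons)
qed

lemma matO_prod:
 fixes m :: "nat \<Rightarrow> 'n::finite \<Rightarrow> 'n \<Rightarrow> 't::ring_1"
 assumes "distinct as"
 shows "app (prod_list (map (\<lambda>a. matO a (m a)) as)) \<phi> r = (\<Sum>t\<in>Ag r as. prod_list (map (\<lambda>a. m a (r a) (t a)) as) * \<phi> t)"
 using assms
proof (induction as arbitrary: r)
 case Nil
 have "Ag r [] = {r}" by (auto simp: Ag_def)
 then show ?case by simp
next
 case (Cons a as)
 have a: "a \<notin> set as" "distinct as" using Cons.prems by auto
 have "app (prod_list (map (\<lambda>a. matO a (m a)) (a # as))) \<phi> r
 = (\<Sum>u\<in>UNIV. \<Sum>t\<in>Ag (r(a := u)) as. m a (r a) u * (prod_list (map (\<lambda>b. m b ((r(a := u)) b) (t b)) as) * \<phi> t))"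
 by (simp add: app_matO Cons.IH[OF a(2)] sum_distrib_left del: fun_upd_apply)
 also have "\<dots> = (\<Sum>u\<in>UNIV. \<Sum>t\<in>Ag (r(a := u)) as. prod_list (map (\<lambda>b. m b (r b) (t b)) (a # as)) * \<phi> t)"
 proof (rule sum.cong[OF refl], rule sum.cong[OF refl])
 fix u t assume "t \<in> Ag (r(a := u)) as"
 then have t: "t a = u" using a by (auto simp: Ag_def)
 have "prod_list (map (\<lambda>b. m b ((r(a := u)) b) (t b)) as) = prod_list (map (\<lambda>b. m b (r b) (t b)) as)"
 by (rule arg_cong[of _ _ prod_list], rule map_cong[OF refl]) (use a in auto)
 then show "m a (r a) u * (prod_list (map (\<lambda>b. m b ((r(a := u)) b) (t b)) as) * \<phi> t)
 = prod_list (map (\<lambda>b. m b (r b) (t b)) (a # as)) * \<phi> t" by (simp add: t mult.assoc)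
 qed
 also have "\<dots> = (\<Sum>t\<in>Ag r (a # as). prod_list (map (\<lambda>b. m b (r b) (t b)) (a # as)) * \<phi> t)"
 unfolding Ag_Cons[OF a(1)]
 proof (rule sum.UNION_disjoint[symmetric])
 show "\<forall>i\<in>UNIV. finite (Ag (r(a := i)) as)" using finite_Ag[OF a(2)] by blast
 show "\<forall>i\<in>UNIV. \<forall>j\<in>UNIV. i \<noteq> j \<longrightarrow> Ag (r(a := i)) as \<inter> Ag (r(a := j)) as = {}"
 using a(1) by (auto simp: Ag_def dest!: spec[of _ a])
 qed simp
 finally show ?case .
qed

context ell_core begin

lemma finite_assignments: "finite S" and Ag_S: "r \<in> S \<Longrightarrow> Ag r [0..<k] = S" "r \<in> S \<Longrightarrow> Ag r (rev [0..<k]) = S"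
proof -
 show a: "r \<in> S \<Longrightarrow> Ag r [0..<k] = S" "r \<in> S \<Longrightarrow> Ag r (rev [0..<k]) = S" for r
 by (auto simp: Ag_def S_def)
 have "(\<lambda>_. d) \<in> S" by (simp add: S_def)
 from a(1)[OF this] show "finite S" using finite_Ag[of "[0..<k]" "\<lambda>_. d"] by simp
qed

text \<open>The abstract trace is expanded into matrix entries, the form in which it can be compared
  with \<open>ell_term\<close>.\<close>

lemma ell_eval: "ell = (\<Sum>s\<in>S. \<Sum>\<sigma> | \<sigma> permutes {..<k}. of_int (sign \<sigma>) *
 (\<Sum>t\<in>S. prod_list (map (\<lambda>a. x a (s (\<sigma> a)) (t a)) [0..<k]) * (\<iota> * prod_list (map (\<lambda>a. y a (t a) (s a)) (rev [0..<k])))))"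
proof -
 have Y1: "app (YY k) (e s 1) t = prod_list (map (\<lambda>a. y a (t a) (s a)) (rev [0..<k]))" if t: "t \<in> S" and s: "s \<in> S" for s t
 proof -
 have dr: "distinct (rev [0..<k])" by simp
 have "app (YY k) (e s 1) t = (\<Sum>t'\<in>S. prod_list (map (\<lambda>a. y a (t a) (t' a)) (rev [0..<k])) * e s 1 t')"
 unfolding YY_def matO_prod[OF dr] Ag_S(2)[OF t] ..
 also have "\<dots> = (\<Sum>t'\<in>S. if t' = s then prod_list (map (\<lambda>a. y a (t a) (t' a)) (rev [0..<k])) else 0)"
 by (rule sum.cong[OF refl]) (auto simp: e_def)
 also have "\<dots> = prod_list (map (\<lambda>a. y a (t a) (s a)) (rev [0..<k]))"
 using s finite_assignments by simp
 finally show ?thesis .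
 qed
 have Z1: "app Z (e s 1) r = (\<Sum>t\<in>S. prod_list (map (\<lambda>a. x a (r a) (t a)) [0..<k]) * (\<iota> * prod_list (map (\<lambda>a. y a (t a) (s a)) (rev [0..<k]))))"
 if r: "r \<in> S" and s: "s \<in> S" for r s
 proof -
 have "app Z (e s 1) r = app (XX k) (app (scO \<iota>) (app (YY k) (e s 1))) r" by (simp add: Z_def)
 also have "\<dots> = (\<Sum>t\<in>S. prod_list (map (\<lambda>a. x a (r a) (t a)) [0..<k]) * app (scO \<iota>) (app (YY k) (e s 1)) t)"
 unfolding XX_def matO_prod[OF distinct_upt] Ag_S(1)[OF r] ..
 finally show ?thesis by (simp add: Y1 s)
 qed
 have "app (A * Z) (e (s(k := d)) 1) (s(k := d)) = (\<Sum>\<sigma> | \<sigma> permutes {..<k}. of_int (sign \<sigma>) *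
 (\<Sum>t\<in>S. prod_list (map (\<lambda>a. x a (s (\<sigma> a)) (t a)) [0..<k]) * (\<iota> * prod_list (map (\<lambda>a. y a (t a) (s a)) (rev [0..<k])))))"
 if s: "s \<in> S" for s
 proof -
 have u: "s(k := d) = s" using s by (intro fun_upd_idem) (simp add: S_def)
 have "app (A * Z) (e s 1) s = (\<Sum>\<sigma> | \<sigma> permutes {..<k}. of_int (sign \<sigma>) * app Z (e s 1) (s \<circ> \<sigma>))"
 by (simp add: A_def app_sum sum_fun_apply)
 also have "\<dots> = (\<Sum>\<sigma> | \<sigma> permutes {..<k}. of_int (sign \<sigma>) *
 (\<Sum>t\<in>S. prod_list (map (\<lambda>a. x a (s (\<sigma> a)) (t a)) [0..<k]) * (\<iota> * prod_list (map (\<lambda>a. y a (t a) (s a)) (rev [0..<k])))))"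
 proof (rule sum.cong[OF refl])
 fix \<sigma> assume "\<sigma> \<in> {\<sigma>. \<sigma> permutes {..<k}}"
 then have p: "\<sigma> permutes {..<k}" by simp
 have "\<sigma> a = a" if "a \<ge> k" for a using permutes_not_in[OF p, of a] that by simp
 then have "s \<circ> \<sigma> \<in> S" using s by (simp add: S_def)
 from Z1[OF this s] show "of_int (sign \<sigma>) * app Z (e s 1) (s \<circ> \<sigma>) = of_int (sign \<sigma>) *
 (\<Sum>t\<in>S. prod_list (map (\<lambda>a. x a (s (\<sigma> a)) (t a)) [0..<k]) * (\<iota> * prod_list (map (\<lambda>a. y a (t a) (s a)) (rev [0..<k]))))"
 by simp
 qed
 finally show ?thesis unfolding u .
 qed
 then show ?thesis unfolding ell_def PT_def by (intro sum.cong[OF refl])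
qed

end

section \<open>The relations in the ring of operators\<close>

text \<open>The entries of L^-(u + ah). \<open>Lq\<close> and \<open>Yq\<close> are those of L^+(u +
  ah + hn/2) and of its inverse; copies are numbered from 0, so u + ah belongs to copy a.\<close>

definition "Xh a i j = sh (px (fps_const (of_nat a) * fps_X)) (Lm i j)"
definition "Lq a (i :: 'n::finite) j = Lh (of_nat a + of_nat CARD('n) / 2) i j"
definition "Yq a (i :: 'n::finite) j = Yh (of_nat a + of_nat CARD('n) / 2) i j"

lemma es_nat: "es (fps_const (of_nat a) * fps_X) = of_nat a * hE"
 unfolding rhomD(2)[OF rhom_es] es_simps fps_of_nat rhom_of_nat[OF rhom_es es_simps(1)] ..

lemma es_half: "es (fps_const (of_nat a + of_nat CARD('n::finite) / 2) * fps_X) = of_nat a * hE + (hn :: 'n ecr)"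
proof -
 have "fps_const (of_nat a + of_nat CARD('n) / 2) * fps_X
 = fps_const (of_nat a) * fps_X + half_n CARD('n)" by (simp only: half_n_def fps_const_add[symmetric] distrib_right)
 then show ?thesis by (simp only: rhomD(1)[OF rhom_es] es_nat hn_def)
qed

lemma hn_hn: "hn + hn = of_nat CARD('n) * (hE :: 'n::finite ecr)"
proof -
 have "half_n CARD('n) + half_n CARD('n) = fps_const (of_nat CARD('n)) * fps_X"
 unfolding half_n_def distrib_right[symmetric] fps_const_add by simp
 then show ?thesis unfolding hn_def rhomD(1)[OF rhom_es, symmetric] by (simp only: es_nat)
qed

lemma Lq_sh: "Lq a i j = sh (pp (fps_const (of_nat a + of_nat CARD('n::finite) / 2) * fps_X)) (Lp i (j :: 'n))"
 unfolding Lq_def Lh_def by (rule fmap_Lplus)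

lemma sm_q [simp]: "sm (Lq a i j)" "sm (Yq a i j)"
 by (simp_all add: Lq_def Yq_def sm_Lh sm_Yh)

lemma Lq_Yq: "(\<Sum>t\<in>UNIV. Lq a i t * Yq a t j) = (if i = j then 1 else 0)"
 "(\<Sum>t\<in>UNIV. Yq a i t * Lq a t j) = (if i = j then 1 else 0)"
 unfolding Lq_def Yq_def by (rule Lh_Yh)+

abbreviation uT :: "'n::finite vv endo fps" where "uT \<equiv> fps_const Uop"
abbreviation hT :: "'n::finite vv endo fps" where "hT \<equiv> fps_const (Dop hE)"
abbreviation hnT :: "'n::finite vv endo fps" where "hnT \<equiv> fps_const (Dop hn)"
abbreviation kT :: "nat \<Rightarrow> 'n::finite vv endo fps" where "kT a \<equiv> fps_const (Dop (of_nat a * hE))"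

definition comm :: "'a::ring_1 set \<Rightarrow> 'a set" where
 "comm G = {w. \<forall>g\<in>G. w * g = g * w}"

lemma comm_closed: "x \<in> comm G \<Longrightarrow> y \<in> comm G \<Longrightarrow> x + y \<in> comm G"
 "x \<in> comm G \<Longrightarrow> y \<in> comm G \<Longrightarrow> x - y \<in> comm G" "x \<in> comm G \<Longrightarrow> - x \<in> comm G"
 "x \<in> comm G \<Longrightarrow> y \<in> comm G \<Longrightarrow> x * y \<in> comm G" "1 \<in> comm G" "of_nat m \<in> comm G"
proof -
 show "x \<in> comm G \<Longrightarrow> y \<in> comm G \<Longrightarrow> x * y \<in> comm G"
 unfolding comm_def by (simp add: mult.assoc) (simp add: mult.assoc[symmetric])
 show "of_nat m \<in> comm G" unfolding comm_def by (simp add: mult_of_nat_commute)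
qed (auto simp: comm_def distrib_left distrib_right left_diff_distrib right_diff_distrib)

definition G0 :: "'n::finite vv endo fps set" where
 "G0 = {uT, fps_X} \<union> range (\<lambda>c. fps_const (Dop (es c)))"

text \<open>The double commutant of u, v and the scalars. Whatever commutes with these generators
  commutes with all of it, it is closed under the ring operations, and it is commutative because the
  generators commute among themselves. One check on generators thus covers every scalar of the
  argument.\<close>

definition Sc0 :: "'n::finite vv endo fps set" where
 "Sc0 = comm (comm G0)"

lemma Sc0_gen: "g \<in> G0 \<Longrightarrow> g \<in> Sc0"
 by (auto simp: Sc0_def comm_def)

lemma es_cc: "es c * es d = es d * es c" by (rule es_central)

lemma G0_comm:
 fixes g g' :: "'a::finite vv endo fps"
 shows "g \<in> G0 \<Longrightarrow> g' \<in> G0 \<Longrightarrow> g * g' = g' * g"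
proof -
 have 1: "Dop (es c) * Dop (es d) = Dop (es d) * Dop (es c :: 'a::finite ecr)" for c d
 by (simp only: rhomD(2)[OF rhom_Dop, symmetric] es_cc)
 show "g \<in> G0 \<Longrightarrow> g' \<in> G0 \<Longrightarrow> g * g' = g' * g"
 unfolding G0_def by (auto simp: 1 Uop_comm fps_mult_fps_X_commute)
qed

lemma Sc0_comm: "p \<in> Sc0 \<Longrightarrow> q \<in> Sc0 \<Longrightarrow> p * q = q * p"
proof -
 assume p: "p \<in> Sc0" and q: "q \<in> Sc0"
 have "g \<in> comm G0" if "g \<in> G0" for g using G0_comm[OF that] by (auto simp: comm_def)
 then have "q \<in> comm G0" using q unfolding Sc0_def comm_def[of "comm G0"] by (auto simp: comm_def[of G0])
 then show ?thesis using p by (auto simp: Sc0_def comm_def[of "comm G0"])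
qed

lemma Sc0_D: "p \<in> Sc0 \<Longrightarrow> w \<in> comm G0 \<Longrightarrow> p * w = w * p"
 by (auto simp: Sc0_def comm_def[of "comm G0"])

lemma Sc0_simps: "uT \<in> (Sc0 :: 'a::finite vv endo fps set)" "fps_X \<in> (Sc0 :: 'a vv endo fps set)"
 "hT \<in> (Sc0 :: 'a vv endo fps set)" "hnT \<in> (Sc0 :: 'a vv endo fps set)" "kT a \<in> (Sc0 :: 'a vv endo fps set)"
proof -
 have "hnT \<in> (G0 :: 'a vv endo fps set)" unfolding G0_def hn_def by blast
 then show "hnT \<in> (Sc0 :: 'a vv endo fps set)" by (rule Sc0_gen)
 have "hT \<in> (G0 :: 'a vv endo fps set)" unfolding G0_def es_simps(3)[symmetric] by blast
 then show "hT \<in> (Sc0 :: 'a vv endo fps set)" by (rule Sc0_gen)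
 have "kT a \<in> (G0 :: 'a vv endo fps set)" unfolding G0_def es_nat[symmetric] by blast
 then show "kT a \<in> (Sc0 :: 'a vv endo fps set)" by (rule Sc0_gen)
qed (auto intro!: Sc0_gen simp: G0_def)

lemmas Sc0_closed = comm_closed[where G = "comm G0", folded Sc0_def]

lemma comm_G0I:
 fixes w :: "'n::finite vv endo fps"
 assumes "uT * w = w * uT" "\<And>c. fps_const (Dop (es c)) * w = w * fps_const (Dop (es c))"
 shows "w \<in> comm G0"
 unfolding comm_def G0_def using assms by (auto simp: fps_mult_fps_X_commute)

lemma fc_es: "fps_const (es c) * z = z * fps_const (es c)" for z :: "'n::finite ecr fps"
 by (rule fps_ext) (simp add: es_central)

lemma comm_G0: "fmap Dop L \<in> comm G0" "fps_const (P2 z) \<in> comm G0" "sm y \<Longrightarrow> fps_const (P1 y) \<in> comm G0"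
 "fps_const io \<in> comm G0"
proof -
 show "fmap Dop L \<in> comm G0"
 by (rule comm_G0I; rule fps_ext; simp add: Uop_comm; simp only: rhomD(2)[OF rhom_Dop, symmetric] es_central)
 show "fps_const (P2 z) \<in> comm G0"
 by (rule comm_G0I) (simp_all add: P2_simps fc_es)
 show "fps_const (P1 y) \<in> comm G0" if "sm y"
 by (rule comm_G0I) (simp_all add: P1_simps(5,6,8)[OF that that] fc_es)
 show "fps_const io \<in> comm G0"
 by (rule comm_G0I) (simp_all add: Uop_comm)
qed

definition xT :: "nat \<Rightarrow> 'n::finite \<Rightarrow> 'n \<Rightarrow> 'n vv endo fps" where "xT a i j = fps_const (P2 (Xh a i j))"
definition LT :: "nat \<Rightarrow> 'n::finite \<Rightarrow> 'n \<Rightarrow> 'n vv endo fps" where "LT a i j = fps_const (P1 (Lq a i j))"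
definition yT :: "nat \<Rightarrow> 'n::finite \<Rightarrow> 'n \<Rightarrow> 'n vv endo fps" where "yT a i j = fps_const (P1 (Yq a i j))"
definition eT :: "'n::finite vv endo fps" where "eT = fps_const E1"

lemma T_torsion: "of_nat m * (z :: 'n::finite vv endo fps) = 0 \<Longrightarrow> m \<noteq> 0 \<Longrightarrow> z = 0"
proof (rule fps_ext)
 fix n assume z: "of_nat m * z = 0" and m: "m \<noteq> 0"
 have "of_nat m = fps_const (of_nat m :: 'n vv endo)" by (rule fps_of_nat[symmetric])
 then have 1: "of_nat m * z $ n = 0" using arg_cong[OF z, of "\<lambda>y. y $ n"] by simp
 have 2: "(of_nat m :: 'n vv endo) = Dop (of_nat m)" by (simp add: rhom_of_nat[OF rhom_Dop Dop_1])
 have "app (z $ n) v = 0" for v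
 proof (rule vv_eqI)
 fix a r
 have "vr (app (of_nat m * z $ n) v) a r = 0" unfolding 1 by simp
 then have "actE (of_nat m) (vr (app (z $ n) v) a r) = 0" unfolding 2 by simp
 then show "vr (app (z $ n) v) a r = vr 0 a r" using wmod_torsion[OF m] by simp
 qed
 then show "z $ n = 0 $ n" by (intro endo_eqI) simp
qed

lemma matO_diag: "matO a (\<lambda>i j. if i = j then e else 0) = scO e"
 by (rule vec_endo_eqI) (simp add: app_matO if_distrib[of "\<lambda>x. x * _"] cong: if_cong)

text \<open>The products are \<open>eT\<close> and not 1, as these operators vanish on the second
  component; but \<open>eT\<close> is a unit for Y on both sides.\<close>

lemma YL: "matO a (yT a) * matO a (LT a) = (scO eT :: ('a::finite, 'a vv endo fps) ivec endo)" "matO a (LT a) * matO a (yT a) = (scO eT :: ('a, 'a vv endo fps) ivec endo)"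
 "scO eT * matO a (yT a) = (matO a (yT a) :: ('a, 'a vv endo fps) ivec endo)"
 "matO a (yT a) * scO eT = (matO a (yT a) :: ('a, 'a vv endo fps) ivec endo)"
proof -
 have P: "(\<Sum>t\<in>UNIV. fps_const (P1 (f t)) * fps_const (P1 (g t))) = (if i = j then eT else 0 :: 'a vv endo fps)"
 if "(\<Sum>t\<in>UNIV. f t * g t) = (if i = j then 1 else 0)" "\<And>t. sm (f t)" "\<And>t. sm (g t)" for f g :: "'a \<Rightarrow> 'a ecr fps" and i j :: 'a
 proof -
 have "(\<Sum>t\<in>UNIV. fps_const (P1 (f t)) * fps_const (P1 (g t))) = fps_const (\<Sum>t\<in>UNIV. P1 (f t * g t))"
 using that(2,3) by (simp add: P1_simps(2) rhomD(6)[OF rhom_fps_const])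
 also have "(\<Sum>t\<in>UNIV. P1 (f t * g t)) = P1 (\<Sum>t\<in>UNIV. f t * g t)"
 by (rule P1_sum[symmetric]) (rule sm_mult[OF that(2,3)])
 finally show ?thesis unfolding that(1) by (simp add: P1_1 eT_def)
 qed
 show "matO a (yT a) * matO a (LT a) = (scO eT :: ('a, 'a vv endo fps) ivec endo)"
 "matO a (LT a) * matO a (yT a) = (scO eT :: ('a, 'a vv endo fps) ivec endo)"
 unfolding matO_mult yT_def LT_def P[OF Lq_Yq(1) sm_q(1,2)] P[OF Lq_Yq(2) sm_q(2,1)] matO_diag by (rule refl)+
 have e: "eT * yT a i j = yT a i j" "yT a i j * eT = yT a i j" for i j :: 'a
 unfolding eT_def yT_def by (simp_all add: P1_simps(9,10)[OF sm_q(2) sm_q(2)])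
 show 1: "scO eT * matO a (yT a) = (matO a (yT a) :: ('a, 'a vv endo fps) ivec endo)"
 by (rule vec_endo_eqI) (simp add: app_matO sum_distrib_left mult.assoc[symmetric] e)
 show "matO a (yT a) * scO eT = (matO a (yT a) :: ('a, 'a vv endo fps) ivec endo)"
 by (rule vec_endo_eqI) (simp add: app_matO mult.assoc[symmetric] e)
qed

lemma eT_comm: "eT \<in> comm G0" "fmap Dop L * eT = eT * fmap Dop L" "p \<in> Sc0 \<Longrightarrow> p * eT = eT * p"
proof -
 show 1: "eT \<in> comm G0" unfolding eT_def by (rule comm_G0I) (simp_all add: Uop_comm)
 show "fmap Dop L * eT = eT * fmap Dop L" unfolding eT_def by (rule fps_ext) (simp add: Uop_comm)
 show "p \<in> Sc0 \<Longrightarrow> p * eT = eT * p" using Sc0_D[OF _ 1] .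
qed

text \<open>For adjacent shifts the relations are known only up to a factor h. The operators live on
  a module where this factor is harmless, by \<open>P_hE_torsion\<close>.\<close>

lemma R56:
 fixes i j k l :: "'a::finite"
 shows
 "xT a i k * xT (Suc a) j l - xT (Suc a) j l * xT a i k - (xT a j k * xT (Suc a) i l - xT (Suc a) j k * xT a i l) = 0"
 "LT a i k * LT (Suc a) j l - LT (Suc a) j l * LT a i k - (LT a j k * LT (Suc a) i l - LT (Suc a) j k * LT a i l) = 0"
proof -
 have "fps_const hE * (Xh a i k * Xh (Suc a) j l - Xh (Suc a) j l * Xh a i k - (Xh a j k * Xh (Suc a) i l - Xh (Suc a) j k * Xh a i l)) = 0"
 unfolding Xh_def
 proof (rule R5)
 show "evp (px (fps_const (of_nat a) * fps_X) :: 'a ecr fps)" "evp (px (fps_const (of_nat (Suc a)) * fps_X) :: 'a ecr fps)"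
 by (rule evp_px, simp)+
 show "px (fps_const (of_nat (Suc a)) * fps_X) = px (fps_const (of_nat a) * fps_X) + fps_const (hE :: 'a ecr)"
 unfolding px_def es_nat by (simp add: distrib_right add.assoc add.commute)
 qed
 from P_hE_torsion(1)[OF this]
 show "xT a i k * xT (Suc a) j l - xT (Suc a) j l * xT a i k - (xT a j k * xT (Suc a) i l - xT (Suc a) j k * xT a i l) = 0"
 unfolding xT_def by (simp add: rhomD(2,5)[OF rhom_P2])
 let ?c = "\<lambda>a. (fps_const (of_nat a + of_nat CARD('a) / 2) * fps_X :: complex fps)"
 let ?d = "\<lambda>a. (1 + fps_const (es (?c a)) * fps_X :: 'a ecr fps)"
 let ?p = "pp (?c a) :: 'a ecr fps" and ?q = "pp (?c (Suc a)) :: 'a ecr fps"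
 have pc: "?p * z = z * ?p" "?q * z = z * ?q" for z :: "'a ecr fps"
 by (rule fps_central, simp add: pp_eq es_central)+
 have dc: "?d b * z = z * ?d b" for b and z :: "'a ecr fps"
 by (rule fps_central) (simp add: fps_X_def distrib_left distrib_right es_central)
 have X: "?d (Suc a) - ?d a = fps_const hE * fps_X"
 unfolding es_half by (simp add: distrib_right fps_const_add[symmetric] del: fps_const_add)
 have "fps_X * ?p = (?d (Suc a) * ?q) * ?p" "fps_X * ?q = (?d a * ?p) * ?q" by (simp_all only: pp_mult)
 moreover have "(?d a * ?p) * ?q = ?d a * (?q * ?p)" "(?d (Suc a) * ?q) * ?p = ?d (Suc a) * (?q * ?p)"
 by (simp_all only: mult.assoc pc(1)[of ?q])
 ultimately have "fps_X * (?p - ?q) = (?d (Suc a) - ?d a) * (?q * ?p)"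
 unfolding right_diff_distrib left_diff_distrib by (simp only:)
 also have "\<dots> = fps_X * (fps_const hE * (?q * ?p))"
 unfolding X by (simp only: fps_mult_fps_X_commute[symmetric] mult.assoc)
 finally have "fps_X * ((?p - ?q) - fps_const hE * (?q * ?p)) = 0" by (simp add: right_diff_distrib)
 then have pq: "?p - ?q = fps_const hE * (?q * ?p)" using cancel_X by fastforce
 have "(?d a * ?d (Suc a)) * (?q * ?p) = ?d a * ((?d (Suc a) * ?q) * ?p)" by (simp only: mult.assoc)
 also have "\<dots> = ?d a * (?p * fps_X)" unfolding pp_mult by (simp only: fps_mult_fps_X_commute)
 also have "\<dots> = (?d a * ?p) * fps_X" by (simp only: mult.assoc)
 finally have d: "(?d a * ?d (Suc a)) * (?q * ?p) = fps_X * fps_X" unfolding pp_mult .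
 let ?R = "\<lambda>i j k l. (Lq a i k * Lq (Suc a) j l - Lq (Suc a) j l * Lq a i k - (Lq a j k * Lq (Suc a) i l - Lq (Suc a) j k * Lq a i l) :: 'a ecr fps)"
 have "fps_const hE * ?R i' j' k' l' = 0" for i' j' k' l'
 unfolding Lq_sh by (rule R6[OF evp_pp evp_pp pq d])
 moreover have s: "sm (Lq b i' k' * Lq c j' l')" for b c and i' j' k' l' :: 'a by (intro sm_mult sm_q)
 ultimately have "P1 (?R i' j' k' l') = 0" for i' j' k' l' by (intro P_hE_torsion(2)) (auto intro!: sm_lin sm_mult)
 then have "P1 (Lq a i' k') * P1 (Lq (Suc a) j' l') - P1 (Lq (Suc a) j' l') * P1 (Lq a i' k')
 - (P1 (Lq a j' k') * P1 (Lq (Suc a) i' l') - P1 (Lq (Suc a) j' k') * P1 (Lq a i' l')) = 0" for i' j' k' l' :: 'a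
 by (simp only: P1_simps(3)[OF sm_lin(3)[OF s s] sm_lin(3)[OF s s]] P1_simps(3)[OF s s] P1_simps(2)[OF sm_q(1) sm_q(1)])
 note R = this
 show "LT a i k * LT (Suc a) j l - LT (Suc a) j l * LT a i k - (LT a j k * LT (Suc a) i l - LT (Suc a) j k * LT a i l) = 0"
 using R[of i k j l] unfolding LT_def by simp
qed

text \<open>With u_a = u + ah, these are v^(-1) times v - u_a + hn/2 and v - u_a - hn/2; here
  \<open>fps_X\<close> is v^(-1). In \<open>alm\<close> and \<open>bem\<close>, which belong to
  L^-(v), \<open>fps_X\<close> is v, and \<open>alm a\<close> is u_a - v.\<close>

definition "alp a = 1 - fps_X * (uT + kT a - hnT)"
definition "bep a = 1 - fps_X * (uT + kT a + hnT)"
definition etp :: "'n::finite vv endo fps" where "etp = - (hT * fps_X)"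
definition "alm a = uT + kT a - fps_X"
definition bem :: "nat \<Rightarrow> 'n::finite vv endo fps" where "bem a = alm a + of_nat CARD('n) * hT"

lemma scalars_Sc0: "alp a \<in> Sc0" "bep a \<in> Sc0" "etp \<in> Sc0" "alm a \<in> Sc0" "bem a \<in> Sc0"
 unfolding alp_def bep_def etp_def alm_def bem_def by (intro Sc0_closed Sc0_simps)+

abbreviation pxa :: "nat \<Rightarrow> 'n::finite ecr fps" where "pxa a \<equiv> px (fps_const (of_nat a) * fps_X)"
text \<open>\<open>Ah\<close>, \<open>Bh\<close>, \<open>Zh\<close> are the scalars
  \<open>alp\<close>, \<open>bep\<close>, \<open>alm\<close> before u is turned into an
  operator.\<close>

definition Ah :: "nat \<Rightarrow> 'n::finite ecr fps fps" where "Ah a = 1 - fps_X * (fps_const (pxa a) - hnn)"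
definition Bh :: "nat \<Rightarrow> 'n::finite ecr fps fps" where "Bh a = 1 - fps_X * (fps_const (pxa a) + hnn)"
definition Zh :: "nat \<Rightarrow> 'n::finite ecr fps fps" where "Zh a = fps_const (pxa a) - fps_X"

lemma fc_px: "fps_const (pxa a) = fps_const fps_X + fps_const (fps_const (of_nat a * hE))"
 unfolding px_def es_nat by simp

lemma act_hat:
 "alp a * fmap P2 z = fmap P2 (Ah a * z)" "bep a * fmap P2 z = fmap P2 (Bh a * z)"
 "etp * fmap P2 z = - fmap P2 (hEE * (fps_X * z))" "alm a * fmap P2 z = fmap P2 (Zh a * z)"
 "hT * fmap P2 z = fmap P2 (hEE * z)"
 unfolding alp_def bep_def etp_def alm_def Ah_def Bh_def Zh_def fc_px
 by (simp_all only: left_diff_distrib right_diff_distrib distrib_left distrib_right mult.assoc mult_1_left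
 mult_minus_left K2(1,2,4,5,6))

lemma hat_comm: "Ah a * (hEE * y) = hEE * (Ah a * y)" "Ah a * (fps_X * y) = fps_X * (Ah a * y)" "Zh a * (hEE * y) = hEE * (Zh a * y)"
 by (rule commute_left, simp only: central_consts(1,2))+

lemma lx_p:
 fixes i j p q :: "'n::finite"
 shows "alp a * bep a * fmap Dop (Lp i j) * xT a p q =
 alp a * bep a * xT a p q * fmap Dop (Lp i j) + etp * bep a * xT a i q * fmap Dop (Lp p j)
 - alp a * etp * xT a p j * fmap Dop (Lp i q) - etp * etp * xT a i j * fmap Dop (Lp p q)"
proof -
 interpret evp "pxa a :: 'n ecr fps" by (rule evp_px) simp
 have gen: "a1 = a2 + - b4 - - b3 - b5" if "a1 = a2 + b3 - b4 - b5" for a1 a2 b3 b4 b5 :: "'n vv endo fps"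
 using that by simp
 note R = R1[of i j p q, folded Ah_def Bh_def Xh_def]
 have K2m: "fmap P2 (- z) = - fmap P2 z" for z :: "'n ecr fps fps" by (rule rhomD(4)[OF rhom_fmap[OF rhom_P2]])
 show ?thesis
 unfolding xT_def K2(9) mult.assoc
 apply (simp only: K2(7,8) act_hat mult_minus_right mult_minus_left minus_minus hat_comm)
 apply (rule gen)
 apply (simp only: R K2(1,2))
 done
qed

text \<open>\<open>R2\<close> has a single factor u_a - v. It is applied once, multiplied by this
  factor, and applied again to one of the resulting terms; this produces all four terms and the
  factor (u_a - v)^2 - h^2.\<close>

lemma lx_m:
 fixes i j p q :: "'n::finite"
 shows "(alm a * alm a - hT * hT) * fmap Dop (Lm i j) * xT a p q =
 alm a * alm a * xT a p q * fmap Dop (Lm i j) + hT * alm a * xT a i q * fmap Dop (Lm p j)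
 - alm a * hT * xT a p j * fmap Dop (Lm i q) - hT * hT * xT a i j * fmap Dop (Lm p q)"
proof -
 interpret evp "pxa a :: 'n ecr fps" by (rule evp_px) simp
 define X where "X i j = fps_const (Xh a i j :: 'n ecr fps)" for i j
 define l where "l i j = (outer (Lm i j) :: 'n ecr fps fps)" for i j
 have E: "Zh a * (X i k * l j m) = Zh a * (l j m * X i k) + hEE * (l j k * X i m) - hEE * (X j k * l i m)" for i j k m
 using R2[of i k j m] unfolding Zh_def X_def l_def Xh_def by (simp add: left_diff_distrib right_diff_distrib algebra_simps)
 have "Zh a * (Zh a * (X p q * l i j)) = Zh a * (Zh a * (l i j * X p q)) + hEE * (Zh a * (l i q * X p j)) - hEE * (Zh a * (X i q * l p j))"
 unfolding E[of p q i j] by (simp only: distrib_left right_diff_distrib hat_comm)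
 moreover have "Zh a * (l i q * X p j) = Zh a * (X p j * l i q) - hEE * (l i j * X p q) + hEE * (X i j * l p q)"
 unfolding E[of p j i q] by simp
 ultimately have key: "Zh a * (Zh a * (l i j * X p q)) - hEE * (hEE * (l i j * X p q))
 = Zh a * (Zh a * (X p q * l i j)) + hEE * (Zh a * (X i q * l p j)) - hEE * (Zh a * (X p j * l i q)) - hEE * (hEE * (X i j * l p q))"
 by (simp add: distrib_left right_diff_distrib)
 show ?thesis
 unfolding xT_def K2(9) mult.assoc left_diff_distrib
 apply (simp only: K2(7,8) act_hat hat_comm)
 apply (simp only: key[unfolded X_def l_def] K2(1,2)[symmetric])
 done
qed

abbreviation kq :: "'n::finite itself \<Rightarrow> nat \<Rightarrow> complex fps" where
 "kq _ a \<equiv> fps_const (of_nat a + of_nat CARD('n) / 2) * fps_X"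

text \<open>u^(-1) times u + ah + hn/2, which clears the denominator of
  \<open>ppa a\<close>.\<close>

definition Cq :: "nat \<Rightarrow> 'n::finite ecr fps fps" where
 "Cq a = fps_const (1 + fps_const (of_nat a * hE + hn) * fps_X)"

abbreviation ppa :: "nat \<Rightarrow> 'n::finite ecr fps" where
 "ppa a \<equiv> pp (kq TYPE('n) a)"

lemma Cq_pp: "Cq a * (fps_const (ppa a) * z) = fps_const fps_X * z"
proof -
 have "Cq a * fps_const (ppa a) = fps_const (fps_X :: 'a ecr fps)"
 using pp_mult(1)[where 'a = 'a and \<kappa> = "kq TYPE('a) a"] unfolding Cq_def es_half by simp
 then show ?thesis by (simp only: mult.assoc[symmetric])
qed

lemma Cq_eq: "Cq a * z = z + fps_const (fps_const (of_nat a * hE + hn)) * (fps_const fps_X * z)"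
 unfolding Cq_def by (simp add: distrib_right mult.assoc[symmetric] fps_const_add[symmetric] del: fps_const_add)

lemma Cq_comm: "y * (Cq a * z) = Cq a * (y * z)"
proof -
 have "fps_const (of_nat a * hE + hn) * w = w * fps_const (of_nat a * hE + hn)" for w :: "'a ecr fps"
 unfolding es_half[symmetric] by (rule fc_es)
 note c = this
 have g: "(1 + c * X) * w = w * (1 + c * X)" if "c * w = w * c" "X * w = w * X" for c X w :: "'a ecr fps"
 proof -
 have "c * X * w = c * (X * w)" by (rule mult.assoc)
 also have "\<dots> = (c * w) * X" unfolding that(2) by (rule mult.assoc[symmetric])
 also have "\<dots> = w * (c * X)" unfolding that(1) by (rule mult.assoc)
 finally show ?thesis by (simp add: distrib_left distrib_right)
 qed
 have 1: "(1 + fps_const (of_nat a * hE + hn) * fps_X) * w = w * (1 + fps_const (of_nat a * hE + hn) * fps_X)" for w :: "'a ecr fps"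
 by (rule g[OF c fps_mult_fps_X_commute])
 have "y * Cq a = Cq a * y" unfolding Cq_def by (rule fps_ext) (simp add: 1)
 then show ?thesis by (rule commute_left)
qed

lemma smm_Cq [simp]: "smm (Cq a)" "smm (fps_const (Lq a i j))"
 unfolding Cq_def by (auto intro!: smm_lin(4) sm_lin sm_mult)

lemma hk_T: "fps_const (Dop (of_nat a * hE + hn)) = kT a + hnT"
 by (simp add: rhomD(1)[OF rhom_Dop])

lemma uT_comm: "uT * (fps_const (Dop c) * y) = fps_const (Dop c) * (uT * y)" "uT * (fps_X * y) = fps_X * (uT * y)"
 by (rule commute_left, simp add: Uop_comm fps_mult_fps_X_commute)+

declare sm_lin(4-7) [simp]

lemma K1a: "smm x \<Longrightarrow> smm y \<Longrightarrow> fmap P1 (x + y) = fmap P1 x + fmap P1 y"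
 "smm x \<Longrightarrow> smm y \<Longrightarrow> fmap P1 (x - y) = fmap P1 x - fmap P1 y"
 using K1(1,2)[of x x y] by blast+

lemma hnT2: "of_nat CARD('n) * hT = hnT + (hnT :: 'n::finite vv endo fps)"
proof -
 have "of_nat CARD('n) * hT = fps_const (Dop (of_nat CARD('n) * hE :: 'n ecr))"
 by (simp only: rhomD(2)[OF rhom_Dop] rhom_of_nat[OF rhom_Dop Dop_1] fps_const_mult[symmetric] fps_of_nat)
 then show ?thesis unfolding hn_hn[symmetric] by (simp add: rhomD(1)[OF rhom_Dop])
qed

lemma K1s:
 assumes "smm z"
 shows "fps_const (Dop c) * fmap P1 z = fmap P1 (fps_const (fps_const c) * z)"
 "uT * fmap P1 (fps_const fps_X * z) = fmap P1 z"
 "fps_X * fmap P1 z = fmap P1 (fps_X * z)"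
 using K1(3-5)[OF assms assms assms] by blast+

lemma SSp_sw:
 fixes i j k l :: "'n::finite"
 defines "G \<equiv> outer (Lp i k) * fps_const (Lp j l) - fps_const (Lp j l) * outer (Lp i k)"
 shows "fps_const fps_X * G - fps_X * G + hEE * (fps_const fps_X * (fps_X *
 (outer (Lp j k) * fps_const (Lp i l) - fps_const (Lp j k) * outer (Lp i l)))) = 0"
 using arg_cong[OF SSp[of i k j l], of sw] unfolding G_def
 by (simp only: rhomD[OF rhom_sw] sw_simps)

text \<open>The shifted argument of L^+ enters through a fraction. Multiplication by
  \<open>Cq\<close> leaves powers of u^(-1), and \<open>Uop\<close> removes them, so that only
  polynomials in u act.\<close>

lemma ent_p:
 fixes i j k l :: "'n::finite"
 shows "bep a * (fmap Dop (Lp i k) * LT a j l - LT a j l * fmap Dop (Lp i k))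
 = etp * (fmap Dop (Lp j k) * LT a i l - LT a j k * fmap Dop (Lp i l))"
proof -
 interpret evp "ppa a :: 'n ecr fps" by (rule evp_pp)
 define G where "G = outer (Lp i k) * fps_const (Lq a j l) - fps_const (Lq a j l) * outer (Lp i k)"
 define H where "H = outer (Lp j k) * fps_const (Lq a i l) - fps_const (Lq a j k) * outer (Lp i l)"
 have s [simp]: "smm G" "smm H" unfolding G_def H_def by simp_all
 have "fps_const (ppa a) * G - fps_X * G + hEE * (fps_const (ppa a) * (fps_X * H)) = 0"
 using arg_cong[OF SSp_sw[of i k j l], of "shm (ppa a)"] unfolding G_def H_def Lq_sh
 by (simp only: shm_lin shm_mult)
 then have "Cq a * (fps_const (ppa a) * G - fps_X * G + hEE * (fps_const (ppa a) * (fps_X * H))) = 0" by simp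
 then have "fps_const fps_X * G - Cq a * (fps_X * G) + hEE * (fps_const fps_X * (fps_X * H)) = 0"
 by (simp only: distrib_left right_diff_distrib Cq_pp Cq_comm[of hEE, symmetric])
 then have z: "fps_const fps_X * G - (fps_X * G + fps_const (fps_const (of_nat a * hE + hn)) * (fps_const fps_X * (fps_X * G)))
 + hEE * (fps_const fps_X * (fps_X * H)) = 0" unfolding Cq_eq .
 have "fmap P1 (fps_const fps_X * G - (fps_X * G + fps_const (fps_const (of_nat a * hE + hn)) * (fps_const fps_X * (fps_X * G)))
 + hEE * (fps_const fps_X * (fps_X * H))) = 0" unfolding z by (rule fps_ext) simp
 moreover have "fmap P1 (x - (y + w) + v) = fmap P1 x - (fmap P1 y + fmap P1 w) + fmap P1 v"
 if "smm x" "smm y" "smm w" "smm v" for x y w v :: "'n ecr fps fps"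
 by (simp add: K1a that)
 ultimately have "fmap P1 (fps_const fps_X * G) - (fmap P1 (fps_X * G) + fmap P1 (fps_const (fps_const (of_nat a * hE + hn)) * (fps_const fps_X * (fps_X * G))))
 + fmap P1 (hEE * (fps_const fps_X * (fps_X * H))) = 0"
 by (metis s smm_lin(3,4,6,7,8) sm_lin(5))
 note z1 = this
 have a1: "fmap P1 (fps_X * G) = fps_X * fmap P1 G" "fmap P1 (fps_X * H) = fps_X * fmap P1 H"
 by (rule K1s(3)[symmetric], simp)+
 have a2: "fmap P1 (fps_const (fps_const (of_nat a * hE + hn)) * (fps_const fps_X * (fps_X * G))) = (kT a + hnT) * fmap P1 (fps_const fps_X * (fps_X * G))"
 unfolding hk_T[symmetric] by (rule K1s(1)[symmetric]) simp
 have a3: "fmap P1 (hEE * (fps_const fps_X * (fps_X * H))) = hT * fmap P1 (fps_const fps_X * (fps_X * H))"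
 by (rule K1s(1)[symmetric]) simp
 have u: "uT * fmap P1 (fps_const fps_X * (fps_X * G)) = fps_X * fmap P1 G" "uT * fmap P1 (fps_const fps_X * (fps_X * H)) = fps_X * fmap P1 H"
 unfolding a1[symmetric] by (rule K1s(2), simp)+
 have "uT * (fmap P1 (fps_const fps_X * G) - (fps_X * fmap P1 G + (kT a + hnT) * fmap P1 (fps_const fps_X * (fps_X * G)))
 + hT * fmap P1 (fps_const fps_X * (fps_X * H))) = 0"
 unfolding z1[unfolded a2 a3 a1(1)] by simp
 then have z2: "fmap P1 G - (fps_X * (uT * fmap P1 G) + (kT a * (fps_X * fmap P1 G) + hnT * (fps_X * fmap P1 G))) + hT * (fps_X * fmap P1 H) = 0"
 by (simp only: distrib_left right_diff_distrib distrib_right uT_comm K1s(2)[OF s(1)] u)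
 have c: "kT a * (fps_X * y) = fps_X * (kT a * y)" "hnT * (fps_X * y) = fps_X * (hnT * y)" for y :: "'n vv endo fps"
 by (rule commute_left, simp add: fps_mult_fps_X_commute)+
 have gen: "(1 - x * (v + w + n)) * g = - (t * x) * g'"
 if "g - (x * (v * g) + (x * (w * g) + x * (n * g))) + t * (x * g') = 0" for x v w n g g' t :: "'n vv endo fps"
 using that by (simp add: algebra_simps eq_neg_iff_add_eq_0)
 have "bep a * fmap P1 G = etp * fmap P1 H"
 unfolding bep_def etp_def by (rule gen) (use z2 in \<open>simp only: c\<close>)
 moreover have "fmap P1 G = fmap Dop (Lp i k) * LT a j l - LT a j l * fmap Dop (Lp i k)"
 "fmap P1 H = fmap Dop (Lp j k) * LT a i l - LT a j k * fmap Dop (Lp i l)"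
 unfolding G_def H_def LT_def by (simp_all add: K1(2)[OF s(1)] K1(6,7)[OF _ s] K1(8)[OF s(1) s])
 ultimately show ?thesis by simp
qed

definition Aq :: "nat \<Rightarrow> 'n::finite ecr fps fps" where "Aq a = Cq a - fps_const fps_X * (fps_X - hnn)"
definition Bq :: "nat \<Rightarrow> 'n::finite ecr fps fps" where "Bq a = Cq a - fps_const fps_X * (fps_X + hnn)"

lemma smm_Aq [simp]: "smm (Aq a)" "smm (Bq a)" unfolding Aq_def Bq_def by simp_all

text \<open>u times \<open>Cq a\<close> is u_a + hn/2. Subtracting v + hn/2 gives u_a - v, and
  subtracting v - hn/2 gives u_a - v + nh.\<close>

lemma AqBq:
 assumes [simp]: "smm z"
 shows "uT * fmap P1 (Bq a * z) = alm a * fmap P1 z" "uT * fmap P1 (Aq a * z) = bem a * fmap P1 (z :: 'n::finite ecr fps fps)"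
proof -
 have sk [simp]: "smm (fps_const (fps_const (of_nat a * hE + hn)) :: 'n ecr fps fps)" by (intro smm_lin(4) sm_lin)
 have 1: "fmap P1 (Cq a * z) = fmap P1 z + (kT a + hnT) * fmap P1 (fps_const fps_X * z)"
 unfolding Cq_eq hk_T[symmetric] by (simp add: K1a K1s(1))
 have C: "uT * fmap P1 (Cq a * z) = uT * fmap P1 z + (kT a * fmap P1 z + hnT * fmap P1 z)"
 unfolding 1 distrib_left distrib_right uT_comm(1) K1s(2)[OF assms] ..
 have X: "uT * fmap P1 (fps_const fps_X * (fps_X * z)) = fps_X * fmap P1 z" "uT * fmap P1 (fps_const fps_X * (hnn * z)) = hnT * fmap P1 z"
 by (simp_all add: K1s)
 have "Bq a * z = Cq a * z - (fps_const fps_X * (fps_X * z) + fps_const fps_X * (hnn * z))"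
 "Aq a * z = Cq a * z - (fps_const fps_X * (fps_X * z) - fps_const fps_X * (hnn * z))"
 unfolding Bq_def Aq_def by (simp_all only: left_diff_distrib distrib_right distrib_left right_diff_distrib mult.assoc)
 then have B: "uT * fmap P1 (Bq a * z) = uT * fmap P1 z + (kT a * fmap P1 z + hnT * fmap P1 z) - (fps_X * fmap P1 z + hnT * fmap P1 z)"
 "uT * fmap P1 (Aq a * z) = uT * fmap P1 z + (kT a * fmap P1 z + hnT * fmap P1 z) - (fps_X * fmap P1 z - hnT * fmap P1 z)"
 by (simp_all add: K1(1,2)[OF assms] distrib_left right_diff_distrib C X)
 have g1: "u * y + (k * y + n * y) - (x * y + n * y) = (u + k - x) * y"
 and g2: "u * y + (k * y + n * y) - (x * y - n * y) = (u + k - x + (n + n)) * y" for u k n x y :: "'n vv endo fps"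
 by (simp_all add: algebra_simps)
 show "uT * fmap P1 (Bq a * z) = alm a * fmap P1 z" "uT * fmap P1 (Aq a * z) = bem a * fmap P1 z"
 unfolding B bem_def alm_def hnT2 by (rule g1, rule g2)
qed

lemma ent_m:
 fixes i j k l :: "'n::finite"
 shows "bem a * (alm a * (LT a i k * fmap Dop (Lm j l))) = bem a * (alm a * (fmap Dop (Lm j l) * LT a i k))
 + hT * (bem a * (fmap Dop (Lm j k) * LT a i l)) - hT * (alm a * (fmap Dop (Lm i l) * LT a j k))
 - hT * (hT * (fmap Dop (Lm i k) * LT a j l))"
proof -
 interpret evp "ppa a :: 'n ecr fps" by (rule evp_pp)
 let ?A = "1 - fps_const (ppa a) * (fps_X - hnn) :: 'n ecr fps fps" and ?B = "1 - fps_const (ppa a) * (fps_X + hnn) :: 'n ecr fps fps"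
 have CA: "Cq a * (?A * z) = Aq a * z" "Cq a * (?B * z) = Bq a * z" for z
 unfolding Aq_def Bq_def by (simp_all only: left_diff_distrib right_diff_distrib mult.assoc mult_1_left Cq_pp)
 define t where "t i k j l = (outer (Lm j l) * fps_const (Lq a i k) :: 'n ecr fps fps)" for i j k l
 define t' where "t' = (fps_const (Lq a i k) * outer (Lm j l) :: 'n ecr fps fps)"
 have s [simp]: "smm (t i k j l)" "smm t'" for i j k l unfolding t_def t'_def by simp_all
 have e1: "Cq a * (Cq a * (?A * (?B * z))) = Aq a * (Bq a * z)" for z
 by (simp only: CA(1) Cq_comm[of "Aq a", symmetric] CA(2))
 have e2': "Cq a * (Cq a * (hEE * (fps_const (ppa a) * (?A * z)))) = hEE * (fps_const fps_X * (Aq a * z))"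
 "Cq a * (Cq a * (hEE * (fps_const (ppa a) * (?B * z)))) = hEE * (fps_const fps_X * (Bq a * z))" for z
 by (simp_all only: Cq_comm[of hEE, symmetric] Cq_pp Cq_comm[of "fps_const fps_X", symmetric] CA)
 have e3: "Cq a * (Cq a * (hEE * (fps_const (ppa a) * (hEE * (fps_const (ppa a) * z))))) = hEE * (fps_const fps_X * (hEE * (fps_const fps_X * z)))" for z
 by (simp only: Cq_comm[of hEE, symmetric] Cq_pp Cq_comm[of "fps_const fps_X", symmetric])
 have "Aq a * (Bq a * t') = Aq a * (Bq a * t i k j l) + hEE * (fps_const fps_X * (Aq a * t i l j k))
 - hEE * (fps_const fps_X * (Bq a * t j k i l)) - hEE * (fps_const fps_X * (hEE * (fps_const fps_X * t j l i k)))"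
 using arg_cong[OF R4[of i k j l], of "\<lambda>z. Cq a * (Cq a * z)"]
 unfolding distrib_left[of "Cq a"] right_diff_distrib[of "Cq a"] e1 e2' e3 Lq_sh[symmetric] t_def t'_def .
 from arg_cong[OF this, of "\<lambda>z. uT * (uT * fmap P1 z)"]
 have "uT * (uT * fmap P1 (Aq a * (Bq a * t'))) = uT * (uT * fmap P1 (Aq a * (Bq a * t i k j l)))
 + uT * (uT * fmap P1 (hEE * (fps_const fps_X * (Aq a * t i l j k))))
 - uT * (uT * fmap P1 (hEE * (fps_const fps_X * (Bq a * t j k i l))))
 - uT * (uT * fmap P1 (hEE * (fps_const fps_X * (hEE * (fps_const fps_X * t j l i k)))))"
 by (simp add: K1(1,2)[OF s(2)] distrib_left right_diff_distrib)
 moreover have "uT * (uT * fmap P1 (Aq a * (Bq a * z))) = bem a * (alm a * fmap P1 z)" if [simp]: "smm z" for z :: "'n ecr fps fps"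
 proof -
 have u: "uT * (bem a * w) = bem a * (uT * w)" for w :: "'n vv endo fps"
 by (rule commute_left[OF Sc0_comm[OF Sc0_simps(1) scalars_Sc0(5)]])
 show ?thesis by (simp add: AqBq u)
 qed
 moreover have "uT * (uT * fmap P1 (hEE * (fps_const fps_X * (Aq a * z)))) = hT * (bem a * fmap P1 z)"
 "uT * (uT * fmap P1 (hEE * (fps_const fps_X * (Bq a * z)))) = hT * (alm a * fmap P1 z)"
 "uT * (uT * fmap P1 (hEE * (fps_const fps_X * (hEE * (fps_const fps_X * z))))) = hT * (hT * fmap P1 z)"
 if [simp]: "smm z" for z :: "'n ecr fps fps"
 proof -
 have H: "fmap P1 (hEE * y) = hT * fmap P1 y" and X: "uT * fmap P1 (fps_const fps_X * y) = fmap P1 y"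
 if "smm y" for y :: "'n ecr fps fps"
 using K1(3,4)[OF that that that] by simp_all
 have u: "uT * (hT * y) = hT * (uT * y)" for y :: "'n vv endo fps"
 by (rule commute_left[OF Sc0_comm[OF Sc0_simps(1,3)]])
 have sA: "smm (Aq a * z)" "smm (Bq a * z)" by simp_all
 show "uT * (uT * fmap P1 (hEE * (fps_const fps_X * (Aq a * z)))) = hT * (bem a * fmap P1 z)"
 "uT * (uT * fmap P1 (hEE * (fps_const fps_X * (Bq a * z)))) = hT * (alm a * fmap P1 z)"
 by (simp_all only: H u X AqBq smm_lin sA that)
 show "uT * (uT * fmap P1 (hEE * (fps_const fps_X * (hEE * (fps_const fps_X * z))))) = hT * (hT * fmap P1 z)"
 by (simp only: H u X smm_lin that)
 qed
 moreover have q: "smm (fps_const (Lq a i k))" for i k :: 'n by simp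
 moreover have "fmap P1 (t i k j l) = fmap Dop (Lm j l) * LT a i k" for i j k l :: 'n
 unfolding t_def LT_def K1(8)[OF q q q] by (rule K1(6)[OF q q q, symmetric])
 moreover have "fmap P1 t' = LT a i k * fmap Dop (Lm j l)"
 unfolding t'_def LT_def K1(8)[OF q q q] by (rule K1(7)[OF q q q, symmetric])
 ultimately show ?thesis by simp
qed

text \<open>The relation between entries as a commutation of the factor \<beta> - \<eta> P with the
  product in the two orders. It is compared under a double sum, where the flip permutes indices;
  \<open>opM\<close> and \<open>opYY\<close> are obtained in the same way.\<close>

lemma opP:
 fixes L m :: "'n::finite \<Rightarrow> 'n \<Rightarrow> 't::ring_1"
 assumes ab: "a \<noteq> b" and c: "\<And>i j. \<beta> * L i j = L i j * \<beta>" "\<And>i j. \<beta> * m i j = m i j * \<beta>"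
 "\<And>i j. \<eta> * L i j = L i j * \<eta>" "\<And>i j. \<eta> * m i j = m i j * \<eta>"
 and e: "\<And>i j k l. \<beta> * (m i k * L j l - L j l * m i k) = \<eta> * (m j k * L i l - L j k * m i l)"
 shows "(scO \<beta> - scO \<eta> * prO (swp b a)) * (matO b m * matO a L)
 = matO a L * matO b m * (scO \<beta> - scO \<eta> * prO (swp b a))"
proof (rule vec_endo_eqI)
 fix \<phi> :: "('n, 't) ivec" and r
 let ?P = "prO (swp b a) :: ('n, 't) ivec endo"
 have s: "matO a L * (scO \<beta> * z) = scO \<beta> * (matO a L * z)" "matO b m * (scO \<beta> * z) = scO \<beta> * (matO b m * z)"
 "matO a L * (scO \<eta> * z) = scO \<eta> * (matO a L * z)" "matO b m * (scO \<eta> * z) = scO \<eta> * (matO b m * z)" for z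
 by (rule commute_left[OF scO_matO[symmetric]], rule c)+
 have s1: "matO b m * scO \<beta> = scO \<beta> * matO b m" by (rule scO_matO[symmetric]) (rule c)
 have X: "matO a L * matO b m * (scO \<beta> - scO \<eta> * ?P) = scO \<beta> * (matO a L * matO b m) - scO \<eta> * (matO a L * matO b m * ?P)"
 by (simp only: right_diff_distrib mult.assoc s s1)
 define F where "F s t = \<phi> (r(a := t, b := s))" for s t
 have "(\<Sum>s\<in>UNIV. \<Sum>t\<in>UNIV. \<beta> * (m (r b) s * L (r a) t - L (r a) t * m (r b) s) * F s t)
 = (\<Sum>s\<in>UNIV. \<Sum>t\<in>UNIV. \<eta> * (m (r a) s * L (r b) t - L (r a) s * m (r b) t) * F s t)"
 by (simp only: e)
 then have "\<beta> * (\<Sum>s\<in>UNIV. \<Sum>t\<in>UNIV. m (r b) s * L (r a) t * F s t) - \<beta> * (\<Sum>s\<in>UNIV. \<Sum>t\<in>UNIV. L (r a) t * m (r b) s * F s t)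
 = \<eta> * (\<Sum>s\<in>UNIV. \<Sum>t\<in>UNIV. m (r a) s * L (r b) t * F s t) - \<eta> * (\<Sum>s\<in>UNIV. \<Sum>t\<in>UNIV. L (r a) s * m (r b) t * F s t)"
 by (simp add: sum_distrib_left right_diff_distrib left_diff_distrib sum_subtractf mult.assoc)
 then have "\<beta> * app (matO b m * matO a L) \<phi> r - \<beta> * app (matO a L * matO b m) \<phi> r
 = \<eta> * app (?P * (matO b m * matO a L)) \<phi> r - \<eta> * app (matO a L * matO b m * ?P) \<phi> r"
 unfolding op_terms[OF ab] F_def .
 moreover have "app ((scO \<beta> - scO \<eta> * ?P) * (matO b m * matO a L)) \<phi> r
 = \<beta> * app (matO b m * matO a L) \<phi> r - \<eta> * app (?P * (matO b m * matO a L)) \<phi> r"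
 by (simp only: left_diff_distrib app_simps(2) mult.assoc) simp
 moreover have "app (scO \<beta> * (matO a L * matO b m) - scO \<eta> * (matO a L * matO b m * ?P)) \<phi> r
 = \<beta> * app (matO a L * matO b m) \<phi> r - \<eta> * app (matO a L * matO b m * ?P) \<phi> r" by simp
 ultimately show "app ((scO \<beta> - scO \<eta> * ?P) * (matO b m * matO a L)) \<phi> r = app (matO a L * matO b m * (scO \<beta> - scO \<eta> * ?P)) \<phi> r"
 unfolding X by (simp only: diff_eq_eq) (simp add: algebra_simps)
qed

lemma opM:
 fixes L m :: "'n::finite \<Rightarrow> 'n \<Rightarrow> 't::ring_1"
 assumes ab: "a \<noteq> b" and c: "\<And>i j. \<alpha> * L i j = L i j * \<alpha>" "\<And>i j. \<alpha> * m i j = m i j * \<alpha>"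
 "\<And>i j. \<eta> * L i j = L i j * \<eta>" "\<And>i j. \<eta> * m i j = m i j * \<eta>"
 and e: "\<And>i j k l. \<beta> * (\<alpha> * (L i k * m j l)) = \<beta> * (\<alpha> * (m j l * L i k)) + \<beta> * (\<eta> * (m j k * L i l))
 - \<eta> * (\<alpha> * (m i l * L j k)) - \<eta> * (\<eta> * (m i k * L j l))"
 shows "scO \<beta> * (scO \<alpha> * (matO a L * matO b m)) = (scO \<beta> - scO \<eta> * prO (swp b a)) *
 (matO b m * (matO a L * (scO \<alpha> + scO \<eta> * prO (swp b a))))"
proof (rule vec_endo_eqI)
 fix \<phi> :: "('n, 't) ivec" and r
 let ?P = "prO (swp b a) :: ('n, 't) ivec endo"
 let ?X = "matO b m * matO a L"
 have s: "matO a L * (scO \<alpha> * z) = scO \<alpha> * (matO a L * z)" "matO b m * (scO \<alpha> * z) = scO \<alpha> * (matO b m * z)"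
 "matO a L * (scO \<eta> * z) = scO \<eta> * (matO a L * z)" "matO b m * (scO \<eta> * z) = scO \<eta> * (matO b m * z)" for z
 by (rule commute_left[OF scO_matO[symmetric]], rule c)+
 have s1: "matO a L * scO \<alpha> = scO \<alpha> * matO a L" by (rule scO_matO[symmetric]) (rule c)
 have sP: "?P * (scO x * z) = scO x * (?P * z)" for x z by (rule commute_left[OF scO_prO[symmetric]])
 have X: "(scO \<beta> - scO \<eta> * ?P) * (matO b m * (matO a L * (scO \<alpha> + scO \<eta> * ?P)))
 = scO \<beta> * (scO \<alpha> * ?X) + scO \<beta> * (scO \<eta> * (?X * ?P)) - scO \<eta> * (scO \<alpha> * (?P * ?X)) - scO \<eta> * (scO \<eta> * (?P * ?X * ?P))"
 by (simp add: distrib_left left_diff_distrib mult.assoc s s1 sP)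
 define F where "F s t = \<phi> (r(a := t, b := s))" for s t
 have "(\<Sum>s\<in>UNIV. \<Sum>t\<in>UNIV. \<beta> * (\<alpha> * (L (r a) t * m (r b) s)) * F s t)
 = (\<Sum>s\<in>UNIV. \<Sum>t\<in>UNIV. (\<beta> * (\<alpha> * (m (r b) s * L (r a) t)) + \<beta> * (\<eta> * (m (r b) t * L (r a) s))
 - \<eta> * (\<alpha> * (m (r a) s * L (r b) t)) - \<eta> * (\<eta> * (m (r a) t * L (r b) s))) * F s t)"
 by (simp only: e)
 then have "\<beta> * (\<alpha> * (\<Sum>s\<in>UNIV. \<Sum>t\<in>UNIV. L (r a) t * m (r b) s * F s t)) =
 \<beta> * (\<alpha> * (\<Sum>s\<in>UNIV. \<Sum>t\<in>UNIV. m (r b) s * L (r a) t * F s t)) + \<beta> * (\<eta> * (\<Sum>s\<in>UNIV. \<Sum>t\<in>UNIV. m (r b) t * L (r a) s * F s t))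
 - \<eta> * (\<alpha> * (\<Sum>s\<in>UNIV. \<Sum>t\<in>UNIV. m (r a) s * L (r b) t * F s t)) - \<eta> * (\<eta> * (\<Sum>s\<in>UNIV. \<Sum>t\<in>UNIV. m (r a) t * L (r b) s * F s t))"
 by (simp add: sum_distrib_left distrib_right left_diff_distrib sum_subtractf sum.distrib mult.assoc)
 then have "\<beta> * (\<alpha> * app (matO a L * matO b m) \<phi> r) = \<beta> * (\<alpha> * app ?X \<phi> r) + \<beta> * (\<eta> * app (?X * ?P) \<phi> r)
 - \<eta> * (\<alpha> * app (?P * ?X) \<phi> r) - \<eta> * (\<eta> * app (?P * ?X * ?P) \<phi> r)"
 unfolding op_terms[OF ab] F_def .
 then show "app (scO \<beta> * (scO \<alpha> * (matO a L * matO b m))) \<phi> r = app ((scO \<beta> - scO \<eta> * ?P) *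
 (matO b m * (matO a L * (scO \<alpha> + scO \<eta> * ?P)))) \<phi> r"
 unfolding X by simp
qed

lemma opYY:
 fixes L m :: "'n::finite \<Rightarrow> 'n \<Rightarrow> 't::ring_1"
 assumes ab: "a \<noteq> b"
 and e: "\<And>i j k l. L i k * m j l - m j l * L i k - (L j k * m i l - m j k * L i l) = 0"
 shows "(1 - prO (swp b a)) * (matO a L * matO b m) = (matO b m * matO a L) * (1 - prO (swp b a))"
proof (rule vec_endo_eqI)
 fix \<phi> :: "('n, 't) ivec" and r
 let ?P = "prO (swp b a) :: ('n, 't) ivec endo"
 have e': "L i k * m j l - L j k * m i l - (m j l * L i k - m j k * L i l) = 0" for i j k l
 using e[of i k j l] by (simp add: algebra_simps)
 define F where "F s t = \<phi> (r(a := t, b := s))" for s t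
 have "(\<Sum>s\<in>UNIV. \<Sum>t\<in>UNIV. (L (r a) t * m (r b) s - L (r b) t * m (r a) s - (m (r b) s * L (r a) t - m (r b) t * L (r a) s)) * F s t) = 0"
 by (simp only: e') simp
 then have "app (matO a L * matO b m) \<phi> r - app (?P * (matO a L * matO b m)) \<phi> r - (app (matO b m * matO a L) \<phi> r - app (matO b m * matO a L * ?P) \<phi> r) = 0"
 unfolding op_terms[OF ab] F_def by (simp only: left_diff_distrib sum_subtractf)
 moreover have "app ((1 - ?P) * (matO a L * matO b m)) \<phi> r = app (matO a L * matO b m) \<phi> r - app (?P * (matO a L * matO b m)) \<phi> r"
 by (simp only: left_diff_distrib app_simps(2) mult_1_left fun_diff_def)
 moreover have "app ((matO b m * matO a L) * (1 - ?P)) \<phi> r = app (matO b m * matO a L) \<phi> r - app (matO b m * matO a L * ?P) \<phi> r"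
 by (simp only: right_diff_distrib app_simps(2) mult_1_right fun_diff_def)
 ultimately show "app ((1 - ?P) * (matO a L * matO b m)) \<phi> r = app ((matO b m * matO a L) * (1 - ?P)) \<phi> r" by simp
qed

text \<open>Multiplying the relation for L by its inverse Y from both sides turns it into one for Y.
  The idempotent e = Y L must be moved to a place next to Y, where it disappears.\<close>

lemma ly_of_plus:
 fixes m N L Y e :: "'a::monoid_mult"
 assumes rel: "N * (m * L) = L * m * N" and YL: "Y * L = e" "L * Y = e" "e * Y = Y" "Y * e = Y"
 and c: "e * m = m * e" "e * N = N * e"
 shows "m * (N * Y) = Y * (N * m)"
proof -
 have "Y * (N * (m * L)) * Y = Y * (N * (m * e))" by (simp only: mult.assoc YL(2))
 also have "\<dots> = Y * (e * (N * m))" by (simp only: c[symmetric] mult.assoc[symmetric])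
 also have "\<dots> = Y * (N * m)" by (simp only: mult.assoc[symmetric] YL)
 finally have 1: "Y * (N * (m * L)) * Y = Y * (N * m)" .
 have "Y * (L * m * N) * Y = e * (m * (N * Y))" by (simp only: mult.assoc[symmetric] YL(1))
 also have "\<dots> = m * (N * (e * Y))" by (simp only: commute_left[OF c(1)] commute_left[OF c(2)])
 also have "\<dots> = m * (N * Y)" by (simp only: YL(3))
 finally show ?thesis using 1 rel by simp
qed

lemma eT_matO: "scO eT * matO k (\<lambda>i j. fmap Dop (f i j)) = matO k (\<lambda>i j. fmap Dop (f i j)) * scO eT"
 by (rule scO_matO) (simp add: eT_comm(2))

lemma eT_scal: "p \<in> Sc0 \<Longrightarrow> q \<in> Sc0 \<Longrightarrow> scO eT * (scO p - scO q * prO \<sigma>) = (scO p - scO q * prO \<sigma>) * scO eT"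
proof -
 assume p: "p \<in> Sc0" and q: "q \<in> Sc0"
 have 1: "scO eT * scO p = scO p * scO eT" and 2: "scO eT * scO q = scO q * scO eT"
 unfolding scO_mult using eT_comm(3)[OF p] eT_comm(3)[OF q] by simp_all
 have c2: "scO eT * (scO q * prO \<sigma>) = scO q * (scO eT * prO \<sigma>)" by (rule commute_left[OF 2])
 have 3: "scO q * (prO \<sigma> * scO eT) = scO q * (scO eT * prO \<sigma>)" by (simp only: scO_prO)
 show ?thesis
 unfolding right_diff_distrib left_diff_distrib mult.assoc 1 c2 3 ..
qed

text \<open>Inverting the relation for two neighbouring factors L reverses their order and gives (1
  - P) Y' Y = Y Y' (1 - P), and (1 - P) (1 + P) = 0.\<close>

lemma yy_T:
 fixes a :: nat
 shows "(1 - prO (swp a (Suc a))) * (matO (Suc a) (yT (Suc a)) * matO a (yT a)) *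
 (1 + prO (swp a (Suc a))) = (0 :: ('n::finite, 'n vv endo fps) ivec endo)"
proof -
 let ?P = "prO (swp a (Suc a)) :: ('n, 'n vv endo fps) ivec endo"
 define L where "L = (matO a (LT a) :: ('n, 'n vv endo fps) ivec endo)"
 define L' where "L' = (matO (Suc a) (LT (Suc a)) :: ('n, 'n vv endo fps) ivec endo)"
 define Y where "Y = (matO a (yT a) :: ('n, 'n vv endo fps) ivec endo)"
 define Y' where "Y' = (matO (Suc a) (yT (Suc a)) :: ('n, 'n vv endo fps) ivec endo)"
 define e where "e = (scO eT :: ('n, 'n vv endo fps) ivec endo)"
 note YL = YL[where a = a and 'a = 'n, folded L_def Y_def e_def] YL[where a = "Suc a" and 'a = 'n, folded L'_def Y'_def e_def]
 have "(1 - prO (swp (Suc a) a)) * (L * L') = (L' * L) * (1 - prO (swp (Suc a) a))"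
 unfolding L_def L'_def by (rule opYY) (simp, rule R56(2))
 then have rel: "(1 - ?P) * (L * L') = (L' * L) * (1 - ?P)" by (simp only: transpose_commute)
 have eP: "e * ?P = ?P * e" unfolding e_def by (rule scO_prO)
 have eQ: "e * (1 - ?P) = (1 - ?P) * e" by (simp only: right_diff_distrib left_diff_distrib eP mult_1_left mult_1_right)
 have "Y * Y' * ((1 - ?P) * (L * L')) * (Y' * Y) = Y * Y' * (1 - ?P) * (L * (L' * Y') * Y)" by (simp only: mult.assoc)
 also have "L * (L' * Y') * Y = e" by (simp only: YL mult.assoc)
 also have "Y * Y' * (1 - ?P) * e = Y * (Y' * e) * (1 - ?P)" by (simp only: mult.assoc eQ)
 finally have 1: "Y * Y' * ((1 - ?P) * (L * L')) * (Y' * Y) = Y * Y' * (1 - ?P)" by (simp only: YL)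
 have "Y * Y' * ((L' * L) * (1 - ?P)) * (Y' * Y) = Y * (Y' * L') * L * (1 - ?P) * (Y' * Y)" by (simp only: mult.assoc)
 also have "\<dots> = e * (1 - ?P) * (Y' * Y)" by (simp only: YL)
 also have "\<dots> = (1 - ?P) * ((e * Y') * Y)" by (simp only: eQ mult.assoc)
 finally have 2: "Y * Y' * ((L' * L) * (1 - ?P)) * (Y' * Y) = (1 - ?P) * (Y' * Y)" by (simp only: YL)
 have "(1 - ?P) * (Y' * Y) = Y * Y' * (1 - ?P)" using 1 2 rel by simp
 then have "(1 - ?P) * (Y' * Y) * (1 + ?P) = Y * Y' * ((1 - ?P) * (1 + ?P))" by (simp only: mult.assoc)
 also have "(1 - ?P) * (1 + ?P) = 1 - ?P * ?P" by (simp add: distrib_left left_diff_distrib)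
 also have "\<dots> = 0" by (simp add: transpose_involutory)
 finally show ?thesis unfolding Y_def Y'_def by simp
qed

lemma ly_p:
 fixes a k :: nat
 assumes a: "a < k"
 defines "P \<equiv> prO (swp k a)" and "l \<equiv> \<lambda>i j :: 'n::finite. fmap Dop (Lp i j)"
 shows "scO (alp a * bep a) * matO k l * (scO (bep a) - scO etp * P) * matO a (yT a)
 = scO (alp a * bep a) * matO a (yT a) * (scO (bep a) - scO etp * P) * matO k l"
proof -
 have cG: "p * fmap Dop f = fmap Dop f * p" "p * LT b i j = LT b i j * p" if "p \<in> Sc0" for p b f and i j :: 'n
 unfolding LT_def by (rule Sc0_D[OF that], rule comm_G0(1), rule Sc0_D[OF that], rule comm_G0(3), rule sm_q(1))
 have rel: "(scO (bep a) - scO etp * P) * (matO k l * matO a (LT a)) = matO a (LT a) * matO k l * (scO (bep a) - scO etp * P)"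
 unfolding P_def l_def by (rule opP) (use a in \<open>simp_all add: cG scalars_Sc0 ent_p\<close>)
 have "matO k l * ((scO (bep a) - scO etp * P) * matO a (yT a)) = matO a (yT a) * ((scO (bep a) - scO etp * P) * matO k l)"
 by (rule ly_of_plus[OF rel YL]) (simp_all add: l_def eT_matO P_def eT_scal scalars_Sc0)
 then show ?thesis by (simp only: mult.assoc)
qed

lemma square_diff:
 fixes x h p :: "'z::{ring, monoid_mult}"
 assumes "p * p = 1" "p * x = x * p" "p * h = h * p" "x * h = h * x"
 shows "(x + h * p) * (x - h * p) = x * x - h * h"
proof -
 have "h * p * (h * p) = h * (p * h) * p" by (simp only: mult.assoc)
 also have "\<dots> = h * h * (p * p)" unfolding assms(3) by (simp only: mult.assoc)
 finally have 1: "h * p * (h * p) = h * h" by (simp add: assms(1))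
 have "h * p * x = h * (p * x)" by (rule mult.assoc)
 also have "\<dots> = (h * x) * p" unfolding assms(2) by (simp only: mult.assoc)
 also have "\<dots> = x * (h * p)" unfolding assms(4)[symmetric] by (simp only: mult.assoc)
 finally have 2: "h * p * x = x * (h * p)" .
 show ?thesis unfolding distrib_right right_diff_distrib 1 2 by simp
qed

text \<open>The relation for L has a factor \<alpha> + h P at the far right. It is multiplied by
  \<alpha> - h P there, which leaves the central scalar \<alpha>^2 - h^2, and then by Y on both
  sides.\<close>

lemma ly_m:
 fixes a k :: nat
 assumes a: "a < k"
 defines "P \<equiv> prO (swp k a)" and "l \<equiv> \<lambda>i j :: 'n::finite. fmap Dop (Lm i j)"
 shows "scO (alm a * bem a) * matO k l * (scO (alm a) - scO hT * P) * matO a (yT a)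
 = scO (alm a * alm a - hT * hT) * matO a (yT a) * (scO (bem a) - scO hT * P) * matO k l"
proof -
 note S = scalars_Sc0 Sc0_simps
 have cG: "p * fmap Dop f = fmap Dop f * p" "p * LT b i j = LT b i j * p" "p * yT b i j = yT b i j * p" if "p \<in> Sc0" for p b f and i j :: 'n
 unfolding LT_def yT_def by (rule Sc0_D[OF that], rule comm_G0(1), rule Sc0_D[OF that], rule comm_G0(3), rule sm_q(1),
 rule Sc0_D[OF that], rule comm_G0(3), rule sm_q(2))
 have ab: "alm a * bem a = bem a * (alm a :: 'n vv endo fps)" "alm a * hT = hT * (alm a :: 'n vv endo fps)"
 "hT * (bem a * z) = bem a * (hT * z :: 'n vv endo fps)" for z
 using Sc0_comm S by (blast, blast, intro commute_left) blast
 have rel: "scO (bem a) * (scO (alm a) * (matO a (LT a) * matO k l)) = (scO (bem a) - scO hT * P) * (matO k l * (matO a (LT a) * (scO (alm a) + scO hT * P)))"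
 unfolding P_def l_def by (rule opM[OF less_imp_neq[OF a]]) (simp_all only: cG S ent_m ab(3))
 have rel': "scO (alm a * bem a) * (matO a (LT a) * matO k l) = (scO (bem a) - scO hT * P) * (matO k l * (matO a (LT a) * (scO (alm a) + scO hT * P)))"
 unfolding ab(1) scO_mult[symmetric] mult.assoc rel ..
 have PP: "P * P = 1" unfolding P_def by (rule transpose_involutory)
 have sP: "P * (scO x * z) = scO x * (P * z)" for x z unfolding P_def by (rule commute_left[OF scO_prO[symmetric]])
 have M: "(scO (alm a) + scO hT * P) * (scO (alm a) - scO hT * P) = scO (alm a * alm a - hT * hT)"
 proof -
 have cP: "P * scO x = scO x * P" for x unfolding P_def by (rule scO_prO[symmetric])
 have "(scO (alm a) + scO hT * P) * (scO (alm a) - scO hT * P) = scO (alm a) * scO (alm a) - scO hT * scO hT"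
 by (rule square_diff) (rule PP, rule cP, rule cP, simp only: scO_mult ab(2))
 then show ?thesis by (simp only: scO_mult scO_diff)
 qed
 have cS: "scO p * matO a (yT a) = matO a (yT a) * scO p" if "p \<in> Sc0" for p :: "'n vv endo fps"
 by (rule scO_matO) (rule cG(3)[OF that])
 have "scO (alm a * bem a) * (matO k l * ((scO (alm a) - scO hT * P) * matO a (yT a)))
 = scO (alm a * alm a - hT * hT) * (matO a (yT a) * ((scO (bem a) - scO hT * P) * matO k l))"
 proof -
 let ?C = "scO (alm a * alm a - hT * hT) :: ('n, 'n vv endo fps) ivec endo"
 let ?Y = "matO a (yT a) :: ('n, 'n vv endo fps) ivec endo" and ?L = "matO a (LT a) :: ('n, 'n vv endo fps) ivec endo"
 let ?N = "scO (bem a) - scO hT * P" and ?M' = "scO (alm a) - scO hT * P" and ?m = "matO k l" and ?S = "scO (alm a * bem a) :: ('n, 'n vv endo fps) ivec endo"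
 have cS': "?S * ?Y = ?Y * ?S" by (rule cS) (intro Sc0_closed S)
 have eM: "scO eT * ?m = ?m * scO eT" "scO eT * ?N = ?N * scO eT" "scO eT * ?M' = ?M' * scO eT"
 unfolding l_def P_def by (rule eT_matO, (rule eT_scal; rule S)+)
 have Cc: "alm a * alm a - hT * hT \<in> (Sc0 :: 'n vv endo fps set)" by (intro Sc0_closed S)
 have CY: "?C * ?Y = ?Y * ?C" by (rule cS[OF Cc])
 have Cm: "?C * ?m = ?m * ?C" unfolding l_def by (rule scO_matO) (rule cG(1)[OF Cc])
 have CL: "?C * ?L = ?L * ?C" by (rule scO_matO) (rule cG(2)[OF Cc])
 have sc: "?C * scO p = scO p * ?C" if "p \<in> Sc0" for p
 unfolding scO_mult Sc0_comm[OF Cc that] ..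
 have CP: "?C * P = P * ?C" unfolding P_def by (rule scO_prO)
 have CN: "?C * ?N = ?N * ?C"
 unfolding right_diff_distrib left_diff_distrib mult.assoc sc[OF scalars_Sc0(5)] commute_left[OF sc[OF Sc0_simps(3)]] CP ..
 have "?Y * (?S * (?L * ?m)) * (?M' * ?Y) = ?S * (?Y * ?L) * ?m * (?M' * ?Y)" by (simp only: mult.assoc commute_left[OF cS'])
 also have "\<dots> = ?S * (scO eT * ?m * ?M') * ?Y" by (simp only: YL mult.assoc)
 also have "scO eT * ?m * ?M' = ?m * (?M' * scO eT)" by (simp only: eM(1) mult.assoc eM(3))
 finally have 1: "?Y * (?S * (?L * ?m)) * (?M' * ?Y) = ?S * (?m * (?M' * ?Y))" by (simp only: mult.assoc YL)
 have "?Y * (?N * (?m * (?L * (scO (alm a) + scO hT * P)))) * (?M' * ?Y) = ?Y * (?N * (?m * (?L * (((scO (alm a) + scO hT * P) * ?M') * ?Y))))"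
 by (simp only: mult.assoc)
 also have "\<dots> = ?Y * (?N * (?m * (?L * (?C * ?Y))))" by (simp only: M)
 also have "\<dots> = ?C * (?Y * (?N * (?m * (?L * ?Y))))"
 by (simp only: commute_left[OF CL[symmetric]] commute_left[OF Cm[symmetric]] commute_left[OF CN[symmetric]] commute_left[OF CY[symmetric]])
 also have "?Y * (?N * (?m * (?L * ?Y))) = ?Y * (?N * (scO eT * ?m))" by (simp only: YL eM(1))
 also have "\<dots> = ?Y * (scO eT * (?N * ?m))" by (simp only: commute_left[OF eM(2)])
 also have "\<dots> = ?Y * (?N * ?m)" by (simp only: mult.assoc[symmetric] YL)
 finally have 2: "?Y * (?N * (?m * (?L * (scO (alm a) + scO hT * P)))) * (?M' * ?Y) = ?C * (?Y * (?N * ?m))" .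
 show ?thesis by (rule trans[OF 1[unfolded rel', symmetric] 2])
 qed
 then show ?thesis by (simp only: mult.assoc)
qed

lemma xx_T: "xT a i p * xT (Suc a) j q - xT a j p * xT (Suc a) i q = xT (Suc a) j q * xT a i p - xT (Suc a) j p * xT a i q"
 using R56(1)[of a i p j q] by (simp add: algebra_simps)

lemma T_comms:
 "p \<in> Sc0 \<Longrightarrow> p * fmap Dop f = fmap Dop f * p" "p \<in> Sc0 \<Longrightarrow> p * xT a i j = xT a i j * p"
 "p \<in> Sc0 \<Longrightarrow> p * yT a i j = yT a i j * p" "p \<in> Sc0 \<Longrightarrow> p * fps_const io = fps_const io * p"
 "fmap Dop f * fps_const io = fps_const io * fmap Dop f"
proof -
 show "p \<in> Sc0 \<Longrightarrow> p * fmap Dop f = fmap Dop f * p" by (rule Sc0_D[OF _ comm_G0(1)])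
 show "p \<in> Sc0 \<Longrightarrow> p * xT a i j = xT a i j * p" unfolding xT_def by (rule Sc0_D[OF _ comm_G0(2)])
 show "p \<in> Sc0 \<Longrightarrow> p * yT a i j = yT a i j * p" unfolding yT_def by (rule Sc0_D[OF _ comm_G0(3)[OF sm_q(2)]])
 show "p \<in> Sc0 \<Longrightarrow> p * fps_const io = fps_const io * p" by (rule Sc0_D[OF _ comm_G0(4)])
 show "fmap Dop f * fps_const io = fps_const io * fmap Dop f" by (rule fps_ext) (simp add: Uop_comm)
qed

lemma kT_Suc: "kT (Suc a) = kT a + hT"
 by (simp add: rhomD(1)[OF rhom_Dop] distrib_right add.commute)

lemma shifts_p: "alp (Suc a) = alp a + (etp :: 'n::finite vv endo fps)" "bep (Suc a) = bep a + (etp :: 'n vv endo fps)"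
 "bep a = alp a + of_nat CARD('n) * (etp :: 'n vv endo fps)"
proof -
 have g: "1 - x * (u + (w + h) - n) = (1 - x * (u + w - n)) + - (x * h)" "1 - x * (u + (w + h) + n) = (1 - x * (u + w + n)) + - (x * h)"
 "1 - x * (u + w + n) = (1 - x * (u + w - n)) + - (x * (n + n))"
 for x u w h n :: "'n vv endo fps" by (simp_all add: algebra_simps)
 show "alp (Suc a) = alp a + (etp :: 'n vv endo fps)" "bep (Suc a) = bep a + (etp :: 'n vv endo fps)"
 unfolding alp_def bep_def etp_def kT_Suc g(1,2) fps_mult_fps_X_commute[of hT] by (rule refl)+
 have "of_nat CARD('n) * (etp :: 'n vv endo fps) = - ((of_nat CARD('n) * hT) * fps_X)"
 unfolding etp_def by (simp only: mult_minus_right mult.assoc)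
 then show "bep a = alp a + of_nat CARD('n) * (etp :: 'n vv endo fps)"
 unfolding alp_def bep_def g(3)[of _ _ _ hnT] unfolding hnT2 by (simp only: fps_mult_fps_X_commute)
qed

lemma shifts_m: "alm (Suc a) = alm a + (hT :: 'n::finite vv endo fps)" "bem (Suc a) = bem a + (hT :: 'n vv endo fps)"
proof -
 have g: "u + (w + h) - x = (u + w - x) + h" "(y + h) + n = (y + n) + h" for x u w h n y :: "'n vv endo fps"
 by (simp_all add: algebra_simps)
 show 1: "alm (Suc a) = alm a + (hT :: 'n::finite vv endo fps)" unfolding alm_def kT_Suc by (rule g)
 show "bem (Suc a) = bem a + (hT :: 'n vv endo fps)" unfolding bem_def 1 by (rule g)
qed

section \<open>The two instances of the fusion argument\<close>

lemma core_p: "ell_core k (\<lambda>i j :: 'n::finite. fmap Dop (Lp i j)) xT yT (fps_const io) etp alp bep bep (\<lambda>a. alp a * bep a) Sc0"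
 apply (rule ell_core.intro)
 apply (rule T_torsion, assumption, assumption)
 apply (rule scalars_Sc0)
 apply (rule scalars_Sc0)
 apply (rule scalars_Sc0)
 apply (rule scalars_Sc0)
 apply (rule Sc0_closed(4)[OF scalars_Sc0(1,2)])
 apply (rule Sc0_comm, assumption, assumption)
 apply (rule T_comms(1), assumption)
 apply (rule T_comms(2), assumption)
 apply (rule T_comms(3), assumption)
 apply (rule T_comms(4), assumption)
 apply (rule T_comms(5))
 apply (rule shifts_p)
 apply (rule shifts_p)
 apply (rule shifts_p)
 apply (rule lx_p)
 apply (rule ly_p, assumption)
 apply (rule xx_T)
 apply (rule yy_T)
 done

lemma core_m: "ell_core k (\<lambda>i j :: 'n::finite. fmap Dop (Lm i j)) xT yT (fps_const io) hT alm bem alm (\<lambda>a. alm a * alm a - hT * hT) Sc0"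
 apply (rule ell_core.intro)
 apply (rule T_torsion, assumption, assumption)
 apply (rule Sc0_simps)
 apply (rule scalars_Sc0)
 apply (rule scalars_Sc0)
 apply (rule scalars_Sc0)
 apply (intro Sc0_closed(2,4) scalars_Sc0 Sc0_simps)
 apply (rule Sc0_comm, assumption, assumption)
 apply (rule T_comms(1), assumption)
 apply (rule T_comms(2), assumption)
 apply (rule T_comms(3), assumption)
 apply (rule T_comms(4), assumption)
 apply (rule T_comms(5))
 apply (rule shifts_m)
 apply (rule shifts_m)
 apply (rule bem_def)
 apply (rule lx_m)
 apply (rule ly_m, assumption)
 apply (rule xx_T)
 apply (rule yy_T)
 done

section \<open>The operator of \<open>\<ell>_k(u)\<close>\<close>

definition Sk :: "nat \<Rightarrow> (nat \<Rightarrow> 'n) set" where "Sk k = {r. \<forall>a\<ge>k. r a = undefined}"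
definition "XP k r t = prod_list (map (\<lambda>a. Xh a (r a) (t a)) [0..<k])"
definition "YP k t s = prod_list (map (\<lambda>a. Yq a (t a) (s a)) (rev [0..<k]))"

text \<open>The operator k! \<ell>_k(u), with the trace and the antisymmetrizer written out. Having
  k! in front keeps the coefficients integral.\<close>

definition Eop :: "nat \<Rightarrow> 'n::finite vv endo" where
 "Eop k = (\<Sum>s\<in>Sk k. \<Sum>\<sigma> | \<sigma> permutes {..<k}. of_int (sign \<sigma>) *
 (\<Sum>t\<in>Sk k. P2 (XP k (s \<circ> \<sigma>) t) * (io * P1 (YP k t s))))"

lemma finite_Sk: "finite (Sk k :: (nat \<Rightarrow> 'n::finite) set)"
proof -
 have "Sk k = Ag (\<lambda>_. undefined :: 'n) [0..<k]" by (auto simp: Sk_def Ag_def)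
 then show ?thesis using finite_Ag[of "[0..<k]"] by simp
qed

lemma sm_prod_list: "(\<And>a. sm (f a)) \<Longrightarrow> sm (prod_list (map f as))"
 by (induction as) (simp_all add: sm_lin sm_mult)

lemma sm_YP [simp]: "sm (YP k t s)"
 unfolding YP_def by (rule sm_prod_list) simp

text \<open>An empty product would be 1, whereas \<open>P1 1\<close> and \<open>P2 1\<close> are
  only projections; hence the list must be nonempty.\<close>

lemma P_prod_list:
 "as \<noteq> [] \<Longrightarrow> prod_list (map (\<lambda>a. fps_const (P2 (f a))) as) = fps_const (P2 (prod_list (map f as)))"
 "as \<noteq> [] \<Longrightarrow> (\<And>a. sm (f a)) \<Longrightarrow> prod_list (map (\<lambda>a. fps_const (P1 (f a))) as) = fps_const (P1 (prod_list (map f as)))"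
proof -
 show "as \<noteq> [] \<Longrightarrow> prod_list (map (\<lambda>a. fps_const (P2 (f a))) as) = fps_const (P2 (prod_list (map f as)))"
 by (induction as rule: list_nonempty_induct) (simp_all add: rhomD(2)[OF rhom_P2])
 show "as \<noteq> [] \<Longrightarrow> (\<And>a. sm (f a)) \<Longrightarrow> prod_list (map (\<lambda>a. fps_const (P1 (f a))) as) = fps_const (P1 (prod_list (map f as)))"
 by (induction as rule: list_nonempty_induct) (simp_all add: P1_simps(2) sm_prod_list)
qed

lemma fmap_prod_list:
 fixes f :: "'a::ring_1 \<Rightarrow> 'b::ring_1"
 assumes "rhom f" "f 1 = 1"
 shows "fmap f (prod_list xs) = prod_list (map (fmap f) xs)"
 by (induction xs) (simp_all add: rhomD(2)[OF rhom_fmap[OF assms(1)]] fmap_1[OF rhomD(3)[OF assms(1)] assms(2)])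

lemma rhom_of_int: "rhom f \<Longrightarrow> f 1 = 1 \<Longrightarrow> f (of_int z) = of_int z" for f :: "'a::ring_1 \<Rightarrow> 'b::ring_1"
 by (cases z rule: int_diff_cases) (simp add: rhomD(5) rhom_of_nat)

abbreviation "ml k s \<equiv> map s [0..<k]"

lemma e2_prods:
 fixes r t :: "nat \<Rightarrow> 'n::finite"
 shows "e2 (Lminus_prod k (ml k r) (ml k t) $ M) = XP k r t $ M"
 "e2 (Lplus_inv_prod k (ml k r) (ml k t) $ M) = YP k r t $ M"
proof -
 have m: "prod_list (map (\<lambda>a. f a (ml k r ! a) (ml k t ! a)) as) = prod_list (map (\<lambda>a. f a (r a) (t a)) as)"
 if "set as \<subseteq> {..<k}" for f :: "nat \<Rightarrow> 'n \<Rightarrow> 'n \<Rightarrow> 'n free fps" and as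
 by (rule arg_cong[of _ _ prod_list], rule map_cong[OF refl]) (use that in auto)
 have u: "set [0..<k] \<subseteq> {..<k}" "set (rev [0..<k]) \<subseteq> {..<k}" "distinct (rev [0..<k])" "length (ml k r) = k" "length (ml k t) = k"
 by auto
 have "Lminus_prod k (ml k r) (ml k t)
 = prod_list (map (\<lambda>a. vec_nth (vec_nth (Lminus (of_nat a)) (ml k r ! a)) (ml k t ! a)) [0..<k])"
 unfolding Lminus_prod_def using tensor_prod_copies[OF distinct_upt u(1,4,5), of "\<lambda>a. Lminus (of_nat a)"] by simp
 also have "\<dots> = prod_list (map (\<lambda>a. vec_nth (vec_nth (Lminus (of_nat a)) (r a)) (t a)) [0..<k])"
 by (rule m[OF u(1)])
 finally have 1: "Lminus_prod k (ml k r) (ml k t) = prod_list (map (\<lambda>a. vec_nth (vec_nth (Lminus (of_nat a)) (r a)) (t a)) [0..<k])" .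
 let ?M = "\<lambda>a. matrix_inv (Lplus (of_nat a + of_nat CARD('n) / 2)) :: 'n free fps^'n^'n"
 have "Lplus_inv_prod k (ml k r) (ml k t)
 = prod_list (map (\<lambda>a. vec_nth (vec_nth (?M a) (ml k r ! a)) (ml k t ! a)) (rev [0..<k]))"
 unfolding Lplus_inv_prod_def using tensor_prod_copies[OF u(3,2,4,5), of ?M] by simp
 also have "\<dots> = prod_list (map (\<lambda>a. vec_nth (vec_nth (?M a) (r a)) (t a)) (rev [0..<k]))"
 by (rule m[OF u(2)])
 finally have 2: "Lplus_inv_prod k (ml k r) (ml k t) = prod_list (map (\<lambda>a. vec_nth (vec_nth (?M a) (r a)) (t a)) (rev [0..<k]))" .
 have "fmap e2 (Lminus_prod k (ml k r) (ml k t)) = XP k r t"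
 unfolding 1 fmap_prod_list[OF rhom_e2 e2_hom(6)] map_map comp_def fmap_Lminus XP_def Xh_def ..
 from arg_cong[OF this, of "\<lambda>y. y $ M"] show "e2 (Lminus_prod k (ml k r) (ml k t) $ M) = XP k r t $ M" by simp
 have "fmap e2 (Lplus_inv_prod k (ml k r) (ml k t)) = YP k r t"
 unfolding 2 fmap_prod_list[OF rhom_e2 e2_hom(6)] map_map comp_def YP_def Yq_def Yh_def ..
 from arg_cong[OF this, of "\<lambda>y. y $ M"] show "e2 (Lplus_inv_prod k (ml k r) (ml k t) $ M) = YP k r t $ M" by simp
qed

lemma e2_antisymmetrizer:
 fixes r t :: "'n::finite list"
 assumes "length t = k"
 shows "of_nat (fact k) * e2 (antisymmetrizer k r t)
 = (\<Sum>\<sigma> | \<sigma> permutes {..<k}. if t = map (\<lambda>a. r ! \<sigma> a) [0..<k] then of_int (sign \<sigma>) else (0 :: 'n ecr))"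
proof -
 define z where "z = (\<Sum>\<sigma> | \<sigma> permutes {..<k}. sign \<sigma> * (if \<forall>a<k. r ! \<sigma> a = t ! a then 1 else 0))"
 have z: "(\<Sum>\<sigma> | \<sigma> permutes {..<k}. of_int (sign \<sigma>) * (if \<forall>a<k. r ! \<sigma> a = t ! a then 1 else 0)) = (of_int z :: complex)"
 unfolding z_def of_int_sum by (rule sum.cong[OF refl]) simp
 have "of_nat (fact k) * fps_const (of_int z / fact k) = (fps_const (of_int z) :: complex fps)"
 unfolding fps_of_nat[symmetric] by simp
 then have "es (of_nat (fact k)) * es (fps_const (of_int z / fact k)) = (es (of_int z) :: 'n ecr)"
 unfolding rhomD(2)[OF rhom_es, symmetric] fps_of_int by (simp only:)
 then have "of_nat (fact k) * e2 (antisymmetrizer k r t) = (of_int z :: 'n ecr)"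
 unfolding antisymmetrizer_def z rhom_of_nat[OF rhom_es es_simps(1)] rhom_of_int[OF rhom_es es_simps(1)]
 by (simp only: es_def)
 also have "\<dots> = (\<Sum>\<sigma> | \<sigma> permutes {..<k}. of_int (sign \<sigma> * (if \<forall>a<k. r ! \<sigma> a = t ! a then 1 else 0)))"
 unfolding z_def of_int_sum ..
 also have "\<dots> = (\<Sum>\<sigma> | \<sigma> permutes {..<k}. if t = map (\<lambda>a. r ! \<sigma> a) [0..<k] then of_int (sign \<sigma>) else 0)"
 proof (rule sum.cong[OF refl])
 fix \<sigma>
 have "(\<forall>a<k. r ! \<sigma> a = t ! a) \<longleftrightarrow> t = map (\<lambda>a. r ! \<sigma> a) [0..<k]"
 using assms by (auto simp: list_eq_iff_nth_eq)
 then show "of_int (sign \<sigma> * (if \<forall>a<k. r ! \<sigma> a = t ! a then 1 else 0))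
 = (if t = map (\<lambda>a. r ! \<sigma> a) [0..<k] then of_int (sign \<sigma>) else (0 :: 'n ecr))" by simp
 qed
 finally show ?thesis .
qed

lemma sum_ml: "(\<Sum>r | length r = k. F r) = (\<Sum>s\<in>Sk k. F (ml k s))" for F :: "'n::finite list \<Rightarrow> 'a::comm_monoid_add"
proof (rule sum.reindex_bij_betw[symmetric])
 show "bij_betw (ml k) (Sk k) {r :: 'n list. length r = k}"
 proof (rule bij_betw_byWitness[where f' = "\<lambda>r a. if a < k then r ! a else undefined"])
 show "\<forall>s\<in>Sk k. (\<lambda>a. if a < k then ml k s ! a else undefined) = s"
 by (auto simp: Sk_def fun_eq_iff)
 show "\<forall>r\<in>{r. length r = k}. ml k (\<lambda>a. if a < k then r ! a else undefined) = r"
 by (auto simp: list_eq_iff_nth_eq)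
 qed (auto simp: Sk_def)
qed

lemma e2_ell_term:
 "of_nat (fact k) * e2 (ell_term k m b :: 'n::finite free) = (if m + int b \<ge> 0 then
 \<Sum>s\<in>Sk k. \<Sum>\<sigma> | \<sigma> permutes {..<k}. of_int (sign \<sigma>) * (\<Sum>t\<in>Sk k. XP k (s \<circ> \<sigma>) t $ nat (m + int b) * YP k t s $ b) else 0)"
proof (cases "m + int b \<ge> 0")
 case True
 define G where "G t r = (\<Sum>u | length u = k. e2 (Lminus_prod k t u $ nat (m + int b)) * e2 (Lplus_inv_prod k u r $ b))" for t r :: "'n list"
 have fin: "finite {u :: 'n list. length u = k}"
 using finite_lists_length_eq[of "UNIV :: 'n set" k] by simp
 have G: "G (ml k r) (ml k s) = (\<Sum>t\<in>Sk k. XP k r t $ nat (m + int b) * YP k t s $ b)" for r s :: "nat \<Rightarrow> 'n"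
 unfolding G_def sum_ml e2_prods ..
 have "e2 (ell_term k m b :: 'n free) = (\<Sum>r | length r = k. \<Sum>t | length t = k. e2 (antisymmetrizer k r t) * G t r)"
 using True by (simp add: ell_term_def tensor_trace_def tensor_mult_def G_def e2_sum)
 then have "of_nat (fact k) * e2 (ell_term k m b :: 'n free)
 = (\<Sum>r | length r = k. \<Sum>t | length t = k. of_nat (fact k) * e2 (antisymmetrizer k r t) * G t r)"
 by (simp only: sum_distrib_left mult.assoc)
 also have "\<dots> = (\<Sum>r | length r = k. \<Sum>\<sigma> | \<sigma> permutes {..<k}. of_int (sign \<sigma>) * G (map (\<lambda>a. r ! \<sigma> a) [0..<k]) r)"
 proof (rule sum.cong[OF refl])
 fix r :: "'n list"
 have "(\<Sum>t | length t = k. of_nat (fact k) * e2 (antisymmetrizer k r t) * G t r)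
 = (\<Sum>t | length t = k. \<Sum>\<sigma> | \<sigma> permutes {..<k}. if t = map (\<lambda>a. r ! \<sigma> a) [0..<k] then of_int (sign \<sigma>) * G t r else 0)"
 proof (rule sum.cong[OF refl])
 fix t :: "'n list" assume "t \<in> {t. length t = k}"
 then have t: "length t = k" by simp
 show "of_nat (fact k) * e2 (antisymmetrizer k r t) * G t r
 = (\<Sum>\<sigma> | \<sigma> permutes {..<k}. if t = map (\<lambda>a. r ! \<sigma> a) [0..<k] then of_int (sign \<sigma>) * G t r else 0)"
 unfolding e2_antisymmetrizer[OF t] sum_distrib_right by (rule sum.cong[OF refl]) simp
 qed
 also have "\<dots> = (\<Sum>\<sigma> | \<sigma> permutes {..<k}. \<Sum>t | length t = k. if t = map (\<lambda>a. r ! \<sigma> a) [0..<k] then of_int (sign \<sigma>) * G t r else 0)"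
 by (rule sum.swap)
 also have "\<dots> = (\<Sum>\<sigma> | \<sigma> permutes {..<k}. of_int (sign \<sigma>) * G (map (\<lambda>a. r ! \<sigma> a) [0..<k]) r)"
 by (rule sum.cong[OF refl], subst sum.delta[OF fin]) simp
 finally show "(\<Sum>t | length t = k. of_nat (fact k) * e2 (antisymmetrizer k r t) * G t r)
 = (\<Sum>\<sigma> | \<sigma> permutes {..<k}. of_int (sign \<sigma>) * G (map (\<lambda>a. r ! \<sigma> a) [0..<k]) r)" .
 qed
 also have "\<dots> = (\<Sum>s\<in>Sk k. \<Sum>\<sigma> | \<sigma> permutes {..<k}. of_int (sign \<sigma>) * G (map (\<lambda>a. ml k s ! \<sigma> a) [0..<k]) (ml k s))"
 by (rule sum_ml)
 also have "\<dots> = (\<Sum>s\<in>Sk k. \<Sum>\<sigma> | \<sigma> permutes {..<k}. of_int (sign \<sigma>) * (\<Sum>t\<in>Sk k. XP k (s \<circ> \<sigma>) t $ nat (m + int b) * YP k t s $ b))"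
 proof (rule sum.cong[OF refl], rule sum.cong[OF refl])
 fix s :: "nat \<Rightarrow> 'n" and \<sigma> assume "\<sigma> \<in> {\<sigma>. \<sigma> permutes {..<k}}"
 then have "\<sigma> a < k" if "a < k" for a using permutes_in_image[of \<sigma> "{..<k}" a] that by simp
 then have "map (\<lambda>a. ml k s ! \<sigma> a) [0..<k] = ml k (s \<circ> \<sigma>)" by simp
 then show "of_int (sign \<sigma>) * G (map (\<lambda>a. ml k s ! \<sigma> a) [0..<k]) (ml k s)
 = of_int (sign \<sigma>) * (\<Sum>t\<in>Sk k. XP k (s \<circ> \<sigma>) t $ nat (m + int b) * YP k t s $ b)" by (simp only: G)
 qed
 finally show ?thesis using True by simp
qed (simp add: ell_term_def)

lemma vr_P1_inc:
 assumes y: "sm y"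
 shows "vr (app (P1 y) (inc w)) False m = (if m \<ge> 0 then actE (y $ nat m) w else 0)"
proof -
 have b: "\<forall>m<0. vr (inc w) False m = 0" by (simp add: vr_inc)
 show ?thesis
 proof (cases "m \<ge> 0")
 case True
 then have K: "m - 0 < int (Suc (nat m))" by simp
 have "vr (app (P1 y) (inc w)) False m = (\<Sum>e<Suc (nat m). actE (y $ e) (vr (inc w) False (m - int e)))"
 unfolding vr_P1[OF y] using cv_eq[OF b K] by simp
 also have "\<dots> = (\<Sum>e<Suc (nat m). if e = nat m then actE (y $ e) w else 0)"
 by (rule sum.cong[OF refl]) (use True in \<open>auto simp: vr_inc\<close>)
 also have "\<dots> = actE (y $ nat m) w" by (subst sum.delta) auto
 finally show ?thesis using True by simp
 next
 case False
 then show ?thesis using cv_bounded[OF b, of m y] y by simp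
 qed
qed

text \<open>The coefficient of u^m arises from u^(-b) in the inverse of L^+ and u^(m+b) in L^-. On a
  fixed vector only b < q contribute, so the sum may be cut off at any B > q.\<close>

lemma vr_term:
 assumes y: "sm y" and q: "\<forall>b\<ge>q. actE (y $ b) w = 0" and B: "B > q"
 shows "vr (app (P2 x * (io * P1 y)) (inc w)) True m
 = (\<Sum>b<B. if m + int b \<ge> 0 then actE (x $ nat (m + int b) * y $ b) w else 0)"
proof -
 define g where "g = vr (app (io * P1 y) (inc w)) True"
 have g: "g m = (if m \<le> 0 then actE (y $ nat (- m)) w else 0)" for m
 unfolding g_def by (simp add: vr_P1_inc[OF y] del: vr_P1)
 have N: "\<forall>m<(- int q). g m = 0" using q by (auto simp: g)
 have K: "m - (- int q) < int (nat (m + int B))" using B by linarith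
 have "vr (app (P2 x * (io * P1 y)) (inc w)) True m = cv x g m" by (simp add: g_def)
 also have "\<dots> = (\<Sum>e<nat (m + int B). actE (x $ e) (g (m - int e)))" by (rule cv_eq[OF N K])
 also have "\<dots> = (\<Sum>e<nat (m + int B). if m \<le> int e then actE (x $ e * y $ nat (int e - m)) w else 0)"
 by (rule sum.cong[OF refl]) (simp add: g actE_lin)
 also have "\<dots> = (\<Sum>e\<in>{e \<in> {..<nat (m + int B)}. m \<le> int e}. actE (x $ e * y $ nat (int e - m)) w)"
 by (rule sum.inter_filter[symmetric]) simp
 also have "\<dots> = (\<Sum>b\<in>{b \<in> {..<B}. m + int b \<ge> 0}. actE (x $ nat (m + int b) * y $ b) w)"
 by (rule sum.reindex_bij_witness[of _ "\<lambda>b. nat (m + int b)" "\<lambda>e. nat (int e - m)"]) auto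
 also have "\<dots> = (\<Sum>b<B. if m + int b \<ge> 0 then actE (x $ nat (m + int b) * y $ b) w else 0)"
 by (rule sum.inter_filter) simp
 finally show ?thesis .
qed

lemma sum_swap3: "(\<Sum>b\<in>B. \<Sum>s\<in>S. \<Sum>r\<in>R. \<Sum>t\<in>T. F b s r t) = (\<Sum>s\<in>S. \<Sum>r\<in>R. \<Sum>t\<in>T. \<Sum>b\<in>B. F b s r t)"
proof -
 have "(\<Sum>b\<in>B. \<Sum>s\<in>S. \<Sum>r\<in>R. \<Sum>t\<in>T. F b s r t) = (\<Sum>s\<in>S. \<Sum>b\<in>B. \<Sum>r\<in>R. \<Sum>t\<in>T. F b s r t)" by (rule sum.swap)
 also have "\<dots> = (\<Sum>s\<in>S. \<Sum>r\<in>R. \<Sum>b\<in>B. \<Sum>t\<in>T. F b s r t)" by (rule sum.cong[OF refl], rule sum.swap)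
 also have "\<dots> = (\<Sum>s\<in>S. \<Sum>r\<in>R. \<Sum>t\<in>T. \<Sum>b\<in>B. F b s r t)" by (rule sum.cong[OF refl], rule sum.cong[OF refl], rule sum.swap)
 finally show ?thesis .
qed

text \<open>On each vector the partial sums that define a coefficient of \<ell>_k(u) become
  stationary, and their value, up to k!, is a component of \<open>Eop\<close>. This ties the
  operator to the elements of the algebra.\<close>

lemma vr_Eop:
 fixes w :: "'n::finite wmod"
 shows "\<exists>B0. \<forall>B\<ge>B0. vr (app (Eop k) (inc w)) True m = (\<Sum>b<B. actE (of_nat (fact k) * e2 (ell_term k m b)) w)
 \<and> actE (e2 (ell_term k m B)) w = 0"
proof -
 have "eventually (\<lambda>b. actE (YP k t s $ b) w = 0) sequentially" for t s :: "nat \<Rightarrow> 'n"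
 using sm_YP[of k t s] unfolding sm_def eventually_sequentially by blast
 then have "eventually (\<lambda>b. \<forall>t\<in>Sk k. \<forall>s\<in>Sk k. actE (YP k t s $ b) w = 0) sequentially"
 by (intro eventually_ball_finite finite_Sk ballI)
 then obtain q where q: "\<And>b t s. b \<ge> q \<Longrightarrow> t \<in> Sk k \<Longrightarrow> s \<in> Sk k \<Longrightarrow> actE (YP k t s $ b) w = 0"
 unfolding eventually_sequentially by blast
 define F where "F b s \<sigma> t = (if m + int b \<ge> 0 then actE (of_int (sign \<sigma>) * (XP k (s \<circ> \<sigma>) t $ nat (m + int b) * YP k t s $ b)) w else 0)"
 for b s \<sigma> t
 have h: "actE (of_nat (fact k) * e2 (ell_term k m b)) w = (\<Sum>s\<in>Sk k. \<Sum>\<sigma> | \<sigma> permutes {..<k}. \<Sum>t\<in>Sk k. F b s \<sigma> t)" for b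
 unfolding e2_ell_term F_def by (simp add: actE_sum sum_distrib_left)
 have 1: "vr (app (Eop k) (inc w)) True m = (\<Sum>b<B. actE (of_nat (fact k) * e2 (ell_term k m b)) w)" if B: "B > q" for B
 proof -
 have D: "of_int z = (Dop (of_int z) :: 'n vv endo)" for z by (simp add: rhom_of_int[OF rhom_Dop Dop_1])
 have "vr (app (Eop k) (inc w)) True m = (\<Sum>s\<in>Sk k. \<Sum>\<sigma> | \<sigma> permutes {..<k}. actE (of_int (sign \<sigma>))
 (\<Sum>t\<in>Sk k. vr (app (P2 (XP k (s \<circ> \<sigma>) t) * (io * P1 (YP k t s))) (inc w)) True m))"
 unfolding Eop_def D app_sum vr_sum app_simps(4)[of "Dop _"] vr_Dop ..
 also have "\<dots> = (\<Sum>s\<in>Sk k. \<Sum>\<sigma> | \<sigma> permutes {..<k}. \<Sum>t\<in>Sk k. \<Sum>b<B. F b s \<sigma> t)"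
 proof (rule sum.cong[OF refl], rule sum.cong[OF refl])
 fix s :: "nat \<Rightarrow> 'n" and \<sigma> assume s: "s \<in> Sk k"
 have "(\<Sum>t\<in>Sk k. vr (app (P2 (XP k (s \<circ> \<sigma>) t) * (io * P1 (YP k t s))) (inc w)) True m)
 = (\<Sum>t\<in>Sk k. \<Sum>b<B. if m + int b \<ge> 0 then actE (XP k (s \<circ> \<sigma>) t $ nat (m + int b) * YP k t s $ b) w else 0)"
 by (rule sum.cong[OF refl], rule vr_term[OF sm_YP _ B]) (use q s in blast)
 then show "actE (of_int (sign \<sigma>)) (\<Sum>t\<in>Sk k. vr (app (P2 (XP k (s \<circ> \<sigma>) t) * (io * P1 (YP k t s))) (inc w)) True m)
 = (\<Sum>t\<in>Sk k. \<Sum>b<B. F b s \<sigma> t)"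
 unfolding F_def by (simp only: actE_sum) (intro sum.cong[OF refl], simp add: actE_lin)
 qed
 also have "\<dots> = (\<Sum>b<B. \<Sum>s\<in>Sk k. \<Sum>\<sigma> | \<sigma> permutes {..<k}. \<Sum>t\<in>Sk k. F b s \<sigma> t)"
 by (rule sum_swap3[symmetric])
 finally show ?thesis unfolding h .
 qed
 have "actE (e2 (ell_term k m b)) w = 0" if b: "b \<ge> q" for b
 proof -
 have "F b s \<sigma> t = 0" if "s \<in> Sk k" "t \<in> Sk k" for s \<sigma> t
 unfolding F_def using q[OF b that(2,1)] by (simp add: actE_lin)
 then have "actE (of_nat (fact k)) (actE (e2 (ell_term k m b)) w) = 0"
 unfolding actE_lin(3)[symmetric] h by simp
 then show ?thesis by (rule wmod_torsion[rotated]) simp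
 qed
 then show ?thesis using 1 by (intro exI[of _ "Suc q"]) simp
qed

section \<open>Centrality\<close>

text \<open>The trace depends on \<open>x\<close>, \<open>y\<close> and \<iota> only, so one
  identification serves both instances of the locale.\<close>

lemma EL_eq:
 assumes k: "1 \<le> k"
 shows "ell_core.ell k xT yT (fps_const io) = fps_const (Eop k :: 'n::finite vv endo)"
proof -
 interpret p: ell_core k "\<lambda>i j :: 'n. fmap Dop (Lp i j)" xT yT "fps_const io" etp alp bep bep "\<lambda>a. alp a * bep a" Sc0
 by (rule core_p)
 have ne: "[0..<k] \<noteq> []" "rev [0..<k] \<noteq> []" using k by simp_all
 have S: "p.S = Sk k" unfolding p.S_def p.d_def Sk_def ..
 have x: "prod_list (map (\<lambda>a. xT a (r a) (t a)) [0..<k]) = fps_const (P2 (XP k r t))" for r t :: "nat \<Rightarrow> 'n"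
 unfolding xT_def XP_def by (rule P_prod_list(1)[OF ne(1)])
 have y: "prod_list (map (\<lambda>a. yT a (t a) (s a)) (rev [0..<k])) = fps_const (P1 (YP k t s))" for s t :: "nat \<Rightarrow> 'n"
 unfolding yT_def YP_def by (rule P_prod_list(2)[OF ne(2)]) simp
 show ?thesis
 unfolding p.ell_eval S x y Eop_def comp_def by (simp only: rhomD(2,6)[OF rhom_fps_const] fps_of_int)
qed

section \<open>Cancelling scalars on a single vector\<close>

lemma app_0: "app f 0 = 0"
 using app_add[of f 0 0] by simp

definition Ann :: "'n::finite vv \<Rightarrow> 'n vv endo fps set" where
 "Ann v = {z. \<forall>p. app (z $ p) v = 0}"

lemma Ann_D: "z \<in> Ann v \<Longrightarrow> f * z \<in> Ann v" "y \<in> Ann v \<Longrightarrow> z \<in> Ann v \<Longrightarrow> y - z \<in> Ann v" "0 \<in> Ann v"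
 unfolding Ann_def by (simp_all add: fps_mult_nth app_sum app_0)

text \<open>As a power series in v, the factor u - v has the invertible constant term u, so the
  coefficients of z vanish on the vector one after the other.\<close>

lemma Ann_y:
 assumes "(uT - fps_X) * z \<in> Ann v"
 shows "z \<in> Ann (v :: 'n::finite vv)"
proof -
 have c: "app (((uT - fps_X) * z) $ p) v = 0" for p using assms unfolding Ann_def by blast
 have U0: "v' = 0" if "app Uop v' = 0" for v' :: "'n vv"
 proof -
 have "app (Uin * Uop) v' = app Uin (app Uop v')" by (rule app_simps(4))
 then show ?thesis unfolding that UU(2) app_0 by simp
 qed
 have "app (z $ p) v = 0" for p
 proof (induction p)
 case 0
 have "((uT - fps_X) * z) $ 0 = Uop * z $ 0" by (simp add: left_diff_distrib)
 then show ?case using c[of 0] U0 by simp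
 next
 case (Suc p)
 have "((uT - fps_X) * z) $ Suc p = Uop * z $ Suc p - z $ p" by (simp add: left_diff_distrib)
 then have "app Uop (app (z $ Suc p) v) - app (z $ p) v = 0" using c[of "Suc p"] by simp
 then show ?case using Suc.IH U0 by simp
 qed
 then show ?thesis by (simp add: Ann_def)
qed

lemma Ann_power: "(uT - fps_X) ^ M * z \<in> Ann v \<Longrightarrow> z \<in> Ann v"
proof (induction M arbitrary: z)
 case (Suc M)
 then show ?case using Ann_y[of "(uT - fps_X) ^ M * z" v] by (simp add: mult.assoc)
qed simp

text \<open>Modulo h every scalar of the L^- case is a power of u - v, and this shape is stable
  under products.\<close>

definition Kf :: "'n::finite vv endo fps \<Rightarrow> bool" where
 "Kf f \<longleftrightarrow> (\<exists>M. \<exists>G\<in>Sc0. f = (uT - fps_X) ^ M + hT * G)"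

lemma Sc0_power: "(x :: 'n::finite vv endo fps) \<in> Sc0 \<Longrightarrow> x ^ M \<in> Sc0"
 by (induction M) (auto intro: Sc0_closed)

lemma uX_Sc0: "uT - fps_X \<in> (Sc0 :: 'n::finite vv endo fps set)"
 by (intro Sc0_closed Sc0_simps)

lemma Sc0_0: "0 \<in> (Sc0 :: 'n::finite vv endo fps set)"
 using Sc0_closed(2)[OF Sc0_closed(5) Sc0_closed(5)] by simp

lemma Kf_add: "Kf f \<Longrightarrow> G \<in> Sc0 \<Longrightarrow> Kf (f + hT * G)"
proof -
 assume f: "Kf f" and G: "G \<in> Sc0"
 obtain M G' where "G' \<in> Sc0" "f = (uT - fps_X) ^ M + hT * G'" using f unfolding Kf_def by blast
 then have "f + hT * G = (uT - fps_X) ^ M + hT * (G' + G)" "G' + G \<in> Sc0"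
 using G by (simp_all only: distrib_left add.assoc Sc0_closed(1))
 then show ?thesis unfolding Kf_def by blast
qed

lemma Kf_1: "Kf 1"
 unfolding Kf_def by (rule exI[of _ 0], rule bexI[OF _ Sc0_0]) simp

lemma Kf_mult: "Kf f \<Longrightarrow> Kf g \<Longrightarrow> Kf (f * g)"
proof -
 assume f: "Kf f" and g: "Kf g"
 obtain M G where 1: "G \<in> Sc0" "f = (uT - fps_X) ^ M + hT * G" using f unfolding Kf_def by blast
 obtain M' G' where 2: "G' \<in> Sc0" "g = (uT - fps_X) ^ M' + hT * G'" using g unfolding Kf_def by blast
 have y: "(uT - fps_X) ^ M \<in> Sc0" for M by (rule Sc0_power[OF uX_Sc0])
 have c: "(uT - fps_X) ^ M * (hT * G') = hT * ((uT - fps_X) ^ M * G')"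
 by (rule commute_left[OF Sc0_comm[OF y Sc0_simps(3)]])
 have gen: "(a + h * G) * (b + h * G') = a * b + h * (a * G' + G * b + G * (h * G'))"
 if "a * (h * G') = h * (a * G')" for a b h G G' :: "'n::finite vv endo fps"
 by (simp add: distrib_left distrib_right mult.assoc that add.assoc)
 have "f * g = (uT - fps_X) ^ (M + M') + hT * ((uT - fps_X) ^ M * G' + G * (uT - fps_X) ^ M' + G * (hT * G'))"
 unfolding 1 2 power_add by (rule gen[OF c])
 moreover have "(uT - fps_X) ^ M * G' + G * (uT - fps_X) ^ M' + G * (hT * G') \<in> Sc0"
 by (intro Sc0_closed(1,4) y 1 2 Sc0_simps)
 ultimately show ?thesis unfolding Kf_def by blast
qed

lemma kT_eq: "kT a = hT * of_nat a"
proof -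
 have "Dop (of_nat a * hE) = of_nat a * Dop hE"
 by (simp only: rhomD(2)[OF rhom_Dop] rhom_of_nat[OF rhom_Dop Dop_1])
 then have "kT a = fps_const (of_nat a) * hT" by simp
 then show ?thesis unfolding fps_of_nat by (simp only: mult_of_nat_commute)
qed

lemma Kf_scalars: "Kf (alm a :: 'n::finite vv endo fps)" "Kf (bem a :: 'n vv endo fps)" "Kf (alm a * alm a - hT * hT :: 'n vv endo fps)"
proof -
 have g: "u + w - x = (u - x) ^ 1 + w" for u w x :: "'n vv endo fps" by simp
 have "alm a = (uT - fps_X) ^ 1 + hT * (of_nat a :: 'n vv endo fps)" unfolding alm_def kT_eq by (rule g)
 then show 1: "Kf (alm a :: 'n vv endo fps)" using Sc0_closed(6) unfolding Kf_def by blast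
 have "bem a = alm a + hT * (of_nat CARD('n) :: 'n vv endo fps)" unfolding bem_def by (simp only: mult_of_nat_commute)
 then show "Kf (bem a :: 'n vv endo fps)" using Kf_add[OF 1 Sc0_closed(6)] by (simp only:)
 have "alm a * alm a - hT * hT = alm a * alm a + hT * (- hT :: 'n vv endo fps)" by (simp only: mult_minus_right diff_conv_add_uminus)
 then show "Kf (alm a * alm a - hT * hT :: 'n vv endo fps)"
 using Kf_add[OF Kf_mult[OF 1 1] Sc0_closed(3)[OF Sc0_simps(3)]] by (simp only:)
qed

lemma Kf_prod_list: "(\<And>x. x \<in> set xs \<Longrightarrow> Kf x) \<Longrightarrow> Kf (prod_list xs)"
 by (induction xs) (simp_all add: Kf_1 Kf_mult)

text \<open>\<open>h\<close> is nilpotent on every vector, so \<open>u - v\<close> plus a multiple of \<open>h\<close> acts injectively.\<close>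

lemma Kf_cancel:
 assumes "Kf f" and f: "f * z \<in> Ann v" and N: "hT ^ N * z \<in> Ann v"
 shows "z \<in> Ann (v :: 'n::finite vv)"
proof -
 obtain M G where G: "G \<in> Sc0" "f = (uT - fps_X) ^ M + hT * G" using assms(1) unfolding Kf_def by blast
 have y: "(uT - fps_X) ^ M \<in> (Sc0 :: 'n vv endo fps set)" by (rule Sc0_power[OF uX_Sc0])
 have h: "hT ^ N \<in> (Sc0 :: 'n vv endo fps set)" for N by (rule Sc0_power[OF Sc0_simps(3)])
 show ?thesis using N
 proof (induction N)
 case (Suc N)
 have 1: "hT ^ N * ((uT - fps_X) ^ M * z) = (uT - fps_X) ^ M * (hT ^ N * z)"
 by (rule commute_left[OF Sc0_comm[OF h y]])
 have "hT ^ N * (hT * (G * z)) = hT ^ Suc N * (G * z)" by (simp only: power_Suc2 mult.assoc)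
 also have "\<dots> = G * (hT ^ Suc N * z)" by (rule commute_left[OF Sc0_comm[OF h G(1)]])
 finally have "hT ^ N * (f * z) = (uT - fps_X) ^ M * (hT ^ N * z) + G * (hT ^ Suc N * z)"
 unfolding G(2) distrib_right distrib_left mult.assoc 1 by (simp only:)
 then have "(uT - fps_X) ^ M * (hT ^ N * z) = hT ^ N * (f * z) - G * (hT ^ Suc N * z)" by simp
 then have "(uT - fps_X) ^ M * (hT ^ N * z) \<in> Ann v"
 using Ann_D(2)[OF Ann_D(1)[OF f] Ann_D(1)[OF Suc.prems]] by (simp only:)
 then show ?case by (intro Suc.IH) (rule Ann_power)
 qed simp
qed

lemma prod_list_nth0: "(\<And>x. x \<in> set xs \<Longrightarrow> x $ 0 = 1) \<Longrightarrow> prod_list xs $ 0 = (1 :: 'a::ring_1)"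
 by (induction xs) (simp_all add: fps_mult_nth_0)

text \<open>The scalars \<open>alp\<close> and \<open>bep\<close> have constant term 1 in v^(-1), so
  their product cancels from the formal power series and the commutation holds on all
  vectors.\<close>

lemma comm_p:
 fixes i j :: "'n::finite"
 assumes k: "1 \<le> k"
 shows "Dop (Lp i j $ q) * Eop k = Eop k * Dop (Lp i j $ q)"
proof -
 interpret p: ell_core k "\<lambda>i j :: 'n. fmap Dop (Lp i j)" xT yT "fps_const io" etp alp bep bep "\<lambda>a. alp a * bep a" Sc0
 by (rule core_p)
 have "p.AB k $ 0 = 1" "p.CC k $ 0 = 1" unfolding p.AB_def p.CC_def
 by (rule prod_list_nth0, auto simp: fps_mult_nth_0 alp_def bep_def)+
 then have F0: "(p.AB k * p.CC k) $ 0 = 1" by (simp add: fps_mult_nth_0)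
 have "p.AB k * p.CC k * (fmap Dop (Lp i j) * fps_const (Eop k)) = p.AB k * p.CC k * (fps_const (Eop k) * fmap Dop (Lp i j))"
 using p.ell_commutes[of i j] unfolding EL_eq[OF k] right_diff_distrib by simp
 from arg_cong[OF fps_cancel_unit[OF F0 this], of "\<lambda>z. z $ q"] show ?thesis by simp
qed

lemma Eop_hE: "Dop hE * Eop k = Eop k * (Dop hE :: 'n::finite vv endo)"
proof -
 have hc: "fps_const hE * x = x * fps_const hE" for x :: "'n ecr fps"
 by (rule fps_ext) (simp, rule hE_central(1))
 have a: "Dop hE * P2 x = P2 x * Dop hE" for x :: "'n ecr fps" unfolding P2_simps(1,2) hc ..
 have b: "Dop hE * io = io * (Dop hE :: 'n vv endo)" by (rule Uop_comm(4)[symmetric])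
 have c: "Dop hE * P1 x = P1 x * Dop hE" if "sm x" for x :: "'n ecr fps" unfolding P1_simps(5,6)[OF that that] hc ..
 have 1: "Dop hE * (\<Sum>t\<in>Sk k. P2 (XP k (s \<circ> \<sigma>) t) * (io * P1 (YP k t s)))
 = (\<Sum>t\<in>Sk k. P2 (XP k (s \<circ> \<sigma>) t) * (io * P1 (YP k t s))) * Dop hE" for s :: "nat \<Rightarrow> 'n" and \<sigma>
 unfolding sum_distrib_left sum_distrib_right
 by (rule sum.cong[OF refl]) (simp only: commute_left[OF a] commute_left[OF b] c[OF sm_YP] mult.assoc)
 show ?thesis
 unfolding Eop_def sum_distrib_left[of "Dop hE"] sum_distrib_right[of _ _ "Dop hE"]
 by (rule sum.cong[OF refl], rule sum.cong[OF refl])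
 (simp only: commute_left[OF mult_of_int_commute[symmetric]] 1 mult.assoc)
qed

lemma app_Dop_inc: "app (Dop c) (inc w) = inc (actE c w)" "inc 0 = 0"
 by (rule vv_eqI; simp add: vr_inc)+

text \<open>The cancellation needs a power of h that kills the commutator on the vector. Powers of h
  commute with it and can be moved to the vector w, where one of them is zero; this is why the
  statement is about \<open>inc w\<close>.\<close>

lemma comm_m:
 fixes i j :: "'n::finite"
 assumes k: "1 \<le> k"
 shows "app (Dop (Lm i j $ q)) (app (Eop k) (inc w)) = app (Eop k) (app (Dop (Lm i j $ q)) (inc w))"
proof -
 interpret p: ell_core k "\<lambda>i j :: 'n. fmap Dop (Lm i j)" xT yT "fps_const io" hT alm bem alm "\<lambda>a. alm a * alm a - hT * hT" Sc0
 by (rule core_m)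
 define l where "l = fmap Dop (Lm i j)"
 define E where "E = (fps_const (Eop k) :: 'n vv endo fps)"
 define z where "z = l * E - E * l"
 have 1: "Kf x" if "x \<in> set (map (\<lambda>a. alm a * bem a) [0..<k])" for x :: "'n vv endo fps"
 using that Kf_mult[OF Kf_scalars(1,2)] unfolding set_map by blast
 have 2: "Kf x" if "x \<in> set (map (\<lambda>a. alm a * alm a - hT * hT) [0..<k])" for x :: "'n vv endo fps"
 using that Kf_scalars(3) unfolding set_map by blast
 have F: "Kf (p.AB k * p.CC k)"
 unfolding p.AB_def p.CC_def by (rule Kf_mult[OF Kf_prod_list Kf_prod_list]) (erule 1, erule 2)
 have "p.AB k * p.CC k * z = 0"
 using p.ell_commutes[of i j] unfolding EL_eq[OF k] z_def l_def E_def .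
 then have Fz: "p.AB k * p.CC k * z \<in> Ann (inc w)" using Ann_D(3) by simp
 obtain N where N: "actE (hE ^ N) w = 0" using hE_nilpotent[of w] by blast
 have hl: "hT * l = l * hT" unfolding l_def by (rule T_comms(1)[OF Sc0_simps(3)])
 have hEe: "hT * E = E * hT" unfolding E_def by (simp add: Eop_hE)
 have hz: "hT * z = z * hT"
 unfolding z_def right_diff_distrib left_diff_distrib mult.assoc commute_left[OF hl] commute_left[OF hEe] hl hEe ..
 have hN: "hT ^ N = (fps_const (Dop (hE ^ N)) :: 'n vv endo fps)"
 unfolding fps_const_power rhom_power[OF rhom_Dop Dop_1] ..
 have c: "fps_const (Dop (hE ^ N)) * z = z * fps_const (Dop (hE ^ N))"
 using power_commuting_commutes[OF hz, of N] unfolding hN .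
 have "hT ^ N * z \<in> Ann (inc w)"
 unfolding hN c Ann_def by (simp add: app_Dop_inc N app_0)
 from Kf_cancel[OF F Fz this] have "app (z $ q) (inc w) = 0" by (simp add: Ann_def)
 moreover have "z $ q = Dop (Lm i j $ q) * Eop k - Eop k * Dop (Lm i j $ q)"
 by (simp add: z_def l_def E_def)
 ultimately show ?thesis by simp
qed

text \<open>h times a generator is, up to sign and an identity matrix, a coefficient of L^+ for r
  \<ge> 0 and of L^- for r < 0.\<close>

lemma comm_gen:
 fixes i j :: "'n::finite"
 assumes k: "1 \<le> k"
 shows "app (Dop (hE * eg i j r)) (app (Eop k) (inc w)) = app (Eop k) (app (Dop (hE * eg i j r)) (inc w))"
proof (cases "r \<ge> 0")
 case True
 have "Lp i j $ Suc (nat r) = lc True i j (- int (Suc (nat r)))" by (simp only: Lp_def fps_nth_Abs_fps)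
 also have "\<dots> = - (hE * eg i j r)" unfolding lc_eq(1) using True by simp
 finally have "Dop (- (hE * eg i j r)) * Eop k = Eop k * Dop (- (hE * eg i j r))"
 using comm_p[OF k, of i j "Suc (nat r)"] by (simp only:)
 then have "Dop (hE * eg i j r) * Eop k = Eop k * Dop (hE * eg i j r)"
 unfolding rhomD(4)[OF rhom_Dop] by simp
 then show ?thesis unfolding app_simps(4)[symmetric] by (simp only:)
next
 case False
 define q where "q = nat (- r - 1)"
 define \<delta> where "\<delta> = (if q = 0 \<and> i = j then 1 else 0 :: 'n ecr)"
 have r: "- int q - 1 = r" using False by (simp add: q_def)
 have L: "Lm i j $ q = \<delta> + hE * eg i j r"
 unfolding Lm_def fps_nth_Abs_fps lc_eq(3) r \<delta>_def ..
 have "app (Dop \<delta>) (app (Eop k) (inc w)) = app (Eop k) (app (Dop \<delta>) (inc w))"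
 unfolding \<delta>_def by (simp add: Dop_1 rhomD(3)[OF rhom_Dop] app_0)
 then show ?thesis using comm_m[OF k, of i j q w]
 unfolding L rhomD(1)[OF rhom_Dop] app_simps(1) app_add by simp
qed

section \<open>Testing on the generators of the module\<close>

lemma T1: "\<exists>B. \<forall>b\<ge>B. ell_term k m b \<in> (Ipn p N :: 'n::finite free set)"
proof -
 define j where "j = max p N"
 obtain B0 where B0: "\<And>b. b \<ge> B0 \<Longrightarrow> actE (e2 (ell_term k m b)) (om j :: 'n wmod) = 0"
 using vr_Eop[of k "om j :: 'n wmod" m] by blast
 have "ell_term k m b \<in> (Ipn p N :: 'n free set)" if "b \<ge> B0" for b
 proof -
 have "ell_term k m b \<in> (hI j :: 'n free set)" using B0[OF that] unfolding actE_e2 act_om .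
 then obtain x :: "'n free" where "ell_term k m b = hh * x" "x \<in> Ipn j j" unfolding hI_def by blast
 then have "ell_term k m b \<in> (Ipn j j :: 'n free set)" using Ipn_D(3)[of x j j hh] by (simp only:)
 then show ?thesis using Ipn_mono[of p j N j] unfolding j_def by auto
 qed
 then show ?thesis by blast
qed

text \<open>The vector \<open>om d\<close> with d = max p N detects membership: that \<ell>_k(u)
  commutes with h times a generator on it says that h times the commutator lies in
  \<open>hI d\<close>. Dividing by h puts the commutator in \<open>Ipn d d\<close>, which is
  contained in \<open>Ipn p N\<close>.\<close>

lemma T2:
 fixes i j :: "'n::finite"
 assumes k: "1 \<le> k"
 shows "\<exists>B0. \<forall>B\<ge>B0. (\<Sum>b<B. ell_term k m b) * gen (Ell i j r) - gen (Ell i j r) * (\<Sum>b<B. ell_term k m b) \<in> Ipn p N"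
proof -
 define d where "d = max p N"
 define w where "w = (om d :: 'n wmod)"
 define c where "c = hE * eg i j r"
 obtain B1 where B1: "\<And>B. B \<ge> B1 \<Longrightarrow> vr (app (Eop k) (inc w)) True m = (\<Sum>b<B. actE (of_nat (fact k) * e2 (ell_term k m b)) w)"
 using vr_Eop[of k w m] by blast
 obtain B2 where B2: "\<And>B. B \<ge> B2 \<Longrightarrow> vr (app (Eop k) (inc (actE c w))) True m = (\<Sum>b<B. actE (of_nat (fact k) * e2 (ell_term k m b)) (actE c w))"
 using vr_Eop[of k "actE c w" m] by blast
 have "(\<Sum>b<B. ell_term k m b) * gen (Ell i j r) - gen (Ell i j r) * (\<Sum>b<B. ell_term k m b) \<in> Ipn p N"
 if B: "B \<ge> max B1 B2" for B
 proof -
 define s where "s = (\<Sum>b<B. ell_term k m b :: 'n free)"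
 define g where "g = (gen (Ell i j r) :: 'n free)"
 have S: "(\<Sum>b<B. actE (of_nat (fact k) * e2 (ell_term k m b)) v) = actE (of_nat (fact k) * e2 s) v" for v :: "'n wmod"
 unfolding s_def by (simp only: e2_sum sum_distrib_left actE_sum)
 have "vr (app (Dop c) (app (Eop k) (inc w))) True m = vr (app (Eop k) (inc (actE c w))) True m"
 unfolding c_def comm_gen[OF k] app_Dop_inc ..
 then have "actE c (actE (of_nat (fact k) * e2 s) w) = actE (of_nat (fact k) * e2 s) (actE c w)"
 using B1[of B] B2[of B] B by (simp add: S)
 then have e: "actE (c * (of_nat (fact k) * e2 s)) w = actE (of_nat (fact k) * e2 s * c) w" by (simp only: actE_lin(3))
 have nc: "c * (of_nat (fact k) * e2 s) = of_nat (fact k) * (c * e2 s)"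
 by (rule commute_left[OF mult_of_nat_commute[symmetric]])
 have "actE (of_nat (fact k)) (actE (c * e2 s - e2 s * c) w) = 0"
 using e unfolding actE_lin(3)[symmetric] nc by (simp add: right_diff_distrib mult.assoc)
 then have "actE (c * e2 s - e2 s * c) w = 0" by (rule wmod_torsion[rotated]) simp
 moreover have "e2 s * (hE * e2 g) = hE * (e2 s * e2 g)" by (rule commute_left[OF hE_central(1)[symmetric]])
 ultimately have "actE (e2 (hh * (g * s - s * g))) w = 0"
 unfolding c_def g_def[symmetric] by (simp add: hE_def[symmetric] right_diff_distrib mult.assoc)
 then have "g * s - s * g \<in> Ipn d d" unfolding actE_e2 w_def act_om hI_iff .
 from Ipn_D(4)[OF this] have "s * g - g * s \<in> Ipn d d" by simp
 then show ?thesis using Ipn_mono[of p d N d] unfolding d_def s_def g_def by auto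
 qed
 then show ?thesis by blast
qed

text \<open>In the critical quotient c is the number -n, so its commutators are zero there.\<close>

lemma T2_Cen: "s * gen Cen - gen Cen * s \<in> (Ipn p N :: 'n::finite free set)"
proof -
 have "to_cr (s * (gen Cen + of_nat CARD('n)) - (gen Cen + of_nat CARD('n)) * s) = 0"
 unfolding to_cr_hom(2,3) to_cr_Cen by simp
 moreover have "s * (gen Cen + of_nat CARD('n)) - (gen Cen + of_nat CARD('n)) * s = s * gen Cen - gen Cen * s"
 by (simp add: distrib_left distrib_right mult_of_nat_commute)
 ultimately have "to_cr (s * gen Cen - gen Cen * s) = 0" by (simp only:)
 then show ?thesis by (intro Ipn_D(8) Icr_zero)
qed

theorem theorem4p4:
 fixes k :: nat and m :: int
 assumes "CARD('n::finite) \<ge> 2"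
 and "1 \<le> k" and "k \<le> CARD('n)"
 shows "(ell_coeff k m :: nat \<Rightarrow> 'n dycr set) \<in> completion_center"
 unfolding ell_coeff_def
proof (rule central_limit)
 show "\<exists>B. \<forall>b\<ge>B. ell_term k m b \<in> (Ipn p N :: 'n free set)" for p N by (rule T1)
 show "\<exists>B0. \<forall>B\<ge>B0. (\<Sum>b<B. ell_term k m b) * gen g - gen g * (\<Sum>b<B. ell_term k m b) \<in> (Ipn p N :: 'n free set)" for p N g
 proof (cases g)
 case (Ell i j r)
 show ?thesis unfolding Ell by (rule T2[OF assms(2)])
 next
 case Cen
 show ?thesis unfolding Cen by (intro exI[of _ 0] allI impI T2_Cen)
 qed
qed

end
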